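(* Let $C(\varepsilon)=C+\varepsilon\tilde C$ with $\tilde C=\mathrm{diag}(\tilde c_i:i\in\mathcal S)$, and assume $\tilde c_i<0$ for all $i\in\mathcal S_0$; write $\mathcal S_\ominus$ for $\mathcal S_0$, so that $\tilde C$ has diagonal blocks $\tilde C_+,\tilde C_\ominus,\tilde C_-$. For small $\varepsilon>0$ let $\boldsymbol\Psi(\varepsilon)=\begin{bmatrix}\Psi_{+\ominus}(\varepsilon)&\Psi_{+-}(\varepsilon)\end{bmatrix}$ be the matrix of first return probabilities to the initial level from above of the model with phase generator $A$ and rate matrix $C(\varepsilon)$, that is, the minimal nonnegative solution of the system $$(C_++\varepsilon\tilde C_+)^{-1}(A_{+\ominus}+A_{++}\Psi_{+\ominus}(\varepsilon))+\Psi_{+\ominus}(\varepsilon)|\varepsilon\tilde C_\ominus|^{-1}(A_{\ominus\ominus}+A_{\ominus+}\Psi_{+\ominus}(\varepsilon))+\Psi_{+-}(\varepsilon)|C_-+\varepsilon\tilde C_-|^{-1}(A_{-\ominus}+A_{-+}\Psi_{+\ominus}(\varepsilon))=0,$$ $$(C_++\varepsilon\tilde C_+)^{-1}(A_{+-}+A_{++}\Psi_{+-}(\varepsilon))+\Psi_{+\ominus}(\varepsilon)|\varepsilon\tilde C_\ominus|^{-1}(A_{\ominus-}+A_{\ominus+}\Psi_{+-}(\varepsilon))+\Psi_{+-}(\varepsilon)|C_-+\varepsilon\tilde C_-|^{-1}(A_{--}+A_{-+}\Psi_{+-}(\varepsilon))=0 .$$ Then $\boldsymbol\Psi(\varepsilon)$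 is analytic near zero and may be written as $\boldsymbol\Psi(\varepsilon)=\overline\Psi+\varepsilon\Psi^{(1)}+O(\varepsilon^2)$, where $$\overline\Psi=\begin{bmatrix}0&\Psi\end{bmatrix},\qquad \Psi^{(1)}=\begin{bmatrix}\Psi^{(1)}_{+\ominus}&\Psi^{(1)}_{+-}\end{bmatrix},$$ $\Psi$ is the matrix of first return probabilities of the unperturbed model, $\Psi^{(1)}_{+-}$ is the unique solution $X$ of the Sylvester equation $$KX+XU=-\Psi|C_-^{-1}|\tilde C_-U-C_+^{-1}\tilde C_+\Psi U-KP_\ominus,$$ and $$\Psi^{(1)}_{+\ominus}=(C_+^{-1}A_{+\ominus}+\Psi|C_-^{-1}|A_{-\ominus})(-A_{\ominus\ominus}^{-1})|\tilde C_\ominus|,\qquad P_\ominus=\Psi^{(1)}_{+\ominus}(-A_{\ominus\ominus}^{-1})(A_{\ominus-}+A_{\ominus+}\Psi).$$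
   Context: Markov modulated fluid model: $\varphi(t)$ is a continuous-time Markov chain (the phase process) on a finite set $\mathcal S$ with generator $A$, and $Y(t)=Y(0)+\int_0^t c_{\varphi(s)}\,\mathrm ds$ with real rates $c_i$, $i\in\mathcal S$. Partition $\mathcal S=\mathcal S_+\cup\mathcal S_0\cup\mathcal S_-$ according to $c_i>0$, $c_i=0$, $c_i<0$; matrices indexed by phases are partitioned accordingly into blocks $A_{++},A_{+0},A_{+-}$, etc. (with index $\ominus$ in place of $0$ in the claim, so $A_{\ominus\ominus}=A_{00}$, $A_{+\ominus}=A_{+0}$, etc.). Put $C_+=\mathrm{diag}(c_i:i\in\mathcal S_+)$, $C_-=\mathrm{diag}(c_i:i\in\mathcal S_-)$, and let $C$ be the block-diagonal matrix with diagonal blocks $C_+,0,C_-$; $|\cdot|$ denotes entrywise absolute value and $\mathbf 1$ is the column vector of ones. Standing assumption (positive recurrence): $\boldsymbol\xi C\mathbf 1<0$, where $\boldsymbol\xi$ is the stationary probability vector of the phase process, the unique solution of $\boldsymbol\xi A=0$, $\boldsymbol\xi\mathbf 1=1$. First return probabilities from above: for a phase $i$ of positive rate and a phase $j$ of negative rate, the $(i,j)$ entry is $\mathbb P[\tau_-<\infty,\ \varphi(\tau_-)=j\mid Y(0)=0,\varphi(0)=i]$ with $\tau_-=\inf\{t>0:Y(t)<0\}$. For the unperturbed model this is the $|\mathcal S_+|\times|\mathcal S_-|$ matrix $\Psi$, which is known (Rogers) to be the minimal nonnegative solution of $C_+^{-1}Q_{+-}+C_+^{-1}Q_{++}X+X|C_-^{-1}|Q_{--}+X|C_-^{-1}|Q_{-+}X=0$,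 with $$\begin{bmatrix}Q_{++}&Q_{+-}\\ Q_{-+}&Q_{--}\end{bmatrix}=\begin{bmatrix}A_{++}&A_{+-}\\ A_{-+}&A_{--}\end{bmatrix}+\begin{bmatrix}A_{+0}\\ A_{-0}\end{bmatrix}(-A_{00}^{-1})\begin{bmatrix}A_{0+}&A_{0-}\end{bmatrix}.$$ Define $$U=|C_-^{-1}|Q_{--}+|C_-^{-1}|Q_{-+}\Psi,\qquad K=C_+^{-1}Q_{++}+\Psi|C_-^{-1}|Q_{-+}.$$ It is assumed that $\varepsilon$ is small enough that the diagonal elements of $C_++\varepsilon\tilde C_+$ are strictly positive and those of $C_-+\varepsilon\tilde C_-$ are strictly negative. In the perturbed model the phases of negative rate are $\mathcal S_\ominus\cup\mathcal S_-$. "Analytic near zero" means that $\boldsymbol\Psi(\varepsilon)$, defined for small $\varepsilon>0$, coincides there with a matrix function analytic in a neighbourhood of $\varepsilon=0$. *)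

theory Defs
  imports "HOL-Probability.Probability"
begin

text \<open>
  The finite phase space is a type \<open>'s\<close>.  A matrix with rows indexed by \<open>I\<close> and columns
  indexed by \<open>J\<close> is represented by a matrix over the whole of \<open>'s\<close> whose entries outside
  \<open>I \<times> J\<close> vanish; in this way the product \<open>**\<close>, the order and the (entrywise) absolute value
  of the library apply to blocks, and the index sets are allowed to be empty.  Two adjacent blocks
  \<open>[X Y]\<close> are put together by addition.
\<close>

definition blk :: "'s set \<Rightarrow> 's set \<Rightarrow> real^'s^'s \<Rightarrow> real^'s^'s" where
  "blk I J M = (\<chi> i j. if i \<in> I \<and> j \<in> J then M $ i $ j else 0)"

definition diagm :: "real^'s \<Rightarrow> real^'s^'s" where
  "diagm d = (\<chi> i j. if i = j then d $ i else 0)"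

text \<open>The inverse of an \<open>I \<times> I\<close> block, within the \<open>I \<times> I\<close> blocks.\<close>

definition blk_inv :: "'s set \<Rightarrow> real^'s^'s \<Rightarrow> real^'s^'s" where
  "blk_inv I M =
     (THE X. blk I I X = X \<and> M ** X = blk I I (mat 1) \<and> X ** M = blk I I (mat 1))"

definition generator :: "real^'s^'s \<Rightarrow> bool" where
  "generator A \<longleftrightarrow>
     (\<forall>i j. i \<noteq> j \<longrightarrow> 0 \<le> A $ i $ j) \<and> (\<forall>i. (\<Sum>j\<in>UNIV. A $ i $ j) = 0)"

definition jump_prob :: "real^'s^'s \<Rightarrow> 's \<Rightarrow> 's \<Rightarrow> real" where
  "jump_prob A i j =
     (if A $ i $ i = 0 then (if j = i then 1 else 0)
      else (if j = i then 0 else A $ i $ j / (- A $ i $ i)))"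

text \<open>
  \<open>\<phi>\<close> is a continuous-time Markov chain on the probability space \<open>M\<close>, with generator \<open>A\<close>
  and started in \<open>i\<close>: its paths are right-continuous step functions with finitely many jumps in
  every bounded interval, the successive states \<open>Z n\<close> form a discrete-time Markov chain with
  transition probabilities \<open>jump_prob A\<close>, and given these states the sojourn times \<open>H n\<close> are
  independent and exponentially distributed with parameters \<open>- A $ Z n $ Z n\<close>.
  The sojourn in an absorbing state is infinite, which is why \<open>H\<close> takes extended real values; the
  states \<open>Z\<close> that come after it do not occur on the path.
\<close>

definition ctmc :: "real^'s^'s \<Rightarrow> 's \<Rightarrow> 'w measure \<Rightarrow> (real \<Rightarrow> 'w \<Rightarrow> 's) \<Rightarrow> bool" where
  "ctmc A i M \<phi> \<longleftrightarrow> prob_space M \<and>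
     (\<exists>(Z :: nat \<Rightarrow> 'w \<Rightarrow> 's) (H :: nat \<Rightarrow> 'w \<Rightarrow> ereal).
        (\<forall>n. Z n \<in> measurable M (count_space UNIV)) \<and>
        (\<forall>n. H n \<in> borel_measurable M) \<and>
        (\<forall>\<omega>\<in>space M. (\<forall>n. 0 < H n \<omega>) \<and>
           (\<forall>t\<ge>0. \<exists>n. (\<Sum>k<n. H k \<omega>) \<le> ereal t \<and> ereal t < (\<Sum>k\<le>n. H k \<omega>) \<and>
                     \<phi> t \<omega> = Z n \<omega>)) \<and>
        (\<forall>n z u. (\<forall>k. 0 \<le> u k) \<longrightarrow>
           measure M {\<omega> \<in> space M. \<forall>k\<le>n. Z k \<omega> = z k \<and> ereal (u k) < H k \<omega>} =
             (if z 0 = i then 1 else 0)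
             * (\<Prod>k<n. jump_prob A (z k) (z (Suc k)))
             * (\<Prod>k\<le>n. exp (A $ z k $ z k * u k))))"

text \<open>The level at time \<open>t\<close>, starting from level 0, when the phases follow the path \<open>x\<close>.\<close>

definition level :: "real^'s \<Rightarrow> (real \<Rightarrow> 's) \<Rightarrow> real \<Rightarrow> real" where
  "level r x t = integral {0..t} (\<lambda>s. r $ x s)"

definition first_return_time :: "real^'s \<Rightarrow> (real \<Rightarrow> 's) \<Rightarrow> real" where
  "first_return_time r x = Inf {t. 0 < t \<and> level r x t < 0}"

text \<open>
  First return probabilities from above for the rates \<open>r\<close>, where \<open>P i\<close> is the law under which the
  initial phase is \<open>i\<close>.  The return time is finite iff the set of which it is the infimum is
  nonempty.
\<close>

definition first_return ::
  "('s \<Rightarrow> 'w measure) \<Rightarrow> (real \<Rightarrow> 'w \<Rightarrow> 's) \<Rightarrow> real^'s \<Rightarrow> real^'s^'s" where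
  "first_return P \<phi> r = (\<chi> i j.
     if 0 < r $ i \<and> r $ j < 0
     then measure (P i) {\<omega> \<in> space (P i).
            (\<exists>t>0. level r (\<lambda>s. \<phi> s \<omega>) t < 0) \<and>
            \<phi> (first_return_time r (\<lambda>s. \<phi> s \<omega>)) \<omega> = j}
     else 0)"

definition minimal_nonneg_solution :: "(real^'s^'s \<Rightarrow> bool) \<Rightarrow> real^'s^'s \<Rightarrow> bool" where
  "minimal_nonneg_solution S X \<longleftrightarrow> 0 \<le> X \<and> S X \<and> (\<forall>Z. 0 \<le> Z \<and> S Z \<longrightarrow> X \<le> Z)"

end

theory Submission
  imports Defs "HOL-Complex_Analysis.Cauchy_Integral_Formula" "HOL-Real_Asymp.Real_Asymp"
begin

text \<open>
  The return probabilities are identified with a least solution, and least solutions are tractable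
  because of a comparison principle.  Let \<open>first_passage\<close> be the probability that a path which starts
  at height \<open>y\<close> falls below zero for the first time in a given phase.  Conditioning on the first jump
  (\<open>markov_first_jump\<close>) exhibits it as the limit of the iterates, started from zero, of a monotone
  integral operator (\<open>first_return_eq_SUP_passage\<close>).  Two facts follow.  It is a semigroup in \<open>y\<close>,
  and differentiating it at height zero gives the Riccati equation (\<open>return_prob_riccati\<close>).  It lies
  below every nonnegative supersolution of the drift inequality (\<open>passage_supersolution\<close>); a
  nonnegative matrix solution of the Riccati equation yields such a supersolution by means of a matrix
  exponential, so the return probabilities are the least nonnegative solution
  (\<open>return_prob_minimal\<close>).

  In the perturbed model the coefficients \<open>1 / (\<epsilon> ct)\<close> of the zero rate phases are singular.  The
  singularity disappears when the columns of these phases are divided by \<open>\<epsilon>\<close>: the function \<open>F\<close> of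
  the rescaled unknown has coefficients that are analytic at \<open>\<epsilon> = 0\<close>.  At \<open>\<epsilon> = 0\<close> it has the zero
  \<open>base\<close>, whose blocks are \<open>\<Psi>\<close> and the claimed first order term of the zero rate columns.  Its
  linearization there is, up to the elimination of the zero rate columns, the Sylvester operator
  \<open>X \<mapsto> K X + X U\<close>.

  Everything rests on the stability of \<open>K\<close>.  Negative drift makes the Poisson equation
  \<open>A g = - c - d\<close> solvable with \<open>d > 0\<close> (\<open>poisson_equation\<close>), and the solution is a Lyapunov
  function: it gives a positive \<open>h\<close> with \<open>K h < 0\<close> (\<open>K_stable\<close>).  Together with a suitable positive left
  vector this produces a positive weight on which the linearization is strictly negative
  (\<open>weight_exists\<close>).  Since the linearization has nonnegative off-diagonal entries, such a weight
  makes the Sylvester equation uniquely solvable (\<open>sylvester_unique\<close>), makes a relaxed iteration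
  for \<open>F\<close> a contraction in the weighted maximum norm and so yields a holomorphic branch of zeros
  (\<open>analytic_branch\<close>), and turns \<open>base\<close> plus a small multiple of the weight into a strict
  supersolution.

  It remains to see that the return probabilities follow this branch.  The supersolution bounds the
  rescaled return probabilities from above; by compactness they have limit points, these are
  nonnegative zeros of \<open>F\<close> at \<open>\<epsilon> = 0\<close>, and \<open>base\<close> is the least such zero
  (\<open>scaled_return_tendsto\<close>).  Hence the return probabilities enter the region in which the branch is
  the only zero.  The derivative of the branch at zero solves the Sylvester equation
  (\<open>branch_derivative\<close>), and Taylor's formula gives the expansion.
\<close>

section \<open>Metzler matrices with a strictly negative test vector\<close>

text \<open>A maximum principle: at the index where \<open>y / p\<close> is least, a negative minimum would make the
  row sum of \<open>B y\<close> at least the minimum times a negative number, hence positive.\<close>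

lemma metzler_nonneg:
  fixes B :: "'a \<Rightarrow> 'a \<Rightarrow> real"
  assumes fin: "finite I"
    and off: "\<And>i j. i \<in> I \<Longrightarrow> j \<in> I \<Longrightarrow> i \<noteq> j \<Longrightarrow> 0 \<le> B i j"
    and p: "\<And>i. i \<in> I \<Longrightarrow> 0 < p i" and Bp: "\<And>i. i \<in> I \<Longrightarrow> (\<Sum>j\<in>I. B i j * p j) < 0"
    and By: "\<And>i. i \<in> I \<Longrightarrow> (\<Sum>j\<in>I. B i j * y j) \<le> 0"
    and i: "i \<in> I"
  shows "0 \<le> y i"
proof -
  define m where "m = Min ((\<lambda>i. y i / p i) ` I)"
  have "m \<in> (\<lambda>i. y i / p i) ` I" unfolding m_def using fin i by (intro Min_in) auto
  then obtain k where k: "k \<in> I" "m = y k / p k" by auto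
  have le: "m * p j \<le> y j" if "j \<in> I" for j
  proof -
    have "m \<le> y j / p j" unfolding m_def using that fin by auto
    then show ?thesis using p[OF that] by (simp add: field_simps)
  qed
  have "0 \<le> m"
  proof (rule ccontr)
    assume "\<not> 0 \<le> m"
    have "(\<Sum>j\<in>I. B k j * (m * p j)) \<le> (\<Sum>j\<in>I. B k j * y j)"
    proof (rule sum_mono)
      fix j assume j: "j \<in> I"
      show "B k j * (m * p j) \<le> B k j * y j"
      proof (cases "j = k")
        case True
        then show ?thesis using k p[OF k(1)] by simp
      next
        case False
        then show ?thesis using off[OF k(1) j] le[OF j] by (intro mult_left_mono) auto
      qed
    qed
    moreover have "(\<Sum>j\<in>I. B k j * (m * p j)) = m * (\<Sum>j\<in>I. B k j * p j)"
      by (simp add: sum_distrib_left algebra_simps)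
    moreover have "m * (\<Sum>j\<in>I. B k j * p j) > 0"
      using \<open>\<not> 0 \<le> m\<close> Bp[OF k(1)] by (simp add: mult_neg_neg)
    ultimately show False using By[OF k(1)] by simp
  qed
  then show ?thesis using le[OF i] mult_nonneg_nonneg[of m "p i"] p[OF i] by linarith
qed

lemma metzler_inj:
  fixes B :: "'a \<Rightarrow> 'a \<Rightarrow> real"
  assumes fin: "finite I"
    and off: "\<And>i j. i \<in> I \<Longrightarrow> j \<in> I \<Longrightarrow> i \<noteq> j \<Longrightarrow> 0 \<le> B i j"
    and p: "\<And>i. i \<in> I \<Longrightarrow> 0 < p i" and Bp: "\<And>i. i \<in> I \<Longrightarrow> (\<Sum>j\<in>I. B i j * p j) < 0"
    and By: "\<And>i. i \<in> I \<Longrightarrow> (\<Sum>j\<in>I. B i j * y j) = 0"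
    and i: "i \<in> I"
  shows "y i = 0"
proof -
  have "0 \<le> y i"
    by (rule metzler_nonneg[where I = I and B = B and p = p]) (use assms in auto)
  moreover have "0 \<le> - y i"
    by (rule metzler_nonneg[where I = I and B = B and p = p and y = "\<lambda>i. - y i"])
      (use assms in \<open>auto simp: sum_negf\<close>)
  ultimately show ?thesis by simp
qed

text \<open>The theorem on matrices over a finite type, applied to the matrix that is extended by the
  identity outside \<open>I\<close>.\<close>

lemma inverse_of_injective:
  fixes B :: "'a::finite \<Rightarrow> 'a \<Rightarrow> real"
  assumes inj: "\<And>y. \<forall>i\<in>I. (\<Sum>j\<in>I. B i j * y j) = 0 \<Longrightarrow> \<forall>i\<in>I. y i = 0"
  shows "\<exists>N. (\<forall>i\<in>I. \<forall>j\<in>I. (\<Sum>k\<in>I. B i k * N k j) = (if i = j then 1 else 0))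
    \<and> (\<forall>i\<in>I. \<forall>j\<in>I. (\<Sum>k\<in>I. N i k * B k j) = (if i = j then 1 else 0))"
proof -
  define M :: "real^'a^'a"
    where "M = (\<chi> i j. if i \<in> I \<and> j \<in> I then B i j else if i = j then 1 else 0)"
  have Mrow: "(\<Sum>j\<in>UNIV. M $ i $ j * y j) = (if i \<in> I then (\<Sum>j\<in>I. B i j * y j) else y i)" for i y
  proof -
    have "(\<Sum>j\<in>UNIV. M $ i $ j * y j)
        = (\<Sum>j\<in>UNIV. if i \<in> I then (if j \<in> I then B i j * y j else 0) else (if i = j then y j else 0))"
      by (intro sum.cong) (auto simp: M_def)
    then show ?thesis by (auto simp: sum.If_cases)
  qed
  have "\<forall>x. M *v x = 0 \<longrightarrow> x = 0"
  proof (intro allI impI)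
    fix x assume x: "M *v x = 0"
    have row: "(\<Sum>j\<in>UNIV. M $ i $ j * x $ j) = 0" for i
      using x by (simp add: matrix_vector_mult_def vec_eq_iff)
    have "x $ i = 0" for i
    proof (cases "i \<in> I")
      case True
      have "(\<Sum>j\<in>I. B l j * x $ j) = 0" if "l \<in> I" for l
        using row[of l] Mrow[of l "\<lambda>j. x $ j"] that by simp
      then have "\<forall>l\<in>I. (\<Sum>j\<in>I. B l j * x $ j) = 0" by blast
      from inj[OF this] have "\<forall>i\<in>I. x $ i = 0" .
      then show ?thesis using True by blast
    next
      case False
      then show ?thesis using row[of i] Mrow[of i "\<lambda>j. x $ j"] by simp
    qed
    then show "x = 0" by (simp add: vec_eq_iff)
  qed
  then obtain M' where M': "M' ** M = mat 1" using matrix_left_invertible_ker by blast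
  then have M'2: "M ** M' = mat 1" using matrix_left_right_inverse by blast
  have ent1: "(\<Sum>j\<in>UNIV. M $ i $ j * M' $ j $ k) = (if i = k then 1 else 0)" for i k
    using M'2 by (auto simp: matrix_matrix_mult_def mat_def vec_eq_iff)
  have ent2: "(\<Sum>j\<in>UNIV. M' $ i $ j * M $ j $ k) = (if i = k then 1 else 0)" for i k
    using M' by (auto simp: matrix_matrix_mult_def mat_def vec_eq_iff)
  show ?thesis
  proof (intro exI[of _ "\<lambda>i j. M' $ i $ j"] conjI ballI)
    fix i j assume ij: "i \<in> I" "j \<in> I"
    show "(\<Sum>k\<in>I. B i k * M' $ k $ j) = (if i = j then 1 else 0)"
      using ent1[of i j] Mrow[of i "\<lambda>k. M' $ k $ j"] ij by simp
  next
    fix i j assume ij: "i \<in> I" "j \<in> I"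
    have "(\<Sum>k\<in>UNIV. M' $ i $ k * M $ k $ j) = (\<Sum>k\<in>UNIV. if k \<in> I then M' $ i $ k * B k j else 0)"
      by (intro sum.cong) (use ij in \<open>auto simp: M_def\<close>)
    then show "(\<Sum>k\<in>I. M' $ i $ k * B k j) = (if i = j then 1 else 0)"
      using ent2[of i j] by (simp add: sum.If_cases)
  qed
qed

text \<open>The inverse of \<open>B\<close> is nonpositive by the maximum principle, so the negated column sums of the
  inverse are a nonnegative \<open>u\<close> with \<open>u B = -1\<close>; a zero entry of \<open>u\<close> would contradict this.\<close>

lemma metzler_left_vector:
  fixes B :: "'a::finite \<Rightarrow> 'a \<Rightarrow> real"
  assumes off: "\<And>i j. i \<in> I \<Longrightarrow> j \<in> I \<Longrightarrow> i \<noteq> j \<Longrightarrow> 0 \<le> B i j"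
    and p: "\<And>i. i \<in> I \<Longrightarrow> 0 < p i" and Bp: "\<And>i. i \<in> I \<Longrightarrow> (\<Sum>j\<in>I. B i j * p j) < 0"
  obtains u where "\<And>i. i \<in> I \<Longrightarrow> 0 < u i" "\<And>j. j \<in> I \<Longrightarrow> (\<Sum>i\<in>I. u i * B i j) < 0"
proof -
  have fin: "finite I" by simp
  have inj: "\<forall>i\<in>I. y i = 0" if "\<forall>i\<in>I. (\<Sum>j\<in>I. B i j * y j) = 0" for y
  proof
    fix i assume "i \<in> I"
    then show "y i = 0"
      by (intro metzler_inj[where I = I and B = B and p = p and y = y]) (use off p Bp that in auto)
  qed
  obtain N where N: "\<And>i j. i \<in> I \<Longrightarrow> j \<in> I \<Longrightarrow> (\<Sum>k\<in>I. B i k * N k j) = (if i = j then 1 else 0)"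
    "\<And>i j. i \<in> I \<Longrightarrow> j \<in> I \<Longrightarrow> (\<Sum>k\<in>I. N i k * B k j) = (if i = j then 1 else 0)"
    using inverse_of_injective[of I B, OF inj] by blast
  have Nle: "0 \<le> - N i j" if "i \<in> I" "j \<in> I" for i j
    by (rule metzler_nonneg[where I = I and B = B and p = p and y = "\<lambda>i. - N i j"])
      (use off p Bp that N(1) in \<open>auto simp: sum_negf\<close>)
  define u where "u = (\<lambda>j. \<Sum>i\<in>I. - N i j)"
  have uB: "(\<Sum>i\<in>I. u i * B i j) = -1" if "j \<in> I" for j
  proof -
    have "(\<Sum>i\<in>I. u i * B i j) = (\<Sum>k\<in>I. - (\<Sum>i\<in>I. N k i * B i j))"
      unfolding u_def by (simp add: sum_distrib_right sum_negf) (rule sum.swap)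
    also have "\<dots> = -1" using that N(2) by (simp add: sum_negf)
    finally show ?thesis .
  qed
  have unn: "0 \<le> u i" if "i \<in> I" for i
    unfolding u_def using Nle that by (auto intro: sum_nonneg)
  have "0 < u i" if i: "i \<in> I" for i
  proof (rule ccontr)
    assume "\<not> 0 < u i"
    then have "u i = 0" using unn[OF i] by simp
    then have "(\<Sum>k\<in>I. u k * B k i) \<ge> 0"
    proof (intro sum_nonneg)
      fix k assume "k \<in> I"
      then show "0 \<le> u k * B k i" using \<open>u i = 0\<close> off[of k i] unn[of k] i by (cases "k = i") auto
    qed
    then show False using uB[OF i] by simp
  qed
  then show ?thesis using that[of u] uB by simp
qed

section \<open>Consequences of negative drift\<close>

context
  fixes A :: "real^'s^'s" and c xi :: "real^'s"
  assumes gen: "generator A"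
    and stationary: "\<And>x. (x v* A = 0 \<and> x \<bullet> 1 = 1) = (x = xi)"
    and drift: "(xi v* diagm c) \<bullet> 1 < 0"
begin

text \<open>Uniqueness of the normalized left null vector makes the left kernel one-dimensional: adding a
  multiple of \<open>xi\<close> to any null vector normalizes it.\<close>

lemma left_kernel:
  assumes "x v* A = 0" shows "x = (x \<bullet> 1) *\<^sub>R xi"
proof -
  have xi: "xi v* A = 0" "xi \<bullet> 1 = 1" using stationary[of xi] by auto
  let ?y = "x + (1 - x \<bullet> 1) *\<^sub>R xi"
  have "?y v* A = 0" using assms xi
    by (metis add.right_neutral scaleR_vector_matrix_assoc scaleR_zero_right vector_matrix_left_distrib)
  moreover have "?y \<bullet> 1 = 1" using xi by (simp add: inner_add_left)
  ultimately have "?y = xi" using stationary by blast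
  then show ?thesis by (simp add: algebra_simps)
qed

lemma drift_sum: "(\<Sum>i\<in>UNIV. xi $ i * c $ i) < 0"
proof -
  have "(xi v* diagm c) $ j = xi $ j * c $ j" for j
    by (simp add: vector_matrix_mult_def diagm_def if_distrib cong: if_cong)
  then show ?thesis using drift by (simp add: inner_vec_def)
qed

text \<open>A null vector of the block of the zero rate phases attains its maximum on a set of phases that the
  chain cannot leave.  Then \<open>xi\<close> is carried by this set, where the rates vanish, and the drift would
  be zero.\<close>

lemma zero_rate_block_inj:
  assumes y: "\<And>i. c $ i = 0 \<Longrightarrow> (\<Sum>j | c $ j = 0. A $ i $ j * y j) = 0" and k: "c $ k = 0"
  shows "y k = 0"
proof -
  have off: "0 \<le> A $ i $ j" if "i \<noteq> j" for i j using gen that by (simp add: generator_def)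
  have rows: "(\<Sum>j\<in>UNIV. A $ i $ j) = 0" for i using gen by (simp add: generator_def)
  have nonpos: "z k \<le> 0"
    if z: "\<And>i. c $ i = 0 \<Longrightarrow> (\<Sum>j | c $ j = 0. A $ i $ j * z j) = 0" and k: "c $ k = 0" for z k
  proof (rule ccontr)
    assume pos: "\<not> z k \<le> 0"
    let ?I = "{j. c $ j = 0}"
    define m where "m = Max (z ` ?I)"
    have m: "z j \<le> m" if "c $ j = 0" for j unfolding m_def using that by auto
    have mpos: "m > 0" using m[OF k] pos by simp
    define J where "J = {j. c $ j = 0 \<and> z j = m}"
    have Jne: "J \<noteq> {}"
    proof -
      have "m \<in> z ` ?I" unfolding m_def using k by (intro Max_in) auto
      then show ?thesis by (auto simp: J_def)
    qed
    \<comment> \<open>the set where the maximum is attained is closed for the chain\<close>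
    have closed: "A $ i $ j = 0" if i: "i \<in> J" and j: "j \<notin> J" for i j
    proof -
      have ci: "c $ i = 0" "z i = m" using i by (auto simp: J_def)
      have "(\<Sum>j\<in>UNIV. A $ i $ j * (m - (if c $ j = 0 then z j else 0)))
          = m * (\<Sum>j\<in>UNIV. A $ i $ j) - (\<Sum>j\<in>UNIV. if c $ j = 0 then A $ i $ j * z j else 0)"
        by (simp add: sum_distrib_left flip: sum_subtractf)
          (intro sum.cong, auto simp: algebra_simps)
      also have "\<dots> = 0" using rows[of i] z[OF ci(1)] by (simp add: sum.If_cases)
      finally have s0: "(\<Sum>j\<in>UNIV. A $ i $ j * (m - (if c $ j = 0 then z j else 0))) = 0" .
      have nn: "0 \<le> A $ i $ l * (m - (if c $ l = 0 then z l else 0))" for l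
      proof (cases "l = i")
        case False
        then show ?thesis using off[of i l] m[of l] mpos by auto
      qed (use ci in auto)
      have "A $ i $ j * (m - (if c $ j = 0 then z j else 0)) = 0"
        using s0 nn by (subst (asm) sum_nonneg_eq_0_iff) auto
      then show ?thesis using j mpos m[of j] by (auto simp: J_def split: if_splits)
    qed
    \<comment> \<open>so it carries a left null vector\<close>
    have "\<exists>x. (\<forall>j. j \<notin> J \<longrightarrow> x j = 0) \<and> (\<exists>j. x j \<noteq> 0) \<and> (\<forall>j. (\<Sum>i\<in>UNIV. x i * A $ i $ j) = 0)"
    proof -
      \<comment> \<open>the rows outside \<open>J\<close> are those of the identity, so that a left null vector of \<open>M\<close> lives on \<open>J\<close>\<close>
      define M :: "real^'s^'s" where
        "M = (\<chi> i j. if i \<in> J then A $ i $ j else if i = j then 1 else 0)"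
      let ?e = "(\<chi> j. if j \<in> J then 1 else 0) :: real^'s"
      have "(M *v ?e) $ i = 0" for i
      proof -
        have "(M *v ?e) $ i = (\<Sum>j\<in>UNIV. if i \<in> J then A $ i $ j else 0)"
          unfolding matrix_vector_mult_def M_def using closed
          by (auto intro!: sum.cong sum.neutral)
        then show ?thesis using rows by (cases "i \<in> J") simp_all
      qed
      then have "M *v ?e = 0" by (simp add: vec_eq_iff)
      moreover have "?e \<noteq> 0" using Jne by (auto simp: vec_eq_iff)
      ultimately have "\<not> (\<exists>B. B ** M = mat 1)" using matrix_left_invertible_ker by blast
      then have "\<not> (\<exists>B. M ** B = mat 1)" using matrix_left_right_inverse by blast
      then have "\<not> (\<exists>B. B ** transpose M = mat 1)"
        by (metis matrix_transpose_mul transpose_mat transpose_transpose)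
      then obtain x where x: "transpose M *v x = 0" "x \<noteq> 0"
        using matrix_left_invertible_ker by blast
      have col: "(\<Sum>i\<in>UNIV. x $ i * M $ i $ j) = 0" for j
        using x(1) by (simp add: matrix_vector_mult_def transpose_def vec_eq_iff mult.commute)
      have out: "x $ j = 0" if j: "j \<notin> J" for j
      proof -
        have "x $ i * M $ i $ j = (if i = j then x $ j else 0)" for i
          using closed[of i j] j by (auto simp: M_def)
        then show ?thesis using col[of j] by simp
      qed
      have "(\<Sum>i\<in>UNIV. x $ i * A $ i $ j) = 0" for j
      proof -
        have "(\<Sum>i\<in>UNIV. x $ i * A $ i $ j) = (\<Sum>i\<in>UNIV. x $ i * M $ i $ j)"
          by (intro sum.cong) (auto simp: M_def out)
        then show ?thesis using col by simp
      qed
      then show ?thesis using out x(2)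
        by (intro exI[of _ "\<lambda>j. x $ j"]) (auto simp: vec_eq_iff)
    qed
    then obtain x where x: "\<And>j. j \<notin> J \<Longrightarrow> x j = 0" "\<exists>j. x j \<noteq> 0" "\<And>j. (\<Sum>i\<in>UNIV. x i * A $ i $ j) = 0"
      by auto
    let ?x = "(\<chi> i. x i) :: real^'s"
    have "?x v* A = 0" using x(3) by (simp add: vector_matrix_mult_def vec_eq_iff mult.commute)
    then have eq: "?x = (?x \<bullet> 1) *\<^sub>R xi" by (rule left_kernel)
    then have ne: "?x \<bullet> 1 \<noteq> 0" using x(2) by (metis scaleR_zero_left vec_lambda_beta zero_index)
    have "xi $ j * c $ j = 0" for j
    proof (cases "j \<in> J")
      case False
      then have "(?x \<bullet> 1) * xi $ j = 0"
        using eq x(1)[OF False] by (metis vector_scaleR_component vec_lambda_beta real_scaleR_def)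
      then show ?thesis using ne by simp
    qed (auto simp: J_def)
    then have "(\<Sum>j\<in>UNIV. xi $ j * c $ j) = 0" by (intro sum.neutral) simp
    then show False using drift_sum by simp
  qed
  have "y k \<le> 0" using nonpos[of y] y k by blast
  moreover have "- y k \<le> 0" using nonpos[of "\<lambda>i. - y i"] y k by (simp add: sum_negf)
  ultimately show ?thesis by simp
qed

text \<open>The constant \<open>d\<close> is the negated mean drift, the only value for which the right-hand side is
  annihilated by \<open>xi\<close>.\<close>

lemma poisson_equation:
  obtains g d where "0 < (d::real)" "\<And>i. (\<Sum>j\<in>UNIV. A $ i $ j * g j) = - c $ i - d"
proof -
  have rows: "(\<Sum>j\<in>UNIV. A $ i $ j) = 0" for i using gen by (simp add: generator_def)
  have xi: "xi v* A = 0" "xi \<bullet> 1 = 1" using stationary[of xi] by auto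
  have xis: "(\<Sum>i\<in>UNIV. xi $ i) = 1" using xi(2) by (simp add: inner_vec_def)
  have xiA: "(\<Sum>i\<in>UNIV. xi $ i * A $ i $ j) = 0" for j
    using xi(1) by (simp add: vector_matrix_mult_def vec_eq_iff mult.commute)
  \<comment> \<open>subtracting the rank one matrix with rows \<open>xi\<close> removes the kernel of \<open>A\<close>; on solutions with \<open>xi g = 0\<close> it changes nothing\<close>
  define M :: "real^'s^'s" where "M = (\<chi> i j. A $ i $ j - xi $ j)"
  have "\<forall>x. transpose M *v x = 0 \<longrightarrow> x = 0"
  proof (intro allI impI)
    fix x assume "transpose M *v x = 0"
    then have col: "(\<Sum>i\<in>UNIV. x $ i * (A $ i $ j - xi $ j)) = 0" for j
      by (simp add: matrix_vector_mult_def transpose_def vec_eq_iff mult.commute M_def)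
    then have xA: "(\<Sum>i\<in>UNIV. x $ i * A $ i $ j) = (\<Sum>i\<in>UNIV. x $ i) * xi $ j" for j
      using col[of j] by (simp add: right_diff_distrib sum_subtractf sum_distrib_right)
    have "(\<Sum>j\<in>UNIV. (\<Sum>i\<in>UNIV. x $ i * A $ i $ j)) = 0"
      by (subst sum.swap) (simp add: rows flip: sum_distrib_left)
    then have z: "(\<Sum>i\<in>UNIV. x $ i) = 0"
      unfolding xA by (simp add: xis flip: sum_distrib_left)
    then have "x v* A = 0" using xA by (simp add: vector_matrix_mult_def vec_eq_iff mult.commute)
    then have "x = (x \<bullet> 1) *\<^sub>R xi" by (rule left_kernel)
    then show "x = 0" using z by (simp add: inner_vec_def)
  qed
  then obtain N where "N ** transpose M = mat 1" using matrix_left_invertible_ker by blast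
  then have N: "M ** transpose N = mat 1"
    by (metis matrix_transpose_mul transpose_mat transpose_transpose)
  define s where "s = (\<Sum>i\<in>UNIV. xi $ i * c $ i)"
  define b :: "real^'s" where "b = (\<chi> i. s - c $ i)"
  define g where "g = transpose N *v b"
  have Mg: "M *v g = b" unfolding g_def by (simp only: matrix_vector_mul_assoc N matrix_vector_mul_lid)
  have row: "(\<Sum>j\<in>UNIV. A $ i $ j * g $ j) - (\<Sum>j\<in>UNIV. xi $ j * g $ j) = b $ i" for i
    using Mg by (auto simp: matrix_vector_mult_def M_def left_diff_distrib sum_subtractf vec_eq_iff)
  have "(\<Sum>i\<in>UNIV. xi $ i * ((\<Sum>j\<in>UNIV. A $ i $ j * g $ j) - (\<Sum>j\<in>UNIV. xi $ j * g $ j)))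
      = (\<Sum>i\<in>UNIV. xi $ i * b $ i)" by (simp add: row)
  moreover have "(\<Sum>i\<in>UNIV. xi $ i * (\<Sum>j\<in>UNIV. A $ i $ j * g $ j)) = 0"
  proof -
    have "(\<Sum>i\<in>UNIV. xi $ i * (\<Sum>j\<in>UNIV. A $ i $ j * g $ j))
        = (\<Sum>j\<in>UNIV. (\<Sum>i\<in>UNIV. xi $ i * A $ i $ j) * g $ j)"
      by (simp add: sum_distrib_left sum_distrib_right mult.assoc) (rule sum.swap)
    then show ?thesis by (simp add: xiA)
  qed
  moreover have "(\<Sum>i\<in>UNIV. xi $ i * b $ i) = 0"
    by (simp add: b_def right_diff_distrib sum_subtractf xis s_def flip: sum_distrib_right)
  ultimately have "(\<Sum>j\<in>UNIV. xi $ j * g $ j) = 0"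
    by (simp add: right_diff_distrib sum_subtractf xis flip: sum_distrib_right)
  then have "(\<Sum>j\<in>UNIV. A $ i $ j * g $ j) = - c $ i - (- s)" for i
    using row[of i] by (simp add: b_def)
  then show ?thesis using that[of "- s" "\<lambda>j. g $ j"] drift_sum by (simp add: s_def)
qed

end

section \<open>The law of states and sojourn times\<close>

text \<open>A path is coded by the sequence of its states and sojourn times; a sojourn time is infinite in
  an absorbing state.\<close>

definition seqM :: "(nat \<Rightarrow> 's \<times> ereal) measure" where
  "seqM = PiM UNIV (\<lambda>_. count_space UNIV \<Otimes>\<^sub>M borel)"

lemma space_seqM [simp]: "space seqM = UNIV"
  by (simp add: seqM_def space_PiM space_pair_measure)

lemma measurable_fst_seqM [measurable]: "(\<lambda>x. fst (x n)) \<in> measurable seqM (count_space UNIV)"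
  unfolding seqM_def by measurable

lemma measurable_snd_seqM [measurable]: "(\<lambda>x. snd (x n)) \<in> borel_measurable seqM"
  unfolding seqM_def by measurable

definition positive_holding :: "(nat \<Rightarrow> 's \<times> ereal) measure \<Rightarrow> bool" where
  "positive_holding L \<longleftrightarrow> prob_space L \<and> sets L = sets seqM \<and> (AE x in L. \<forall>k. 0 < snd (x k))"

text \<open>The cylinders, together with those that leave some of the sojourn times unconstrained, are closed
  under intersection and generate the \<open>\<sigma>\<close>-algebra.  Positivity of the sojourn times reduces an
  unconstrained or negative bound to the bound zero.\<close>

lemma seqM_eqI:
  fixes L L' :: "(nat \<Rightarrow> 's::finite \<times> ereal) measure"
  assumes L: "positive_holding L" and L': "positive_holding L'"
    and eq: "\<And>n z u. (\<And>k. 0 \<le> u k) \<Longrightarrow>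
      emeasure L {x. \<forall>k\<le>n. fst (x k) = z k \<and> ereal (u k) < snd (x k)}
      = emeasure L' {x. \<forall>k\<le>n. fst (x k) = z k \<and> ereal (u k) < snd (x k)}"
  shows "L = L'"
proof -
  \<comment> \<open>the bound \<open>-\<infinity>\<close> encodes the absence of a constraint\<close>
  define cyl :: "nat \<Rightarrow> (nat \<Rightarrow> 's) \<Rightarrow> (nat \<Rightarrow> ereal) \<Rightarrow> (nat \<Rightarrow> 's \<times> ereal) set" where
    "cyl n z u = {x. \<forall>k\<le>n. fst (x k) = z k \<and> (u k = -\<infinity> \<or> u k < snd (x k))}" for n z u
  let ?E = "insert UNIV (insert {} {cyl n z u | n z u. True})"
  have cyl_sets[measurable]: "cyl n z u \<in> sets seqM" for n z u
  proof -
    have "cyl n z u = {x\<in>space seqM. \<forall>k\<in>{..n}. fst (x k) = z k \<and> (u k = -\<infinity> \<or> u k < snd (x k))}"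
      by (auto simp: cyl_def)
    also have "\<dots> \<in> sets seqM" by measurable
    finally show ?thesis .
  qed
  have gen: "sets seqM = sigma_sets UNIV ?E"
  proof (intro antisym)
    let ?N = "sigma UNIV ?E"
    have cylN: "cyl n z u \<in> sets ?N" for n z u
      by (simp add: sets_measure_of) (auto intro!: sigma_sets.Basic)
    have fin: "finite (PiE {..i::nat} (\<lambda>_. UNIV :: 's set))" for i by (intro finite_PiE) auto
    have m1: "(\<lambda>x. fst (x i)) \<in> measurable ?N (count_space UNIV)" for i
    proof (subst measurable_count_space_eq2, simp, intro conjI ballI)
      fix a :: 's
      have "(\<lambda>x. fst (x i)) -` {a} \<inter> space ?N
          = (\<Union>z\<in>{z\<in>PiE {..i} (\<lambda>_. UNIV). z i = a}. cyl i z (\<lambda>_. -\<infinity>))" (is "?l = ?r")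
      proof (intro equalityI subsetI)
        fix x assume "x \<in> ?l"
        then have "x \<in> cyl i (restrict (fst \<circ> x) {..i}) (\<lambda>_. -\<infinity>)" "fst (x i) = a"
          by (auto simp: cyl_def)
        then show "x \<in> ?r" by (intro UN_I[of "restrict (fst \<circ> x) {..i}"]) auto
      qed (auto simp: cyl_def space_measure_of)
      also have "\<dots> \<in> sets ?N" using fin[of i] cylN by (intro sets.finite_UN) auto
      finally show "(\<lambda>x. fst (x i)) -` {a} \<inter> space ?N \<in> sets ?N" .
    qed simp
    have m2': "{x. y < snd (x i)} \<in> sets ?N" if "y \<noteq> -\<infinity>" for i and y :: ereal
    proof -
      have "{x. y < snd (x i)}
          = (\<Union>z\<in>PiE {..i} (\<lambda>_. UNIV). cyl i z (\<lambda>k. if k = i then y else -\<infinity>))" (is "?l = ?r")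
      proof (intro equalityI subsetI)
        fix x assume "x \<in> ?l"
        then show "x \<in> ?r"
          by (intro UN_I[of "restrict (fst \<circ> x) {..i}"]) (auto simp: cyl_def)
      qed (use that in \<open>auto simp: cyl_def\<close>)
      also have "\<dots> \<in> sets ?N" using fin[of i] cylN by (intro sets.finite_UN) auto
      finally show ?thesis .
    qed
    have m2: "(\<lambda>x. snd (x i)) \<in> borel_measurable ?N" for i
    proof (rule borel_measurableI_greater)
      fix y :: ereal
      show "{x \<in> space ?N. y < snd (x i)} \<in> sets ?N"
      proof (cases "y = -\<infinity>")
        case True
        have "{x \<in> space ?N. y < snd (x i)} = (\<Union>n. {x. ereal (- real n) < snd (x i)})"
        proof (intro equalityI subsetI)
          fix x assume "x \<in> {x \<in> space ?N. y < snd (x i)}"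
          then have "\<exists>n::nat. ereal (- real n) < snd (x i)"
          proof (cases "snd (x i)")
            case (real r)
            obtain n :: nat where "- r < real n" using reals_Archimedean2 by blast
            then show ?thesis using real by (intro exI[of _ n]) simp
          qed (use True in auto)
          then show "x \<in> (\<Union>n. {x. ereal (- real n) < snd (x i)})" by simp
        qed (use True in \<open>auto simp: space_measure_of intro: less_le_trans\<close>)
        moreover have "(\<Union>n. {x. ereal (- real n) < snd (x i)}) \<in> sets ?N"
          by (intro sets.countable_nat_UN image_subsetI m2') simp
        ultimately show ?thesis by (simp only:)
      qed (use m2' in \<open>auto simp: space_measure_of\<close>)
    qed
    have m: "(\<lambda>x. x i) \<in> measurable ?N (count_space UNIV \<Otimes>\<^sub>M borel)" for i
      using measurable_Pair[OF m1[of i] m2[of i]] by simp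
    have "sets seqM \<subseteq> sets ?N"
      unfolding seqM_def
    proof (rule sets_PiM_in_sets)
      show "space ?N = (\<Pi>\<^sub>E i\<in>UNIV. space (count_space UNIV \<Otimes>\<^sub>M borel))"
        by (auto simp: space_measure_of space_pair_measure)
      fix i :: nat and A :: "('s \<times> ereal) set" assume "A \<in> sets (count_space UNIV \<Otimes>\<^sub>M borel)"
      from measurable_sets[OF m[of i] this] show "{x \<in> space ?N. x i \<in> A} \<in> sets ?N"
        by (auto simp: vimage_def Int_def conj_commute)
    qed
    then show "sets seqM \<subseteq> sigma_sets UNIV ?E" by (simp add: sets_measure_of)
    show "sigma_sets UNIV ?E \<subseteq> sets seqM"
    proof -
      have "?E \<subseteq> sets seqM"
        using cyl_sets sets.top[of "seqM :: (nat \<Rightarrow> 's \<times> ereal) measure"] by auto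
      from sets.sigma_sets_subset[OF this] show ?thesis by simp
    qed
  qed
  have eqcyl: "emeasure L (cyl n z u) = emeasure L' (cyl n z u)" for n z u
  proof (cases "\<exists>k\<le>n. u k = \<infinity>")
    case True
    then have "cyl n z u = {}" by (auto simp: cyl_def)
    then show ?thesis by simp
  next
    case False
    define v where "v k = (if k \<le> n then max 0 (real_of_ereal (u k)) else 0)" for k
    have red: "emeasure K (cyl n z u) = emeasure K {x. \<forall>k\<le>n. fst (x k) = z k \<and> ereal (v k) < snd (x k)}"
      if K: "positive_holding K" for K :: "(nat \<Rightarrow> 's \<times> ereal) measure"
    proof (rule emeasure_eq_AE)
      have "AE x in K. \<forall>k. 0 < snd (x k)" using K by (simp add: positive_holding_def)
      then show "AE x in K. x \<in> cyl n z u \<longleftrightarrow>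
          x \<in> {x. \<forall>k\<le>n. fst (x k) = z k \<and> ereal (v k) < snd (x k)}"
      proof (rule AE_mp, intro AE_I2 impI)
        fix x :: "nat \<Rightarrow> 's \<times> ereal" assume pos: "\<forall>k. 0 < snd (x k)"
        have "(u k = -\<infinity> \<or> u k < snd (x k)) \<longleftrightarrow> ereal (v k) < snd (x k)" if "k \<le> n" for k
          using pos[rule_format, of k] False that
          by (cases "u k"; cases "snd (x k)") (auto simp: v_def max_def)
        then show "x \<in> cyl n z u \<longleftrightarrow>
          x \<in> {x. \<forall>k\<le>n. fst (x k) = z k \<and> ereal (v k) < snd (x k)}"
          by (auto simp: cyl_def)
      qed
      show "cyl n z u \<in> sets K" using K cyl_sets by (simp add: positive_holding_def)
      have "{x\<in>space seqM. \<forall>k\<in>{..n}. fst (x k) = z k \<and> ereal (v k) < snd (x k)} \<in> sets seqM"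
        by measurable
      then show "{x. \<forall>k\<le>n. fst (x k) = z k \<and> ereal (v k) < snd (x k)} \<in> sets K"
        using K by (simp add: positive_holding_def Ball_def)
    qed
    show ?thesis using red[OF L] red[OF L'] eq[of v n z] by (simp add: v_def)
  qed
  interpret L: prob_space L using L by (simp add: positive_holding_def)
  interpret L': prob_space L' using L' by (simp add: positive_holding_def)
  have sp: "space L = UNIV" "space L' = UNIV"
    using L L' sets_eq_imp_space_eq[of L seqM] sets_eq_imp_space_eq[of L' seqM]
    by (auto simp: positive_holding_def)
  show ?thesis
  proof (rule measure_eqI_generator_eq[of ?E UNIV _ _ "\<lambda>_. UNIV"])
    show "Int_stable ?E"
    proof (rule Int_stableI)
      have cc: "cyl n z u \<inter> cyl m z' u' \<in> ?E" for n m z z' u u'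
      proof (cases "\<forall>k. k \<le> n \<and> k \<le> m \<longrightarrow> z k = z' k")
        case True
        have "cyl n z u \<inter> cyl m z' u' = cyl (max n m) (\<lambda>k. if k \<le> n then z k else z' k)
          (\<lambda>k. if k \<le> n then (if k \<le> m then max (u k) (u' k) else u k) else u' k)" (is "_ = ?r")
        proof -
          have "x \<in> cyl n z u \<inter> cyl m z' u' \<longleftrightarrow> x \<in> ?r" for x
          proof -
            have *: "(max a b = -\<infinity> \<or> max a b < y) \<longleftrightarrow> (a = -\<infinity> \<or> a < y) \<and> (b = -\<infinity> \<or> b < y)"
              for a b y :: ereal
              by (cases a; cases b; cases y) (auto simp: max_def)
            have **: "max a b = -\<infinity> \<longleftrightarrow> a = -\<infinity> \<and> b = -\<infinity>" for a b :: ereal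
              by (auto simp: max_def)
            have "x \<in> cyl n z u \<inter> cyl m z' u' \<longleftrightarrow> (\<forall>k. (k \<le> n \<longrightarrow> fst (x k) = z k \<and> (u k = -\<infinity> \<or> u k < snd (x k)))
               \<and> (k \<le> m \<longrightarrow> fst (x k) = z' k \<and> (u' k = -\<infinity> \<or> u' k < snd (x k))))"
              by (auto simp: cyl_def)
            also have "\<dots> \<longleftrightarrow> x \<in> ?r"
              unfolding cyl_def mem_Collect_eq
            proof (intro all_cong1)
              fix k
              show "((k \<le> n \<longrightarrow> fst (x k) = z k \<and> (u k = -\<infinity> \<or> u k < snd (x k)))
               \<and> (k \<le> m \<longrightarrow> fst (x k) = z' k \<and> (u' k = -\<infinity> \<or> u' k < snd (x k)))) \<longleftrightarrow>
               (k \<le> max n m \<longrightarrow> fst (x k) = (if k \<le> n then z k else z' k) \<and>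
                ((if k \<le> n then if k \<le> m then max (u k) (u' k) else u k else u' k) = - \<infinity> \<or>
                 (if k \<le> n then if k \<le> m then max (u k) (u' k) else u k else u' k) < snd (x k)))"
                using True by (cases "k \<le> n"; cases "k \<le> m") (auto simp: * ** le_max_iff_disj)
            qed
            finally show ?thesis .
          qed
          then show ?thesis by blast
        qed
        then show ?thesis by blast
      next
        case False
        then have "cyl n z u \<inter> cyl m z' u' = {}" by (auto simp: cyl_def)
        then show ?thesis by simp
      qed
      fix a b assume "a \<in> ?E" "b \<in> ?E"
      then consider "a = UNIV" | "b = UNIV" | "a = {}" | "b = {}"
        | n z u m z' u' where "a = cyl n z u" "b = cyl m z' u'" by blast
      then show "a \<inter> b \<in> ?E"
      proof cases
        case 5
        then show ?thesis using cc by blast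
      qed (use \<open>a \<in> ?E\<close> \<open>b \<in> ?E\<close> in simp_all)
    qed
    fix X assume "X \<in> ?E"
    then consider "X = UNIV" | "X = {}" | n z u where "X = cyl n z u" by blast
    then show "emeasure L X = emeasure L' X"
      by cases (use eqcyl L.emeasure_space_1 L'.emeasure_space_1 sp in simp_all)
  next
    show "sets L = sigma_sets UNIV ?E" "sets L' = sigma_sets UNIV ?E"
      using L L' gen by (simp_all add: positive_holding_def)
    show "emeasure L UNIV \<noteq> \<infinity>" for i :: nat using L.emeasure_space_1 sp by simp
  qed auto
qed

text \<open>The defining formula of a chain started in \<open>i\<close>, as a property of a law on sequences: in this
  form it can be compared with the law after the first jump.\<close>

definition sojourn_law :: "real^'s^'s \<Rightarrow> 's \<Rightarrow> (nat \<Rightarrow> 's \<times> ereal) measure \<Rightarrow> bool" where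
  "sojourn_law A i L \<longleftrightarrow> positive_holding L \<and> (\<forall>n z u. (\<forall>k. 0 \<le> u k) \<longrightarrow>
     measure L {x. \<forall>k\<le>n. fst (x k) = z k \<and> ereal (u k) < snd (x k)} =
       (if z 0 = i then 1 else 0) * (\<Prod>k<n. jump_prob A (z k) (z (Suc k)))
         * (\<Prod>k\<le>n. exp (A $ z k $ z k * u k)))"

lemma ctmc_sojourn_law:
  fixes A :: "real^'s^'s"
  assumes "ctmc A i M \<phi>"
  obtains Z H where "\<And>n. Z n \<in> measurable M (count_space UNIV)" "\<And>n. H n \<in> borel_measurable M"
    "\<And>\<omega> n. \<omega> \<in> space M \<Longrightarrow> 0 < H n \<omega>"
    "\<And>\<omega> t. \<omega> \<in> space M \<Longrightarrow> 0 \<le> t \<Longrightarrow> \<exists>n. (\<Sum>k<n. H k \<omega>) \<le> ereal t \<and> ereal t < (\<Sum>k\<le>n. H k \<omega>) \<and>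
                     \<phi> t \<omega> = Z n \<omega>"
    "(\<lambda>\<omega> k. (Z k \<omega>, H k \<omega>)) \<in> measurable M seqM"
    "sojourn_law A i (distr M seqM (\<lambda>\<omega> k. (Z k \<omega>, H k \<omega>)))"
proof -
  from assms obtain Z H where
    [measurable]: "\<And>n. Z n \<in> measurable M (count_space UNIV)" "\<And>n. H n \<in> borel_measurable M"
    and pos: "\<And>\<omega> n. \<omega> \<in> space M \<Longrightarrow> 0 < H n \<omega>"
    and path: "\<And>\<omega> t. \<omega> \<in> space M \<Longrightarrow> 0 \<le> t \<Longrightarrow> \<exists>n. (\<Sum>k<n. H k \<omega>) \<le> ereal t \<and> ereal t < (\<Sum>k\<le>n. H k \<omega>) \<and>
                     \<phi> t \<omega> = Z n \<omega>"
    and law: "\<And>n z u. (\<forall>k. 0 \<le> u k) \<Longrightarrow>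
           measure M {\<omega> \<in> space M. \<forall>k\<le>n. Z k \<omega> = z k \<and> ereal (u k) < H k \<omega>} =
             (if z 0 = i then 1 else 0)
             * (\<Prod>k<n. jump_prob A (z k) (z (Suc k)))
             * (\<Prod>k\<le>n. exp (A $ z k $ z k * u k))"
    and ps: "prob_space M"
    unfolding ctmc_def by blast
  have X[measurable]: "(\<lambda>\<omega> k. (Z k \<omega>, H k \<omega>)) \<in> measurable M seqM"
    unfolding seqM_def by (intro measurable_PiM_single') (auto simp: space_pair_measure)
  have "sojourn_law A i (distr M seqM (\<lambda>\<omega> k. (Z k \<omega>, H k \<omega>)))"
    unfolding sojourn_law_def positive_holding_def
  proof (intro conjI allI impI)
    show "prob_space (distr M seqM (\<lambda>\<omega> k. (Z k \<omega>, H k \<omega>)))"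
      using prob_space.prob_space_distr[OF ps X] .
    show "AE x in distr M seqM (\<lambda>\<omega> k. (Z k \<omega>, H k \<omega>)). \<forall>k. 0 < snd (x k)"
    proof (subst AE_distr_iff[OF X])
      have "{x\<in>space seqM. \<forall>k. 0 < snd (x k)} \<in> sets (seqM :: (nat \<Rightarrow> 's \<times> ereal) measure)"
        by measurable
      then show "{x\<in>space seqM. \<forall>k. 0 < snd (x k)} \<in> sets (seqM :: (nat \<Rightarrow> 's \<times> ereal) measure)" .
    qed (use pos in auto)
    fix n and z :: "nat \<Rightarrow> 's" and u :: "nat \<Rightarrow> real" assume u: "\<forall>k. 0 \<le> u k"
    have "{x\<in>space seqM. \<forall>k\<in>{..n}. fst (x k) = z k \<and> ereal (u k) < snd (x k)} \<in> sets seqM"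
      by measurable
    then have s: "{x. \<forall>k\<le>n. fst (x k) = z k \<and> ereal (u k) < snd (x k)} \<in> sets seqM"
      by (simp add: Ball_def)
    have "measure (distr M seqM (\<lambda>\<omega> k. (Z k \<omega>, H k \<omega>))) {x. \<forall>k\<le>n. fst (x k) = z k \<and> ereal (u k) < snd (x k)}
      = measure M {\<omega> \<in> space M. \<forall>k\<le>n. Z k \<omega> = z k \<and> ereal (u k) < H k \<omega>}"
      using s by (subst measure_distr[OF X]) (auto intro!: arg_cong[where f = "measure M"])
    then show "measure (distr M seqM (\<lambda>\<omega> k. (Z k \<omega>, H k \<omega>))) {x. \<forall>k\<le>n. fst (x k) = z k \<and> ereal (u k) < snd (x k)} =
       (if z 0 = i then 1 else 0) * (\<Prod>k<n. jump_prob A (z k) (z (Suc k)))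
         * (\<Prod>k\<le>n. exp (A $ z k $ z k * u k))" using law[OF u] by simp
  qed simp
  then show ?thesis using that[of Z H] pos path X by simp
qed

lemma jump_prob_nonneg: "generator A \<Longrightarrow> 0 \<le> jump_prob A i j"
proof -
  assume g: "generator A"
  have "(\<Sum>j\<in>UNIV. A $ i $ j) = 0" using g by (simp add: generator_def)
  then have "A $ i $ i = - (\<Sum>j\<in>UNIV - {i}. A $ i $ j)" by (subst (asm) sum.remove[of _ i]) auto
  moreover have "0 \<le> (\<Sum>j\<in>UNIV - {i}. A $ i $ j)" using g by (intro sum_nonneg) (auto simp: generator_def)
  ultimately show ?thesis using g by (auto simp: jump_prob_def generator_def divide_nonneg_neg)
qed

lemma generator_diag: "generator A \<Longrightarrow> (\<Sum>j\<in>UNIV - {i}. A $ i $ j) = - A $ i $ i"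
  unfolding generator_def by (drule conjunct2, drule spec[of _ i], subst (asm) sum.remove[of _ i]) auto

lemma generator_diag_nonpos: "generator A \<Longrightarrow> A $ i $ i \<le> 0"
  using generator_diag[of A i] sum_nonneg[of "UNIV - {i}" "\<lambda>j. A $ i $ j"]
  by (auto simp: generator_def)

text \<open>This holds for an absorbing state as well, where \<open>jump_prob\<close> is a convention and both sides
  vanish.\<close>

lemma jump_prob_exit:
  "generator A \<Longrightarrow> - A $ i $ i * jump_prob A i k = (if k = i then 0 else A $ i $ k)"
proof -
  assume g: "generator A"
  show ?thesis
  proof (cases "A $ i $ i = 0")
    case True
    have "A $ i $ k = 0" if "k \<noteq> i"
    proof -
      have "(\<Sum>j\<in>UNIV - {i}. A $ i $ j) = 0" using generator_diag[OF g, of i] True by simp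
      then show ?thesis
        using g that by (subst (asm) sum_nonneg_eq_0_iff) (auto simp: generator_def)
    qed
    then show ?thesis using True by (auto simp: jump_prob_def)
  qed (auto simp: jump_prob_def)
qed

lemma jump_prob_sum: "generator A \<Longrightarrow> (\<Sum>k\<in>UNIV. jump_prob A i k) = 1"
proof (cases "A $ i $ i = 0")
  case True then show ?thesis by (simp add: jump_prob_def)
next
  case False
  assume g: "generator A"
  have "- A $ i $ i * (\<Sum>k\<in>UNIV. jump_prob A i k) = (\<Sum>k\<in>UNIV. if k = i then 0 else A $ i $ k)"
    by (simp only: sum_distrib_left jump_prob_exit[OF g])
  also have "\<dots> = (\<Sum>j\<in>UNIV - {i}. A $ i $ j)" by (subst sum.remove[of _ i]) auto
  also have "\<dots> = - A $ i $ i" by (rule generator_diag[OF g])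
  finally show ?thesis using False by simp
qed

definition jump_pmf :: "real^'s^'s \<Rightarrow> 's \<Rightarrow> 's pmf" where
  "jump_pmf A i = embed_pmf (jump_prob A i)"

lemma pmf_jump_pmf: "generator A \<Longrightarrow> pmf (jump_pmf A i) k = jump_prob A i k"
  unfolding jump_pmf_def
  by (intro pmf_embed_pmf jump_prob_nonneg, assumption)
    (simp add: nn_integral_count_space_finite sum_ennreal jump_prob_nonneg jump_prob_sum)

context
  fixes A :: "real^'s^'s" and L :: "'s \<Rightarrow> (nat \<Rightarrow> 's \<times> ereal) measure"
  assumes gen: "generator A" and law: "\<And>i. sojourn_law A i (L i)"
begin

lemma L_facts: "prob_space (L i)" "sets (L i) = sets seqM" "space (L i) = UNIV"
    "AE x in L i. \<forall>k. 0 < snd (x k)"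
proof -
  show "prob_space (L i)" "sets (L i) = sets seqM" "AE x in L i. \<forall>k. 0 < snd (x k)"
    using law[of i] by (auto simp: sojourn_law_def positive_holding_def)
  then show "space (L i) = UNIV" using sets_eq_imp_space_eq[of "L i" seqM] by simp
qed

lemma measurable_L: "f \<in> measurable seqM N \<Longrightarrow> f \<in> measurable (L i) N"
  using measurable_cong_sets[OF L_facts(2)[of i] refl] by blast

lemma cyl_sets: "{x :: nat \<Rightarrow> 's \<times> ereal. \<forall>k\<le>n. fst (x k) = z k \<and> ereal (u k) < snd (x k)} \<in> sets seqM"
proof -
  have "{x\<in>space seqM. \<forall>k\<in>{..n}. fst (x k :: 's \<times> ereal) = z k \<and> ereal (u k) < snd (x k)} \<in> sets seqM"
    by measurable
  then show ?thesis by (simp add: Ball_def)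
qed

lemma emeasure_cyl:
  assumes "\<And>k. 0 \<le> u k"
  shows "emeasure (L i) {x. \<forall>k\<le>n. fst (x k) = z k \<and> ereal (u k) < snd (x k)} =
      ennreal ((if z 0 = i then 1 else 0) * (\<Prod>k<n. jump_prob A (z k) (z (Suc k)))
         * (\<Prod>k\<le>n. exp (A $ z k $ z k * u k)))"
proof -
  interpret prob_space "L i" by (rule L_facts)
  show ?thesis using law[of i] assms by (simp add: emeasure_eq_measure sojourn_law_def)
qed

lemma initial_state: "AE x in L i. fst (x 0) = i"
proof -
  interpret prob_space "L i" by (rule L_facts)
  have e: "{x. \<forall>k\<le>0::nat. fst (x k) = i \<and> ereal 0 < snd (x k)} = {x. fst (x 0) = i \<and> 0 < snd (x 0)}"
    by (auto simp: zero_ereal_def)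
  have "emeasure (L i) {x. fst (x 0) = i \<and> 0 < snd (x 0)} = 1"
    using emeasure_cyl[of "\<lambda>_. 0" i 0 "\<lambda>_. i"] unfolding e by simp
  moreover have "{x. fst (x 0) = i \<and> 0 < snd (x 0)} \<in> sets (L i)"
    using cyl_sets[of 0 "\<lambda>_. i" "\<lambda>_. 0"] unfolding e by (simp add: L_facts)
  ultimately have "AE x in L i. fst (x 0) = i \<and> 0 < snd (x 0)"
    by (subst AE_iff_emeasure_eq_1) (auto simp: L_facts pred_def)
  then show ?thesis by (rule AE_mp) auto
qed

lemma first_sojourn_tail:
  assumes "0 \<le> u"
  shows "emeasure (L i) {x. ereal u < snd (x 0)} = ennreal (exp (A $ i $ i * u))"
proof -
  have "emeasure (L i) {x. ereal u < snd (x 0)}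
      = emeasure (L i) {x. \<forall>k\<le>0::nat. fst (x k) = i \<and> ereal u < snd (x k)}"
  proof (rule emeasure_eq_AE)
    show "AE x in L i. (x \<in> {x. ereal u < snd (x 0)}) = (x \<in> {x. \<forall>k\<le>0::nat. fst (x k) = i \<and> ereal u < snd (x k)})"
      using initial_state[of i] by (rule AE_mp) auto
    have "{x\<in>space seqM. ereal u < snd (x 0 :: 's \<times> ereal)} \<in> sets seqM" by measurable
    then show "{x. ereal u < snd (x 0)} \<in> sets (L i)" by (simp add: L_facts)
    show "{x. \<forall>k\<le>0::nat. fst (x k) = i \<and> ereal u < snd (x k)} \<in> sets (L i)"
      using cyl_sets[of 0 "\<lambda>_. i" "\<lambda>_. u"] by (simp add: L_facts)
  qed
  also have "\<dots> = ennreal (exp (A $ i $ i * u))"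
    using emeasure_cyl[of "\<lambda>_. u" i 0 "\<lambda>_. i"] assms by simp
  finally show ?thesis .
qed

text \<open>The first sojourn is exponential.  When \<open>i\<close> is absorbing the density vanishes and the sojourn is
  infinite, which is why \<open>f \<infinity> = 0\<close> is assumed.\<close>

lemma first_sojourn_integral:
  assumes f[measurable]: "f \<in> borel_measurable (borel :: ereal measure)"
    and finf: "f \<infinity> = 0"
  shows "(\<integral>\<^sup>+x. f (snd (x 0)) \<partial>L i) =
    (\<integral>\<^sup>+t. ennreal (- A $ i $ i * exp (A $ i $ i * t)) * f (ereal t) * indicator {0..} t \<partial>lborel)"
proof -
  interpret prob_space "L i" by (rule L_facts)
  have [measurable]: "(\<lambda>x. snd (x n)) \<in> borel_measurable (L i)" for n
    by (rule measurable_L) simp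
  show ?thesis
  proof (cases "A $ i $ i = 0")
    case True
    have "AE x in L i. ereal (real n) < snd (x 0)" for n
    proof -
      have "emeasure (L i) {x. ereal (real n) < snd (x 0)} = 1" using first_sojourn_tail[of "real n" i] True by simp
      moreover have "{x \<in> space (L i). ereal (real n) < snd (x 0)} \<in> sets (L i)" by measurable
      ultimately show ?thesis by (subst AE_iff_emeasure_eq_1) (auto simp: L_facts)
    qed
    then have "AE x in L i. \<forall>n::nat. ereal (real n) < snd (x 0)" by (subst AE_all_countable) auto
    then have "AE x in L i. f (snd (x 0)) = 0"
    proof (rule AE_mp, intro AE_I2 impI)
      fix x :: "nat \<Rightarrow> 's \<times> ereal" assume n: "\<forall>n::nat. ereal (real n) < snd (x 0)"
      have "snd (x 0) = \<infinity>"
      proof (cases "snd (x 0)")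
        case (real r)
        then show ?thesis using n reals_Archimedean2[of r] by (metis less_ereal.simps(1) not_less_iff_gr_or_eq)
      qed (use n in auto)
      then show "f (snd (x 0)) = 0" using finf by simp
    qed
    then have "(\<integral>\<^sup>+x. f (snd (x 0)) \<partial>L i) = 0" by (subst nn_integral_0_iff_AE) auto
    then show ?thesis using True by simp
  next
    case False
    define a where "a = - A $ i $ i"
    have a: "0 < a" using False generator_diag_nonpos[OF gen, of i] by (simp add: a_def)
    have tail: "prob {x. ereal u < snd (x 0)} = exp (- a * u)" if "0 \<le> u" for u
      using first_sojourn_tail[OF that, of i] by (simp add: a_def emeasure_eq_measure)
    have fin: "AE x in L i. snd (x 0) \<noteq> \<infinity>"
    proof -
      have le: "prob {x\<in>space (L i). snd (x 0) = \<infinity>} \<le> exp (- a * real n)" for n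
      proof -
        have "prob {x\<in>space (L i). snd (x 0) = \<infinity>} \<le> prob {x\<in>space (L i). ereal (real n) < snd (x 0)}"
          by (intro finite_measure_mono) auto
        then show ?thesis using tail[of "real n"] by (simp add: L_facts)
      qed
      have "(\<lambda>n. exp (- a * real n)) \<longlonglongrightarrow> 0"
      proof -
        have "(\<lambda>n. (exp (-a)) ^ n) \<longlonglongrightarrow> 0" using a by (intro LIMSEQ_realpow_zero) auto
        then show ?thesis by (simp add: exp_of_nat_mult[symmetric] mult.commute)
      qed
      then have "prob {x\<in>space (L i). snd (x 0) = \<infinity>} \<le> 0"
        by (rule LIMSEQ_le_const) (use le in blast)
      then have "prob {x\<in>space (L i). snd (x 0) = \<infinity>} = 0" by (simp add: measure_le_0_iff)
      then show ?thesis by (subst AE_iff_measurable[OF _ refl]) (auto simp: emeasure_eq_measure)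
    qed
    have D: "distributed (L i) lborel (\<lambda>x. real_of_ereal (snd (x 0))) (exponential_density a)"
    proof (subst exponential_distributed_iff[OF a], intro conjI allI impI)
      fix t :: real assume t: "0 \<le> t"
      have "prob {x\<in>space (L i). real_of_ereal (snd (x 0)) \<le> t}
          = prob {x\<in>space (L i). \<not> ereal t < snd (x 0)}"
      proof (rule measure_eq_AE)
        have "AE x in L i. snd (x 0) \<noteq> \<infinity> \<and> 0 < snd (x 0)"
          using fin L_facts(4)[of i] by eventually_elim auto
        then show "AE x in L i. x \<in> {x \<in> space (L i). real_of_ereal (snd (x 0)) \<le> t} \<longleftrightarrow>
          x \<in> {x \<in> space (L i). \<not> ereal t < snd (x 0)}"
        proof (rule AE_mp, intro AE_I2 impI)
          fix x :: "nat \<Rightarrow> 's \<times> ereal" assume "snd (x 0) \<noteq> \<infinity> \<and> 0 < snd (x 0)"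
          then show "x \<in> {x \<in> space (L i). real_of_ereal (snd (x 0)) \<le> t} \<longleftrightarrow>
          x \<in> {x \<in> space (L i). \<not> ereal t < snd (x 0)}"
            by (cases "snd (x 0)") (auto simp: L_facts)
        qed
      qed measurable
      also have "\<dots> = 1 - prob {x\<in>space (L i). ereal t < snd (x 0)}"
        by (rule prob_neg) measurable
      finally show "prob {x\<in>space (L i). real_of_ereal (snd (x 0)) \<le> t} = 1 - exp (- t * a)"
        using tail[OF t] by (simp add: L_facts mult.commute)
    qed measurable
    have "(\<integral>\<^sup>+x. f (snd (x 0)) \<partial>L i) = (\<integral>\<^sup>+x. f (ereal (real_of_ereal (snd (x 0)))) \<partial>L i)"
    proof (rule nn_integral_cong_AE)
      have "AE x in L i. snd (x 0) \<noteq> \<infinity> \<and> 0 < snd (x 0)"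
        using fin L_facts(4)[of i] by eventually_elim auto
      then show "AE x in L i. f (snd (x 0)) = f (ereal (real_of_ereal (snd (x 0))))"
      proof (rule AE_mp, intro AE_I2 impI)
        fix x :: "nat \<Rightarrow> 's \<times> ereal" assume "snd (x 0) \<noteq> \<infinity> \<and> 0 < snd (x 0)"
        then show "f (snd (x 0)) = f (ereal (real_of_ereal (snd (x 0))))" by (cases "snd (x 0)") auto
      qed
    qed
    also have "\<dots> = (\<integral>\<^sup>+t. exponential_density a t * f (ereal t) \<partial>lborel)"
      by (rule distributed_nn_integral[OF D, symmetric]) measurable
    also have "\<dots> = (\<integral>\<^sup>+t. ennreal (- A $ i $ i * exp (A $ i $ i * t)) * f (ereal t) * indicator {0..} t \<partial>lborel)"
      by (intro nn_integral_cong) (auto simp: exponential_density_def a_def indicator_def mult.commute)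
    finally show ?thesis .
  qed
qed

lemma measurable_case_nat_seqM [measurable]:
  "(\<lambda>(h, x). case_nat (i, h) x) \<in> measurable (borel \<Otimes>\<^sub>M seqM) (seqM :: (nat \<Rightarrow> 's \<times> ereal) measure)"
proof -
  have "(\<lambda>p. case_nat (i, fst p) (snd p)) \<in> measurable (borel \<Otimes>\<^sub>M seqM) (seqM :: (nat \<Rightarrow> 's \<times> ereal) measure)"
    unfolding seqM_def
  proof (rule measurable_PiM_single', goal_cases)
    case (1 n)
    show ?case
      by (cases n) (auto intro!: measurable_compose[OF measurable_snd measurable_component_singleton])
  qed (auto simp: space_pair_measure)
  then show ?thesis by (simp add: case_prod_beta')
qed

text \<open>The Markov property at the first jump: after the first sojourn the sequence starts afresh
  from the state that is jumped to.  Both sides agree on the cylinders, and these determine a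
  law.\<close>

lemma markov_first_jump:
  assumes S: "S \<in> sets seqM"
  shows "emeasure (L i) S = (\<integral>\<^sup>+x. (\<Sum>k\<in>UNIV. ennreal (jump_prob A i k)
      * emeasure (L k) {y. case_nat (i, snd (x 0)) y \<in> S}) \<partial>L i)"
proof -
  \<comment> \<open>\<open>R\<close> is the law in which the first sojourn and the remaining sequence \<open>nxt\<close> are independent\<close>
  define \<nu> where "\<nu> = distr (L i) borel (\<lambda>x. snd (x 0))"
  define nxt where "nxt = measure_pmf (jump_pmf A i) \<bind> L"
  have m0[measurable]: "(\<lambda>x. snd (x n)) \<in> borel_measurable (L k)" for k n
    by (rule measurable_L) simp
  have kern: "L \<in> measure_pmf (jump_pmf A i) \<rightarrow>\<^sub>M subprob_algebra seqM"
    using L_facts by (auto simp: measurable_pmf_measure1 space_subprob_algebra intro: prob_space_imp_subprob_space)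
  have nxtE: "emeasure nxt T = (\<Sum>k\<in>UNIV. ennreal (jump_prob A i k) * emeasure (L k) T)"
    if "T \<in> sets seqM" for T
    unfolding nxt_def using that
    by (subst emeasure_bind[OF _ kern])
      (simp_all add: nn_integral_measure_pmf nn_integral_count_space_finite pmf_jump_pmf[OF gen])
  have sets_nxt[simp]: "sets nxt = sets seqM"
    unfolding nxt_def by (rule sets_bind[OF sets_kernel[OF kern]]) simp_all
  have "emeasure nxt UNIV = (\<Sum>k\<in>UNIV. ennreal (jump_prob A i k) * emeasure (L k) (space (L k)))"
    using nxtE[of UNIV] sets.top[of seqM] by (simp add: L_facts)
  also have "\<dots> = 1"
    by (simp add: prob_space.emeasure_space_1[OF L_facts(1)] sum_ennreal jump_prob_nonneg[OF gen] jump_prob_sum[OF gen])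
  finally have nxt1: "emeasure nxt UNIV = 1" .
  have space_nxt[simp]: "space nxt = UNIV" using sets_eq_imp_space_eq[OF sets_nxt] by simp
  interpret N: prob_space "nxt" by standard (simp add: nxt1)
  interpret Li: prob_space "L i" by (rule L_facts)
  interpret V: prob_space \<nu> unfolding \<nu>_def by (rule Li.prob_space_distr) simp
  interpret P: pair_prob_space \<nu> "nxt" ..
  have setsV[simp]: "sets \<nu> = sets borel" and spV[simp]: "space \<nu> = UNIV" by (auto simp: \<nu>_def)
  have setsP: "sets (\<nu> \<Otimes>\<^sub>M nxt) = sets (borel \<Otimes>\<^sub>M seqM)" by (intro sets_pair_measure_cong) auto
  have cm: "(\<lambda>(h, x). case_nat (i, h) x) \<in> measurable (\<nu> \<Otimes>\<^sub>M nxt) seqM"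
    using measurable_case_nat_seqM measurable_cong_sets[OF setsP refl] by blast
  define R where "R = distr (\<nu> \<Otimes>\<^sub>M nxt) seqM (\<lambda>(h, x). case_nat (i, h) x)"
  have RE: "emeasure R T = (\<integral>\<^sup>+h. emeasure nxt {y. case_nat (i, h) y \<in> T} \<partial>\<nu>)"
    if T: "T \<in> sets seqM" for T
  proof -
    have "emeasure R T = emeasure (\<nu> \<Otimes>\<^sub>M nxt) ((\<lambda>(h, x). case_nat (i, h) x) -` T \<inter> space (\<nu> \<Otimes>\<^sub>M nxt))"
      unfolding R_def by (rule emeasure_distr[OF cm T])
    also have "\<dots> = (\<integral>\<^sup>+h. emeasure nxt (Pair h -` ((\<lambda>(h, x). case_nat (i, h) x) -` T \<inter> space (\<nu> \<Otimes>\<^sub>M nxt))) \<partial>\<nu>)"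
      using measurable_sets[OF cm T] by (rule N.emeasure_pair_measure_alt)
    also have "\<dots> = (\<integral>\<^sup>+h. emeasure nxt {y. case_nat (i, h) y \<in> T} \<partial>\<nu>)"
      by (simp add: space_pair_measure vimage_def)
    finally show ?thesis .
  qed
  have "AE h in \<nu>. 0 < h" unfolding \<nu>_def by (subst AE_distr_iff) (use L_facts(4)[of i] in auto)
  moreover have "AE x in nxt. \<forall>k. 0 < snd (x k)"
    unfolding nxt_def
  proof (subst AE_bind[OF kern])
    have "{x\<in>space seqM. \<forall>k. 0 < snd (x k :: 's \<times> ereal)} \<in> sets seqM" by measurable
    then show "Measurable.pred seqM (\<lambda>x :: nat \<Rightarrow> 's \<times> ereal. \<forall>k. 0 < snd (x k))" by (simp add: pred_def)
  qed (use L_facts(4) in auto)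
  ultimately have AEp: "AE p in \<nu> \<Otimes>\<^sub>M nxt. 0 < fst p \<and> (\<forall>k. 0 < snd (snd p k))"
  proof -
    assume a: "AE h in \<nu>. 0 < h" "AE x in nxt. \<forall>k. 0 < snd (x k)"
    have [measurable]: "(\<lambda>p. snd (snd p k)) \<in> borel_measurable
        ((borel :: ereal measure) \<Otimes>\<^sub>M (seqM :: (nat \<Rightarrow> 's \<times> ereal) measure))" for k
      by (rule measurable_compose[OF measurable_snd measurable_snd_seqM])
    have m: "{p\<in>space ((borel :: ereal measure) \<Otimes>\<^sub>M (seqM :: (nat \<Rightarrow> 's \<times> ereal) measure)).
        0 < fst p \<and> (\<forall>k. 0 < snd (snd p k))}
        \<in> sets ((borel :: ereal measure) \<Otimes>\<^sub>M (seqM :: (nat \<Rightarrow> 's \<times> ereal) measure))" by measurable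
    show ?thesis
    proof (rule P.AE_pair_measure)
      show "{p \<in> space (\<nu> \<Otimes>\<^sub>M nxt). 0 < fst p \<and> (\<forall>k. 0 < snd (snd p k))} \<in> sets (\<nu> \<Otimes>\<^sub>M nxt)"
        using m by (simp add: setsP space_pair_measure)
      show "AE h in \<nu>. AE y in nxt. 0 < fst (h, y) \<and> (\<forall>k. 0 < snd (snd (h, y) k))"
        using a(1) by eventually_elim (use a(2) in simp)
    qed
  qed
  have RP: "positive_holding R"
    unfolding positive_holding_def
  proof (intro conjI)
    show "prob_space R" unfolding R_def by (rule P.prob_space_distr[OF cm])
    show "sets R = sets seqM" by (simp add: R_def)
    have "{x\<in>space seqM. \<forall>k. 0 < snd (x k :: 's \<times> ereal)} \<in> sets seqM" by measurable
    then show "AE x in R. \<forall>k. 0 < snd (x k)"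
      unfolding R_def
    proof (subst AE_distr_iff[OF cm])
      show "AE p in \<nu> \<Otimes>\<^sub>M nxt. \<forall>k. 0 < snd ((case p of (h, x) \<Rightarrow> case_nat (i, h) x) k)"
        using AEp by eventually_elim (auto split: nat.split)
    qed simp_all
  qed
  have "L i = R"
  proof (rule seqM_eqI[OF _ RP])
    show "positive_holding (L i)" using law by (simp add: sojourn_law_def)
    fix n and z :: "nat \<Rightarrow> 's" and u :: "nat \<Rightarrow> real" assume u: "\<And>k. 0 \<le> u k"
    let ?C = "\<lambda>n z u. {x :: nat \<Rightarrow> 's \<times> ereal. \<forall>k\<le>n. fst (x k) = z k \<and> ereal (u k) < snd (x k)}"
    let ?T = "case n of 0 \<Rightarrow> UNIV | Suc m \<Rightarrow> ?C m (z \<circ> Suc) (u \<circ> Suc)"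
    have pre: "{y. case_nat (i, h) y \<in> ?C n z u} = (if z 0 = i \<and> ereal (u 0) < h then ?T else {})" for h
    proof (cases n)
      case (Suc m)
      have *: "(\<forall>k\<le>Suc m. Q k) \<longleftrightarrow> Q 0 \<and> (\<forall>k\<le>m. Q (Suc k))" for Q by (metis Suc_le_mono le0 not0_implies_Suc)
      show ?thesis by (auto simp: Suc *)
    qed auto
    have nT: "emeasure nxt ?T = ennreal ((\<Prod>k<n. jump_prob A (if k = 0 then i else z k) (z (Suc k))) * (\<Prod>k=1..n. exp (A $ z k $ z k * u k)))"
    proof (cases n)
      case 0 then show ?thesis by (simp add: nxt1)
    next
      case (Suc m)
      have "emeasure nxt ?T = (\<Sum>k\<in>UNIV. ennreal (jump_prob A i k) * emeasure (L k) (?C m (z \<circ> Suc) (u \<circ> Suc)))"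
        using nxtE[OF cyl_sets[of m "z \<circ> Suc" "u \<circ> Suc"]] by (simp add: Suc)
      also have "\<dots> = (\<Sum>k\<in>UNIV. if k = z (Suc 0) then ennreal (jump_prob A i k * ((\<Prod>k<m. jump_prob A (z (Suc k)) (z (Suc (Suc k))))
         * (\<Prod>k\<le>m. exp (A $ z (Suc k) $ z (Suc k) * u (Suc k))))) else 0)"
        using emeasure_cyl[of "u \<circ> Suc" _ m "z \<circ> Suc"] u jump_prob_nonneg[OF gen]
        by (intro sum.cong) (auto simp: ennreal_mult' prod_nonneg)
      also have "\<dots> = ennreal (jump_prob A i (z (Suc 0)) * ((\<Prod>k<m. jump_prob A (z (Suc k)) (z (Suc (Suc k))))
         * (\<Prod>k\<le>m. exp (A $ z (Suc k) $ z (Suc k) * u (Suc k)))))" by simp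
      finally have e: "emeasure nxt ?T = ennreal (jump_prob A i (z (Suc 0)) * ((\<Prod>k<m. jump_prob A (z (Suc k)) (z (Suc (Suc k))))
         * (\<Prod>k\<le>m. exp (A $ z (Suc k) $ z (Suc k) * u (Suc k)))))" .
      have p1: "(\<Prod>k<n. jump_prob A (if k = 0 then i else z k) (z (Suc k)))
          = jump_prob A i (z (Suc 0)) * (\<Prod>k<m. jump_prob A (z (Suc k)) (z (Suc (Suc k))))"
        unfolding Suc by (subst prod.lessThan_Suc_shift) simp
      have p2: "(\<Prod>k=1..n. exp (A $ z k $ z k * u k)) = (\<Prod>k\<le>m. exp (A $ z (Suc k) $ z (Suc k) * u (Suc k)))"
        unfolding Suc One_nat_def prod.shift_bounds_cl_Suc_ivl atMost_atLeast0 ..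
      show ?thesis unfolding e p1 p2 by (simp only: mult.assoc)
    qed
    have "emeasure R (?C n z u) = (\<integral>\<^sup>+h. emeasure nxt {y. case_nat (i, h) y \<in> ?C n z u} \<partial>\<nu>)"
      by (rule RE[OF cyl_sets])
    also have "\<dots> = (\<integral>\<^sup>+h. (if z 0 = i then emeasure nxt ?T else 0) * indicator {ereal (u 0)<..} h \<partial>\<nu>)"
      unfolding pre by (intro nn_integral_cong) (auto simp: indicator_def)
    also have "\<dots> = (if z 0 = i then emeasure nxt ?T else 0) * emeasure \<nu> {ereal (u 0)<..}"
      by (subst nn_integral_cmult_indicator) auto
    also have "emeasure \<nu> {ereal (u 0)<..} = ennreal (exp (A $ i $ i * u 0))"
      unfolding \<nu>_def by (subst emeasure_distr)
        (use first_sojourn_tail[OF u[of 0], of i] in \<open>auto simp: vimage_def L_facts\<close>)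
    also have "(if z 0 = i then emeasure nxt ?T else 0) * ennreal (exp (A $ i $ i * u 0))
       = emeasure (L i) (?C n z u)"
    proof (cases "z 0 = i")
      case True
      have "(\<Prod>k\<le>n. exp (A $ z k $ z k * u k)) = exp (A $ i $ i * u 0) * (\<Prod>k=1..n. exp (A $ z k $ z k * u k))"
        using True by (simp add: atMost_atLeast0 prod.atLeast_Suc_atMost)
      moreover have "(\<Prod>k<n. jump_prob A (if k = 0 then i else z k) (z (Suc k)))
         = (\<Prod>k<n. jump_prob A (z k) (z (Suc k)))" using True by (intro prod.cong) auto
      ultimately show ?thesis
        unfolding emeasure_cyl[OF u] nT using True
        by (simp add: ennreal_mult'[symmetric] algebra_simps)
    qed (simp add: emeasure_cyl[OF u])
    finally show "emeasure (L i) (?C n z u) = emeasure R (?C n z u)" ..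
  qed
  then have "emeasure (L i) S = (\<integral>\<^sup>+h. emeasure nxt {y. case_nat (i, h) y \<in> S} \<partial>\<nu>)"
    using RE[OF S] by simp
  also have "\<dots> = (\<integral>\<^sup>+h. (\<Sum>k\<in>UNIV. ennreal (jump_prob A i k) * emeasure (L k) {y. case_nat (i, h) y \<in> S}) \<partial>\<nu>)"
  proof (intro nn_integral_cong nxtE)
    fix h :: ereal
    have "(\<lambda>y. (h, y)) \<in> measurable seqM (borel \<Otimes>\<^sub>M (seqM :: (nat \<Rightarrow> 's \<times> ereal) measure))" by measurable
    from measurable_sets[OF measurable_compose[OF this measurable_case_nat_seqM[of i]] S]
    show "{y. case_nat (i, h) y \<in> S} \<in> sets seqM" by (simp add: vimage_def)
  qed
  also have "\<dots> = (\<integral>\<^sup>+x. (\<Sum>k\<in>UNIV. ennreal (jump_prob A i k)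
      * emeasure (L k) {y. case_nat (i, snd (x 0)) y \<in> S}) \<partial>L i)"
  proof -
    have [measurable]: "(\<lambda>h. emeasure (L k) {y. case_nat (i, h) y \<in> S}) \<in> borel_measurable (borel :: ereal measure)" for k
    proof -
      interpret Lk: prob_space "L k" by (rule L_facts)
      have "{p \<in> space (borel \<Otimes>\<^sub>M L k). (case p of (h, x) \<Rightarrow> case_nat (i, h) x) \<in> S} \<in> sets (borel \<Otimes>\<^sub>M L k)"
      proof -
        have "sets ((borel :: ereal measure) \<Otimes>\<^sub>M L k) = sets (borel \<Otimes>\<^sub>M seqM)" by (intro sets_pair_measure_cong) (auto simp: L_facts)
        then show ?thesis using measurable_sets[OF measurable_case_nat_seqM[of i] S]
          by (simp add: vimage_def space_pair_measure L_facts(3))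
      qed
      from Lk.measurable_emeasure_Pair[OF this] show ?thesis
        by (simp add: space_pair_measure L_facts vimage_def)
    qed
    have "(\<lambda>h. \<Sum>k\<in>UNIV. ennreal (jump_prob A i k) * emeasure (L k) {y. case_nat (i, h) y \<in> S})
        \<in> borel_measurable (distr (L i) borel (\<lambda>x. snd (x 0)))" by measurable
    from nn_integral_distr[OF m0[of 0 i] this] show ?thesis by (simp only: \<nu>_def)
  qed
  finally show ?thesis .
qed

end

section \<open>The first return, read off the sequence of sojourns\<close>

text \<open>A path with sojourns \<open>x\<close> that starts at height \<open>y\<close> falls below zero for the first time during
  one of the first \<open>n\<close> sojourns, in phase \<open>j\<close>.  The recursion follows the first sojourn, which makes
  it suitable for the Markov property.\<close>

fun hit :: "real^'s \<Rightarrow> 's \<Rightarrow> nat \<Rightarrow> real \<Rightarrow> (nat \<Rightarrow> 's \<times> ereal) \<Rightarrow> bool" where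
  "hit r j 0 y x \<longleftrightarrow> False"
| "hit r j (Suc n) y x \<longleftrightarrow>
     (if r $ fst (x 0) < 0 \<and> ereal (y / - r $ fst (x 0)) < snd (x 0) then fst (x 0) = j
      else snd (x 0) \<noteq> \<infinity> \<and> hit r j n (y + r $ fst (x 0) * real_of_ereal (snd (x 0))) (\<lambda>k. x (Suc k)))"

lemma hit_mono: "hit r j n y x \<Longrightarrow> n \<le> m \<Longrightarrow> hit r j m y x"
proof (induction n arbitrary: m y x)
  case (Suc n)
  then show ?case by (cases m) (auto split: if_splits)
qed simp

definition height :: "real^'s \<Rightarrow> real \<Rightarrow> (nat \<Rightarrow> 's \<times> ereal) \<Rightarrow> nat \<Rightarrow> real" where
  "height r y x n = y + (\<Sum>k<n. r $ fst (x k) * real_of_ereal (snd (x k)))"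

definition crosses :: "real^'s \<Rightarrow> real \<Rightarrow> (nat \<Rightarrow> 's \<times> ereal) \<Rightarrow> nat \<Rightarrow> bool" where
  "crosses r y x n \<longleftrightarrow> r $ fst (x n) < 0 \<and> ereal (height r y x n / - r $ fst (x n)) < snd (x n)"

text \<open>Unfolding the recursion gives the description by the index of the sojourn, which is the one that
  can be compared with the path.\<close>

lemma hit_iff_crosses:
  "hit r j n y x \<longleftrightarrow>
    (\<exists>m<n. fst (x m) = j \<and> crosses r y x m \<and> (\<forall>k<m. snd (x k) \<noteq> \<infinity> \<and> \<not> crosses r y x k))"
proof (induction n arbitrary: y x)
  case (Suc n)
  let ?y = "y + r $ fst (x 0) * real_of_ereal (snd (x 0))" and ?x = "\<lambda>k. x (Suc k)"
  have pos: "height r y x (Suc k) = height r ?y ?x k" for k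
    unfolding height_def by (subst sum.lessThan_Suc_shift) (simp add: algebra_simps)
  have cr: "crosses r y x (Suc k) \<longleftrightarrow> crosses r ?y ?x k" for k
    unfolding crosses_def pos ..
  have c0: "crosses r y x 0 \<longleftrightarrow> r $ fst (x 0) < 0 \<and> ereal (y / - r $ fst (x 0)) < snd (x 0)"
    by (simp add: crosses_def height_def)
  have ex: "(\<exists>m<Suc n. Q m) \<longleftrightarrow> Q 0 \<or> (\<exists>m<n. Q (Suc m))" for Q
    by (auto simp: less_Suc_eq_0_disj)
  have all: "(\<forall>k<Suc m. Q k) \<longleftrightarrow> Q 0 \<and> (\<forall>k<m. Q (Suc k))" for Q m
    by (auto simp: less_Suc_eq_0_disj)
  show ?case
    unfolding ex all cr hit.simps c0[symmetric] Suc.IH by auto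
qed simp

context
  fixes r :: "real^'s" and x :: "nat \<Rightarrow> 's \<times> ereal" and p :: "real \<Rightarrow> 's"
  assumes pos: "\<And>k. 0 < snd (x k)"
    and path: "\<And>t. 0 \<le> t \<Longrightarrow> \<exists>n. (\<Sum>k<n. snd (x k)) \<le> ereal t \<and> ereal t < (\<Sum>k\<le>n. snd (x k)) \<and> p t = fst (x n)"
begin

text \<open>\<open>T n\<close> is the time of the \<open>n\<close>-th jump, \<open>R n\<close> its value as a real number, which is
  meaningful under \<open>fin n\<close>, and \<open>V n\<close> is the level at that time.\<close>

private abbreviation "T n \<equiv> (\<Sum>k<n. snd (x k))"
private abbreviation "R n \<equiv> (\<Sum>k<n. real_of_ereal (snd (x k)))"
private abbreviation "fin n \<equiv> (\<forall>k<n. snd (x k) \<noteq> \<infinity>)"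
private abbreviation "V n \<equiv> height r 0 x n"

private lemma sojourn_real: "snd (x k) \<noteq> \<infinity> \<Longrightarrow> snd (x k) = ereal (real_of_ereal (snd (x k)))"
  using pos[of k] by (cases "snd (x k)") auto

private lemma T_real: "fin n \<Longrightarrow> T n = ereal (R n)"
proof (induction n)
  case (Suc n)
  then show ?case using sojourn_real[of n] by (simp add: less_Suc_eq) (metis plus_ereal.simps(1))
qed (simp add: zero_ereal_def)

private lemma T_mono: "m \<le> n \<Longrightarrow> T m \<le> T n"
  by (rule sum_mono2) (use pos in \<open>auto intro: less_imp_le\<close>)

private lemma T_fin: "T n \<le> ereal t \<Longrightarrow> fin n"
proof (intro allI impI notI)
  fix k assume le: "T n \<le> ereal t" and k: "k < n" and inf: "snd (x k) = \<infinity>"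
  have "snd (x k) \<le> T n" using sum_mono2[of "{..<n}" "{k}" "\<lambda>k. snd (x k)"] k pos by (auto intro: less_imp_le)
  then show False using inf le by simp
qed

private lemma sojourn_at:
  assumes "0 \<le> t"
  obtains n where "T n \<le> ereal t" "ereal t < T (Suc n)" "p t = fst (x n)"
  using path[OF assms] by (auto simp: lessThan_Suc_atMost)

private lemma phase_eq:
  assumes "0 \<le> t" "T n \<le> ereal t" "ereal t < T (Suc n)"
  shows "p t = fst (x n)"
proof -
  obtain m where m: "T m \<le> ereal t" "ereal t < T (Suc m)" "p t = fst (x m)"
    using sojourn_at[OF assms(1)] by blast
  have "\<not> Suc m \<le> n" "\<not> Suc n \<le> m"
    using T_mono[of "Suc m" n] T_mono[of "Suc n" m] m assms by (meson leD order_trans)+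
  then have "m = n" by linarith
  then show ?thesis using m by simp
qed

private lemma R_nonneg: "0 \<le> R n"
  by (intro sum_nonneg real_of_ereal_pos) (use pos in \<open>auto intro: less_imp_le\<close>)

private lemma piece:
  assumes f: "fin n" and t: "R n \<le> t" "ereal t \<le> T (Suc n)"
  shows "((\<lambda>s. r $ p s) has_integral r $ fst (x n) * (t - R n)) {R n..t}"
proof -
  have "((\<lambda>s. r $ fst (x n)) has_integral (t - R n) *\<^sub>R (r $ fst (x n))) {R n..t}"
    using has_integral_const_real[of "r $ fst (x n)" "R n" t] t by simp
  then have "((\<lambda>s. r $ p s) has_integral (t - R n) *\<^sub>R (r $ fst (x n))) {R n..t}"
  proof (rule has_integral_spike_finite[of "{t}", rotated 2])
    fix s assume s: "s \<in> {R n..t} - {t}"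
    have "ereal s < ereal t" using s by auto
    then have "p s = fst (x n)"
    proof (intro phase_eq)
      show "0 \<le> s" using R_nonneg[of n] s by auto
      show "T n \<le> ereal s" using T_real[OF f] s by simp
      show "ereal s < T (Suc n)" using \<open>ereal s < ereal t\<close> t(2) by (rule less_le_trans)
    qed
    then show "r $ p s = r $ fst (x n)" by simp
  qed simp
  then show ?thesis by (simp add: mult.commute)
qed

private lemma level_integral:
  assumes f: "fin n" and t: "R n \<le> t" "ereal t \<le> T (Suc n)"
  shows "((\<lambda>s. r $ p s) has_integral V n + r $ fst (x n) * (t - R n)) {0..t}"
  using assms
proof (induction n arbitrary: t)
  case 0
  then show ?case using piece[of 0 t] by (simp add: height_def)
next
  case (Suc n)
  have f: "fin n" "snd (x n) \<noteq> \<infinity>" using Suc.prems(1) by auto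
  have le: "R n \<le> R (Suc n)" using pos[of n] by (simp add: real_of_ereal_pos less_imp_le)
  have "((\<lambda>s. r $ p s) has_integral V n + r $ fst (x n) * (R (Suc n) - R n)) {0..R (Suc n)}"
    using Suc.IH[OF f(1) le] T_real[OF Suc.prems(1)] by simp
  moreover have "V n + r $ fst (x n) * (R (Suc n) - R n) = V (Suc n)" by (simp add: height_def)
  ultimately have 1: "((\<lambda>s. r $ p s) has_integral V (Suc n)) {0..R (Suc n)}" by simp
  show ?case
    by (rule has_integral_combine[OF R_nonneg Suc.prems(2) 1 piece[OF Suc.prems]])
qed

private lemma level_eq:
  assumes t: "0 \<le> t" "T n \<le> ereal t" "ereal t \<le> T (Suc n)"
  shows "fin n" "R n \<le> t" "level r p t = V n + r $ fst (x n) * (t - R n)"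
proof -
  show f: "fin n" using T_fin[OF t(2)] .
  show R: "R n \<le> t" using t(2) T_real[OF f] by simp
  show "level r p t = V n + r $ fst (x n) * (t - R n)"
    unfolding level_def using level_integral[OF f R t(3)] by (rule integral_unique)
qed

text \<open>If the level has not crossed zero during a sojourn, it is nonnegative at its end: it is monotone
  in between.\<close>

private lemma V_nonneg:
  assumes "\<And>k. k < m \<Longrightarrow> snd (x k) \<noteq> \<infinity> \<and> \<not> crosses r 0 x k" "n \<le> m"
  shows "0 \<le> V n"
  using assms(2)
proof (induction n)
  case (Suc n)
  then have IH: "0 \<le> V n" and n: "snd (x n) \<noteq> \<infinity>" "\<not> crosses r 0 x n" using assms(1) by auto
  have h: "0 \<le> real_of_ereal (snd (x n))" using pos[of n] by (simp add: real_of_ereal_pos less_imp_le)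
  have V: "V (Suc n) = V n + r $ fst (x n) * real_of_ereal (snd (x n))" by (simp add: height_def)
  show ?case
  proof (cases "r $ fst (x n) < 0")
    case True
    then have "\<not> ereal (V n / - r $ fst (x n)) < ereal (real_of_ereal (snd (x n)))"
      using n sojourn_real[OF n(1)] by (simp add: crosses_def)
    then show ?thesis unfolding V using True by (simp add: field_simps)
  next
    case False
    then show ?thesis unfolding V using IH h by simp
  qed
qed (simp add: height_def)

private lemma before_crossing:
  assumes before: "\<And>k. k < m \<Longrightarrow> snd (x k) \<noteq> \<infinity> \<and> \<not> crosses r 0 x k"
    and t: "0 \<le> t" "T n \<le> ereal t" "ereal t < T (Suc n)" and n: "n < m \<or> n = m \<and> \<not> crosses r 0 x m"
  shows "0 \<le> level r p t"
proof -
  have le: "R n \<le> t" and l: "level r p t = V n + r $ fst (x n) * (t - R n)" and f: "fin n"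
    using level_eq[OF t(1,2) less_imp_le[OF t(3)]] by auto
  have V: "0 \<le> V n" using V_nonneg[OF before] n by auto
  show ?thesis
  proof (cases "r $ fst (x n) < 0")
    case True
    have "\<not> crosses r 0 x n" using before n by auto
    then have "\<not> ereal (V n / - r $ fst (x n)) < snd (x n)" using True by (simp add: crosses_def)
    moreover have "ereal (t - R n) \<le> snd (x n)"
      using t(3) T_real[OF f] by (cases "snd (x n)") (use pos[of n] in auto)
    ultimately have "ereal (t - R n) \<le> ereal (V n / - r $ fst (x n))" by (metis leI order_trans)
    then have "t - R n \<le> V n / - r $ fst (x n)" by simp
    then show ?thesis unfolding l using True by (simp add: field_simps)
  next
    case False
    then show ?thesis unfolding l using V le by simp
  qed
qed

text \<open>During the crossing sojourn the level is linear with negative slope and vanishes at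
  \<open>\<tau>\<close>.  It is nonnegative up to \<open>\<tau>\<close> and negative immediately after, so \<open>\<tau>\<close> is the infimum.\<close>

private lemma first_crossing:
  assumes before: "\<And>k. k < m \<Longrightarrow> snd (x k) \<noteq> \<infinity> \<and> \<not> crosses r 0 x k" and m: "crosses r 0 x m"
  shows "\<exists>t>0. level r p t < 0" and "p (first_return_time r p) = fst (x m)"
proof -
  define \<rho> where "\<rho> = - r $ fst (x m)"
  have \<rho>: "0 < \<rho>" and c: "ereal (V m / \<rho>) < snd (x m)" using m by (auto simp: crosses_def \<rho>_def)
  have f: "fin m" using before by blast
  have V: "0 \<le> V m" using V_nonneg[OF before] by auto
  define \<tau> where "\<tau> = R m + V m / \<rho>"
  have \<tau>: "0 \<le> \<tau>" "T m \<le> ereal \<tau>" "ereal \<tau> < T (Suc m)"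
  proof -
    show "0 \<le> \<tau>" using R_nonneg[of m] V \<rho> by (simp add: \<tau>_def)
    show "T m \<le> ereal \<tau>" using T_real[OF f] V \<rho> by (simp add: \<tau>_def)
    show "ereal \<tau> < T (Suc m)" using T_real[OF f] c by (cases "snd (x m)") (auto simp: \<tau>_def)
  qed
  have after: "level r p t < 0" if t: "\<tau> < t" "ereal t < T (Suc m)" for t
  proof -
    have "T m \<le> ereal t" using \<tau>(2) t by (meson ereal_less_eq(3) less_imp_le order_trans)
    then have l: "level r p t = V m + r $ fst (x m) * (t - R m)"
      using level_eq[of t m] t \<tau>(1) by auto
    have "V m / \<rho> < t - R m" using t(1) by (simp add: \<tau>_def)
    then have "V m < (t - R m) * \<rho>" using \<rho> by (simp add: pos_divide_less_eq)
    then show ?thesis unfolding l by (simp add: \<rho>_def algebra_simps)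
  qed
  have upto: "0 \<le> level r p t" if t: "0 < t" "t \<le> \<tau>" for t
  proof -
    obtain n where n: "T n \<le> ereal t" "ereal t < T (Suc n)" "p t = fst (x n)"
      using sojourn_at[of t] t by auto
    have "\<not> Suc m \<le> n"
      using T_mono[of "Suc m" n] \<tau>(3) t n(1) by (meson ereal_less_eq(3) leD order_trans)
    then consider "n < m" | "n = m" by linarith
    then show ?thesis
    proof cases
      case 1
      then show ?thesis using before_crossing[OF before] n t by auto
    next
      case 2
      then have l: "level r p t = V m + r $ fst (x m) * (t - R m)" using level_eq[of t n] n t by auto
      have "t - R m \<le> V m / \<rho>" using t by (simp add: \<tau>_def)
      then have "(t - R m) * \<rho> \<le> V m" using \<rho> by (simp add: pos_le_divide_eq)
      then show ?thesis unfolding l by (simp add: \<rho>_def algebra_simps)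
    qed
  qed
  have ex: "\<exists>t. \<tau> < t \<and> t < \<tau> + e \<and> ereal t < T (Suc m)" if "0 < e" for e
  proof -
    have "ereal \<tau> < min (ereal (\<tau> + e)) (T (Suc m))" using that \<tau>(3) by simp
    then obtain t where "ereal \<tau> < ereal t" "ereal t < min (ereal (\<tau> + e)) (T (Suc m))"
      using ereal_dense2 by blast
    then show ?thesis by auto
  qed
  let ?S = "{t. 0 < t \<and> level r p t < 0}"
  have S: "\<tau> < t" if "t \<in> ?S" for t using upto[of t] that by force
  obtain t1 where "\<tau> < t1" "ereal t1 < T (Suc m)" using ex[of 1] by auto
  then show "\<exists>t>0. level r p t < 0" using after[of t1] \<tau>(1) by (intro exI[of _ t1]) simp
  then have ne: "?S \<noteq> {}" by auto
  have "Inf ?S = \<tau>"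
  proof (rule antisym)
    show "\<tau> \<le> Inf ?S" using S by (intro cInf_greatest[OF ne]) (auto intro: less_imp_le)
    show "Inf ?S \<le> \<tau>"
    proof (rule field_le_epsilon)
      fix e :: real assume "0 < e"
      then obtain t where t: "\<tau> < t" "t < \<tau> + e" "ereal t < T (Suc m)" using ex by blast
      then have "t \<in> ?S" using after \<tau>(1) by auto
      then have "Inf ?S \<le> t" using S by (intro cInf_lower bdd_belowI[of _ \<tau>]) (auto intro: less_imp_le)
      then show "Inf ?S \<le> \<tau> + e" using t by simp
    qed
  qed
  then show "p (first_return_time r p) = fst (x m)"
    unfolding first_return_time_def using phase_eq[OF \<tau>] by simp
qed

text \<open>If the level is negative at some time, some sojourn crosses zero, for otherwise it would be
  nonnegative throughout; the first such sojourn determines the phase at the return.\<close>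

lemma first_return_event_iff_hit:
  "(\<exists>t>0. level r p t < 0) \<and> p (first_return_time r p) = j \<longleftrightarrow> (\<exists>n. hit r j n 0 x)"
proof
  assume L: "(\<exists>t>0. level r p t < 0) \<and> p (first_return_time r p) = j"
  then obtain t where t: "0 < t" "level r p t < 0" by blast
  obtain n where n: "T n \<le> ereal t" "ereal t < T (Suc n)" using sojourn_at[of t] t by auto
  have f: "fin n" using T_fin n by blast
  have "\<exists>m\<le>n. crosses r 0 x m"
  proof (rule ccontr)
    assume "\<not> (\<exists>m\<le>n. crosses r 0 x m)"
    then have "0 \<le> level r p t" using before_crossing[of n t n] n t f by auto
    then show False using t by simp
  qed
  then obtain m0 where m0: "m0 \<le> n" "crosses r 0 x m0" by blast
  define m where "m = (LEAST m. crosses r 0 x m)"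
  have m: "crosses r 0 x m" "m \<le> n" "\<And>k. k < m \<Longrightarrow> \<not> crosses r 0 x k"
    unfolding m_def using m0 LeastI[of "crosses r 0 x"] Least_le[of "crosses r 0 x" m0] not_less_Least by auto
  have before: "snd (x k) \<noteq> \<infinity> \<and> \<not> crosses r 0 x k" if "k < m" for k using that m f by auto
  from first_crossing(2)[OF before m(1)] L have "fst (x m) = j" by simp
  then have "hit r j (Suc m) 0 x" unfolding hit_iff_crosses using m before by blast
  then show "\<exists>n. hit r j n 0 x" ..
next
  assume "\<exists>n. hit r j n 0 x"
  then obtain m where m: "fst (x m) = j" "crosses r 0 x m" "\<And>k. k < m \<Longrightarrow> snd (x k) \<noteq> \<infinity> \<and> \<not> crosses r 0 x k"
    unfolding hit_iff_crosses by blast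
  from first_crossing[OF m(3,2)] m(1) show "(\<exists>t>0. level r p t < 0) \<and> p (first_return_time r p) = j" by simp
qed

end

section \<open>First passage functions as least solutions\<close>

text \<open>The two terms of the first jump decomposition: \<open>exit_first\<close> is the probability to descend to
  zero before any jump, and \<open>jump_first\<close> integrates the reward \<open>f\<close> of the new phase and height
  over the time of a jump that takes place before this.\<close>

definition exit_first :: "real^'s^'s \<Rightarrow> real^'s \<Rightarrow> 's \<Rightarrow> 's \<Rightarrow> real \<Rightarrow> ennreal" where
  "exit_first A r i j y = (if i = j \<and> r $ i < 0 then ennreal (exp (A $ i $ i * (y / - r $ i))) else 0)"

definition jump_first :: "real^'s^'s \<Rightarrow> real^'s \<Rightarrow> ('s \<Rightarrow> real \<Rightarrow> ennreal) \<Rightarrow> 's \<Rightarrow> real \<Rightarrow> ennreal" where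
  "jump_first A r f i y = (\<integral>\<^sup>+t. ennreal (exp (A $ i $ i * t))
     * (\<Sum>k\<in>UNIV - {i}. ennreal (A $ i $ k) * f k (y + r $ i * t))
     * indicator {t. 0 \<le> t \<and> 0 \<le> y + r $ i * t} t \<partial>lborel)"

primrec passage :: "real^'s^'s \<Rightarrow> real^'s \<Rightarrow> nat \<Rightarrow> 's \<Rightarrow> 's \<Rightarrow> real \<Rightarrow> ennreal" where
  "passage A r 0 i j y = 0"
| "passage A r (Suc n) i j y = exit_first A r i j y + jump_first A r (\<lambda>k. passage A r n k j) i y"

lemma measurable_jump_first [measurable (raw)]:
  assumes [measurable]: "\<And>k. f k \<in> borel_measurable borel"
  shows "jump_first A r f i \<in> borel_measurable borel"
  unfolding jump_first_def by measurable

lemma measurable_passage [measurable]: "passage A r n i j \<in> borel_measurable borel"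
proof (induction n arbitrary: i)
  case (Suc n)
  note Suc[measurable]
  have "passage A r (Suc n) i j = (\<lambda>y. exit_first A r i j y + jump_first A r (\<lambda>k. passage A r n k j) i y)"
    by (simp add: fun_eq_iff)
  moreover have [measurable]: "exit_first A r i j \<in> borel_measurable borel"
    unfolding exit_first_def by measurable
  ultimately show ?case by simp
next
  case 0
  have "passage A r 0 i j = (\<lambda>_. 0)" by (simp add: fun_eq_iff)
  then show ?case by simp
qed

lemma measurable_hit:
  "(\<lambda>p. hit r j n (fst p) (snd p)) \<in> measurable (borel \<Otimes>\<^sub>M (seqM :: (nat \<Rightarrow> 's::finite \<times> ereal) measure)) (count_space UNIV)"
proof (induction n)
  case (Suc n)
  let ?M = "borel \<Otimes>\<^sub>M (seqM :: (nat \<Rightarrow> 's \<times> ereal) measure)"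
  have m1[measurable]: "(\<lambda>p. fst (snd p k)) \<in> measurable ?M (count_space UNIV)" for k
    by (rule measurable_compose[OF measurable_snd measurable_fst_seqM])
  have m2[measurable]: "(\<lambda>p. snd (snd p k)) \<in> borel_measurable ?M" for k
    by (rule measurable_compose[OF measurable_snd measurable_snd_seqM])
  have m3[measurable]: "(\<lambda>p. r $ fst (snd p 0)) \<in> borel_measurable ?M"
    by (rule measurable_compose[OF m1]) simp
  have sh: "(\<lambda>p k. snd p (Suc k)) \<in> measurable ?M seqM"
  proof -
    have "(\<lambda>p. snd p (Suc k)) \<in> measurable ?M (count_space UNIV \<Otimes>\<^sub>M borel)" for k
      using measurable_Pair[OF m1[of "Suc k"] m2[of "Suc k"]] by simp
    then have "(\<lambda>p k. snd p (Suc k)) \<in> measurable ?M (PiM UNIV (\<lambda>_. count_space UNIV \<Otimes>\<^sub>M borel))"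
      by (rule measurable_PiM_single') (auto simp: space_pair_measure)
    then show ?thesis by (simp only: seqM_def)
  qed
  have "(\<lambda>p. (fst p + r $ fst (snd p 0) * real_of_ereal (snd (snd p 0)), \<lambda>k. snd p (Suc k))) \<in> measurable ?M ?M"
    by (intro measurable_Pair sh) measurable
  from measurable_compose[OF this Suc]
  have [measurable]: "(\<lambda>p. hit r j n (fst p + r $ fst (snd p 0) * real_of_ereal (snd (snd p 0))) (\<lambda>k. snd p (Suc k)))
      \<in> measurable ?M (count_space UNIV)" by simp
  show ?case unfolding hit.simps by measurable
qed simp

lemma hit_sets [measurable]:
  fixes r :: "real^'s"
  shows "{x. hit r j n y x} \<in> sets seqM"
proof -
  have "(\<lambda>x. hit r j n y x) \<in> measurable (seqM :: (nat \<Rightarrow> 's \<times> ereal) measure) (count_space UNIV)"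
    using measurable_compose[OF _ measurable_hit[of r j n], of "\<lambda>x. (y, x)" seqM] by simp
  then have "{x\<in>space seqM. hit r j n y x} \<in> sets seqM" by (simp only: pred_def)
  then show ?thesis by simp
qed

context
  fixes A :: "real^'s^'s" and L :: "'s \<Rightarrow> (nat \<Rightarrow> 's \<times> ereal) measure" and r :: "real^'s"
  assumes gen: "generator A" and law: "\<And>i. sojourn_law A i (L i)"
begin

text \<open>Induction on the number of sojourns, by the Markov property at the first jump.\<close>

lemma emeasure_hit:
  assumes "0 \<le> y"
  shows "emeasure (L i) {x. hit r j n y x} = passage A r n i j y"
  using assms
proof (induction n arbitrary: i y)
  case (Suc n)
  note L = L_facts[OF gen law]
  interpret Li: prob_space "L i" by (rule L)
  have y: "0 \<le> y" by fact
  let ?c = "\<lambda>h. r $ i < 0 \<and> ereal (y / - r $ i) < h"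
  let ?f = "\<lambda>h. if \<not> ?c h \<and> h \<noteq> \<infinity> \<and> 0 \<le> h then \<Sum>k\<in>UNIV. ennreal (jump_prob A i k) * passage A r n k j (y + r $ i * real_of_ereal h) else 0"
  have sum1: "(\<Sum>k\<in>UNIV. ennreal (jump_prob A i k)) = 1"
    by (simp add: sum_ennreal jump_prob_nonneg[OF gen] jump_prob_sum[OF gen])
  have m0[measurable]: "(\<lambda>x. snd (x n)) \<in> borel_measurable (L i)" for n
    by (rule measurable_L[OF gen law]) simp
  have inner: "(\<Sum>k\<in>UNIV. ennreal (jump_prob A i k) * emeasure (L k) {x'. case_nat (i, h) x' \<in> {x. hit r j (Suc n) y x}})
      = (if i = j \<and> ?c h then 1 else 0) + ?f h" if h: "0 < h" for h
  proof (cases "?c h")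
    case True
    then have "{x'. case_nat (i, h) x' \<in> {x. hit r j (Suc n) y x}} = (if i = j then UNIV else {})" by auto
    then show ?thesis using True sum1 prob_space.emeasure_space_1[OF L(1)] by (auto simp: L)
  next
    case False
    then have e: "{x'. case_nat (i, h) x' \<in> {x. hit r j (Suc n) y x}}
        = (if h \<noteq> \<infinity> then {x. hit r j n (y + r $ i * real_of_ereal h) x} else {})" by auto
    have "0 \<le> y + r $ i * real_of_ereal h" if hi: "h \<noteq> \<infinity>"
    proof -
      obtain t where t: "h = ereal t" "0 < t" using h hi by (cases h) auto
      show ?thesis
      proof (cases "r $ i < 0")
        case True
        then have "t \<le> y / - r $ i" using False t by simp
        then show ?thesis using True t by (simp add: field_simps)
      next
        case False2: False
        then show ?thesis using t y by simp
      qed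
    qed
    then show ?thesis unfolding e using False h Suc.IH by (auto intro!: sum.cong)
  qed
  have "emeasure (L i) {x. hit r j (Suc n) y x} = (\<integral>\<^sup>+x. (if i = j \<and> ?c (snd (x 0)) then 1 else 0) + ?f (snd (x 0)) \<partial>L i)"
    unfolding markov_first_jump[OF gen law hit_sets]
  proof (rule nn_integral_cong_AE)
    have "AE x in L i. \<forall>k. 0 < snd (x k)" by (rule L)
    then show "AE x in L i. (\<Sum>k\<in>UNIV. ennreal (jump_prob A i k) * emeasure (L k) {x'. case_nat (i, snd (x 0)) x' \<in> {x. hit r j (Suc n) y x}})
        = (if i = j \<and> ?c (snd (x 0)) then 1 else 0) + ?f (snd (x 0))"
      by (rule AE_mp) (intro AE_I2 impI, rule inner, blast)
  qed
  also have "\<dots> = (\<integral>\<^sup>+x. (if i = j \<and> ?c (snd (x 0)) then 1 else 0) \<partial>L i) + (\<integral>\<^sup>+x. ?f (snd (x 0)) \<partial>L i)"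
    by (rule nn_integral_add) measurable
  also have "(\<integral>\<^sup>+x. (if i = j \<and> ?c (snd (x 0)) then 1 else 0) \<partial>L i) = exit_first A r i j y"
  proof (cases "i = j \<and> r $ i < 0")
    case True
    have "(\<integral>\<^sup>+x. (if i = j \<and> ?c (snd (x 0)) then 1 else 0) \<partial>L i)
        = (\<integral>\<^sup>+x. indicator {x\<in>space (L i). ereal (y / - r $ i) < snd (x 0)} x \<partial>L i)"
      using True by (intro nn_integral_cong) (auto simp: indicator_def L)
    also have "\<dots> = emeasure (L i) {x\<in>space (L i). ereal (y / - r $ i) < snd (x 0)}"
      by (rule nn_integral_indicator) measurable
    also have "\<dots> = exit_first A r i j y"
      using first_sojourn_tail[OF gen law, of "y / - r $ i" i] y True[THEN conjunct1] True[THEN conjunct2]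
        divide_nonneg_neg[of y "r $ i"]
      by (simp add: exit_first_def L)
    finally show ?thesis .
  next
    case False
    then have "(\<integral>\<^sup>+x. (if i = j \<and> ?c (snd (x 0)) then 1 else 0) \<partial>L i) = (\<integral>\<^sup>+x. 0 \<partial>L i)"
      by (intro nn_integral_cong) auto
    then show ?thesis using False by (auto simp: exit_first_def)
  qed
  also have "(\<integral>\<^sup>+x. ?f (snd (x 0)) \<partial>L i) = jump_first A r (\<lambda>k. passage A r n k j) i y"
  proof -
    have "(\<integral>\<^sup>+x. ?f (snd (x 0)) \<partial>L i)
      = (\<integral>\<^sup>+t. ennreal (- A $ i $ i * exp (A $ i $ i * t)) * ?f (ereal t) * indicator {0..} t \<partial>lborel)"
    proof (rule first_sojourn_integral[OF gen law, of ?f i])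
      have [measurable]: "(\<lambda>h. passage A r n k j (y + r $ i * real_of_ereal h)) \<in> borel_measurable (borel :: ereal measure)" for k
        by (rule measurable_compose[OF _ measurable_passage]) measurable
      show "?f \<in> borel_measurable borel" by measurable
    qed simp
    also have "\<dots> = jump_first A r (\<lambda>k. passage A r n k j) i y"
      unfolding jump_first_def
    proof (intro nn_integral_cong)
      fix t :: real
      have a: "0 \<le> - A $ i $ i" using generator_diag_nonpos[OF gen, of i] by simp
      show "ennreal (- A $ i $ i * exp (A $ i $ i * t)) * ?f (ereal t) * indicator {0..} t
        = ennreal (exp (A $ i $ i * t)) * (\<Sum>k\<in>UNIV - {i}. ennreal (A $ i $ k) * passage A r n k j (y + r $ i * t))
         * indicator {t. 0 \<le> t \<and> 0 \<le> y + r $ i * t} t"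
      proof (cases "0 \<le> t \<and> 0 \<le> y + r $ i * t")
        case False
        have "?c (ereal t)" if "0 \<le> t" "y + r $ i * t < 0"
        proof -
          have "r $ i * t < 0" using that y by linarith
          then have "r $ i < 0" using that(1) by (simp add: mult_less_0_iff)
          then show ?thesis using that by (simp add: field_simps)
        qed
        then show ?thesis using False by (auto simp: indicator_def)
      next
        case True
        have nc: "\<not> ?c (ereal t)" using True by (auto simp: field_simps)
        have "ennreal (- A $ i $ i) * (\<Sum>k\<in>UNIV. ennreal (jump_prob A i k) * passage A r n k j (y + r $ i * t))
          = (\<Sum>k\<in>UNIV. ennreal (- A $ i $ i * jump_prob A i k) * passage A r n k j (y + r $ i * t))"
          unfolding sum_distrib_left
          by (intro sum.cong refl, subst ennreal_mult[OF a jump_prob_nonneg[OF gen]]) (simp only: mult.assoc)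
        also have "\<dots> = (\<Sum>k\<in>UNIV. if k = i then 0 else ennreal (A $ i $ k) * passage A r n k j (y + r $ i * t))"
          by (intro sum.cong refl) (simp only: jump_prob_exit[OF gen], simp)
        also have "\<dots> = (\<Sum>k\<in>UNIV - {i}. ennreal (A $ i $ k) * passage A r n k j (y + r $ i * t))"
          by (subst sum.remove[of _ i]) auto
        finally have e: "ennreal (- A $ i $ i) * (\<Sum>k\<in>UNIV. ennreal (jump_prob A i k) * passage A r n k j (y + r $ i * t))
          = (\<Sum>k\<in>UNIV - {i}. ennreal (A $ i $ k) * passage A r n k j (y + r $ i * t))" .
        have f: "?f (ereal t) = (\<Sum>k\<in>UNIV. ennreal (jump_prob A i k) * passage A r n k j (y + r $ i * t))"
          using nc True by simp
        show ?thesis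
          unfolding f ennreal_mult[OF a exp_ge_zero] e[symmetric] using True by (simp add: mult_ac)
      qed
    qed
    finally show ?thesis .
  qed
  finally show ?case by simp
next
  case 0
  have "{x. hit r j 0 y x} = {}" by auto
  then show ?case by (simp only: passage.simps emeasure_empty)
qed

end

text \<open>The return event is the increasing union of the events
  \<open>hit\<close>, and their probabilities are given by the law of the sojourn sequence.\<close>

lemma first_return_eq_SUP_passage:
  fixes A :: "real^'s^'s" and P :: "'s \<Rightarrow> 'w measure" and r :: "real^'s"
  assumes gen: "generator A" and phase: "\<And>i. ctmc A i (P i) \<phi>" and i: "0 < r $ i" and j: "r $ j < 0"
  shows "ennreal (first_return P \<phi> r $ i $ j) = (SUP n. passage A r n i j 0)"
proof -
  have "\<exists>K. (\<forall>i. prob_space (P i)) \<and> (\<forall>i. K i \<in> measurable (P i) seqM) \<and> (\<forall>i. sojourn_law A i (distr (P i) seqM (K i))) \<and>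
     (\<forall>i. \<forall>\<omega>\<in>space (P i). (\<forall>k. 0 < snd (K i \<omega> k)) \<and>
      (\<forall>t\<ge>0. \<exists>n. (\<Sum>k<n. snd (K i \<omega> k)) \<le> ereal t \<and> ereal t < (\<Sum>k\<le>n. snd (K i \<omega> k)) \<and> \<phi> t \<omega> = fst (K i \<omega> n)))"
  proof -
    have "\<exists>K. prob_space (P i) \<and> K \<in> measurable (P i) seqM \<and> sojourn_law A i (distr (P i) seqM K) \<and>
     (\<forall>\<omega>\<in>space (P i). (\<forall>k. 0 < snd (K \<omega> k)) \<and>
      (\<forall>t\<ge>0. \<exists>n. (\<Sum>k<n. snd (K \<omega> k)) \<le> ereal t \<and> ereal t < (\<Sum>k\<le>n. snd (K \<omega> k)) \<and> \<phi> t \<omega> = fst (K \<omega> n)))" for i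
    proof -
      have "prob_space (P i)" using phase[of i] by (simp add: ctmc_def)
      obtain Z H where ZH: "\<And>\<omega> n. \<omega> \<in> space (P i) \<Longrightarrow> 0 < H n \<omega>"
        "\<And>\<omega> t. \<omega> \<in> space (P i) \<Longrightarrow> 0 \<le> t \<Longrightarrow> \<exists>n. (\<Sum>k<n. H k \<omega>) \<le> ereal t \<and> ereal t < (\<Sum>k\<le>n. H k \<omega>) \<and>
                     \<phi> t \<omega> = Z n \<omega>"
        "(\<lambda>\<omega> k. (Z k \<omega>, H k \<omega>)) \<in> measurable (P i) seqM"
        "sojourn_law A i (distr (P i) seqM (\<lambda>\<omega> k. (Z k \<omega>, H k \<omega>)))"
        by (rule ctmc_sojourn_law[OF phase[of i]]) blast
      show ?thesis
      proof (rule exI[of _ "\<lambda>\<omega> k. (Z k \<omega>, H k \<omega>)"], intro conjI ballI allI impI, unfold fst_conv snd_conv)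
      qed (fact \<open>prob_space (P i)\<close> ZH(3) ZH(4) | erule ZH(1) | erule ZH(2), assumption)+
    qed
    then show ?thesis by metis
  qed
  then obtain K where K: "\<And>i. prob_space (P i)" "\<And>i. K i \<in> measurable (P i) seqM"
      "\<And>i. sojourn_law A i (distr (P i) seqM (K i))"
      "\<And>i \<omega> k. \<omega> \<in> space (P i) \<Longrightarrow> 0 < snd (K i \<omega> k)"
      "\<And>i \<omega> t. \<omega> \<in> space (P i) \<Longrightarrow> 0 \<le> t \<Longrightarrow> \<exists>n. (\<Sum>k<n. snd (K i \<omega> k)) \<le> ereal t \<and> ereal t < (\<Sum>k\<le>n. snd (K i \<omega> k)) \<and> \<phi> t \<omega> = fst (K i \<omega> n)"
    by metis
  interpret prob_space "P i" by (rule K)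
  have "{\<omega> \<in> space (P i). (\<exists>t>0. level r (\<lambda>s. \<phi> s \<omega>) t < 0) \<and> \<phi> (first_return_time r (\<lambda>s. \<phi> s \<omega>)) \<omega> = j}
      = {\<omega> \<in> space (P i). \<exists>n. hit r j n 0 (K i \<omega>)}"
    using first_return_event_iff_hit[where x = "K i _" and p = "\<lambda>s. \<phi> s _", OF K(4) K(5)]
    by (intro Collect_cong conj_cong refl) blast
  then have "ennreal (first_return P \<phi> r $ i $ j) = emeasure (P i) {\<omega> \<in> space (P i). \<exists>n. hit r j n 0 (K i \<omega>)}"
    using i j by (simp add: first_return_def emeasure_eq_measure)
  also have "\<dots> = emeasure (distr (P i) seqM (K i)) (\<Union>n. {x. hit r j n 0 x})"
    by (subst emeasure_distr[OF K(2)]) (auto intro!: arg_cong[where f = "emeasure (P i)"])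
  also have "\<dots> = (SUP n. emeasure (distr (P i) seqM (K i)) {x. hit r j n 0 x})"
    by (rule SUP_emeasure_incseq[symmetric]) (auto simp: incseq_def intro: hit_mono)
  also have "\<dots> = (SUP n. passage A r n i j 0)"
    using emeasure_hit[OF gen, of "\<lambda>i. distr (P i) seqM (K i)" 0 i r j] K(3) by simp
  finally show ?thesis .
qed

lemma jump_first_mono:
  assumes "\<And>k y. 0 \<le> y \<Longrightarrow> f k y \<le> g k y"
  shows "jump_first A r f i y \<le> jump_first A r g i y"
  unfolding jump_first_def
  by (intro nn_integral_mono) (auto simp: indicator_def intro!: mult_left_mono sum_mono assms)

lemma jump_first_linear:
  fixes f :: "'m::finite \<Rightarrow> 's::finite \<Rightarrow> real \<Rightarrow> ennreal"
  assumes [measurable]: "\<And>m k. f m k \<in> borel_measurable borel"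
  shows "jump_first A r (\<lambda>k y. \<Sum>m\<in>UNIV. f m k y * c m) i y = (\<Sum>m\<in>UNIV. jump_first A r (f m) i y * c m)"
proof -
  have "jump_first A r (\<lambda>k y. \<Sum>m\<in>UNIV. f m k y * c m) i y
      = (\<integral>\<^sup>+t. (\<Sum>m\<in>UNIV. (ennreal (exp (A $ i $ i * t)) * (\<Sum>k\<in>UNIV - {i}. ennreal (A $ i $ k) * f m k (y + r $ i * t))
     * indicator {t. 0 \<le> t \<and> 0 \<le> y + r $ i * t} t) * c m) \<partial>lborel)"
    unfolding jump_first_def
  proof (intro nn_integral_cong)
    fix t :: real
    have "(\<Sum>k\<in>UNIV - {i}. ennreal (A $ i $ k) * (\<Sum>m\<in>UNIV. f m k (y + r $ i * t) * c m))
        = (\<Sum>m\<in>UNIV. (\<Sum>k\<in>UNIV - {i}. ennreal (A $ i $ k) * f m k (y + r $ i * t)) * c m)"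
      by (simp add: sum_distrib_left sum_distrib_right mult.assoc) (rule sum.swap)
    then show "ennreal (exp (A $ i $ i * t)) * (\<Sum>k\<in>UNIV - {i}. ennreal (A $ i $ k) * (\<Sum>m\<in>UNIV. f m k (y + r $ i * t) * c m))
        * indicator {t. 0 \<le> t \<and> 0 \<le> y + r $ i * t} t
      = (\<Sum>m\<in>UNIV. (ennreal (exp (A $ i $ i * t)) * (\<Sum>k\<in>UNIV - {i}. ennreal (A $ i $ k) * f m k (y + r $ i * t))
     * indicator {t. 0 \<le> t \<and> 0 \<le> y + r $ i * t} t) * c m)"
      by (simp only: sum_distrib_left sum_distrib_right mult_ac)
  qed
  also have "\<dots> = (\<Sum>m\<in>UNIV. jump_first A r (f m) i y * c m)"
    unfolding jump_first_def by (subst nn_integral_sum) (simp_all add: nn_integral_multc)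
  finally show ?thesis .
qed

lemma passage_mono: "n \<le> m \<Longrightarrow> passage A r n i j y \<le> passage A r m i j y"
proof (rule lift_Suc_mono_le[where f = "\<lambda>n. passage A r n i j y"])
  show "passage A r n i j y \<le> passage A r (Suc n) i j y" for n
  proof (induction n arbitrary: i y)
    case (Suc n)
    show ?case unfolding passage.simps(2)[of A r "Suc n"] passage.simps(2)[of A r n i]
      by (intro add_left_mono jump_first_mono Suc.IH)
  qed simp
qed

definition first_passage :: "real^'s^'s \<Rightarrow> real^'s \<Rightarrow> 's \<Rightarrow> 's \<Rightarrow> real \<Rightarrow> ennreal" where
  "first_passage A r i j y = (SUP n. passage A r n i j y)"

lemma measurable_first_passage [measurable]: "first_passage A r i j \<in> borel_measurable borel"
  unfolding first_passage_def by measurable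

lemma passage_le_first_passage: "passage A r n i j y \<le> first_passage A r i j y"
  unfolding first_passage_def by (rule SUP_upper) simp

lemma first_passage_eq:
  "first_passage A r i j y = exit_first A r i j y + jump_first A r (\<lambda>k. first_passage A r k j) i y"
proof -
  have "jump_first A r (\<lambda>k. first_passage A r k j) i y
      = (\<integral>\<^sup>+t. (SUP n. ennreal (exp (A $ i $ i * t))
     * (\<Sum>k\<in>UNIV - {i}. ennreal (A $ i $ k) * passage A r n k j (y + r $ i * t))
     * indicator {t. 0 \<le> t \<and> 0 \<le> y + r $ i * t} t) \<partial>lborel)"
    unfolding jump_first_def
  proof (intro nn_integral_cong)
    fix t :: real
    let ?y = "y + r $ i * t"
    have "(\<Sum>k\<in>UNIV - {i}. ennreal (A $ i $ k) * first_passage A r k j ?y)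
        = (SUP n. \<Sum>k\<in>UNIV - {i}. ennreal (A $ i $ k) * passage A r n k j ?y)"
      unfolding first_passage_def SUP_mult_left_ennreal
      by (rule ennreal_SUP_sum[symmetric])
        (auto simp: incseq_def intro: mult_left_mono passage_mono)
    then show "ennreal (exp (A $ i $ i * t)) * (\<Sum>k\<in>UNIV - {i}. ennreal (A $ i $ k) * first_passage A r k j ?y)
        * indicator {t. 0 \<le> t \<and> 0 \<le> y + r $ i * t} t
      = (SUP n. ennreal (exp (A $ i $ i * t)) * (\<Sum>k\<in>UNIV - {i}. ennreal (A $ i $ k) * passage A r n k j ?y)
         * indicator {t. 0 \<le> t \<and> 0 \<le> y + r $ i * t} t)"
      by (simp only: SUP_mult_left_ennreal SUP_mult_right_ennreal)
  qed
  also have "\<dots> = (SUP n. jump_first A r (\<lambda>k. passage A r n k j) i y)"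
    unfolding jump_first_def
  proof (rule nn_integral_monotone_convergence_SUP)
    show "incseq (\<lambda>n t. ennreal (exp (A $ i $ i * t))
     * (\<Sum>k\<in>UNIV - {i}. ennreal (A $ i $ k) * passage A r n k j (y + r $ i * t))
     * indicator {t. 0 \<le> t \<and> 0 \<le> y + r $ i * t} t)"
      by (auto simp: incseq_def le_fun_def intro!: mult_right_mono mult_left_mono sum_mono passage_mono)
  qed measurable
  finally have J: "jump_first A r (\<lambda>k. first_passage A r k j) i y
    = (SUP n. jump_first A r (\<lambda>k. passage A r n k j) i y)" .
  have "first_passage A r i j y = (SUP n. passage A r (Suc n) i j y)"
    unfolding first_passage_def
  proof (rule antisym)
    show "(SUP n. passage A r n i j y) \<le> (SUP n. passage A r (Suc n) i j y)"
      by (rule SUP_mono) (use passage_mono[of _ "Suc _"] in \<open>blast intro: le_SucI\<close>)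
    show "(SUP n. passage A r (Suc n) i j y) \<le> (SUP n. passage A r n i j y)"
      by (rule SUP_mono) blast
  qed
  also have "\<dots> = exit_first A r i j y + (SUP n. jump_first A r (\<lambda>k. passage A r n k j) i y)"
    by (simp add: ennreal_SUP_add_right)
  finally show ?thesis by (simp only: J)
qed

text \<open>From height \<open>y + z\<close>, a jump takes place either while the height is above \<open>z\<close>, or else the
  phase is descending and survives until height \<open>z\<close>, from where the waiting time starts afresh.\<close>

lemma jump_first_shift:
  fixes f :: "'s::finite \<Rightarrow> real \<Rightarrow> ennreal"
  assumes [measurable]: "\<And>k. f k \<in> borel_measurable borel" and y: "0 \<le> y" and z: "0 \<le> z"
  shows "jump_first A r f i (y + z) = jump_first A r (\<lambda>k w. f k (w + z)) i y
    + (if r $ i < 0 then ennreal (exp (A $ i $ i * (y / - r $ i))) * jump_first A r f i z else 0)"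
proof (cases "r $ i < 0")
  case False
  then have "{t. 0 \<le> t \<and> 0 \<le> y + z + r $ i * t} = {t. 0 \<le> t \<and> 0 \<le> y + r $ i * t}"
    using y z by auto
  then show ?thesis using False by (simp add: jump_first_def algebra_simps)
next
  case True
  define s where "s = y / - r $ i"
  have s: "0 \<le> s" "r $ i * s = - y" using y True by (auto simp: s_def divide_nonneg_neg)
  define F where "F t = ennreal (exp (A $ i $ i * t)) * (\<Sum>k\<in>UNIV - {i}. ennreal (A $ i $ k) * f k (y + z + r $ i * t))" for t
  have [measurable]: "F \<in> borel_measurable borel" unfolding F_def by measurable
  have le: "0 \<le> y + r $ i * t \<longleftrightarrow> t \<le> s" for t using True by (auto simp: s_def field_simps)
  have "jump_first A r f i (y + z) = (\<integral>\<^sup>+t. F t * indicator {t. 0 \<le> t \<and> 0 \<le> y + z + r $ i * t} t \<partial>lborel)"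
    by (simp add: jump_first_def F_def)
  also have "\<dots> = (\<integral>\<^sup>+t. F t * indicator {t. 0 \<le> t \<and> 0 \<le> y + r $ i * t} t
      + F t * indicator {t. s \<le> t \<and> 0 \<le> y + z + r $ i * t} t \<partial>lborel)"
  proof (rule nn_integral_cong_AE)
    show "AE t in lborel. F t * indicator {t. 0 \<le> t \<and> 0 \<le> y + z + r $ i * t} t
      = F t * indicator {t. 0 \<le> t \<and> 0 \<le> y + r $ i * t} t
      + F t * indicator {t. s \<le> t \<and> 0 \<le> y + z + r $ i * t} t"
      using AE_lborel_singleton[of s]
    proof eventually_elim
      fix t assume "t \<noteq> s"
      have "0 \<le> y + z + r $ i * t" if "t < s" using le[of t] that z by linarith
      then show "F t * indicator {t. 0 \<le> t \<and> 0 \<le> y + z + r $ i * t} t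
      = F t * indicator {t. 0 \<le> t \<and> 0 \<le> y + r $ i * t} t
      + F t * indicator {t. s \<le> t \<and> 0 \<le> y + z + r $ i * t} t"
        using \<open>t \<noteq> s\<close> s(1) unfolding le by (auto simp: indicator_def)
    qed
  qed
  also have "\<dots> = (\<integral>\<^sup>+t. F t * indicator {t. 0 \<le> t \<and> 0 \<le> y + r $ i * t} t \<partial>lborel)
      + (\<integral>\<^sup>+t. F t * indicator {t. s \<le> t \<and> 0 \<le> y + z + r $ i * t} t \<partial>lborel)"
    by (rule nn_integral_add) measurable
  also have "(\<integral>\<^sup>+t. F t * indicator {t. 0 \<le> t \<and> 0 \<le> y + r $ i * t} t \<partial>lborel) = jump_first A r (\<lambda>k w. f k (w + z)) i y"
    by (simp add: jump_first_def F_def add_ac)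
  also have "(\<integral>\<^sup>+t. F t * indicator {t. s \<le> t \<and> 0 \<le> y + z + r $ i * t} t \<partial>lborel)
      = (\<integral>\<^sup>+t. F (s + t) * indicator {t. s \<le> t \<and> 0 \<le> y + z + r $ i * t} (s + t) \<partial>lborel)"
    by (subst nn_integral_real_affine[where c = 1 and t = s]) simp_all
  also have "\<dots> = (\<integral>\<^sup>+t. ennreal (exp (A $ i $ i * s)) * (ennreal (exp (A $ i $ i * t))
     * (\<Sum>k\<in>UNIV - {i}. ennreal (A $ i $ k) * f k (z + r $ i * t))
     * indicator {t. 0 \<le> t \<and> 0 \<le> z + r $ i * t} t) \<partial>lborel)"
  proof (intro nn_integral_cong)
    fix t :: real
    have e1: "y + z + r $ i * (s + t) = z + r $ i * t" using s(2) by (simp add: algebra_simps)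
    have e2: "ennreal (exp (A $ i $ i * (s + t))) = ennreal (exp (A $ i $ i * s)) * ennreal (exp (A $ i $ i * t))"
      by (simp add: distrib_left exp_add ennreal_mult)
    have e3: "indicator {t. s \<le> t \<and> 0 \<le> y + z + r $ i * t} (s + t)
        = (indicator {t. 0 \<le> t \<and> 0 \<le> z + r $ i * t} t :: ennreal)"
      by (simp add: indicator_def e1)
    show "F (s + t) * indicator {t. s \<le> t \<and> 0 \<le> y + z + r $ i * t} (s + t)
      = ennreal (exp (A $ i $ i * s)) * (ennreal (exp (A $ i $ i * t))
     * (\<Sum>k\<in>UNIV - {i}. ennreal (A $ i $ k) * f k (z + r $ i * t))
     * indicator {t. 0 \<le> t \<and> 0 \<le> z + r $ i * t} t)"
      unfolding e3 F_def e1 e2 by (simp only: mult.assoc)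
  qed
  also have "\<dots> = ennreal (exp (A $ i $ i * s)) * jump_first A r f i z"
    unfolding jump_first_def by (rule nn_integral_cmult) measurable
  finally show ?thesis using True by (simp add: s_def)
qed

lemma exit_first_shift:
  assumes "0 \<le> y" "0 \<le> z"
  shows "exit_first A r i j (y + z) = (if r $ i < 0 then ennreal (exp (A $ i $ i * (y / - r $ i))) * exit_first A r i j z else 0)"
proof -
  have "ennreal (exp (a * ((y + z) / b))) = ennreal (exp (a * (y / b))) * ennreal (exp (a * (z / b)))" for a b
    by (simp add: ennreal_mult[symmetric] exp_add[symmetric] add_divide_distrib distrib_left)
  from this[of "A $ i $ i" "- r $ i"] show ?thesis by (auto simp: exit_first_def)
qed

lemma exit_first_sum:
  "(\<Sum>k\<in>UNIV. exit_first A r i k y * c k) = (if r $ i < 0 then ennreal (exp (A $ i $ i * (y / - r $ i))) * c i else 0)"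
proof -
  have "(\<Sum>k\<in>UNIV. exit_first A r i k y * c k)
    = (\<Sum>k\<in>UNIV. if k = i then (if r $ i < 0 then ennreal (exp (A $ i $ i * (y / - r $ i))) * c i else 0) else 0)"
    by (intro sum.cong) (auto simp: exit_first_def)
  then show ?thesis by simp
qed

text \<open>To descend by \<open>y + z\<close> is to descend by \<open>y\<close> and then, from the phase in which this happened,
  by \<open>z\<close>.  As functions of \<open>y\<close>, both sides are the least solution of one and the same system, in
  which leaving through level \<open>-y\<close> in phase \<open>k\<close> is rewarded with the probability from \<open>k\<close>.\<close>

lemma first_passage_semigroup:
  assumes y: "0 \<le> y" and z: "0 \<le> z"
  shows "first_passage A r i j (y + z) = (\<Sum>k\<in>UNIV. first_passage A r i k y * first_passage A r k j z)"
proof (rule antisym)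
  have "passage A r n i j (y + z) \<le> (\<Sum>k\<in>UNIV. first_passage A r i k y * first_passage A r k j z)" for n
    using y
  proof (induction n arbitrary: i y)
    case (Suc n)
    let ?e = "\<lambda>X. if r $ i < 0 then ennreal (exp (A $ i $ i * (y / - r $ i))) * X else 0"
    have "passage A r (Suc n) i j (y + z) = ?e (exit_first A r i j z) + (jump_first A r (\<lambda>k w. passage A r n k j (w + z)) i y
        + ?e (jump_first A r (\<lambda>k. passage A r n k j) i z))"
      unfolding passage.simps exit_first_shift[OF Suc.prems z]
      by (subst jump_first_shift[OF _ Suc.prems z]) simp_all
    also have "\<dots> = ?e (passage A r (Suc n) i j z) + jump_first A r (\<lambda>k w. passage A r n k j (w + z)) i y"
      by (simp add: distrib_left add_ac)
    also have "\<dots> \<le> ?e (first_passage A r i j z) + jump_first A r (\<lambda>l w. \<Sum>k\<in>UNIV. first_passage A r l k w * first_passage A r k j z) i y"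
    proof (rule add_mono)
      show "?e (passage A r (Suc n) i j z) \<le> ?e (first_passage A r i j z)"
        using passage_le_first_passage[of A r "Suc n" i j z] by (auto intro: mult_left_mono simp del: passage.simps)
    qed (intro jump_first_mono Suc.IH)
    also have "\<dots> = (\<Sum>k\<in>UNIV. (exit_first A r i k y + jump_first A r (\<lambda>l. first_passage A r l k) i y) * first_passage A r k j z)"
      by (subst jump_first_linear) (simp_all add: distrib_right sum.distrib exit_first_sum)
    finally show ?case by (simp only: first_passage_eq[symmetric])
  qed simp
  then show "first_passage A r i j (y + z) \<le> (\<Sum>k\<in>UNIV. first_passage A r i k y * first_passage A r k j z)"
    unfolding first_passage_def[of A r i j "y + z"] by (rule SUP_least)
next
  have "(\<Sum>k\<in>UNIV. passage A r n i k y * first_passage A r k j z) \<le> first_passage A r i j (y + z)" for n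
    using y
  proof (induction n arbitrary: i y)
    case (Suc n)
    let ?e = "\<lambda>X. if r $ i < 0 then ennreal (exp (A $ i $ i * (y / - r $ i))) * X else 0"
    have "(\<Sum>k\<in>UNIV. passage A r (Suc n) i k y * first_passage A r k j z)
        = ?e (first_passage A r i j z) + jump_first A r (\<lambda>l w. \<Sum>k\<in>UNIV. passage A r n l k w * first_passage A r k j z) i y"
      by (subst jump_first_linear) (simp_all add: distrib_right sum.distrib exit_first_sum)
    also have "\<dots> \<le> ?e (first_passage A r i j z) + jump_first A r (\<lambda>k w. first_passage A r k j (w + z)) i y"
      by (intro add_left_mono jump_first_mono Suc.IH)
    also have "\<dots> = ?e (exit_first A r i j z) + (jump_first A r (\<lambda>k w. first_passage A r k j (w + z)) i y
        + ?e (jump_first A r (\<lambda>k. first_passage A r k j) i z))"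
      by (subst first_passage_eq[of A r i j z]) (simp add: distrib_left add_ac)
    also have "\<dots> = first_passage A r i j (y + z)"
      unfolding first_passage_eq[of A r i j "y + z"] exit_first_shift[OF Suc.prems z]
      by (subst jump_first_shift[OF _ Suc.prems z]) simp_all
    finally show ?case .
  qed simp
  moreover have "(\<Sum>k\<in>UNIV. first_passage A r i k y * first_passage A r k j z)
      = (SUP n. \<Sum>k\<in>UNIV. passage A r n i k y * first_passage A r k j z)"
    unfolding first_passage_def[of A r i _ y] SUP_mult_right_ennreal
    by (rule ennreal_SUP_sum[symmetric]) (auto simp: incseq_def intro: mult_right_mono passage_mono)
  ultimately show "(\<Sum>k\<in>UNIV. first_passage A r i k y * first_passage A r k j z) \<le> first_passage A r i j (y + z)"
    by (auto intro: SUP_least)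
qed

section \<open>Supersolutions\<close>

text \<open>The drift condition says that \<open>f\<close>, evaluated at the phase and the height, is a
  supermartingale up to the passage; \<open>\<beta>\<close> is the reward at the passage.  Analytically, \<open>f\<close> is a
  supersolution of the first jump decomposition, and the iterates, which start from zero, stay below
  it.\<close>

lemma passage_supersolution:
  fixes A :: "real^'s^'s" and f f' :: "'s \<Rightarrow> real \<Rightarrow> real"
  assumes gen: "generator A"
    and deriv: "\<And>i y. (f i has_real_derivative f' i y) (at y)"
    and [measurable]: "\<And>i. f' i \<in> borel_measurable borel"
    and nonneg: "\<And>i y. 0 \<le> y \<Longrightarrow> 0 \<le> f i y"
    and super: "\<And>i y. 0 \<le> y \<Longrightarrow> r $ i * f' i y + (\<Sum>k\<in>UNIV. A $ i $ k * f k y) \<le> 0"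
    and \<beta>: "\<And>j. r $ j < 0 \<Longrightarrow> \<beta> j \<le> f j 0"
    and y: "0 \<le> y"
  shows "(\<Sum>j\<in>UNIV. first_passage A r i j y * ennreal (\<beta> j)) \<le> ennreal (f i y)"
proof -
  have cont: "isCont (f i) y" for i y using deriv by (rule DERIV_isCont)
  have [measurable]: "f i \<in> borel_measurable borel" for i
    by (intro borel_measurable_continuous_onI continuous_at_imp_continuous_on) (use cont in blast)
  have step: "(if r $ i < 0 then ennreal (exp (A $ i $ i * (y / - r $ i))) * ennreal (\<beta> i) else 0)
      + jump_first A r (\<lambda>k y. ennreal (f k y)) i y \<le> ennreal (f i y)" if y: "0 \<le> y" for i y
  proof -
    \<comment> \<open>the negated value along a path without jumps, times the probability of no jump; by the drift condition its derivative dominates the integrand of \<open>jump_first\<close>\<close>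
    define \<phi> where "\<phi> t = - exp (A $ i $ i * t) * f i (y + r $ i * t)" for t
    define \<phi>' where "\<phi>' t = - exp (A $ i $ i * t) * (A $ i $ i * f i (y + r $ i * t) + r $ i * f' i (y + r $ i * t))" for t
    have d: "(\<phi> has_real_derivative \<phi>' t) (at t)" for t
    proof -
      have "((\<lambda>t. f i (y + r $ i * t)) has_real_derivative f' i (y + r $ i * t) * r $ i) (at t)"
        by (rule DERIV_chain'[OF _ deriv]) (auto intro!: derivative_eq_intros)
      then show ?thesis unfolding \<phi>_def \<phi>'_def
        by (auto intro!: derivative_eq_intros simp: algebra_simps)
    qed
    have [measurable]: "\<phi>' \<in> borel_measurable borel" unfolding \<phi>'_def by measurable
    have sum_nn: "0 \<le> (\<Sum>k\<in>UNIV - {i}. A $ i $ k * f k w)" if "0 \<le> w" for w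
      using gen nonneg that by (intro sum_nonneg mult_nonneg_nonneg) (auto simp: generator_def)
    have ge: "exp (A $ i $ i * t) * (\<Sum>k\<in>UNIV - {i}. A $ i $ k * f k (y + r $ i * t)) \<le> \<phi>' t"
      if "0 \<le> y + r $ i * t" for t
    proof -
      have "(\<Sum>k\<in>UNIV. A $ i $ k * f k (y + r $ i * t))
          = A $ i $ i * f i (y + r $ i * t) + (\<Sum>k\<in>UNIV - {i}. A $ i $ k * f k (y + r $ i * t))"
        by (subst sum.remove[of _ i]) auto
      then have "(\<Sum>k\<in>UNIV - {i}. A $ i $ k * f k (y + r $ i * t))
          \<le> - (A $ i $ i * f i (y + r $ i * t) + r $ i * f' i (y + r $ i * t))"
        using super[OF that, of i] by linarith
      then have "exp (A $ i $ i * t) * (\<Sum>k\<in>UNIV - {i}. A $ i $ k * f k (y + r $ i * t))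
          \<le> exp (A $ i $ i * t) * - (A $ i $ i * f i (y + r $ i * t) + r $ i * f' i (y + r $ i * t))"
        by (rule mult_left_mono) simp
      then show ?thesis unfolding \<phi>'_def by (simp only: mult_minus_left mult_minus_right)
    qed
    have nn: "0 \<le> \<phi>' t" if "0 \<le> y + r $ i * t" for t
      using ge[OF that] sum_nn[OF that] by (meson exp_ge_zero mult_nonneg_nonneg order_trans)
    have J: "jump_first A r (\<lambda>k y. ennreal (f k y)) i y
        \<le> (\<integral>\<^sup>+t. ennreal (\<phi>' t) * indicator {t. 0 \<le> t \<and> 0 \<le> y + r $ i * t} t \<partial>lborel)"
      unfolding jump_first_def
    proof (intro nn_integral_mono)
      fix t
      show "ennreal (exp (A $ i $ i * t)) * (\<Sum>k\<in>UNIV - {i}. ennreal (A $ i $ k) * ennreal (f k (y + r $ i * t)))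
         * indicator {t. 0 \<le> t \<and> 0 \<le> y + r $ i * t} t
         \<le> ennreal (\<phi>' t) * indicator {t. 0 \<le> t \<and> 0 \<le> y + r $ i * t} t"
      proof (cases "0 \<le> y + r $ i * t")
        case True
        have "(\<Sum>k\<in>UNIV - {i}. ennreal (A $ i $ k) * ennreal (f k (y + r $ i * t)))
            = (\<Sum>k\<in>UNIV - {i}. ennreal (A $ i $ k * f k (y + r $ i * t)))"
          using gen nonneg[OF True] by (intro sum.cong) (auto simp: generator_def ennreal_mult)
        also have "\<dots> = ennreal (\<Sum>k\<in>UNIV - {i}. A $ i $ k * f k (y + r $ i * t))"
          using gen nonneg[OF True] by (intro sum_ennreal) (auto simp: generator_def)
        finally have "ennreal (exp (A $ i $ i * t)) * (\<Sum>k\<in>UNIV - {i}. ennreal (A $ i $ k) * ennreal (f k (y + r $ i * t)))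
            = ennreal (exp (A $ i $ i * t) * (\<Sum>k\<in>UNIV - {i}. A $ i $ k * f k (y + r $ i * t)))"
          using sum_nn[OF True] by (simp add: ennreal_mult)
        also have "\<dots> \<le> ennreal (\<phi>' t)" using ge[OF True] by (rule ennreal_leI)
        finally show ?thesis by (rule mult_right_mono) simp
      qed simp
    qed
    have FTC: "(\<integral>\<^sup>+t. ennreal (\<phi>' t) * indicator {0..s} t \<partial>lborel) = ennreal (\<phi> s - \<phi> 0)"
      if s: "0 \<le> s" "\<And>t. 0 \<le> t \<Longrightarrow> t \<le> s \<Longrightarrow> 0 \<le> y + r $ i * t" for s
      using s nn d by (intro nn_integral_FTC_Icc) auto
    show ?thesis
    proof (cases "r $ i < 0")
      case True
      define s where "s = y / - r $ i"
      have s: "0 \<le> s" "y + r $ i * s = 0" using y True by (auto simp: s_def divide_nonneg_neg)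
      have le: "0 \<le> y + r $ i * t \<longleftrightarrow> t \<le> s" for t using True by (auto simp: s_def field_simps)
      have "jump_first A r (\<lambda>k y. ennreal (f k y)) i y \<le> ennreal (\<phi> s - \<phi> 0)"
        using J FTC[of s] s(1) unfolding le by (simp add: atLeastAtMost_def atLeast_def atMost_def Int_def)
      moreover have "ennreal (exp (A $ i $ i * s)) * ennreal (\<beta> i) \<le> ennreal (exp (A $ i $ i * s) * f i 0)"
        using \<beta>[OF True] by (simp add: ennreal_mult' ennreal_leI mult_left_mono)
      moreover have "\<phi> s - \<phi> 0 = f i y - exp (A $ i $ i * s) * f i 0"
        using s(2) by (simp add: \<phi>_def)
      moreover have "0 \<le> \<phi> s - \<phi> 0"
        using DERIV_nonneg_imp_nondecreasing[OF s(1), of \<phi>] d nn le by force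
      ultimately have "ennreal (exp (A $ i $ i * s)) * ennreal (\<beta> i) + jump_first A r (\<lambda>k y. ennreal (f k y)) i y
          \<le> ennreal (exp (A $ i $ i * s) * f i 0) + ennreal (f i y - exp (A $ i $ i * s) * f i 0)"
        by (simp add: add_mono)
      also have "\<dots> = ennreal (f i y)"
        using nonneg[of 0 i] \<open>0 \<le> \<phi> s - \<phi> 0\<close> \<open>\<phi> s - \<phi> 0 = _\<close> by (subst ennreal_plus[symmetric]) auto
      finally show ?thesis using True by (simp add: s_def)
    next
      case False
      have pos: "0 \<le> y + r $ i * t" if "0 \<le> t" for t using False y that by simp
      have "jump_first A r (\<lambda>k y. ennreal (f k y)) i y
        \<le> (\<integral>\<^sup>+t. (SUP n. ennreal (\<phi>' t) * indicator {0..real n} t) \<partial>lborel)"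
      proof (rule order_trans[OF J], intro nn_integral_mono)
        fix t :: real
        obtain n where "t \<le> real n" using real_arch_simple by blast
        then have "ennreal (\<phi>' t) * indicator {t. 0 \<le> t \<and> 0 \<le> y + r $ i * t} t \<le> ennreal (\<phi>' t) * indicator {0..real n} t"
          by (auto simp: indicator_def)
        then show "ennreal (\<phi>' t) * indicator {t. 0 \<le> t \<and> 0 \<le> y + r $ i * t} t
          \<le> (SUP n. ennreal (\<phi>' t) * indicator {0..real n} t)" by (rule SUP_upper2[OF UNIV_I])
      qed
      also have "\<dots> = (SUP n. \<integral>\<^sup>+t. ennreal (\<phi>' t) * indicator {0..real n} t \<partial>lborel)"
        by (rule nn_integral_monotone_convergence_SUP)
          (auto simp: incseq_def le_fun_def indicator_def)
      also have "\<dots> \<le> ennreal (f i y)"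
      proof (rule SUP_least)
        fix n
        have "\<phi> (real n) \<le> 0" using nonneg[OF pos, of "real n" i] by (simp add: \<phi>_def)
        then show "(\<integral>\<^sup>+t. ennreal (\<phi>' t) * indicator {0..real n} t \<partial>lborel) \<le> ennreal (f i y)"
          using FTC[of "real n"] pos by (simp add: \<phi>_def ennreal_leI)
      qed
      finally show ?thesis using False by simp
    qed
  qed
  have "(\<Sum>j\<in>UNIV. passage A r n i j y * ennreal (\<beta> j)) \<le> ennreal (f i y)" for n
    using y
  proof (induction n arbitrary: i y)
    case (Suc n)
    have "(\<Sum>j\<in>UNIV. passage A r (Suc n) i j y * ennreal (\<beta> j))
        = (if r $ i < 0 then ennreal (exp (A $ i $ i * (y / - r $ i))) * ennreal (\<beta> i) else 0)
          + jump_first A r (\<lambda>l w. \<Sum>j\<in>UNIV. passage A r n l j w * ennreal (\<beta> j)) i y"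
      by (subst jump_first_linear) (simp_all add: distrib_right sum.distrib exit_first_sum)
    also have "\<dots> \<le> (if r $ i < 0 then ennreal (exp (A $ i $ i * (y / - r $ i))) * ennreal (\<beta> i) else 0)
          + jump_first A r (\<lambda>k y. ennreal (f k y)) i y"
      by (intro add_left_mono jump_first_mono Suc.IH)
    also have "\<dots> \<le> ennreal (f i y)" by (rule step[OF Suc.prems])
    finally show ?case .
  qed simp
  moreover have "(\<Sum>j\<in>UNIV. first_passage A r i j y * ennreal (\<beta> j))
      = (SUP n. \<Sum>j\<in>UNIV. passage A r n i j y * ennreal (\<beta> j))"
    unfolding first_passage_def SUP_mult_right_ennreal
    by (rule ennreal_SUP_sum[symmetric]) (auto simp: incseq_def intro: mult_right_mono passage_mono)
  ultimately show ?thesis by (auto intro: SUP_least)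
qed

text \<open>Adding a multiple \<open>q\<close> of the identity makes the matrix nonnegative; the power series of its
  exponential has nonnegative terms, and the factor \<open>exp (- q y)\<close> undoes the shift.\<close>

lemma metzler_exponential:
  fixes U :: "'s::finite \<Rightarrow> 's \<Rightarrow> real"
  assumes off: "\<And>k l. k \<noteq> l \<Longrightarrow> 0 \<le> U k l"
  shows "\<exists>E. (\<forall>k j y. (E k j has_real_derivative (\<Sum>l\<in>UNIV. U k l * E l j y)) (at y))
    \<and> (\<forall>k j. E k j 0 = (if k = j then 1 else 0)) \<and> (\<forall>k j. \<forall>y\<ge>0. 0 \<le> E k j y)"
proof -
  define q where "q = (\<Sum>k\<in>UNIV. \<bar>U k k\<bar>)"
  define P where "P k l = U k l + (if k = l then q else 0)" for k l
  have "\<bar>U k k\<bar> \<le> q" for k unfolding q_def by (rule member_le_sum) auto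
  then have P: "0 \<le> P k l" for k l using off[of k l] by (auto simp: P_def abs_le_iff) (smt (verit))
  define c where "c = (\<Sum>k\<in>UNIV. \<Sum>l\<in>UNIV. P k l)"
  define W where "W = rec_nat (\<lambda>k j. if k = j then 1 else (0::real)) (\<lambda>n w k j. \<Sum>l\<in>UNIV. P k l * w l j)"
  have W0: "W 0 k j = (if k = j then 1 else 0)" and WS: "W (Suc n) k j = (\<Sum>l\<in>UNIV. P k l * W n l j)" for n k j
    by (simp_all add: W_def)
  have Wnn: "0 \<le> W n k j" for n k j
    by (induction n arbitrary: k) (auto simp: W0 WS intro!: sum_nonneg mult_nonneg_nonneg P)
  have row: "(\<Sum>l\<in>UNIV. P k l) \<le> c" for k
    unfolding c_def by (rule member_le_sum[of k UNIV "\<lambda>k. \<Sum>l\<in>UNIV. P k l"]) (auto intro: sum_nonneg P)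
  have c: "0 \<le> c" unfolding c_def by (intro sum_nonneg P)
  have Wle: "W n k j \<le> c ^ n" for n k j
  proof (induction n arbitrary: k)
    case (Suc n)
    have "W (Suc n) k j \<le> (\<Sum>l\<in>UNIV. P k l * c ^ n)"
      unfolding WS by (intro sum_mono mult_left_mono Suc.IH P)
    also have "\<dots> \<le> c * c ^ n" using row[of k] c by (simp add: sum_distrib_right[symmetric] mult_right_mono)
    finally show ?case by simp
  qed (simp add: W0)
  define w where "w k j n = W n k j / fact n" for k j n
  have summ: "summable (\<lambda>n. w k j n * y ^ n)" for k j y
  proof (rule summable_comparison_test'[where N = 0])
    show "summable (\<lambda>n. (c * \<bar>y\<bar>) ^ n / fact n)" by (rule summable_exp[of "c * \<bar>y\<bar>", unfolded divide_inverse mult.commute[of "inverse _"] , folded divide_inverse])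
    show "norm (w k j n * y ^ n) \<le> (c * \<bar>y\<bar>) ^ n / fact n" for n
      using Wnn[of n k j] Wle[of n k j]
      by (simp add: w_def abs_mult power_abs power_mult_distrib divide_right_mono mult_right_mono)
  qed
  define p where "p k j y = (\<Sum>n. w k j n * y ^ n)" for k j y
  have dp: "(p k j has_real_derivative (\<Sum>l\<in>UNIV. P k l * p l j y)) (at y)" for k j y
  proof -
    have "diffs (w k j) n * y ^ n = (\<Sum>l\<in>UNIV. P k l * (w l j n * y ^ n))" for n
    proof -
      have "diffs (w k j) n = W (Suc n) k j / fact n"
        by (simp add: diffs_def w_def divide_simps del: of_nat_Suc)
      then show ?thesis by (simp add: WS w_def sum_distrib_right sum_divide_distrib mult.assoc)
    qed
    then have "(\<Sum>n. diffs (w k j) n * y ^ n) = (\<Sum>l\<in>UNIV. P k l * p l j y)"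
      unfolding p_def using summ by (simp add: suminf_sum summable_mult suminf_mult)
    moreover have "(p k j has_real_derivative (\<Sum>n. diffs (w k j) n * y ^ n)) (at y)"
      unfolding p_def[abs_def] by (rule termdiffs_strong_converges_everywhere[OF summ])
    ultimately show ?thesis by simp
  qed
  define E where "E k j y = exp (- q * y) * p k j y" for k j y
  show ?thesis
  proof (intro exI[of _ E] conjI allI impI)
    fix k j and y :: real
    have "(E k j has_real_derivative (exp (- q * y) * (\<Sum>l\<in>UNIV. P k l * p l j y) + exp (- q * y) * (- q) * p k j y)) (at y)"
      unfolding E_def[abs_def] by (rule derivative_eq_intros dp refl | simp)+
    moreover have "(\<Sum>l\<in>UNIV. P k l * p l j y) = (\<Sum>l\<in>UNIV. U k l * p l j y) + q * p k j y"
    proof -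
      have "(\<Sum>l\<in>UNIV. P k l * p l j y) = (\<Sum>l\<in>UNIV. U k l * p l j y + (if k = l then q * p k j y else 0))"
        by (intro sum.cong) (auto simp: P_def distrib_right)
      then show ?thesis by (simp add: sum.distrib)
    qed
    ultimately show "(E k j has_real_derivative (\<Sum>l\<in>UNIV. U k l * E l j y)) (at y)"
      by (simp add: E_def algebra_simps sum_distrib_left)
    show "E k j 0 = (if k = j then 1 else 0)"
      unfolding E_def p_def powser_zero by (simp add: w_def W0)
    show "0 \<le> E k j y" if "0 \<le> y"
      unfolding E_def p_def using that by (intro mult_nonneg_nonneg suminf_nonneg summ) (auto simp: w_def Wnn)
  qed
qed

section \<open>Return probabilities: minimality\<close>

definition return_prob :: "real^'s^'s \<Rightarrow> real^'s \<Rightarrow> 's \<Rightarrow> 's \<Rightarrow> real" where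
  "return_prob A r i j = enn2real (first_passage A r i j 0)"

lemma return_prob_nonneg: "0 \<le> return_prob A r i j"
  by (simp add: return_prob_def)

lemma first_return_eq_return_prob:
  assumes "generator A" "\<And>i. ctmc A i (P i) \<phi>" "0 < r $ i" "r $ j < 0"
  shows "first_return P \<phi> r $ i $ j = return_prob A r i j"
proof -
  have "0 \<le> first_return P \<phi> r $ i $ j" by (simp add: first_return_def)
  then show ?thesis
    using first_return_eq_SUP_passage[OF assms] by (simp add: return_prob_def first_passage_def)
      (metis enn2real_ennreal)
qed

lemma first_passage_sum_le:
  assumes "generator A" "0 \<le> y" shows "(\<Sum>j\<in>UNIV. first_passage A r i j y) \<le> 1"
  using passage_supersolution[where f = "\<lambda>_ _. 1" and f' = "\<lambda>_ _. 0" and \<beta> = "\<lambda>_. 1" and A = A and r = r and y = y and i = i] assms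
  by (simp add: generator_def)

lemma first_passage_le_1:
  assumes "generator A" "0 \<le> y" shows "first_passage A r i j y \<le> 1"
  using first_passage_sum_le[OF assms, of r i] member_le_sum[of j UNIV "\<lambda>j. first_passage A r i j y"]
  by (auto intro: order_trans)

lemma first_passage_real:
  assumes "generator A" "0 \<le> y" shows "first_passage A r i j y = ennreal (enn2real (first_passage A r i j y))"
  using first_passage_le_1[OF assms, of r i j] le_less_trans[OF _ ennreal_one_less_top] by (metis ennreal_enn2real)

lemma first_passage_nondescending:
  assumes "0 \<le> r $ j" shows "first_passage A r i j y = 0"
proof -
  have "passage A r n i j y = 0" for n
  proof (induction n arbitrary: i y)
    case (Suc n)
    then show ?case using assms by (auto simp: exit_first_def jump_first_def)
  qed simp
  then show ?thesis by (simp add: first_passage_def)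
qed

lemma supersolution_return_prob:
  fixes A :: "real^'s^'s" and f f' :: "'s \<Rightarrow> real \<Rightarrow> real"
  assumes gen: "generator A"
    and deriv: "\<And>i y. (f i has_real_derivative f' i y) (at y)"
    and "\<And>i. f' i \<in> borel_measurable borel"
    and "\<And>i y. 0 \<le> y \<Longrightarrow> 0 \<le> f i y"
    and "\<And>i y. 0 \<le> y \<Longrightarrow> r $ i * f' i y + (\<Sum>k\<in>UNIV. A $ i $ k * f k y) \<le> 0"
    and \<beta>: "\<And>j. r $ j < 0 \<Longrightarrow> \<beta> j \<le> f j 0" and \<beta>0: "\<And>j. 0 \<le> \<beta> j"
  shows "(\<Sum>j\<in>UNIV. return_prob A r i j * \<beta> j) \<le> f i 0"
proof -
  have "(\<Sum>j\<in>UNIV. first_passage A r i j 0 * ennreal (\<beta> j)) \<le> ennreal (f i 0)"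
    by (rule passage_supersolution) (use assms in auto)
  also have "(\<Sum>j\<in>UNIV. first_passage A r i j 0 * ennreal (\<beta> j)) = (\<Sum>j\<in>UNIV. ennreal (return_prob A r i j * \<beta> j))"
    using first_passage_real[OF gen order_refl, of r i] \<beta>0
    by (intro sum.cong) (simp_all add: ennreal_mult return_prob_def)
  also have "\<dots> = ennreal (\<Sum>j\<in>UNIV. return_prob A r i j * \<beta> j)"
    using \<beta>0 by (intro sum_ennreal) (simp add: return_prob_nonneg)
  finally show ?thesis using assms(4)[of 0 i] by (simp add: ennreal_le_iff)
qed

text \<open>With \<open>U\<close> the descending block of the generator of the phase at successive minima that \<open>X\<close>
  suggests, \<open>f i y\<close> is the \<open>(i, j)\<close> entry of \<open>X exp (U y)\<close>.  The inequalities for \<open>X\<close> are exactly the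
  drift condition for \<open>f\<close>, and \<open>f\<close> agrees with \<open>X\<close> at height zero.\<close>

lemma return_prob_minimal:
  fixes A :: "real^'s^'s" and X :: "'s \<Rightarrow> 's \<Rightarrow> real"
  assumes gen: "generator A"
    and X: "\<And>i j. 0 \<le> X i j"
    and Xm: "\<And>i j. r $ i < 0 \<Longrightarrow> X i j = (if i = j then 1 else 0)"
    and X0: "\<And>i j. r $ i = 0 \<Longrightarrow> r $ j < 0 \<Longrightarrow> (\<Sum>k\<in>UNIV. A $ i $ k * X k j) \<le> 0"
    and Xp: "\<And>i j. 0 < r $ i \<Longrightarrow> r $ j < 0 \<Longrightarrow> (\<Sum>k\<in>UNIV. A $ i $ k * X k j) / r $ i
        + (\<Sum>k | r $ k < 0. X i k * ((\<Sum>l\<in>UNIV. A $ k $ l * X l j) / - r $ k)) \<le> 0"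
    and j: "r $ j < 0"
  shows "return_prob A r i j \<le> X i j"
proof -
  let ?M = "{k. r $ k < 0}"
  define AX where "AX i j = (\<Sum>k\<in>UNIV. A $ i $ k * X k j)" for i j
  define U where "U k l = (if r $ k < 0 \<and> r $ l < 0 then AX k l / - r $ k else 0)" for k l
  have offU: "0 \<le> U k l" if "k \<noteq> l" for k l
  proof (cases "r $ k < 0 \<and> r $ l < 0")
    case True
    have "0 \<le> A $ k $ m * X m l" for m
      using gen X[of m l] Xm[of k l] True that by (cases "m = k") (auto simp: generator_def)
    then have "0 \<le> AX k l" unfolding AX_def by (intro sum_nonneg)
    then show ?thesis using True by (auto simp: U_def intro: divide_nonneg_pos simp del: divide_minus_right)
  qed (auto simp: U_def)
  obtain E where E: "\<And>k j y. (E k j has_real_derivative (\<Sum>l\<in>UNIV. U k l * E l j y)) (at y)"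
    "\<And>k j. E k j 0 = (if k = j then 1 else 0)" "\<And>k j y. 0 \<le> y \<Longrightarrow> 0 \<le> E k j y"
    using metzler_exponential[of U, OF offU] by blast
  have UE: "(\<Sum>l\<in>UNIV. U k l * E l j y) = (\<Sum>l\<in>?M. U k l * E l j y)" for k y
    by (rule sum.mono_neutral_right) (auto simp: U_def)
  define f where "f i y = (\<Sum>k\<in>?M. X i k * E k j y)" for i y
  define f' where "f' i y = (\<Sum>k\<in>?M. X i k * (\<Sum>l\<in>?M. U k l * E l j y))" for i y
  have cont: "continuous_on UNIV (E k j)" for k
    using E(1) by (intro DERIV_continuous_on) (blast intro: has_field_derivative_at_within)
  have f0: "f m 0 = X m j" for m
    unfolding f_def using j by (simp add: E(2) if_distrib cong: if_cong)
  have "(\<Sum>l\<in>UNIV. return_prob A r i l * (if l = j then 1 else 0)) \<le> f i 0"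
  proof (rule supersolution_return_prob[OF gen, where f' = f'])
    show "(f i has_real_derivative f' i y) (at y)" for i y
      unfolding f_def[abs_def] f'_def UE[symmetric] by (intro DERIV_sum DERIV_cmult E)
    show "f' i \<in> borel_measurable borel" for i
      unfolding f'_def[abs_def]
      by (intro borel_measurable_continuous_onI continuous_intros cont)
    show "0 \<le> f i y" if "0 \<le> y" for i y
      unfolding f_def using that by (intro sum_nonneg mult_nonneg_nonneg X E)
    show "r $ i * f' i y + (\<Sum>k\<in>UNIV. A $ i $ k * f k y) \<le> 0" if y: "0 \<le> y" for i y
    proof -
      have "(\<Sum>k\<in>UNIV. A $ i $ k * f k y) = (\<Sum>l\<in>?M. AX i l * E l j y)"
        unfolding f_def AX_def sum_distrib_left sum_distrib_right
        by (subst sum.swap) (simp add: mult.assoc)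
      moreover have "f' i y = (\<Sum>l\<in>?M. (\<Sum>k\<in>?M. X i k * U k l) * E l j y)"
        unfolding f'_def sum_distrib_left sum_distrib_right
        by (subst sum.swap) (simp add: mult.assoc)
      ultimately have "r $ i * f' i y + (\<Sum>k\<in>UNIV. A $ i $ k * f k y)
          = (\<Sum>l\<in>?M. (r $ i * (\<Sum>k\<in>?M. X i k * U k l) + AX i l) * E l j y)"
        by (simp add: sum_distrib_left sum.distrib[symmetric] algebra_simps)
      also have "\<dots> \<le> 0"
      proof (intro sum_nonpos mult_nonpos_nonneg E y)
        fix l assume "l \<in> ?M"
        then have l: "r $ l < 0" by simp
        consider "r $ i < 0" | "r $ i = 0" | "0 < r $ i" by linarith
        then show "r $ i * (\<Sum>k\<in>?M. X i k * U k l) + AX i l \<le> 0"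
        proof cases
          case 1
          have "(\<Sum>k\<in>?M. X i k * U k l) = (\<Sum>k\<in>?M. if k = i then U i l else 0)"
            by (intro sum.cong) (use Xm[OF 1] in auto)
          also have "\<dots> = U i l" using 1 by simp
          finally show ?thesis using 1 l by (simp add: U_def)
        next
          case 2
          then show ?thesis using X0[OF 2 l] by (simp add: AX_def)
        next
          case 3
          have "(\<Sum>k\<in>?M. X i k * U k l) = (\<Sum>k | r $ k < 0. X i k * (AX k l / - r $ k))"
            by (intro sum.cong) (auto simp: U_def l)
          then have "AX i l / r $ i + (\<Sum>k\<in>?M. X i k * U k l) \<le> 0"
            using Xp[OF 3 l] by (simp add: AX_def)
          then have "r $ i * (AX i l / r $ i + (\<Sum>k\<in>?M. X i k * U k l)) \<le> 0"
            using 3 by (simp add: mult_nonneg_nonpos)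
          then show ?thesis using 3 by (simp add: distrib_left add.commute)
        qed
      qed
      finally show ?thesis .
    qed
    show "(if k = j then 1 else 0) \<le> f k 0" if "r $ k < 0" for k
      unfolding f0 using Xm[OF that] by simp
  qed auto
  then show ?thesis unfolding f0 by (simp add: if_distrib cong: if_cong)
qed

section \<open>Return probabilities: the Riccati equation\<close>

lemma nn_integral_Icc:
  fixes h :: "real \<Rightarrow> real"
  assumes [measurable]: "h \<in> borel_measurable borel" and b: "\<And>t. 0 \<le> t \<Longrightarrow> t \<le> T \<Longrightarrow> 0 \<le> h t \<and> h t \<le> C"
  shows "h integrable_on {0..T}"
    "(\<integral>\<^sup>+t. ennreal (h t) * indicator {0..T} t \<partial>lborel) = ennreal (integral {0..T} h)"
proof -
  have int: "integrable lborel (\<lambda>t. indicator {0..T} t *\<^sub>R h t)"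
    by (rule integrableI_bounded_set_indicator[where B = C]) (use b in \<open>auto intro!: AE_I2 simp: emeasure_lborel_Icc_eq\<close>)
  then have si: "set_integrable lborel {0..T} h" by (simp add: set_integrable_def)
  show "h integrable_on {0..T}" using set_borel_integral_eq_integral(1)[OF si] .
  have "(\<integral>\<^sup>+t. ennreal (h t) * indicator {0..T} t \<partial>lborel) = (\<integral>\<^sup>+t. ennreal (indicator {0..T} t *\<^sub>R h t) \<partial>lborel)"
    by (intro nn_integral_cong) (auto simp: indicator_def)
  also have "\<dots> = ennreal (\<integral>t. indicator {0..T} t *\<^sub>R h t \<partial>lborel)"
    by (rule nn_integral_eq_integral[OF int]) (use b in \<open>auto intro!: AE_I2 simp: indicator_def\<close>)
  also have "(\<integral>t. indicator {0..T} t *\<^sub>R h t \<partial>lborel) = integral {0..T} h"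
    using set_borel_integral_eq_integral(2)[OF si] by (simp add: set_lebesgue_integral_def)
  finally show "(\<integral>\<^sup>+t. ennreal (h t) * indicator {0..T} t \<partial>lborel) = ennreal (integral {0..T} h)" .
qed

lemma integral_average_at_right:
  fixes h :: "real \<Rightarrow> real"
  assumes "h integrable_on {0..1}" "(h \<longlongrightarrow> h 0) (at_right 0)"
  shows "((\<lambda>T. integral {0..T} h / T) \<longlongrightarrow> h 0) (at_right 0)"
proof -
  have at: "at 0 within {0..1::real} = at_right 0" by (rule at_within_Icc_at_right) simp
  have "((\<lambda>u. integral {0..u} h) has_vector_derivative h 0) (at 0 within {0..1} - {})"
    by (rule integral_has_vector_derivative_continuous_at) (use assms in \<open>auto simp: continuous_within at\<close>)
  then have "((\<lambda>u. integral {0..u} h) has_field_derivative h 0) (at_right 0)"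
    by (simp add: has_real_derivative_iff_has_vector_derivative at)
  then show ?thesis by (simp add: has_field_derivative_iff)
qed

lemma integral_tendsto_0_at_right:
  fixes h :: "real \<Rightarrow> real"
  assumes "h integrable_on {0..1}"
  shows "((\<lambda>T. integral {0..T} h) \<longlongrightarrow> 0) (at_right 0)"
proof -
  have at: "at 0 within {0..1::real} = at_right 0" by (rule at_within_Icc_at_right) simp
  have "continuous_on {0..1} (\<lambda>T. integral {0..T} h)"
    by (rule indefinite_integral_continuous_1[OF assms])
  then have "((\<lambda>T. integral {0..T} h) \<longlongrightarrow> integral {0..0} h) (at 0 within {0..1})"
    unfolding continuous_on_def by (rule bspec) simp
  then show ?thesis by (simp add: at)
qed

lemma tendsto_at_right_0_scale:
  fixes f :: "real \<Rightarrow> real"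
  assumes "((\<lambda>T. f (\<rho> * T)) \<longlongrightarrow> l) (at_right 0)" "0 < \<rho>"
  shows "(f \<longlongrightarrow> l) (at_right 0)"
proof -
  have "filterlim (\<lambda>y. (1 / \<rho>) * y) (at_right 0) (at_right 0)"
    by (rule filterlim_times_pos[OF filterlim_ident]) (use assms(2) in auto)
  from filterlim_compose[OF assms(1) this] show ?thesis using assms(2) by simp
qed

context
  fixes A :: "real^'s^'s" and r :: "real^'s"
  assumes gen: "generator A"
begin

private abbreviation "g i j y \<equiv> enn2real (first_passage A r i j y)"
private definition "B i j y = (\<Sum>k\<in>UNIV - {i}. A $ i $ k * g k j y)"

private lemma g_bounds: "0 \<le> y \<Longrightarrow> g i j y \<le> 1"
  using enn2real_mono[OF first_passage_le_1[OF gen, of y r i j]] by simp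

private lemma A_off: "i \<noteq> k \<Longrightarrow> 0 \<le> A $ i $ k"
  using gen by (simp add: generator_def)

private lemma B_nonneg: "0 \<le> B i j y"
  unfolding B_def by (intro sum_nonneg mult_nonneg_nonneg A_off) auto

private lemma B_le: "0 \<le> y \<Longrightarrow> B i j y \<le> - A $ i $ i"
proof -
  assume y: "0 \<le> y"
  have "B i j y \<le> (\<Sum>k\<in>UNIV - {i}. A $ i $ k * 1)"
    unfolding B_def by (intro sum_mono mult_left_mono A_off g_bounds y) auto
  then show ?thesis using generator_diag[OF gen, of i] by simp
qed

private lemma measurable_B [measurable]: "B i j \<in> borel_measurable borel"
  unfolding B_def[abs_def] by measurable

private lemma row_eq: "(\<Sum>k\<in>UNIV. A $ i $ k * g k j y) = A $ i $ i * g i j y + B i j y"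
  unfolding B_def by (subst sum.remove[of _ i]) auto

private lemma jump_first_B:
  "jump_first A r (\<lambda>k. first_passage A r k j) i y
    = (\<integral>\<^sup>+t. ennreal (exp (A $ i $ i * t) * B i j (y + r $ i * t)) * indicator {t. 0 \<le> t \<and> 0 \<le> y + r $ i * t} t \<partial>lborel)"
  unfolding jump_first_def
proof (intro nn_integral_cong)
  fix t :: real
  show "ennreal (exp (A $ i $ i * t)) * (\<Sum>k\<in>UNIV - {i}. ennreal (A $ i $ k) * first_passage A r k j (y + r $ i * t))
      * indicator {t. 0 \<le> t \<and> 0 \<le> y + r $ i * t} t
    = ennreal (exp (A $ i $ i * t) * B i j (y + r $ i * t)) * indicator {t. 0 \<le> t \<and> 0 \<le> y + r $ i * t} t"
  proof (cases "0 \<le> y + r $ i * t")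
    case True
    have "(\<Sum>k\<in>UNIV - {i}. ennreal (A $ i $ k) * first_passage A r k j (y + r $ i * t))
        = (\<Sum>k\<in>UNIV - {i}. ennreal (A $ i $ k * g k j (y + r $ i * t)))"
    proof (intro sum.cong refl)
      fix k assume "k \<in> UNIV - {i}"
      then show "ennreal (A $ i $ k) * first_passage A r k j (y + r $ i * t) = ennreal (A $ i $ k * g k j (y + r $ i * t))"
        using first_passage_real[OF gen True, of r k j] A_off[of i k] by (simp add: ennreal_mult)
    qed
    also have "\<dots> = ennreal (B i j (y + r $ i * t))"
      unfolding B_def by (intro sum_ennreal) (use A_off in auto)
    finally show ?thesis using B_nonneg by (simp add: ennreal_mult)
  qed simp
qed

private lemma g_descending:
  assumes r: "r $ i < 0" and T: "0 \<le> T"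
  shows "(\<lambda>s. exp (- A $ i $ i * s) * B i j (- r $ i * s)) integrable_on {0..T}"
    "g i j (- r $ i * T) = exp (A $ i $ i * T)
      * ((if i = j then 1 else 0) + integral {0..T} (\<lambda>s. exp (- A $ i $ i * s) * B i j (- r $ i * s)))"
proof -
  let ?h = "\<lambda>s. exp (- A $ i $ i * s) * B i j (- r $ i * s)"
  have a: "0 \<le> - A $ i $ i" using generator_diag_nonpos[OF gen, of i] by simp
  have b: "0 \<le> ?h s \<and> ?h s \<le> exp (- A $ i $ i * T) * (- A $ i $ i)" if "0 \<le> s" "s \<le> T" for s
  proof -
    have "0 \<le> - r $ i * s" using r that by (simp add: mult_nonpos_nonneg)
    moreover from a have "- A $ i $ i * s \<le> - A $ i $ i * T" using that a by (intro mult_left_mono) auto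
    then have "exp (- A $ i $ i * s) \<le> exp (- A $ i $ i * T)" by simp
    ultimately have "?h s \<le> exp (- A $ i $ i * T) * (- A $ i $ i)"
      by (intro mult_mono B_le B_nonneg exp_ge_zero)
    then show ?thesis using B_nonneg[of i j "- r $ i * s"] by simp
  qed
  have hm: "?h \<in> borel_measurable borel" by measurable
  show "?h integrable_on {0..T}" by (rule nn_integral_Icc(1)[OF hm b])
  have I: "0 \<le> integral {0..T} ?h" using b by (intro integral_nonneg nn_integral_Icc(1)[OF hm b]) auto
  have le: "0 \<le> - r $ i * T + r $ i * t \<longleftrightarrow> t \<le> T" for t using r by (simp add: mult.commute)
  have "jump_first A r (\<lambda>k. first_passage A r k j) i (- r $ i * T)
      = (\<integral>\<^sup>+t. ennreal (exp (A $ i $ i * t) * B i j (- r $ i * T + r $ i * t)) * indicator {0..T} t \<partial>lborel)"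
    unfolding jump_first_B le by (simp add: atLeastAtMost_def atLeast_def atMost_def Int_def)
  also have "\<dots> = (\<integral>\<^sup>+s. ennreal (exp (A $ i $ i * (T + - 1 * s)) * B i j (- r $ i * T + r $ i * (T + - 1 * s))) * indicator {0..T} (T + - 1 * s) \<partial>lborel)"
    by (subst nn_integral_real_affine[where c = "- 1" and t = T]) simp_all
  also have "\<dots> = (\<integral>\<^sup>+s. ennreal (exp (A $ i $ i * T)) * (ennreal (?h s) * indicator {0..T} s) \<partial>lborel)"
  proof (intro nn_integral_cong)
    fix s :: real
    have "exp (A $ i $ i * (T + - 1 * s)) = exp (A $ i $ i * T) * exp (- A $ i $ i * s)"
      by (simp add: exp_add[symmetric] algebra_simps)
    moreover have "- r $ i * T + r $ i * (T + - 1 * s) = - r $ i * s" by (simp add: algebra_simps)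
    ultimately show "ennreal (exp (A $ i $ i * (T + - 1 * s)) * B i j (- r $ i * T + r $ i * (T + - 1 * s))) * indicator {0..T} (T + - 1 * s)
      = ennreal (exp (A $ i $ i * T)) * (ennreal (?h s) * indicator {0..T} s)"
      by (auto simp: indicator_def ennreal_mult' mult.assoc)
  qed
  also have "\<dots> = ennreal (exp (A $ i $ i * T)) * ennreal (integral {0..T} ?h)"
  proof -
    have e: "(\<integral>\<^sup>+s. ennreal (?h s) * indicator {0..T} s \<partial>lborel) = ennreal (integral {0..T} ?h)"
      by (rule nn_integral_Icc(2)[OF hm b])
    show ?thesis unfolding e[symmetric] by (rule nn_integral_cmult) measurable
  qed
  finally have J: "jump_first A r (\<lambda>k. first_passage A r k j) i (- r $ i * T)
      = ennreal (exp (A $ i $ i * T)) * ennreal (integral {0..T} ?h)" .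
  have "- r $ i * T / - r $ i = T" using r by simp
  then have E: "exit_first A r i j (- r $ i * T) = ennreal (if i = j then exp (A $ i $ i * T) else 0)"
    unfolding exit_first_def using r by (simp only:) simp
  have "first_passage A r i j (- r $ i * T)
      = ennreal (if i = j then exp (A $ i $ i * T) else 0) + ennreal (exp (A $ i $ i * T) * integral {0..T} ?h)"
    unfolding first_passage_eq[of A r i j "- r $ i * T"] E J using I by (simp only: ennreal_mult[OF exp_ge_zero I])
  also have "\<dots> = ennreal (exp (A $ i $ i * T) * ((if i = j then 1 else 0) + integral {0..T} ?h))"
    using I by (subst ennreal_plus[symmetric]) (auto simp: distrib_left)
  finally show "g i j (- r $ i * T) = exp (A $ i $ i * T) * ((if i = j then 1 else 0) + integral {0..T} ?h)"
    using I by simp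
qed

private lemma g_ascending:
  assumes r: "0 < r $ i" and T: "0 \<le> T"
  shows "(\<lambda>t. exp (A $ i $ i * t) * B i j (r $ i * t)) integrable_on {0..T}"
    "g i j 0 = integral {0..T} (\<lambda>t. exp (A $ i $ i * t) * B i j (r $ i * t)) + exp (A $ i $ i * T) * g i j (r $ i * T)"
proof -
  let ?h = "\<lambda>t. exp (A $ i $ i * t) * B i j (r $ i * t)"
  have a: "A $ i $ i \<le> 0" by (rule generator_diag_nonpos[OF gen])
  have b: "0 \<le> ?h s \<and> ?h s \<le> 1 * (- A $ i $ i)" if "0 \<le> s" for s
  proof -
    have "0 \<le> r $ i * s" using r that by simp
    moreover have "A $ i $ i * s \<le> 0" using that a by (simp add: mult_nonpos_nonneg)
    then have "exp (A $ i $ i * s) \<le> 1" by simp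
    ultimately have "?h s \<le> 1 * (- A $ i $ i)"
      by (intro mult_mono B_le B_nonneg) simp_all
    then show ?thesis using B_nonneg[of i j "r $ i * s"] by simp
  qed
  then have b': "0 \<le> ?h s \<and> ?h s \<le> 1 * (- A $ i $ i)" if "0 \<le> s" "s \<le> T" for s using that by blast
  have hm[measurable]: "?h \<in> borel_measurable borel" by measurable
  show "?h integrable_on {0..T}" by (rule nn_integral_Icc(1)[OF hm b'])
  have I: "0 \<le> integral {0..T} ?h" using b by (intro integral_nonneg nn_integral_Icc(1)[OF hm b']) auto
  have fp: "first_passage A r i j y = (\<integral>\<^sup>+t. ennreal (exp (A $ i $ i * t) * B i j (y + r $ i * t)) * indicator {0..} t \<partial>lborel)"
    if "0 \<le> y" for y
  proof -
    have "{t. 0 \<le> t \<and> 0 \<le> y + r $ i * t} = {0..}" using r that by auto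
    then show ?thesis unfolding first_passage_eq[of A r i j y] exit_first_def jump_first_B using r by simp
  qed
  have "first_passage A r i j 0 = (\<integral>\<^sup>+t. ennreal (?h t) * indicator {0..} t \<partial>lborel)"
    using fp[of 0] by simp
  also have "\<dots> = (\<integral>\<^sup>+t. ennreal (?h t) * indicator {0..T} t + ennreal (?h t) * indicator {T..} t \<partial>lborel)"
    using AE_lborel_singleton[of T] T
    by (intro nn_integral_cong_AE, elim AE_mp, intro AE_I2 impI) (auto simp: indicator_def)
  also have "\<dots> = (\<integral>\<^sup>+t. ennreal (?h t) * indicator {0..T} t \<partial>lborel) + (\<integral>\<^sup>+t. ennreal (?h t) * indicator {T..} t \<partial>lborel)"
    by (rule nn_integral_add) measurable
  also have "(\<integral>\<^sup>+t. ennreal (?h t) * indicator {0..T} t \<partial>lborel) = ennreal (integral {0..T} ?h)"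
    by (rule nn_integral_Icc(2)[OF hm b'])
  also have "(\<integral>\<^sup>+t. ennreal (?h t) * indicator {T..} t \<partial>lborel) = (\<integral>\<^sup>+t. ennreal (?h (T + t)) * indicator {T..} (T + t) \<partial>lborel)"
    by (subst nn_integral_real_affine[where c = 1 and t = T]) simp_all
  also have "\<dots> = (\<integral>\<^sup>+t. ennreal (exp (A $ i $ i * T)) * (ennreal (exp (A $ i $ i * t) * B i j (r $ i * T + r $ i * t)) * indicator {0..} t) \<partial>lborel)"
    by (intro nn_integral_cong) (auto simp: indicator_def ennreal_mult' distrib_left exp_add mult.assoc)
  also have "\<dots> = ennreal (exp (A $ i $ i * T)) * first_passage A r i j (r $ i * T)"
    using r T by (subst nn_integral_cmult) (simp_all add: fp)
  also have "first_passage A r i j (r $ i * T) = ennreal (g i j (r $ i * T))"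
    using r T by (intro first_passage_real[OF gen]) simp
  finally have "first_passage A r i j 0 = ennreal (integral {0..T} ?h + exp (A $ i $ i * T) * g i j (r $ i * T))"
    using I by (simp add: ennreal_mult' ennreal_plus)
  moreover have "0 \<le> integral {0..T} ?h + exp (A $ i $ i * T) * g i j (r $ i * T)"
    using I by simp
  ultimately show "g i j 0 = integral {0..T} ?h + exp (A $ i $ i * T) * g i j (r $ i * T)"
    by (simp only: enn2real_ennreal)
qed

text \<open>In a phase of rate zero the height stays put, so the first jump decomposition is an algebraic
  equation; multiplied by the exit rate it is a row of the generator.\<close>

private lemma g_level:
  assumes r: "r $ i = 0" and y: "0 \<le> y"
  shows "(\<Sum>k\<in>UNIV. A $ i $ k * g k j y) = 0"
proof (cases "A $ i $ i = 0")
  case True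
  then show ?thesis unfolding row_eq using B_nonneg[of i j y] B_le[OF y, of i j] by simp
next
  case False
  define a where "a = - A $ i $ i"
  have a: "0 < a" using False generator_diag_nonpos[OF gen, of i] by (simp add: a_def)
  have "first_passage A r i j y = (\<integral>\<^sup>+t. ennreal (exp (- a * t) * B i j y) * indicator {0..} t \<partial>lborel)"
    unfolding first_passage_eq[of A r i j y] exit_first_def jump_first_B
    using r y by (simp add: a_def atLeast_def)
  also have "\<dots> = ennreal (0 - (- (B i j y / a) * exp (- a * 0)))"
  proof (rule nn_integral_FTC_atLeast)
    show "((\<lambda>t. - (B i j y / a) * exp (- a * t)) has_real_derivative exp (- a * x) * B i j y) (at x)" for x
      using a by (auto intro!: derivative_eq_intros)
    have "((\<lambda>t. exp (- a * t)) \<longlongrightarrow> 0) at_top"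
      using a by real_asymp
    from tendsto_mult_left[OF this, of "- (B i j y / a)"]
    show "((\<lambda>t. - (B i j y / a) * exp (- a * t)) \<longlongrightarrow> 0) at_top" by simp
  qed (auto intro!: mult_nonneg_nonneg B_nonneg)
  finally have "g i j y = B i j y / a" using B_nonneg[of i j y] a by simp
  then show ?thesis unfolding row_eq using a by (simp add: a_def field_simps)
qed

lemma return_prob_descending:
  assumes "r $ i < 0" shows "return_prob A r i j = (if i = j then 1 else 0)"
  using g_descending(2)[OF assms order_refl, of j] by (simp add: return_prob_def)

lemma return_prob_zero_rate:
  assumes "r $ i = 0" shows "(\<Sum>k\<in>UNIV. A $ i $ k * return_prob A r k j) = 0"
  using g_level[OF assms order_refl, of j] by (simp add: return_prob_def)

lemma return_prob_nondescending:
  assumes "0 \<le> r $ j" shows "return_prob A r i j = 0"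
  using first_passage_nondescending[OF assms] by (simp add: return_prob_def)

lemma return_prob_sum_le: "(\<Sum>j\<in>UNIV. return_prob A r i j) \<le> 1"
proof -
  have "ennreal (\<Sum>j\<in>UNIV. return_prob A r i j) = (\<Sum>j\<in>UNIV. first_passage A r i j 0)"
    by (subst sum_ennreal[symmetric])
      (auto simp: return_prob_def first_passage_real[OF gen order_refl, of r i, symmetric])
  then have "ennreal (\<Sum>j\<in>UNIV. return_prob A r i j) \<le> 1"
    using first_passage_sum_le[OF gen order_refl, of r i] by (simp only:)
  then show ?thesis by (simp only: ennreal_le_1)
qed

text \<open>The passage probabilities are differentiable at level \<open>0\<close>, from the integral equations of the
  phases with nonzero rate; the semigroup property turns the two expressions for the derivative in
  an ascending phase into the Riccati equation.\<close>

lemma return_prob_riccati: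
  assumes inj: "\<And>x. \<forall>i\<in>{i. r $ i = 0}. (\<Sum>j | r $ j = 0. A $ i $ j * x j) = 0 \<Longrightarrow> \<forall>i\<in>{i. r $ i = 0}. x i = (0::real)"
    and i: "0 < r $ i"
  shows "(\<Sum>k\<in>UNIV. A $ i $ k * return_prob A r k j) / r $ i
    + (\<Sum>k | r $ k < 0. return_prob A r i k * ((\<Sum>l\<in>UNIV. A $ k $ l * return_prob A r l j) / - r $ k)) = 0"
proof -
  let ?Y = "return_prob A r" and ?M = "{k. r $ k < 0}"
  define AY where "AY i = (\<Sum>k\<in>UNIV. A $ i $ k * ?Y k j)" for i
  have g0: "g i j 0 = ?Y i j" for i j by (simp add: return_prob_def)
  have lim_minus: "((\<lambda>y. g i j y) \<longlongrightarrow> ?Y i j) (at_right 0)" if r: "r $ i < 0" for i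
  proof (rule tendsto_at_right_0_scale)
    let ?h = "\<lambda>s. exp (- A $ i $ i * s) * B i j (- r $ i * s)"
    have "((\<lambda>T. exp (A $ i $ i * T) * ((if i = j then 1 else 0) + integral {0..T} ?h)) \<longlongrightarrow> exp (A $ i $ i * 0) * ((if i = j then 1 else 0) + 0)) (at_right 0)"
      by (intro tendsto_intros integral_tendsto_0_at_right g_descending(1)[OF r]) simp_all
    moreover have "eventually (\<lambda>T. exp (A $ i $ i * T) * ((if i = j then 1 else 0) + integral {0..T} ?h) = g i j (- r $ i * T)) (at_right 0)"
      using eventually_at_right_less[of "0::real"] by eventually_elim (rule g_descending(2)[OF r, symmetric], simp)
    ultimately show "((\<lambda>T. g i j (- r $ i * T)) \<longlongrightarrow> ?Y i j) (at_right 0)"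
      using return_prob_descending[OF r, of j] by (auto elim: Lim_transform_eventually)
  qed (use r in simp)
  have sg: "g i j y = (\<Sum>k\<in>?M. ?Y i k * g k j y)" if "0 \<le> y" for i y
  proof -
    have "first_passage A r i j y = (\<Sum>k\<in>UNIV. first_passage A r i k 0 * first_passage A r k j y)"
      using first_passage_semigroup[OF order_refl that, of A r i j] by simp
    also have "\<dots> = (\<Sum>k\<in>UNIV. ennreal (?Y i k * g k j y))"
      using first_passage_real[OF gen order_refl, of r i] first_passage_real[OF gen that, of r _ j]
      by (intro sum.cong refl) (simp add: ennreal_mult return_prob_def)
    also have "\<dots> = ennreal (\<Sum>k\<in>UNIV. ?Y i k * g k j y)"
      by (intro sum_ennreal) (simp add: return_prob_nonneg)
    finally have "g i j y = (\<Sum>k\<in>UNIV. ?Y i k * g k j y)"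
      by (simp add: sum_nonneg return_prob_nonneg)
    also have "\<dots> = (\<Sum>k\<in>?M. ?Y i k * g k j y)"
      by (rule sum.mono_neutral_right) (auto simp: return_prob_nondescending)
    finally show ?thesis .
  qed
  have lim: "((\<lambda>y. g i j y) \<longlongrightarrow> ?Y i j) (at_right 0)" for i
  proof -
    have "((\<lambda>y. \<Sum>k\<in>?M. ?Y i k * g k j y) \<longlongrightarrow> (\<Sum>k\<in>?M. ?Y i k * ?Y k j)) (at_right 0)"
      by (intro tendsto_intros lim_minus) simp
    moreover have "(\<Sum>k\<in>?M. ?Y i k * ?Y k j) = ?Y i j" using sg[OF order_refl, of i] by (simp add: g0)
    moreover have "eventually (\<lambda>y. (\<Sum>k\<in>?M. ?Y i k * g k j y) = g i j y) (at_right 0)"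
      using eventually_at_right_less[of "0::real"] by eventually_elim (rule sg[symmetric], simp)
    ultimately show ?thesis by (auto elim: Lim_transform_eventually)
  qed
  have Blim: "((\<lambda>s. B i j (\<rho> * s)) \<longlongrightarrow> B i j 0) (at_right 0)" if "0 < \<rho>" for \<rho> i
  proof -
    have "((\<lambda>y. B i j y) \<longlongrightarrow> B i j 0) (at_right 0)"
      unfolding B_def g0 by (intro tendsto_intros lim)
    moreover have "filterlim (\<lambda>s. \<rho> * s) (at_right 0) (at_right 0)"
      by (rule filterlim_times_pos[OF filterlim_ident]) (use that in auto)
    ultimately show ?thesis by (rule filterlim_compose)
  qed
  have AYB: "AY i = A $ i $ i * ?Y i j + B i j 0" for i
    using row_eq[of i j 0] by (simp add: AY_def g0)
  have expd: "((\<lambda>T. (exp (a * T) - 1) / T) \<longlongrightarrow> a) (at_right 0)" for a :: real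
  proof -
    have "((\<lambda>T. exp (a * T)) has_real_derivative a) (at 0)"
      by (auto intro!: derivative_eq_intros)
    then have "((\<lambda>T. (exp (a * T) - 1) / T) \<longlongrightarrow> a) (at 0)" by (simp add: has_field_derivative_iff)
    then show ?thesis by (rule tendsto_mono[rotated]) (simp add: at_le)
  qed
  have der_minus: "((\<lambda>y. (g k j y - ?Y k j) / y) \<longlongrightarrow> AY k / - r $ k) (at_right 0)" if r: "r $ k < 0" for k
  proof (rule tendsto_at_right_0_scale)
    let ?h = "\<lambda>s. exp (- A $ k $ k * s) * B k j (- r $ k * s)"
    have "(?h \<longlongrightarrow> exp (- A $ k $ k * 0) * B k j 0) (at_right 0)"
      using r by (intro tendsto_intros Blim) simp
    then have h: "((\<lambda>T. integral {0..T} ?h / T) \<longlongrightarrow> ?h 0) (at_right 0)"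
      by (intro integral_average_at_right g_descending(1)[OF r]) simp_all
    have "((\<lambda>T. (?Y k j * ((exp (A $ k $ k * T) - 1) / T) + exp (A $ k $ k * T) * (integral {0..T} ?h / T)) / - r $ k)
        \<longlongrightarrow> (?Y k j * A $ k $ k + exp (A $ k $ k * 0) * ?h 0) / - r $ k) (at_right 0)"
      using r by (intro tendsto_intros expd h) simp
    moreover have "eventually (\<lambda>T. (?Y k j * ((exp (A $ k $ k * T) - 1) / T) + exp (A $ k $ k * T) * (integral {0..T} ?h / T)) / - r $ k
        = (g k j (- r $ k * T) - ?Y k j) / (- r $ k * T)) (at_right 0)"
      using eventually_at_right_less[of "0::real"]
    proof eventually_elim
      case (elim T)
      have "g k j (- r $ k * T) - ?Y k j = ?Y k j * (exp (A $ k $ k * T) - 1) + exp (A $ k $ k * T) * integral {0..T} ?h"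
        unfolding g_descending(2)[OF r less_imp_le[OF elim], of j] return_prob_descending[OF r, of j]
        by (simp add: algebra_simps)
      then show ?case using elim r by (simp add: divide_simps)
    qed
    ultimately show "((\<lambda>T. (g k j (- r $ k * T) - ?Y k j) / (- r $ k * T)) \<longlongrightarrow> AY k / - r $ k) (at_right 0)"
      by (auto elim: Lim_transform_eventually simp: AYB mult.commute)
  qed (use r in simp)
  have "((\<lambda>y. \<Sum>k\<in>?M. ?Y i k * ((g k j y - ?Y k j) / y)) \<longlongrightarrow> (\<Sum>k\<in>?M. ?Y i k * (AY k / - r $ k))) (at_right 0)"
    by (intro tendsto_intros der_minus) simp
  moreover have "eventually (\<lambda>y. (\<Sum>k\<in>?M. ?Y i k * ((g k j y - ?Y k j) / y)) = (g i j y - ?Y i j) / y) (at_right 0)"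
    using eventually_at_right_less[of "0::real"]
  proof eventually_elim
    case (elim y)
    have "?Y i j = (\<Sum>k\<in>?M. ?Y i k * ?Y k j)" using sg[OF order_refl, of i] by (simp add: g0)
    then show ?case using sg[of y i] elim
      by (simp add: sum_subtractf right_diff_distrib flip: sum_divide_distrib)
  qed
  \<comment> \<open>the derivative of the ascending phase through the semigroup property\<close>
  ultimately have d1: "((\<lambda>y. (g i j y - ?Y i j) / y) \<longlongrightarrow> (\<Sum>k\<in>?M. ?Y i k * (AY k / - r $ k))) (at_right 0)"
    by (rule Lim_transform_eventually)
  \<comment> \<open>the same derivative through the integral equation\<close>
  have d2: "((\<lambda>y. (g i j y - ?Y i j) / y) \<longlongrightarrow> - AY i / r $ i) (at_right 0)"
  proof (rule tendsto_at_right_0_scale)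
    let ?h = "\<lambda>s. exp (A $ i $ i * s) * B i j (r $ i * s)"
    have "(?h \<longlongrightarrow> exp (A $ i $ i * 0) * B i j 0) (at_right 0)"
      using i by (intro tendsto_intros Blim) simp
    then have h: "((\<lambda>T. integral {0..T} ?h / T) \<longlongrightarrow> ?h 0) (at_right 0)"
      by (intro integral_average_at_right g_ascending(1)[OF i]) simp_all
    have "((\<lambda>T. (?Y i j * ((exp (- A $ i $ i * T) - 1) / T) - exp (- A $ i $ i * T) * (integral {0..T} ?h / T)) / r $ i)
        \<longlongrightarrow> (?Y i j * - A $ i $ i - exp (- A $ i $ i * 0) * ?h 0) / r $ i) (at_right 0)"
      using i by (intro tendsto_intros expd h) simp
    moreover have "eventually (\<lambda>T. (?Y i j * ((exp (- A $ i $ i * T) - 1) / T) - exp (- A $ i $ i * T) * (integral {0..T} ?h / T)) / r $ i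
        = (g i j (r $ i * T) - ?Y i j) / (r $ i * T)) (at_right 0)"
      using eventually_at_right_less[of "0::real"]
    proof eventually_elim
      case (elim T)
      have "exp (A $ i $ i * T) * g i j (r $ i * T) = ?Y i j - integral {0..T} ?h"
        using g_ascending(2)[OF i less_imp_le[OF elim], of j] by (simp add: g0)
      then have "exp (- A $ i $ i * T) * (exp (A $ i $ i * T) * g i j (r $ i * T))
          = exp (- A $ i $ i * T) * (?Y i j - integral {0..T} ?h)" by simp
      then have "g i j (r $ i * T) - ?Y i j = ?Y i j * (exp (- A $ i $ i * T) - 1) - exp (- A $ i $ i * T) * integral {0..T} ?h"
        unfolding mult.assoc[symmetric] exp_add[symmetric] by (simp add: algebra_simps)
      then show ?case using elim i by (simp add: divide_simps)
    qed
    ultimately show "((\<lambda>T. (g i j (r $ i * T) - ?Y i j) / (r $ i * T)) \<longlongrightarrow> - AY i / r $ i) (at_right 0)"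
      by (auto elim: Lim_transform_eventually simp: AYB mult.commute)
  qed (use i in simp)
  from tendsto_unique[OF _ d1 d2] show ?thesis by (simp add: AY_def)
qed

end

section \<open>The unperturbed model and the stability of K\<close>

locale fluid_perturbation =
  fixes A :: "real^'s^'s" and c ct xi :: "real^'s"
  assumes gen: "generator A"
    and stationary: "\<And>x. (x v* A = 0 \<and> x \<bullet> 1 = 1) = (x = xi)"
    and drift: "(xi v* diagm c) \<bullet> 1 < 0"
    and ct_neg: "\<And>i. c $ i = 0 \<Longrightarrow> ct $ i < 0"
begin

abbreviation "Up \<equiv> {i. 0 < c $ i}"
abbreviation "Lv \<equiv> {i. c $ i = 0}"
abbreviation "Dn \<equiv> {i. c $ i < 0}"
abbreviation "ND \<equiv> {i. c $ i \<le> 0}"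

abbreviation "Y \<equiv> return_prob A c"

lemma A_off: "i \<noteq> k \<Longrightarrow> 0 \<le> A $ i $ k"
  using gen by (simp add: generator_def)

lemma A_other: "c $ i \<noteq> c $ k \<Longrightarrow> 0 \<le> A $ i $ k"
  using A_off[of i k] by auto

lemma A_row: "(\<Sum>k\<in>UNIV. A $ i $ k) = 0"
  using gen by (simp add: generator_def)

lemma split_phases:
  fixes f :: "'s \<Rightarrow> 'b::comm_monoid_add"
  shows "(\<Sum>k\<in>UNIV. f k) = (\<Sum>k\<in>Up. f k) + ((\<Sum>k\<in>Lv. f k) + (\<Sum>k\<in>Dn. f k))"
proof -
  have "(\<Sum>k\<in>UNIV. f k) = (\<Sum>k\<in>Up \<union> (Lv \<union> Dn). f k)" by (rule sum.cong) auto
  also have "\<dots> = (\<Sum>k\<in>Up. f k) + ((\<Sum>k\<in>Lv. f k) + (\<Sum>k\<in>Dn. f k))"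
    by (subst sum.union_disjoint; (subst sum.union_disjoint)?) auto
  finally show ?thesis .
qed

lemma split_ND:
  fixes f :: "'s \<Rightarrow> 'b::comm_monoid_add"
  shows "(\<Sum>k\<in>ND. f k) = (\<Sum>k\<in>Lv. f k) + (\<Sum>k\<in>Dn. f k)"
proof -
  have "(\<Sum>k\<in>ND. f k) = (\<Sum>k\<in>Lv \<union> Dn. f k)" by (rule sum.cong) auto
  also have "\<dots> = (\<Sum>k\<in>Lv. f k) + (\<Sum>k\<in>Dn. f k)" by (rule sum.union_disjoint) auto
  finally show ?thesis .
qed

lemma level_inj: "\<forall>i\<in>Lv. (\<Sum>j\<in>Lv. A $ i $ j * x j) = 0 \<Longrightarrow> \<forall>i\<in>Lv. x i = (0::real)"
  using zero_rate_block_inj[OF gen stationary drift, of x] by blast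

text \<open>The negated inverse of the block of the zero rate phases: entry \<open>(i, j)\<close> is the mean time that
  a chain started in \<open>i\<close> spends in \<open>j\<close> before it leaves the phases of rate zero.\<close>

definition level_inv :: "'s \<Rightarrow> 's \<Rightarrow> real" where
  "level_inv = (SOME N. (\<forall>i\<in>Lv. \<forall>j\<in>Lv. (\<Sum>k\<in>Lv. A $ i $ k * N k j) = (if i = j then - 1 else 0))
    \<and> (\<forall>i\<in>Lv. \<forall>j\<in>Lv. (\<Sum>k\<in>Lv. N i k * A $ k $ j) = (if i = j then - 1 else 0)))"

abbreviation "N \<equiv> level_inv"

lemma level_inv:
  assumes "i \<in> Lv" "j \<in> Lv"
  shows "(\<Sum>k\<in>Lv. A $ i $ k * N k j) = (if i = j then - 1 else 0)"
    "(\<Sum>k\<in>Lv. N i k * A $ k $ j) = (if i = j then - 1 else 0)"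
proof -
  obtain N' where N': "\<forall>i\<in>Lv. \<forall>j\<in>Lv. (\<Sum>k\<in>Lv. A $ i $ k * N' k j) = (if i = j then 1 else 0)"
    "\<forall>i\<in>Lv. \<forall>j\<in>Lv. (\<Sum>k\<in>Lv. N' i k * A $ k $ j) = (if i = j then 1 else 0)"
    using inverse_of_injective[of Lv "\<lambda>i j. A $ i $ j", OF level_inj] by blast
  have "\<exists>N. (\<forall>i\<in>Lv. \<forall>j\<in>Lv. (\<Sum>k\<in>Lv. A $ i $ k * N k j) = (if i = j then - 1 else 0))
    \<and> (\<forall>i\<in>Lv. \<forall>j\<in>Lv. (\<Sum>k\<in>Lv. N i k * A $ k $ j) = (if i = j then - 1 else 0))"
    using N' by (intro exI[of _ "\<lambda>i j. - N' i j"]) (simp add: sum_negf)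
  from someI_ex[OF this, folded level_inv_def] assms
  show "(\<Sum>k\<in>Lv. A $ i $ k * N k j) = (if i = j then - 1 else 0)"
    "(\<Sum>k\<in>Lv. N i k * A $ k $ j) = (if i = j then - 1 else 0)" by blast+
qed

text \<open>The vector is the mean time until a chain started in \<open>i\<close> leaves the phases of rate zero.  It is
  positive by a minimum principle: the rows of the block have nonpositive sum.\<close>

lemma level_exit_vector: "\<exists>x. (\<forall>i\<in>Lv. 0 < x i) \<and> (\<forall>i\<in>Lv. (\<Sum>j\<in>Lv. A $ i $ j * x j) = - 1)"
proof -
  define x where "x i = (\<Sum>j\<in>Lv. N i j)" for i
  have Ax: "(\<Sum>j\<in>Lv. A $ i $ j * x j) = - 1" if i: "i \<in> Lv" for i
  proof -
    have "(\<Sum>j\<in>Lv. A $ i $ j * x j) = (\<Sum>m\<in>Lv. \<Sum>j\<in>Lv. A $ i $ j * N j m)"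
      unfolding x_def sum_distrib_left by (rule sum.swap)
    also have "\<dots> = (\<Sum>m\<in>Lv. if i = m then - 1 else 0)"
      by (intro sum.cong refl level_inv i)
    also have "\<dots> = - 1" using i by simp
    finally show ?thesis .
  qed
  have "0 < x i" if i: "i \<in> Lv" for i
  proof (rule ccontr)
    assume neg: "\<not> 0 < x i"
    define m where "m = Min (x ` Lv)"
    have "m \<in> x ` Lv" unfolding m_def using i by (intro Min_in) auto
    then obtain k where k: "k \<in> Lv" "x k = m" by auto
    have le: "m \<le> x j" if "j \<in> Lv" for j unfolding m_def using that by auto
    have m: "m \<le> 0" using le[OF i] neg by simp
    have "(\<Sum>j\<in>Lv. A $ k $ j) \<le> 0"
    proof -
      have "0 \<le> (\<Sum>j\<in>Up. A $ k $ j)" "0 \<le> (\<Sum>j\<in>Dn. A $ k $ j)"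
        using k by (auto intro!: sum_nonneg A_other)
      then show ?thesis using A_row[of k] unfolding split_phases by linarith
    qed
    then have "0 \<le> (\<Sum>j\<in>Lv. A $ k $ j) * m" using m by (simp add: mult_nonpos_nonpos)
    also have "\<dots> \<le> (\<Sum>j\<in>Lv. A $ k $ j * x j)"
      unfolding sum_distrib_right
    proof (rule sum_mono)
      fix j assume j: "j \<in> Lv"
      show "A $ k $ j * m \<le> A $ k $ j * x j"
        using k le[OF j] A_off[of k j] by (cases "j = k") (auto intro: mult_left_mono)
    qed
    finally show False using Ax[OF k(1)] by simp
  qed
  then show ?thesis using Ax by blast
qed

lemma level_inv_nonneg: "i \<in> Lv \<Longrightarrow> j \<in> Lv \<Longrightarrow> 0 \<le> N i j"
proof -
  assume i: "i \<in> Lv" and j: "j \<in> Lv"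
  obtain x where x: "\<forall>i\<in>Lv. 0 < x i" "\<forall>i\<in>Lv. (\<Sum>j\<in>Lv. A $ i $ j * x j) = - 1"
    using level_exit_vector by blast
  show ?thesis
  proof (rule metzler_nonneg[where I = Lv and B = "\<lambda>i j. A $ i $ j" and p = x and y = "\<lambda>i. N i j"])
    show "(\<Sum>k\<in>Lv. A $ l $ k * N k j) \<le> 0" if "l \<in> Lv" for l using level_inv(1)[OF that j] by simp
  qed (use x A_off i in auto)
qed

lemma Y_nonneg: "0 \<le> Y i j" by (rule return_prob_nonneg)

lemma Y_Dn: "i \<in> Dn \<Longrightarrow> Y i j = (if i = j then 1 else 0)"
  using return_prob_descending[OF gen] by auto

lemma Y_ND: "c $ j \<ge> 0 \<Longrightarrow> Y i j = 0"
  using return_prob_nondescending[OF gen] by auto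

text \<open>The terms of which the Riccati equation is composed.  They vanish in the phases of rate zero.\<close>

definition AY :: "'s \<Rightarrow> 's \<Rightarrow> real" where "AY i j = (\<Sum>k\<in>UNIV. A $ i $ k * Y k j)"

lemma AY_Lv: "i \<in> Lv \<Longrightarrow> AY i j = 0"
  unfolding AY_def using return_prob_zero_rate[OF gen] by auto

lemma AY_split: "j \<in> Dn \<Longrightarrow> AY i j = A $ i $ j + (\<Sum>l\<in>Up. A $ i $ l * Y l j) + (\<Sum>q\<in>Lv. A $ i $ q * Y q j)"
proof -
  assume j: "j \<in> Dn"
  have "(\<Sum>k\<in>Dn. A $ i $ k * Y k j) = (\<Sum>k\<in>Dn. if k = j then A $ i $ j else 0)"
    by (intro sum.cong) (auto simp: Y_Dn)
  also have "\<dots> = A $ i $ j" using j by simp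
  finally show ?thesis unfolding AY_def split_phases by simp
qed

lemma riccati: "i \<in> Up \<Longrightarrow> AY i j / c $ i + (\<Sum>k\<in>Dn. Y i k * (AY k j / - c $ k)) = 0"
  unfolding AY_def by (rule return_prob_riccati[OF gen level_inj]) auto

text \<open>The unknown of the rescaled equations has columns for all phases of nonpositive rate.
  The columns of the phases of rate zero are those of the return probabilities divided by the
  perturbation parameter.  \<open>base\<close> is the solution at parameter zero: in the columns of the descending
  phases it is \<open>\<Psi>\<close>, in those of the phases of rate zero it is the first order term of the theorem.\<close>

definition base :: "'s \<Rightarrow> 's \<Rightarrow> real" where
  "base i j = (if j \<in> Dn then Y i j else
     (\<Sum>m\<in>Lv. (A $ i $ m / c $ i + (\<Sum>k\<in>Dn. Y i k * (A $ k $ m / - c $ k))) * N m j) * - ct $ j)"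

text \<open>The inverse absolute rates; in a phase of rate zero, the rate in units of the perturbation
  parameter.  With these factors, \<open>row_fun i\<close> is the linear functional that maps a column of the
  generator to an entry of the row \<open>i\<close> of the rescaled system, which gives one formula for \<open>K\<close> and for
  the equations solved by \<open>base\<close>.\<close>

definition dinv :: "'s \<Rightarrow> real" where
  "dinv k = (if 0 < c $ k then 1 / c $ k else if c $ k < 0 then - 1 / c $ k else - 1 / ct $ k)"

lemma dinv_pos: "0 < dinv k"
  using ct_neg[of k] by (cases "c $ k" "0::real" rule: linorder_cases) (auto simp: dinv_def divide_neg_neg)

definition row_fun :: "'s \<Rightarrow> ('s \<Rightarrow> real) \<Rightarrow> real" where
  "row_fun i v = dinv i * v i + (\<Sum>k\<in>ND. base i k * (dinv k * v k))"

lemma row_fun_sum: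
  "finite J \<Longrightarrow> row_fun i (\<lambda>k. \<Sum>j\<in>J. f k j * a j) = (\<Sum>j\<in>J. row_fun i (\<lambda>k. f k j) * a j)"
proof -
  assume "finite J"
  have "(\<Sum>k\<in>ND. base i k * (dinv k * (\<Sum>j\<in>J. f k j * a j)))
      = (\<Sum>j\<in>J. (\<Sum>k\<in>ND. base i k * (dinv k * f k j)) * a j)"
    unfolding sum_distrib_left sum_distrib_right by (subst sum.swap) (simp add: mult.assoc)
  moreover have "dinv i * (\<Sum>j\<in>J. f i j * a j) = (\<Sum>j\<in>J. dinv i * f i j * a j)"
    by (simp add: sum_distrib_left mult.assoc)
  ultimately show ?thesis by (simp add: row_fun_def distrib_right sum.distrib)
qed

text \<open>This is the defining property of the zero rate columns of \<open>base\<close>: they are chosen such that the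
  functional eliminates the phases of rate zero.\<close>

lemma row_fun_Lv: assumes i: "i \<in> Up" and q: "q \<in> Lv" shows "row_fun i (\<lambda>k. A $ k $ q) = 0"
proof -
  define w where "w m = A $ i $ m / c $ i + (\<Sum>k\<in>Dn. Y i k * (A $ k $ m / - c $ k))" for m
  have "(\<Sum>k\<in>Lv. base i k * (dinv k * A $ k $ q)) = (\<Sum>k\<in>Lv. (\<Sum>m\<in>Lv. w m * N m k) * A $ k $ q)"
  proof (intro sum.cong refl)
    fix k assume k: "k \<in> Lv"
    then show "base i k * (dinv k * A $ k $ q) = (\<Sum>m\<in>Lv. w m * N m k) * A $ k $ q"
      using ct_neg[of k] by (simp add: base_def dinv_def w_def)
  qed
  also have "\<dots> = (\<Sum>m\<in>Lv. w m * (\<Sum>k\<in>Lv. N m k * A $ k $ q))"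
    unfolding sum_distrib_left sum_distrib_right by (subst sum.swap) (simp add: mult.assoc)
  also have "\<dots> = (\<Sum>m\<in>Lv. if m = q then - w q else 0)"
    by (intro sum.cong refl, subst level_inv(2)[OF _ q]) auto
  also have "\<dots> = - w q" using q by simp
  finally have "(\<Sum>k\<in>Lv. base i k * (dinv k * A $ k $ q)) = - w q" .
  moreover have "(\<Sum>k\<in>Dn. base i k * (dinv k * A $ k $ q)) = (\<Sum>k\<in>Dn. Y i k * (A $ k $ q / - c $ k))"
    by (intro sum.cong) (auto simp: base_def dinv_def)
  ultimately show ?thesis using i unfolding row_fun_def split_ND w_def by (simp add: dinv_def)
qed

lemma row_fun_AY: assumes i: "i \<in> Up" shows "row_fun i (\<lambda>k. AY k j) = 0"
proof -
  have "(\<Sum>k\<in>Dn. base i k * (dinv k * AY k j)) = (\<Sum>k\<in>Dn. Y i k * (AY k j / - c $ k))"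
    by (intro sum.cong) (auto simp: base_def dinv_def)
  then show ?thesis using riccati[OF i, of j] i unfolding row_fun_def split_ND
    by (simp add: AY_Lv dinv_def)
qed

definition K :: "'s \<Rightarrow> 's \<Rightarrow> real" where "K i l = row_fun i (\<lambda>k. A $ k $ l)"

lemma base_nonneg: "i \<in> Up \<Longrightarrow> j \<in> ND \<Longrightarrow> 0 \<le> base i j"
proof -
  assume i: "i \<in> Up" and j: "j \<in> ND"
  show ?thesis
  proof (cases "j \<in> Dn")
    case False
    then have j: "j \<in> Lv" using j by auto
    have "0 \<le> A $ i $ m / c $ i + (\<Sum>k\<in>Dn. Y i k * (A $ k $ m / - c $ k))" if "m \<in> Lv" for m
    proof (intro add_nonneg_nonneg sum_nonneg mult_nonneg_nonneg Y_nonneg)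
      show "0 \<le> A $ i $ m / c $ i" using A_other[of i m] i that by (intro divide_nonneg_pos) auto
      show "0 \<le> A $ k $ m / - c $ k" if "k \<in> Dn" for k
        using A_other[of k m] that \<open>m \<in> Lv\<close> by (intro divide_nonneg_pos) auto
    qed
    then have "0 \<le> (\<Sum>m\<in>Lv. (A $ i $ m / c $ i + (\<Sum>k\<in>Dn. Y i k * (A $ k $ m / - c $ k))) * N m j)"
      using level_inv_nonneg j by (intro sum_nonneg mult_nonneg_nonneg) auto
    then show ?thesis using ct_neg[of j] j by (simp add: base_def mult_nonneg_nonpos)
  qed (simp add: base_def Y_nonneg)
qed

lemma K_off: assumes "i \<in> Up" "l \<in> Up" "i \<noteq> l" shows "0 \<le> K i l"
  unfolding K_def row_fun_def using assms base_nonneg A_off A_other dinv_pos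
  by (intro add_nonneg_nonneg sum_nonneg mult_nonneg_nonneg) (auto intro: less_imp_le)

text \<open>With a solution \<open>g\<close> of the Poisson equation, level plus \<open>g\<close> of the phase is a supermartingale
  with strict drift.  Optional stopping at the return makes \<open>h\<close> nonnegative; the Riccati equation
  turns the strict drift into \<open>K h < 0\<close>.\<close>

lemma K_stable: "\<exists>h. (\<forall>i\<in>Up. 0 < h i) \<and> (\<forall>i\<in>Up. (\<Sum>l\<in>Up. K i l * h l) < 0)"
proof -
  obtain g d where d: "0 < (d::real)" and g: "\<And>i. (\<Sum>j\<in>UNIV. A $ i $ j * g j) = - c $ i - d"
    using poisson_equation[OF gen stationary drift] by metis
  \<comment> \<open>\<open>g\<close> is determined up to a constant, which is chosen to make it nonnegative\<close>
  define G where "G i = g i + (\<Sum>k\<in>UNIV. \<bar>g k\<bar>)" for i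
  have Gnn: "0 \<le> G i" for i
    using member_le_sum[of i UNIV "\<lambda>k. \<bar>g k\<bar>"] by (simp add: G_def)
  have AG: "(\<Sum>j\<in>UNIV. A $ i $ j * G j) = - c $ i - d" for i
    using g[of i] A_row[of i] by (simp add: G_def distrib_left sum.distrib flip: sum_distrib_right)
  define h where "h i = G i - (\<Sum>j\<in>Dn. Y i j * G j)" for i
  have hnn: "0 \<le> h i" for i
  proof -
    have "(\<Sum>j\<in>UNIV. Y i j * G j) \<le> G i + 0"
    proof (rule supersolution_return_prob[OF gen, where f = "\<lambda>i y. G i + y" and f' = "\<lambda>_ _. 1"])
      show "((+) (G i) has_real_derivative 1) (at y)" for i y
        by (auto intro!: derivative_eq_intros)
      show "c $ i * 1 + (\<Sum>k\<in>UNIV. A $ i $ k * (G k + y)) \<le> 0" for i and y :: real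
        using AG[of i] A_row[of i] d by (simp add: distrib_left sum.distrib flip: sum_distrib_right)
    qed (use Gnn in auto)
    moreover have "(\<Sum>j\<in>UNIV. Y i j * G j) = (\<Sum>j\<in>Dn. Y i j * G j)"
      by (rule sum.mono_neutral_right) (auto simp: Y_ND)
    ultimately show ?thesis by (simp add: h_def)
  qed
  have Kh: "(\<Sum>l\<in>Up. K i l * h l) < 0" if i: "i \<in> Up" for i
  proof -
    have h0: "h k = 0" if "k \<in> Dn" for k
    proof -
      have "(\<Sum>j\<in>Dn. Y k j * G j) = (\<Sum>j\<in>Dn. if j = k then G k else 0)"
        by (intro sum.cong) (auto simp: Y_Dn[OF that])
      then show ?thesis using that by (simp add: h_def)
    qed
    have "row_fun i (\<lambda>k. \<Sum>l\<in>UNIV. A $ k $ l * h l) = (\<Sum>l\<in>Up. K i l * h l)"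
    proof -
      have "row_fun i (\<lambda>k. \<Sum>l\<in>UNIV. A $ k $ l * h l) = (\<Sum>l\<in>UNIV. row_fun i (\<lambda>k. A $ k $ l) * h l)"
        by (rule row_fun_sum) simp
      then show ?thesis unfolding split_phases using row_fun_Lv[OF i] h0 by (simp add: K_def)
    qed
    moreover have "(\<Sum>l\<in>UNIV. A $ k $ l * h l) = (- c $ k - d) - (\<Sum>j\<in>Dn. AY k j * G j)" for k
    proof -
      have "(\<Sum>l\<in>UNIV. A $ k $ l * (\<Sum>j\<in>Dn. Y l j * G j)) = (\<Sum>j\<in>Dn. AY k j * G j)"
        unfolding AY_def sum_distrib_left sum_distrib_right by (subst sum.swap) (simp add: mult.assoc)
      then show ?thesis using AG[of k] by (simp add: h_def right_diff_distrib sum_subtractf)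
    qed
    moreover have "row_fun i (\<lambda>k. (- c $ k - d) - (\<Sum>j\<in>Dn. AY k j * G j))
        = row_fun i (\<lambda>k. - c $ k - d) - row_fun i (\<lambda>k. \<Sum>j\<in>Dn. AY k j * G j)"
      by (simp add: row_fun_def right_diff_distrib sum_subtractf)
    moreover have "row_fun i (\<lambda>k. \<Sum>j\<in>Dn. AY k j * G j) = 0"
      unfolding row_fun_sum[OF finite] by (simp add: row_fun_AY[OF i])
    moreover have "row_fun i (\<lambda>k. - c $ k - d) < 0"
    proof -
      \<comment> \<open>the row \<open>i\<close> contributes less than \<open>-1\<close>, and the descending phases at most the total return probability\<close>
      have a: "dinv i * (- c $ i - d) < - 1"
        using i d by (simp add: dinv_def field_simps)
      have b: "(\<Sum>k\<in>Lv. base i k * (dinv k * (- c $ k - d))) \<le> 0"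
        using base_nonneg[OF i] dinv_pos d by (intro sum_nonpos mult_nonneg_nonpos) (auto intro: less_imp_le)
      have "(\<Sum>k\<in>Dn. base i k * (dinv k * (- c $ k - d))) \<le> (\<Sum>k\<in>Dn. Y i k)"
      proof (rule sum_mono)
        fix k assume k: "k \<in> Dn"
        then have "dinv k * (- c $ k - d) \<le> 1" using d by (simp add: dinv_def field_simps)
        then have "Y i k * (dinv k * (- c $ k - d)) \<le> Y i k * 1" by (intro mult_left_mono Y_nonneg)
        then show "base i k * (dinv k * (- c $ k - d)) \<le> Y i k" using k by (simp add: base_def)
      qed
      also have "\<dots> \<le> (\<Sum>k\<in>UNIV. Y i k)" by (intro sum_mono2) (auto simp: Y_nonneg)
      also have "\<dots> \<le> 1" by (rule return_prob_sum_le[OF gen])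
      finally show ?thesis using a b unfolding row_fun_def split_ND by linarith
    qed
    ultimately show ?thesis by simp
  qed
  have "0 < h i" if i: "i \<in> Up" for i
  proof (rule ccontr)
    assume "\<not> 0 < h i"
    then have "h i = 0" using hnn[of i] by simp
    then have "0 \<le> (\<Sum>l\<in>Up. K i l * h l)"
      using K_off[OF i] hnn by (intro sum_nonneg) (metis mult_eq_0_iff mult_nonneg_nonneg order_refl)
    then show False using Kh[OF i] by simp
  qed
  then show ?thesis using Kh by blast
qed

lemma K_stable_rate:
  "\<exists>h \<eta>. 0 < \<eta> \<and> (\<forall>i\<in>Up. 0 < h i) \<and> (\<forall>i\<in>Up. (\<Sum>l\<in>Up. K i l * h l) \<le> - \<eta> * h i)"
proof -
  obtain h where h: "\<And>i. i \<in> Up \<Longrightarrow> 0 < h i" "\<And>i. i \<in> Up \<Longrightarrow> (\<Sum>l\<in>Up. K i l * h l) < 0"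
    using K_stable by blast
  define \<eta> where "\<eta> = Min (insert 1 ((\<lambda>i. - (\<Sum>l\<in>Up. K i l * h l) / h i) ` Up))"
  have "0 < \<eta>" unfolding \<eta>_def using h by (subst Min_gr_iff) (auto simp: divide_neg_pos)
  moreover have "(\<Sum>l\<in>Up. K i l * h l) \<le> - \<eta> * h i" if "i \<in> Up" for i
  proof -
    have "\<eta> \<le> - (\<Sum>l\<in>Up. K i l * h l) / h i" unfolding \<eta>_def using that by (intro Min_le) auto
    then have "\<eta> * h i \<le> - (\<Sum>l\<in>Up. K i l * h l)" using h(1)[OF that] by (simp only: pos_le_divide_eq)
    then show ?thesis by simp
  qed
  ultimately show ?thesis using h(1) by blast
qed

text \<open>The analogue of \<open>U\<close> before the elimination of the phases of rate zero: the matrix that multiplies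
  the unknown from the right in the linearization of the rescaled equations.\<close>

definition Uh :: "'s \<Rightarrow> 's \<Rightarrow> real" where
  "Uh k j = dinv k * (A $ k $ j + (if j \<in> Dn then (\<Sum>l\<in>Up. A $ k $ l * Y l j) else 0))"

lemma Uh_off: "k \<in> ND \<Longrightarrow> j \<in> ND \<Longrightarrow> k \<noteq> j \<Longrightarrow> 0 \<le> Uh k j"
  unfolding Uh_def using A_off A_other dinv_pos Y_nonneg
  by (auto intro!: mult_nonneg_nonneg add_nonneg_nonneg sum_nonneg intro: less_imp_le)

lemma Y_sum_Dn: "(\<Sum>j\<in>Dn. Y i j) \<le> 1"
proof -
  have "(\<Sum>j\<in>Dn. Y i j) \<le> (\<Sum>k\<in>UNIV. Y i k)" by (intro sum_mono2) (auto simp: Y_nonneg)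
  also have "\<dots> \<le> 1" by (rule return_prob_sum_le[OF gen])
  finally show ?thesis .
qed

lemma Uh_row: "k \<in> ND \<Longrightarrow> (\<Sum>j\<in>ND. Uh k j) \<le> 0"
proof -
  assume k: "k \<in> ND"
  have "(\<Sum>j\<in>Dn. \<Sum>l\<in>Up. A $ k $ l * Y l j) = (\<Sum>l\<in>Up. A $ k $ l * (\<Sum>j\<in>Dn. Y l j))"
    unfolding sum_distrib_left by (rule sum.swap)
  also have "\<dots> \<le> (\<Sum>l\<in>Up. A $ k $ l * 1)"
    using k by (intro sum_mono mult_left_mono Y_sum_Dn A_off) auto
  finally have "(\<Sum>j\<in>Dn. \<Sum>l\<in>Up. A $ k $ l * Y l j) \<le> (\<Sum>l\<in>Up. A $ k $ l)" by simp
  moreover have "(\<Sum>j\<in>ND. Uh k j) = dinv k * ((\<Sum>j\<in>Lv. A $ k $ j) + ((\<Sum>j\<in>Dn. A $ k $ j) + (\<Sum>j\<in>Dn. \<Sum>l\<in>Up. A $ k $ l * Y l j)))"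
    unfolding split_ND Uh_def by (simp add: sum_distrib_left sum.distrib distrib_left)
  ultimately show ?thesis using A_row[of k] dinv_pos[of k] unfolding split_phases
    by (simp add: mult_nonneg_nonpos)
qed

text \<open>The linearization at \<open>base\<close> is strictly negative on the weight \<open>h i * u j\<close>, where \<open>h\<close> is the
  Lyapunov vector of \<open>K\<close> with rate \<open>\<eta>\<close> and \<open>u\<close> is a left vector for \<open>Uh\<close>.  Since the rows of \<open>Uh\<close>
  have only nonpositive sums, \<open>u Uh\<close> may be positive, but less than \<open>\<eta> u\<close>, and this is compensated by
  \<open>K\<close>.  In the columns of rate zero \<open>K\<close> is absent; there the rate at which the chain leaves these
  phases is used instead.\<close>

lemma weight_exists:
  "\<exists>w. (\<forall>i\<in>Up. \<forall>j\<in>ND. 0 < w i j) \<and>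
    (\<forall>i\<in>Up. \<forall>j\<in>ND. (if j \<in> Dn then \<Sum>l\<in>Up. K i l * w l j else 0) + (\<Sum>k\<in>ND. w i k * Uh k j) < 0)"
proof -
  obtain h \<eta> where \<eta>: "0 < \<eta>" and h: "\<And>i. i \<in> Up \<Longrightarrow> 0 < h i"
    and Kh: "\<And>i. i \<in> Up \<Longrightarrow> (\<Sum>l\<in>Up. K i l * h l) \<le> - \<eta> * h i"
    using K_stable_rate by blast
  obtain x where x: "\<And>i. i \<in> Lv \<Longrightarrow> 0 < x i" "\<And>i. i \<in> Lv \<Longrightarrow> (\<Sum>j\<in>Lv. A $ i $ j * x j) = - 1"
    using level_exit_vector by blast
  define s where "s k = (\<Sum>j\<in>Lv. dinv k * A $ k $ j * x j)" for k
  have s: "0 \<le> s k" if "k \<in> Dn" for k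
    unfolding s_def using that x(1) A_other dinv_pos
    by (intro sum_nonneg mult_nonneg_nonneg) (auto intro: less_imp_le)
  \<comment> \<open>so small that the correction \<open>t x\<close> costs less than \<open>\<eta>\<close> in the descending rows\<close>
  define t where "t = \<eta> / (1 + (\<Sum>k\<in>Dn. s k))"
  have S: "0 \<le> (\<Sum>k\<in>Dn. s k)" using s by (intro sum_nonneg)
  have t: "0 < t" using \<eta> S by (simp add: t_def)
  have ts: "t * s k < \<eta>" if "k \<in> Dn" for k
  proof -
    have "s k \<le> (\<Sum>k\<in>Dn. s k)" using that s by (intro member_le_sum) auto
    then have "t * s k < t * (1 + (\<Sum>k\<in>Dn. s k))" using t by (intro mult_strict_left_mono) auto
    also have "\<dots> = \<eta>" using S by (simp add: t_def)
    finally show ?thesis .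
  qed
  define B where "B k j = Uh k j - (if k = j \<and> j \<in> Dn then \<eta> else 0)" for k j
  define p where "p j = 1 + (if j \<in> Lv then t * x j else 0)" for j
  have Bsum: "(\<Sum>j\<in>ND. B k j * a j) = (\<Sum>j\<in>ND. Uh k j * a j) - (if k \<in> Dn then \<eta> * a k else 0)"
    if "k \<in> ND" for k a
  proof -
    have "(\<Sum>j\<in>ND. B k j * a j) = (\<Sum>j\<in>ND. Uh k j * a j - (if j = k then (if k \<in> Dn then \<eta> * a k else 0) else 0))"
      by (intro sum.cong) (auto simp: B_def algebra_simps)
    then show ?thesis using that by (simp add: sum_subtractf)
  qed
  have "\<exists>u. (\<forall>i\<in>ND. 0 < u i) \<and> (\<forall>j\<in>ND. (\<Sum>i\<in>ND. u i * B i j) < 0)"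
  proof -
    have off: "0 \<le> B i j" if "i \<in> ND" "j \<in> ND" "i \<noteq> j" for i j using Uh_off that by (simp add: B_def)
    have ppos: "0 < p i" for i using x(1) t by (auto simp: p_def intro!: add_pos_nonneg less_imp_le)
    have Bp: "(\<Sum>j\<in>ND. B k j * p j) < 0" if k: "k \<in> ND" for k
    proof -
      have "(\<Sum>j\<in>ND. Uh k j * p j) = (\<Sum>j\<in>ND. Uh k j) + t * s k"
      proof -
        have "(\<Sum>j\<in>ND. Uh k j * p j) = (\<Sum>j\<in>ND. Uh k j) + (\<Sum>j\<in>ND. Uh k j * (if j \<in> Lv then t * x j else 0))"
          by (simp add: p_def distrib_left sum.distrib)
        moreover have "(\<Sum>j\<in>ND. Uh k j * (if j \<in> Lv then t * x j else 0)) = (\<Sum>j\<in>Lv. Uh k j * (t * x j))"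
          unfolding split_ND by simp
        moreover have "\<dots> = t * s k"
          unfolding s_def sum_distrib_left by (intro sum.cong) (auto simp: Uh_def)
        ultimately show ?thesis by simp
      qed
      then have e: "(\<Sum>j\<in>ND. B k j * p j) \<le> t * s k - (if k \<in> Dn then \<eta> else 0)"
        unfolding Bsum[OF k] using Uh_row[OF k] by (simp add: p_def)
      show ?thesis
      proof (cases "k \<in> Dn")
        case True
        then show ?thesis using e ts[of k] by simp
      next
        case False
        then have "k \<in> Lv" using k by auto
        then have "s k = - dinv k" unfolding s_def using x(2)[of k] by (simp add: mult.assoc flip: sum_distrib_left)
        then have "t * s k < 0" using t dinv_pos[of k] by (simp add: mult_pos_neg)
        then show ?thesis using e False by simp
      qed
    qed
    show ?thesis by (rule metzler_left_vector[of ND B p]) (use off ppos Bp in blast)+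
  qed
  then obtain u where u: "\<And>i. i \<in> ND \<Longrightarrow> 0 < u i" "\<And>j. j \<in> ND \<Longrightarrow> (\<Sum>i\<in>ND. u i * B i j) < 0" by blast
  have uU: "(\<Sum>k\<in>ND. u k * Uh k j) < (if j \<in> Dn then \<eta> * u j else 0)" if j: "j \<in> ND" for j
  proof -
    have "(\<Sum>k\<in>ND. u k * B k j) = (\<Sum>k\<in>ND. u k * Uh k j - (if k = j then (if j \<in> Dn then \<eta> * u j else 0) else 0))"
      by (intro sum.cong) (auto simp: B_def algebra_simps)
    then show ?thesis using u(2)[OF j] j by (simp add: sum_subtractf)
  qed
  show ?thesis
  proof (intro exI[of _ "\<lambda>i j. h i * u j"] conjI ballI)
    fix i j assume i: "i \<in> Up" and j: "j \<in> ND"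
    show "0 < h i * u j" using h[OF i] u(1)[OF j] by simp
    have "(\<Sum>k\<in>ND. h i * u k * Uh k j) = h i * (\<Sum>k\<in>ND. u k * Uh k j)"
      by (simp add: sum_distrib_left mult.assoc)
    also have "\<dots> < h i * (if j \<in> Dn then \<eta> * u j else 0)"
      using uU[OF j] h[OF i] by (intro mult_strict_left_mono)
    finally have 1: "(\<Sum>k\<in>ND. h i * u k * Uh k j) < h i * (if j \<in> Dn then \<eta> * u j else 0)" .
    show "(if j \<in> Dn then \<Sum>l\<in>Up. K i l * (h l * u j) else 0) + (\<Sum>k\<in>ND. h i * u k * Uh k j) < 0"
    proof (cases "j \<in> Dn")
      case True
      have "(\<Sum>l\<in>Up. K i l * (h l * u j)) = (\<Sum>l\<in>Up. K i l * h l) * u j"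
        by (simp add: sum_distrib_right mult.assoc)
      also have "\<dots> \<le> - \<eta> * h i * u j" using Kh[OF i] u(1)[OF j] by (intro mult_right_mono) auto
      finally show ?thesis using 1 True by (simp add: mult_ac)
    qed (use 1 in simp)
  qed
qed

definition U :: "'s \<Rightarrow> 's \<Rightarrow> real" where "U k j = AY k j / - c $ k"

text \<open>As a matrix \<open>BB\<close> on pairs of phases, the Sylvester operator has nonnegative off-diagonal entries
  and is strictly negative on a product weight \<open>h i * u j\<close>, so the maximum principle applies.  The row
  sums of \<open>U\<close> are only nonpositive; the stability comes from \<open>K\<close>.\<close>

lemma sylvester_unique:
  assumes X: "\<And>i j. i \<in> Up \<Longrightarrow> j \<in> Dn \<Longrightarrow> (\<Sum>l\<in>Up. K i l * X l j) + (\<Sum>k\<in>Dn. X i k * U k j) = 0"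
    and i: "i \<in> Up" and j: "j \<in> Dn"
  shows "X i j = 0"
proof -
  obtain h \<eta> where \<eta>: "0 < \<eta>" and h: "\<And>i. i \<in> Up \<Longrightarrow> 0 < h i"
    and Kh: "\<And>i. i \<in> Up \<Longrightarrow> (\<Sum>l\<in>Up. K i l * h l) \<le> - \<eta> * h i"
    using K_stable_rate by blast
  have AYoff: "0 \<le> AY k j" if "k \<in> Dn" "j \<in> Dn" "k \<noteq> j" for k j
    unfolding AY_def
  proof (intro sum_nonneg)
    fix l show "0 \<le> A $ k $ l * Y l j"
      using A_off[of k l] Y_nonneg[of l j] Y_Dn[OF that(1), of j] that(3) by (cases "l = k") auto
  qed
  have Uoff: "0 \<le> U k j" if "k \<in> Dn" "j \<in> Dn" "k \<noteq> j" for k j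
    unfolding U_def using AYoff[OF that] that(1) by (intro divide_nonneg_pos) auto
  have Urow: "(\<Sum>j\<in>Dn. U k j) \<le> 0" if k: "k \<in> Dn" for k
  proof -
    have "(\<Sum>j\<in>Dn. AY k j) = (\<Sum>l\<in>UNIV. A $ k $ l * (\<Sum>j\<in>Dn. Y l j))"
      unfolding AY_def sum_distrib_left by (rule sum.swap)
    also have "\<dots> \<le> (\<Sum>l\<in>UNIV. A $ k $ l * 1)"
    proof (rule sum_mono)
      fix l
      have "(\<Sum>j\<in>Dn. Y k j) = (\<Sum>j\<in>Dn. if j = k then 1 else 0)" by (intro sum.cong) (auto simp: Y_Dn[OF k])
      then have "(\<Sum>j\<in>Dn. Y k j) = 1" using k by simp
      then show "A $ k $ l * (\<Sum>j\<in>Dn. Y l j) \<le> A $ k $ l * 1"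
        using A_off[of k l] Y_sum_Dn[of l] by (cases "l = k") (auto intro!: mult_left_mono simp del: mult_1_right)
    qed
    finally have "(\<Sum>j\<in>Dn. AY k j) \<le> 0" by (simp add: A_row)
    then have "(\<Sum>j\<in>Dn. AY k j) / - c $ k \<le> 0" using k by (intro divide_nonpos_pos) auto
    then show ?thesis unfolding U_def sum_divide_distrib .
  qed
  define B where "B k j = U k j - (if k = j then \<eta> else 0)" for k j
  have "\<exists>u. (\<forall>i\<in>Dn. 0 < u i) \<and> (\<forall>j\<in>Dn. (\<Sum>i\<in>Dn. u i * B i j) < 0)"
  proof -
    have off: "0 \<le> B i j" if "i \<in> Dn" "j \<in> Dn" "i \<noteq> j" for i j using Uoff that by (simp add: B_def)
    have Bp: "(\<Sum>j\<in>Dn. B k j * 1) < 0" if k: "k \<in> Dn" for k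
      using Urow[OF k] \<eta> k by (simp add: B_def sum_subtractf)
    show ?thesis by (rule metzler_left_vector[of Dn B "\<lambda>_. 1"]) (use off Bp in auto)
  qed
  then obtain u where u: "\<And>i. i \<in> Dn \<Longrightarrow> 0 < u i" "\<And>j. j \<in> Dn \<Longrightarrow> (\<Sum>i\<in>Dn. u i * B i j) < 0" by blast
  have uU: "(\<Sum>k\<in>Dn. u k * U k j) < \<eta> * u j" if j: "j \<in> Dn" for j
  proof -
    have "(\<Sum>k\<in>Dn. u k * B k j) = (\<Sum>k\<in>Dn. u k * U k j - (if k = j then \<eta> * u j else 0))"
      by (intro sum.cong) (auto simp: B_def algebra_simps)
    then show ?thesis using u(2)[OF j] j by (simp add: sum_subtractf)
  qed
  define BB where "BB a b = (if snd a = snd b then K (fst a) (fst b) else 0) + (if fst a = fst b then U (snd b) (snd a) else 0)"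
    for a b :: "'s \<times> 's"
  have BBsum: "(\<Sum>b\<in>Up \<times> Dn. BB a b * f b) = (\<Sum>l\<in>Up. K (fst a) l * f (l, snd a)) + (\<Sum>k\<in>Dn. f (fst a, k) * U k (snd a))"
    if a: "a \<in> Up \<times> Dn" for a f
  proof -
    have "(\<Sum>b\<in>Up \<times> Dn. BB a b * f b) = (\<Sum>l\<in>Up. \<Sum>k\<in>Dn. BB a (l, k) * f (l, k))"
      by (simp add: sum.cartesian_product)
    also have "\<dots> = (\<Sum>l\<in>Up. \<Sum>k\<in>Dn. (if k = snd a then K (fst a) l * f (l, k) else 0) + (if l = fst a then f (l, k) * U k (snd a) else 0))"
      by (intro sum.cong refl) (auto simp: BB_def algebra_simps)
    also have "\<dots> = (\<Sum>l\<in>Up. \<Sum>k\<in>Dn. if k = snd a then K (fst a) l * f (l, k) else 0) + (\<Sum>k\<in>Dn. \<Sum>l\<in>Up. if l = fst a then f (l, k) * U k (snd a) else 0)"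
      by (simp only: sum.distrib) (subst (2) sum.swap, rule refl)
    also have "\<dots> = (\<Sum>l\<in>Up. K (fst a) l * f (l, snd a)) + (\<Sum>k\<in>Dn. f (fst a, k) * U k (snd a))"
      using a by auto
    finally show ?thesis .
  qed
  have "(\<lambda>b. X (fst b) (snd b)) (i, j) = 0"
  proof (rule metzler_inj[where I = "Up \<times> Dn" and B = BB and p = "\<lambda>b. h (fst b) * u (snd b)"])
    fix a assume a: "a \<in> Up \<times> Dn"
    then obtain i j where ij: "a = (i, j)" "i \<in> Up" "j \<in> Dn" by auto
    show "0 < h (fst a) * u (snd a)" using a h u by auto
    show "(\<Sum>b\<in>Up \<times> Dn. BB a b * X (fst b) (snd b)) = 0" unfolding BBsum[OF a] using X ij by simp
    have "(\<Sum>b\<in>Up \<times> Dn. BB a b * (h (fst b) * u (snd b))) = (\<Sum>l\<in>Up. K i l * h l) * u j + h i * (\<Sum>k\<in>Dn. u k * U k j)"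
      unfolding BBsum[OF a] by (simp add: ij sum_distrib_left sum_distrib_right mult.assoc)
    also have "\<dots> < - \<eta> * h i * u j + h i * (\<eta> * u j)"
      using Kh[OF ij(2)] uU[OF ij(3)] h[OF ij(2)] u(1)[OF ij(3)]
      by (intro add_le_less_mono mult_right_mono mult_strict_left_mono) auto
    also have "\<dots> = 0" by simp
    finally show "(\<Sum>b\<in>Up \<times> Dn. BB a b * (h (fst b) * u (snd b))) < 0" .
    fix b assume "b \<in> Up \<times> Dn" "a \<noteq> b"
    then show "0 \<le> BB a b" using ij K_off Uoff by (auto simp: BB_def)
  qed (use i j in auto)
  then show ?thesis by simp
qed

end

section \<open>Holomorphic dependence of a fixed point\<close>

text \<open>The iterates are holomorphic in the parameter and converge uniformly at a geometric rate, so the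
  fixed point is holomorphic.  The norm is a weighted maximum of the entries.\<close>

lemma holomorphic_contraction_fixed_point:
  fixes T :: "complex \<Rightarrow> complex^'a^'b \<Rightarrow> complex^'a^'b" and X0 :: "complex^'a^'b" and w :: "'b \<Rightarrow> 'a \<Rightarrow> real" and \<rho> \<sigma> q :: real
  defines "Bl \<equiv> {X. \<forall>i j. norm (X $ i $ j - X0 $ i $ j) \<le> \<rho> * w i j}"
  assumes q: "0 \<le> q" "q < 1" and \<rho>: "0 < \<rho>" and w: "\<And>i j. 0 < w i j"
    and contr: "\<And>z X W t i j. norm z < \<sigma> \<Longrightarrow> X \<in> Bl \<Longrightarrow> W \<in> Bl \<Longrightarrow> 0 \<le> t \<Longrightarrow>
      (\<And>i j. norm (X $ i $ j - W $ i $ j) \<le> t * w i j) \<Longrightarrow> norm (T z X $ i $ j - T z W $ i $ j) \<le> q * t * w i j"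
    and start: "\<And>z i j. norm z < \<sigma> \<Longrightarrow> norm (T z X0 $ i $ j - X0 $ i $ j) \<le> (1 - q) * \<rho> * w i j"
    and hol: "\<And>X i j. (\<And>i j. (\<lambda>z. X z $ i $ j) holomorphic_on ball 0 \<sigma>) \<Longrightarrow> (\<lambda>z. T z (X z) $ i $ j) holomorphic_on ball 0 \<sigma>"
  shows "\<exists>\<xi>. (\<forall>i j. (\<lambda>z. \<xi> z $ i $ j) holomorphic_on ball 0 \<sigma>) \<and>
    (\<forall>z\<in>ball 0 \<sigma>. \<xi> z \<in> Bl \<and> T z (\<xi> z) = \<xi> z \<and> (\<forall>X\<in>Bl. T z X = X \<longrightarrow> X = \<xi> z))"
proof -
  define x where "x n z = ((T z) ^^ n) X0" for n z
  have x0: "x 0 z = X0" and xS: "x (Suc n) z = T z (x n z)" for n z by (simp_all add: x_def)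
  have step: "(\<forall>i j. norm (x (Suc n) z $ i $ j - x n z $ i $ j) \<le> q ^ n * ((1 - q) * \<rho>) * w i j)
      \<and> x n z \<in> Bl \<and> x (Suc n) z \<in> Bl" if z: "norm z < \<sigma>" for n z
  proof -
    have dist0: "norm (x m z $ i $ j - X0 $ i $ j) \<le> (1 - q ^ m) * \<rho> * w i j"
      if "\<And>k i j. k < m \<Longrightarrow> norm (x (Suc k) z $ i $ j - x k z $ i $ j) \<le> q ^ k * ((1 - q) * \<rho>) * w i j" for m i j
      using that
    proof (induction m)
      case (Suc m)
      have "norm (x (Suc m) z $ i $ j - X0 $ i $ j)
          \<le> norm (x (Suc m) z $ i $ j - x m z $ i $ j) + norm (x m z $ i $ j - X0 $ i $ j)"
        using norm_triangle_ineq[of "x (Suc m) z $ i $ j - x m z $ i $ j" "x m z $ i $ j - X0 $ i $ j"] by simp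
      also have "\<dots> \<le> q ^ m * ((1 - q) * \<rho>) * w i j + (1 - q ^ m) * \<rho> * w i j"
        using Suc by (intro add_mono) auto
      also have "\<dots> = (1 - q ^ Suc m) * \<rho> * w i j" by (simp add: algebra_simps)
      finally show ?case .
    qed (simp add: x0)
    have inBl: "x m z \<in> Bl"
      if "\<And>k i j. k < m \<Longrightarrow> norm (x (Suc k) z $ i $ j - x k z $ i $ j) \<le> q ^ k * ((1 - q) * \<rho>) * w i j" for m
    proof -
      have le: "(1 - q ^ m) * \<rho> * w i j \<le> 1 * \<rho> * w i j" for i j
        using q \<rho> w[of i j] by (intro mult_right_mono) auto
      have "norm (x m z $ i $ j - X0 $ i $ j) \<le> \<rho> * w i j" for i j
        using order_trans[OF dist0[OF that, of m] le[of i j]] by simp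
      then show ?thesis by (simp add: Bl_def)
    qed
    have d: "norm (x (Suc k) z $ i $ j - x k z $ i $ j) \<le> q ^ k * ((1 - q) * \<rho>) * w i j" for k i j
    proof (induction k arbitrary: i j rule: less_induct)
      case (less k)
      show ?case
      proof (cases k)
        case 0
        then show ?thesis using start[OF z] by (simp add: x0 xS)
      next
        case (Suc m)
        have "norm (T z (x (Suc m) z) $ i $ j - T z (x m z) $ i $ j) \<le> q * (q ^ m * ((1 - q) * \<rho>)) * w i j"
        proof (rule contr[OF z])
          show "x (Suc m) z \<in> Bl" "x m z \<in> Bl" using less Suc by (auto intro: inBl)
          show "norm (x (Suc m) z $ i $ j - x m z $ i $ j) \<le> q ^ m * ((1 - q) * \<rho>) * w i j" for i j
            using less Suc by simp
        qed (use q \<rho> in auto)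
        then show ?thesis by (simp add: Suc xS mult.assoc)
      qed
    qed
    then show ?thesis using inBl by blast
  qed
  define f where "f n i j z = x (Suc n) z $ i $ j - x n z $ i $ j" for n i j z
  have holx: "(\<lambda>z. x n z $ i $ j) holomorphic_on ball 0 \<sigma>" for n i j
  proof (induction n arbitrary: i j)
    case (Suc n)
    show ?case unfolding xS by (rule hol[OF Suc])
  qed (simp add: x0)
  have tele: "(\<Sum>k<n. f k i j z) = x n z $ i $ j - X0 $ i $ j" for n i j z
    unfolding f_def by (induction n) (simp_all add: x0)
  have unif: "uniform_limit (ball 0 \<sigma>) (\<lambda>n z. \<Sum>k<n. f k i j z) (\<lambda>z. \<Sum>k. f k i j z) sequentially" for i j
  proof (rule Weierstrass_m_test)
    show "norm (f n i j z) \<le> q ^ n * ((1 - q) * \<rho> * w i j)" if "z \<in> ball 0 \<sigma>" for n z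
      using step[of z n] that by (simp add: f_def mult.assoc)
    show "summable (\<lambda>n. q ^ n * ((1 - q) * \<rho> * w i j))"
      using q by (intro summable_mult2 summable_geometric) auto
  qed
  define \<xi> :: "complex \<Rightarrow> complex^'a^'b" where "\<xi> z = (\<chi> i j. X0 $ i $ j + (\<Sum>k. f k i j z))" for z
  have unif': "uniform_limit (ball 0 \<sigma>) (\<lambda>n z. x n z $ i $ j) (\<lambda>z. \<xi> z $ i $ j) sequentially" for i j
  proof -
    have "uniform_limit (ball 0 \<sigma>) (\<lambda>n z. X0 $ i $ j + (\<Sum>k<n. f k i j z)) (\<lambda>z. X0 $ i $ j + (\<Sum>k. f k i j z)) sequentially"
      by (intro uniform_limit_intros unif)
    then show ?thesis by (simp add: tele \<xi>_def)
  qed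
  have lim: "(\<lambda>n. x n z $ i $ j) \<longlonglongrightarrow> \<xi> z $ i $ j" if "norm z < \<sigma>" for z i j
    by (rule tendsto_uniform_limitI[OF unif']) (use that in simp)
  have hol\<xi>: "(\<lambda>z. \<xi> z $ i $ j) holomorphic_on ball 0 \<sigma>" for i j
  proof (rule holomorphic_uniform_sequence[OF open_ball holx])
    fix z :: complex assume "z \<in> ball 0 \<sigma>"
    then obtain d where d: "0 < d" "cball z d \<subseteq> ball 0 \<sigma>" using open_contains_cball_eq[OF open_ball] by blast
    then show "\<exists>d>0. cball z d \<subseteq> ball 0 \<sigma> \<and> uniform_limit (cball z d) (\<lambda>n z. x n z $ i $ j) (\<lambda>z. \<xi> z $ i $ j) sequentially"
      using uniform_limit_on_subset[OF unif'] by blast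
  qed
  have Bl: "\<xi> z \<in> Bl" if z: "norm z < \<sigma>" for z
    unfolding Bl_def mem_Collect_eq
  proof (intro allI)
    fix i j
    have "(\<lambda>n. norm (x n z $ i $ j - X0 $ i $ j)) \<longlonglongrightarrow> norm (\<xi> z $ i $ j - X0 $ i $ j)"
      by (intro tendsto_intros lim z)
    then show "norm (\<xi> z $ i $ j - X0 $ i $ j) \<le> \<rho> * w i j"
      by (rule LIMSEQ_le_const2) (use step[OF z] in \<open>auto simp: Bl_def\<close>)
  qed
  have contract_n: "norm (X $ i $ j - x n z $ i $ j) \<le> q ^ n * \<rho> * w i j"
    if z: "norm z < \<sigma>" and X: "X \<in> Bl" "T z X = X" for z X n i j
  proof (induction n arbitrary: i j)
    case 0
    then show ?case using X(1) by (simp add: x0 Bl_def)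
  next
    case (Suc n)
    have "norm (T z X $ i $ j - T z (x n z) $ i $ j) \<le> q * (q ^ n * \<rho>) * w i j"
      by (rule contr[OF z X(1)]) (use step[OF z, of n] Suc q \<rho> in auto)
    then show ?case by (simp add: xS X(2) mult.assoc)
  qed
  have vanish: "(\<lambda>n. q ^ n * \<rho> * w i j) \<longlonglongrightarrow> 0" for i j
    using tendsto_mult_left_zero[OF LIMSEQ_power_zero[of q], of "\<rho> * w i j"] q by (simp add: mult.assoc)
  have fix\<xi>: "T z (\<xi> z) = \<xi> z" if z: "norm z < \<sigma>" for z
  proof -
    have tail: "norm (\<xi> z $ i $ j - x n z $ i $ j) \<le> q ^ n * \<rho> * w i j" for n i j
    proof -
      have "norm (x (n + m) z $ i $ j - x n z $ i $ j) \<le> (q ^ n - q ^ (n + m)) * \<rho> * w i j" for m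
      proof (induction m)
        case (Suc m)
        have "norm (x (n + Suc m) z $ i $ j - x n z $ i $ j)
          \<le> norm (x (Suc (n + m)) z $ i $ j - x (n + m) z $ i $ j) + norm (x (n + m) z $ i $ j - x n z $ i $ j)"
          using norm_triangle_ineq[of "x (Suc (n + m)) z $ i $ j - x (n + m) z $ i $ j" "x (n + m) z $ i $ j - x n z $ i $ j"] by simp
        also have "\<dots> \<le> q ^ (n + m) * ((1 - q) * \<rho>) * w i j + (q ^ n - q ^ (n + m)) * \<rho> * w i j"
          using step[OF z, of "n + m"] Suc by (intro add_mono) auto
        also have "\<dots> = (q ^ n - q ^ (n + Suc m)) * \<rho> * w i j" by (simp add: algebra_simps)
        finally show ?case .
      qed simp
      also have "(q ^ n - q ^ (n + m)) * \<rho> * w i j \<le> q ^ n * \<rho> * w i j" for m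
        using q \<rho> w[of i j] by (intro mult_right_mono) auto
      finally have le: "norm (x (n + m) z $ i $ j - x n z $ i $ j) \<le> q ^ n * \<rho> * w i j" for m .
      have "(\<lambda>m. x (m + n) z $ i $ j) \<longlonglongrightarrow> \<xi> z $ i $ j" by (rule LIMSEQ_ignore_initial_segment[OF lim[OF z]])
      then have "(\<lambda>m. norm (x (n + m) z $ i $ j - x n z $ i $ j)) \<longlonglongrightarrow> norm (\<xi> z $ i $ j - x n z $ i $ j)"
        using tendsto_norm[OF tendsto_diff[OF _ tendsto_const]] by (simp add: add.commute)
      then show ?thesis by (rule LIMSEQ_le_const2) (use le in auto)
    qed
    have "T z (\<xi> z) $ i $ j = \<xi> z $ i $ j" for i j
    proof -
      have b: "norm (T z (\<xi> z) $ i $ j - x (Suc n) z $ i $ j) \<le> q ^ Suc n * \<rho> * w i j" for n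
      proof -
        have "norm (T z (\<xi> z) $ i $ j - T z (x n z) $ i $ j) \<le> q * (q ^ n * \<rho>) * w i j"
          by (rule contr[OF z Bl[OF z]]) (use step[OF z, of n] tail q \<rho> in auto)
        then show ?thesis by (simp add: xS mult.assoc)
      qed
      have l0: "(\<lambda>n. T z (\<xi> z) $ i $ j - x (Suc n) z $ i $ j) \<longlonglongrightarrow> 0"
        by (rule Lim_null_comparison[OF _ LIMSEQ_Suc[OF vanish[of i j]]]) (use b in \<open>auto intro: always_eventually\<close>)
      have l1: "(\<lambda>n. T z (\<xi> z) $ i $ j - x (Suc n) z $ i $ j) \<longlonglongrightarrow> T z (\<xi> z) $ i $ j - \<xi> z $ i $ j"
        by (rule tendsto_diff[OF tendsto_const LIMSEQ_Suc[OF lim[OF z]]])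
      from LIMSEQ_unique[OF l0 l1] show ?thesis by simp
    qed
    then show ?thesis by (simp add: vec_eq_iff)
  qed
  have uniq: "X = \<xi> z" if z: "norm z < \<sigma>" and X: "X \<in> Bl" "T z X = X" for z X
  proof -
    have "X $ i $ j = \<xi> z $ i $ j" for i j
    proof -
      have l0: "(\<lambda>n. X $ i $ j - x n z $ i $ j) \<longlonglongrightarrow> 0"
        by (rule Lim_null_comparison[OF _ vanish[of i j]]) (use contract_n[OF z X] in \<open>auto intro: always_eventually\<close>)
      have l1: "(\<lambda>n. X $ i $ j - x n z $ i $ j) \<longlonglongrightarrow> X $ i $ j - \<xi> z $ i $ j"
        by (rule tendsto_diff[OF tendsto_const lim[OF z]])
      from LIMSEQ_unique[OF l0 l1] show ?thesis by simp
    qed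
    then show ?thesis by (simp add: vec_eq_iff)
  qed
  show ?thesis
    by (rule exI[of _ \<xi>]) (use hol\<xi> Bl fix\<xi> uniq in auto)
qed

lemma nhds_triple_box:
  fixes z0 :: "'a::real_normed_vector" and X0 W0 :: "'a^'n^'m"
  assumes "eventually P (nhds (z0, X0, W0))"
  shows "\<exists>\<eta>>0. \<forall>z X W. norm (z - z0) \<le> \<eta> \<longrightarrow> (\<forall>i j. norm (X $ i $ j - X0 $ i $ j) \<le> \<eta>) \<longrightarrow>
    (\<forall>i j. norm (W $ i $ j - W0 $ i $ j) \<le> \<eta>) \<longrightarrow> P (z, X, W)"
proof -
  obtain e where e: "0 < e" "\<And>p. dist p (z0, X0, W0) < e \<Longrightarrow> P p"
    using assms unfolding eventually_nhds_metric by blast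
  define C where "C = 1 + 2 * (real CARD('m) * real CARD('n))"
  have C: "0 < C" by (simp add: C_def add_pos_nonneg)
  define \<eta> where "\<eta> = e / (2 * C)"
  have \<eta>: "0 < \<eta>" using e C by (simp add: \<eta>_def)
  have nrm: "norm V \<le> real CARD('m) * real CARD('n) * \<eta>" if "\<And>i j. norm (V $ i $ j) \<le> \<eta>" for V :: "'a^'n^'m"
  proof -
    have "norm V \<le> (\<Sum>i\<in>UNIV. norm (V $ i))" unfolding norm_vec_def by (rule L2_set_le_sum) simp
    also have "\<dots> \<le> (\<Sum>i\<in>(UNIV::'m set). \<Sum>j\<in>(UNIV::'n set). norm (V $ i $ j))"
      by (intro sum_mono) (simp add: norm_vec_def L2_set_le_sum)
    also have "\<dots> \<le> (\<Sum>i\<in>(UNIV::'m set). \<Sum>j\<in>(UNIV::'n set). \<eta>)" by (intro sum_mono that)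
    finally show ?thesis by (simp add: mult.assoc)
  qed
  show ?thesis
  proof (intro exI[of _ \<eta>] conjI allI impI \<eta>)
    fix z X W assume a: "norm (z - z0) \<le> \<eta>" "\<forall>i j. norm (X $ i $ j - X0 $ i $ j) \<le> \<eta>"
      "\<forall>i j. norm (W $ i $ j - W0 $ i $ j) \<le> \<eta>"
    have "dist (z, X, W) (z0, X0, W0) \<le> norm (z - z0) + norm (X - X0) + norm (W - W0)"
    proof -
      have "dist (z, X, W) (z0, X0, W0) \<le> dist z z0 + dist (X, W) (X0, W0)"
        unfolding dist_Pair_Pair by (rule sqrt_sum_squares_le_sum) auto
      also have "dist (X, W) (X0, W0) \<le> dist X X0 + dist W W0"
        unfolding dist_Pair_Pair by (rule sqrt_sum_squares_le_sum) auto
      finally show ?thesis by (simp add: dist_norm)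
    qed
    also have "\<dots> \<le> \<eta> + real CARD('m) * real CARD('n) * \<eta> + real CARD('m) * real CARD('n) * \<eta>"
      using a by (intro add_mono nrm) auto
    also have "\<dots> = C * \<eta>" by (simp add: C_def algebra_simps)
    also have "\<dots> < e" using C e by (simp add: \<eta>_def)
    finally show "P (z, X, W)" by (rule e(2))
  qed
qed

section \<open>The rescaled equations\<close>

context fluid_perturbation
begin

text \<open>The system of the perturbed model in the unknown whose zero rate columns are divided by the
  parameter \<open>z\<close>, over the reals for the return probabilities and over the complex numbers for the
  analytic branch.  The unknown itself is recovered by multiplication with \<open>scl\<close>; \<open>dz\<close> are the inverse
  absolute rates times \<open>scl\<close>, so the factor \<open>z\<close> of a zero rate column cancels the singular rate.
  \<open>kap\<close> and \<open>dz * mid\<close> are the left and right coefficients of a difference quotient of \<open>F\<close>, which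
  become \<open>K\<close> and \<open>Uh\<close> at parameter zero.\<close>

definition scl :: "'a::real_normed_field \<Rightarrow> 's \<Rightarrow> 'a" where
  "scl z j = (if c $ j = 0 then z else 1)"

definition dz :: "'a::real_normed_field \<Rightarrow> 's \<Rightarrow> 'a" where
  "dz z k = (if 0 < c $ k then 1 / (of_real (c $ k) + z * of_real (ct $ k))
     else if c $ k < 0 then - 1 / (of_real (c $ k) + z * of_real (ct $ k)) else - 1 / of_real (ct $ k))"

definition mid :: "'a::real_normed_field \<Rightarrow> 'a^'s^'s \<Rightarrow> 's \<Rightarrow> 's \<Rightarrow> 'a" where
  "mid z X k j = of_real (A $ k $ j) + scl z j * (\<Sum>l\<in>Up. of_real (A $ k $ l) * X $ l $ j)"

definition F :: "'a::real_normed_field \<Rightarrow> 'a^'s^'s \<Rightarrow> 's \<Rightarrow> 's \<Rightarrow> 'a" where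
  "F z X i j = dz z i * mid z X i j + (\<Sum>k\<in>ND. X $ i $ k * (dz z k * mid z X k j))"

definition kap :: "'a::real_normed_field \<Rightarrow> 'a^'s^'s \<Rightarrow> 's \<Rightarrow> 's \<Rightarrow> 'a" where
  "kap z X i l = dz z i * of_real (A $ i $ l) + (\<Sum>k\<in>ND. X $ i $ k * (dz z k * of_real (A $ k $ l)))"

definition baseM :: "'a::real_normed_field^'s^'s" where
  "baseM = (\<chi> i j. if i \<in> Up \<and> j \<in> ND then of_real (base i j) else 0)"

text \<open>\<open>F\<close> is quadratic, so a difference of its values is exactly linear in the difference of the
  arguments, with coefficients that depend on both.\<close>

lemma F_diff:
  "F z X i j - F z W i j = (\<Sum>l\<in>Up. kap z W i l * (scl z j * (X $ l $ j - W $ l $ j)))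
    + (\<Sum>k\<in>ND. (X $ i $ k - W $ i $ k) * (dz z k * mid z X k j))"
proof -
  define D where "D k = (\<Sum>l\<in>Up. of_real (A $ k $ l) * (X $ l $ j - W $ l $ j))" for k
  have mid: "mid z X k j - mid z W k j = scl z j * D k" for k
    by (simp add: mid_def D_def right_diff_distrib sum_subtractf)
  have "(\<Sum>l\<in>Up. kap z W i l * (scl z j * (X $ l $ j - W $ l $ j)))
      = dz z i * (scl z j * D i) + (\<Sum>k\<in>ND. W $ i $ k * (dz z k * (scl z j * D k)))"
    unfolding kap_def distrib_right sum.distrib D_def sum_distrib_left sum_distrib_right
    by (subst (2) sum.swap) (simp add: mult_ac)
  also have "\<dots> = dz z i * (mid z X i j - mid z W i j) + (\<Sum>k\<in>ND. W $ i $ k * (dz z k * (mid z X k j - mid z W k j)))"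
    by (simp only: mid)
  finally show ?thesis
    by (simp add: F_def algebra_simps sum_subtractf sum.distrib)
qed

lemma scl_0: "j \<in> ND \<Longrightarrow> scl 0 j = (if j \<in> Dn then 1 else 0)"
  by (auto simp: scl_def)

lemma dz_0: "dz 0 k = of_real (dinv k)"
  by (simp add: dz_def dinv_def)

lemma kap_0: "i \<in> Up \<Longrightarrow> kap 0 baseM i l = of_real (K i l)"
  unfolding kap_def K_def row_fun_def baseM_def dz_0 by simp

lemma ups_0: "j \<in> ND \<Longrightarrow> dz 0 k * mid 0 baseM k j = of_real (Uh k j)"
  unfolding Uh_def dz_0 mid_def
  by (cases "j \<in> Dn") (simp_all add: scl_0 baseM_def base_def)

text \<open>A column of \<open>F\<close> plus a combination of the zero rate columns has the same form; with the return
  probabilities from the phases of rate zero as coefficients, this eliminates these phases.\<close>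

lemma F_combine:
  fixes y :: "'s \<Rightarrow> 'a::real_normed_field"
  shows "F z X i j + (\<Sum>q\<in>Lv. F z X i q * y q)
    = dz z i * (mid z X i j + (\<Sum>q\<in>Lv. mid z X i q * y q))
      + (\<Sum>k\<in>ND. X $ i $ k * (dz z k * (mid z X k j + (\<Sum>q\<in>Lv. mid z X k q * y q))))"
proof -
  have "(\<Sum>q\<in>Lv. (\<Sum>k\<in>ND. X $ i $ k * (dz z k * mid z X k q)) * y q)
      = (\<Sum>k\<in>ND. X $ i $ k * (dz z k * (\<Sum>q\<in>Lv. mid z X k q * y q)))"
    unfolding sum_distrib_left sum_distrib_right by (subst sum.swap) (simp add: mult_ac)
  then show ?thesis
    by (simp add: F_def distrib_right distrib_left sum.distrib sum_distrib_left mult.assoc)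
qed

lemma mid_0_Lv: "q \<in> Lv \<Longrightarrow> mid 0 X k q = of_real (A $ k $ q)"
  by (simp add: mid_def scl_def)

lemma F_base:
  assumes i: "i \<in> Up" and j: "j \<in> ND" shows "F 0 baseM i j = (0 :: 'a::real_normed_field)"
proof -
  have L: "F 0 baseM i q = (0 :: 'a)" if q: "q \<in> Lv" for q
  proof -
    have "F 0 baseM i q = (of_real (row_fun i (\<lambda>k. A $ k $ q)) :: 'a)"
      unfolding F_def mid_0_Lv[OF q] dz_0 row_fun_def baseM_def using i by simp
    then show ?thesis using row_fun_Lv[OF i q] by simp
  qed
  have bm: "baseM $ i $ k = (of_real (base i k) :: 'a)" if "c $ k \<le> 0" for k
    using that i by (simp add: baseM_def)
  show ?thesis
  proof (cases "j \<in> Dn")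
    case True
    have M: "mid 0 baseM k j + (\<Sum>q\<in>Lv. mid 0 baseM k q * of_real (Y q j)) = (of_real (AY k j) :: 'a)" for k
      unfolding AY_split[OF True] using True
      by (simp add: mid_0_Lv) (simp add: mid_def scl_def baseM_def base_def)
    have "F 0 baseM i j + (\<Sum>q\<in>Lv. F 0 baseM i q * of_real (Y q j)) = (of_real (row_fun i (\<lambda>k. AY k j)) :: 'a)"
      unfolding F_combine M dz_0 row_fun_def using bm by simp
    then show ?thesis using L row_fun_AY[OF i] by simp
  qed (use L j in auto)
qed

lemma scl_of_real: "scl (of_real e) k = of_real (scl e k)"
  by (simp add: scl_def)

lemma dz_of_real: "dz (of_real e) k = of_real (dz e k)"
  by (simp add: dz_def)

lemma mid_of_real: "mid (of_real e) (\<chi> i j. of_real (X $ i $ j)) k j = of_real (mid e X k j)"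
  by (simp add: mid_def scl_of_real)

lemma F_of_real: "F (of_real e) (\<chi> i j. of_real (X $ i $ j)) i j = of_real (F e X i j)"
  unfolding F_def mid_of_real dz_of_real by simp

lemma tendsto_dz:
  assumes "(zf \<longlongrightarrow> 0) G" shows "((\<lambda>p. dz (zf p) k) \<longlongrightarrow> dz 0 k) G"
proof (cases "c $ k = 0")
  case False
  have "((\<lambda>p. of_real (c $ k) + zf p * of_real (ct $ k)) \<longlongrightarrow> of_real (c $ k) + 0 * of_real (ct $ k)) G"
    by (intro tendsto_intros assms)
  then show ?thesis unfolding dz_def using False by (auto intro!: tendsto_intros)
qed (simp add: dz_def)

lemma tendsto_scl: "(zf \<longlongrightarrow> z) G \<Longrightarrow> ((\<lambda>p. scl (zf p) k) \<longlongrightarrow> scl z k) G"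
  by (simp add: scl_def)

lemma tendsto_mid:
  "(zf \<longlongrightarrow> 0) G \<Longrightarrow> (Xf \<longlongrightarrow> X) G \<Longrightarrow> ((\<lambda>p. mid (zf p) (Xf p) k j) \<longlongrightarrow> mid 0 X k j) G"
  unfolding mid_def by (intro tendsto_intros tendsto_scl)

lemma tendsto_F:
  "(zf \<longlongrightarrow> 0) G \<Longrightarrow> (Xf \<longlongrightarrow> X) G \<Longrightarrow> ((\<lambda>p. F (zf p) (Xf p) k j) \<longlongrightarrow> F 0 X k j) G"
  unfolding F_def by (intro tendsto_intros tendsto_dz tendsto_mid)

lemma tendsto_kap:
  "(zf \<longlongrightarrow> 0) G \<Longrightarrow> (Xf \<longlongrightarrow> X) G \<Longrightarrow> ((\<lambda>p. kap (zf p) (Xf p) k j) \<longlongrightarrow> kap 0 X k j) G"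
  unfolding kap_def by (intro tendsto_intros tendsto_dz)

lemma holomorphic_dz:
  assumes "\<And>k z. c $ k \<noteq> 0 \<Longrightarrow> z \<in> S \<Longrightarrow> of_real (c $ k) + z * of_real (ct $ k) \<noteq> 0"
  shows "(\<lambda>z. dz z k) holomorphic_on S"
proof (cases "c $ k = 0")
  case False
  then show ?thesis using assms[of k] by (cases "0 < c $ k") (auto simp: dz_def intro!: holomorphic_intros)
qed (simp add: dz_def)

lemma holomorphic_F:
  assumes "\<And>k z. c $ k \<noteq> 0 \<Longrightarrow> z \<in> S \<Longrightarrow> of_real (c $ k) + z * of_real (ct $ k) \<noteq> 0"
    and X: "\<And>i j. (\<lambda>z. X z $ i $ j) holomorphic_on S"
  shows "(\<lambda>z. F z (X z) i j) holomorphic_on S"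
proof -
  have s: "(\<lambda>z. scl z j) holomorphic_on S" for j by (cases "c $ j = 0") (simp_all add: scl_def)
  show ?thesis unfolding F_def mid_def
    by (intro holomorphic_intros X s holomorphic_dz assms(1))
qed

section \<open>Convergence of the rescaled return probabilities\<close>

text \<open>The parameters for which no rate of the ascending and descending phases changes its sign.\<close>

definition good :: "real \<Rightarrow> bool" where
  "good e \<longleftrightarrow> 0 < e \<and> (\<forall>i\<in>Up. 0 < c $ i + e * ct $ i) \<and> (\<forall>i\<in>Dn. c $ i + e * ct $ i < 0)"

lemma eventually_good: "eventually good (at_right 0)"
proof -
  have t: "((\<lambda>e. c $ i + e * ct $ i) \<longlongrightarrow> c $ i + 0 * ct $ i) (at_right 0)" for i
    by (intro tendsto_intros)
  have "eventually (\<lambda>e. \<forall>i\<in>Up. 0 < c $ i + e * ct $ i) (at_right 0)"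
    using order_tendstoD(1)[OF t] by (intro eventually_ball_finite) auto
  moreover have "eventually (\<lambda>e. \<forall>i\<in>Dn. c $ i + e * ct $ i < 0) (at_right 0)"
    using order_tendstoD(2)[OF t] by (intro eventually_ball_finite) auto
  ultimately show ?thesis
    using eventually_at_right_less[of "0::real"] unfolding good_def by eventually_elim blast
qed

context
  fixes e :: real
  assumes e: "good e"
begin

lemma good_rate: "0 < (c + e *\<^sub>R ct) $ i \<longleftrightarrow> i \<in> Up" "(c + e *\<^sub>R ct) $ i < 0 \<longleftrightarrow> i \<in> ND" "(c + e *\<^sub>R ct) $ i \<noteq> 0"
proof -
  consider "i \<in> Up" | "i \<in> Dn" | "i \<in> Lv" by fastforce
  then have "(i \<in> Up \<and> 0 < c $ i + e * ct $ i) \<or> (i \<in> ND \<and> c $ i + e * ct $ i < 0)"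
  proof cases
    case 3
    then show ?thesis using e ct_neg[of i] by (auto simp: good_def mult_pos_neg)
  qed (use e in \<open>auto simp: good_def\<close>)
  then show "0 < (c + e *\<^sub>R ct) $ i \<longleftrightarrow> i \<in> Up" "(c + e *\<^sub>R ct) $ i < 0 \<longleftrightarrow> i \<in> ND" "(c + e *\<^sub>R ct) $ i \<noteq> 0"
    by auto
qed

lemma dz_good: "i \<in> Up \<Longrightarrow> dz e i = 1 / (c + e *\<^sub>R ct) $ i"
  "i \<in> ND \<Longrightarrow> dz e i = scl e i / - (c + e *\<^sub>R ct) $ i"
proof -
  show "i \<in> Up \<Longrightarrow> dz e i = 1 / (c + e *\<^sub>R ct) $ i" by (simp add: dz_def)
  assume i: "i \<in> ND"
  show "dz e i = scl e i / - (c + e *\<^sub>R ct) $ i"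
  proof (cases "i \<in> Dn")
    case True
    have "- (1 / (c $ i + e * ct $ i)) = 1 / - (c $ i + e * ct $ i)" by (simp only: minus_divide_right)
    then show ?thesis using True by (simp add: dz_def scl_def del: minus_add_distrib)
  next
    case False
    then show ?thesis using i e ct_neg[of i] by (simp add: dz_def scl_def good_def)
  qed
qed

lemma scl_good: "0 < scl e j"
  using e by (simp add: scl_def good_def)

text \<open>Under the rescaling, the Riccati equation of the perturbed model, in which no rate vanishes,
  becomes \<open>F = 0\<close>.\<close>

lemma riccati_good:
  fixes X' :: "'s \<Rightarrow> 's \<Rightarrow> real"
  assumes X': "\<And>k j. k \<in> Up \<Longrightarrow> j \<in> ND \<Longrightarrow> X' k j = scl e j * X $ k $ j"
    "\<And>k j. k \<in> ND \<Longrightarrow> X' k j = (if k = j then 1 else 0)"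
    and i: "i \<in> Up" and j: "j \<in> ND"
  shows "(\<Sum>k\<in>UNIV. A $ i $ k * X' k j) / (c + e *\<^sub>R ct) $ i
    + (\<Sum>k | (c + e *\<^sub>R ct) $ k < 0. X' i k * ((\<Sum>l\<in>UNIV. A $ k $ l * X' l j) / - (c + e *\<^sub>R ct) $ k)) = F e X i j"
proof -
  have mid: "(\<Sum>l\<in>UNIV. A $ k $ l * X' l j) = mid e X k j" for k
  proof -
    have "(\<Sum>l\<in>UNIV. A $ k $ l * X' l j) = (\<Sum>l\<in>Up. A $ k $ l * X' l j) + (\<Sum>l\<in>ND. A $ k $ l * X' l j)"
      unfolding split_phases split_ND ..
    also have "(\<Sum>l\<in>ND. A $ k $ l * X' l j) = (\<Sum>l\<in>ND. if l = j then A $ k $ j else 0)"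
      by (intro sum.cong) (auto simp: X')
    also have "\<dots> = A $ k $ j" using j by simp
    also have "(\<Sum>l\<in>Up. A $ k $ l * X' l j) = scl e j * (\<Sum>l\<in>Up. A $ k $ l * X $ l $ j)"
      unfolding sum_distrib_left by (intro sum.cong) (use X' j in auto)
    finally show ?thesis by (simp add: mid_def)
  qed
  have "(\<Sum>k | (c + e *\<^sub>R ct) $ k < 0. X' i k * (mid e X k j / - (c + e *\<^sub>R ct) $ k))
      = (\<Sum>k\<in>ND. X $ i $ k * (dz e k * mid e X k j))"
    by (intro sum.cong) (use good_rate(2) X'(1)[OF i] dz_good(2) in auto)
  then show ?thesis unfolding mid F_def using dz_good(1)[OF i] by simp
qed

end

definition scaled_return :: "real \<Rightarrow> real^'s^'s" where
  "scaled_return e = (\<chi> i j. if i \<in> Up \<and> j \<in> ND then return_prob A (c + e *\<^sub>R ct) i j / scl e j else 0)"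

lemma F_scaled_return:
  assumes e: "good e" and i: "i \<in> Up" and j: "j \<in> ND"
  shows "F e (scaled_return e) i j = 0"
proof -
  let ?r = "c + e *\<^sub>R ct"
  note g = good_rate[OF e]
  have no: "{i. ?r $ i = 0} = {}" using g(3) by blast
  have "(\<Sum>k\<in>UNIV. A $ i $ k * return_prob A ?r k j) / ?r $ i
    + (\<Sum>k | ?r $ k < 0. return_prob A ?r i k * ((\<Sum>l\<in>UNIV. A $ k $ l * return_prob A ?r l j) / - ?r $ k)) = 0"
    by (rule return_prob_riccati[OF gen]) (use no g(1) i in auto)
  moreover have "(\<Sum>k\<in>UNIV. A $ i $ k * return_prob A ?r k j) / ?r $ i
    + (\<Sum>k | ?r $ k < 0. return_prob A ?r i k * ((\<Sum>l\<in>UNIV. A $ k $ l * return_prob A ?r l j) / - ?r $ k))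
    = F e (scaled_return e) i j"
  proof (rule riccati_good[OF e _ _ i j])
    fix k l assume "k \<in> Up" "l \<in> ND"
    then show "return_prob A ?r k l = scl e l * scaled_return e $ k $ l"
      using scl_good[OF e, of l] by (simp add: scaled_return_def)
  next
    fix k l assume "k \<in> ND"
    then show "return_prob A ?r k l = (if k = l then 1 else 0)"
      using return_prob_descending[OF gen, of ?r k l] g(2) by simp
  qed
  ultimately show ?thesis by simp
qed

lemma scaled_return_le:
  assumes e: "good e" and X: "\<And>i j. i \<in> Up \<Longrightarrow> j \<in> ND \<Longrightarrow> 0 \<le> X $ i $ j"
    and F: "\<And>i j. i \<in> Up \<Longrightarrow> j \<in> ND \<Longrightarrow> F e X i j \<le> 0"
    and i: "i \<in> Up" and j: "j \<in> ND"
  shows "scaled_return e $ i $ j \<le> X $ i $ j"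
proof -
  let ?r = "c + e *\<^sub>R ct"
  note g = good_rate[OF e]
  define X' where "X' k l = (if k \<in> Up then if l \<in> ND then scl e l * X $ k $ l else 0 else if k = l then 1 else 0)" for k l
  have "return_prob A ?r i j \<le> X' i j"
  proof (rule return_prob_minimal[OF gen])
    show "0 \<le> X' k l" for k l using X[of k l] scl_good[OF e, of l] by (auto simp: X'_def)
    show "(\<Sum>m\<in>UNIV. A $ k $ m * X' m l) / ?r $ k
        + (\<Sum>m | ?r $ m < 0. X' k m * ((\<Sum>q\<in>UNIV. A $ m $ q * X' q l) / - ?r $ m)) \<le> 0"
      if k: "0 < ?r $ k" and l: "?r $ l < 0" for k l
    proof -
      have kl: "k \<in> Up" "l \<in> ND" using k l g(1,2) by auto
      have "(\<Sum>m\<in>UNIV. A $ k $ m * X' m l) / ?r $ k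
        + (\<Sum>m | ?r $ m < 0. X' k m * ((\<Sum>q\<in>UNIV. A $ m $ q * X' q l) / - ?r $ m)) = F e X k l"
        by (rule riccati_good[OF e _ _ kl]) (auto simp: X'_def)
      then show ?thesis using F[OF kl] by (simp only:)
    qed
    show "X' k l = (if k = l then 1 else 0)" if "?r $ k < 0" for k l
      using that unfolding g(2) by (auto simp: X'_def)
  qed (use g j in auto)
  then show ?thesis using i j scl_good[OF e, of j]
    by (simp add: scaled_return_def X'_def pos_divide_le_eq mult.commute)
qed

lemma scaled_return_nonneg: "good e \<Longrightarrow> 0 \<le> scaled_return e $ i $ j"
  by (auto simp: scaled_return_def intro!: divide_nonneg_pos return_prob_nonneg scl_good)

text \<open>Eliminating the columns of rate zero gives back the Riccati equation of the unperturbed model, of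
  which \<open>\<Psi>\<close> is the least nonnegative solution; the zero rate columns of a solution are increasing
  functions of the others.\<close>

lemma base_minimal:
  fixes X :: "real^'s^'s"
  assumes X: "\<And>i j. i \<in> Up \<Longrightarrow> j \<in> ND \<Longrightarrow> 0 \<le> X $ i $ j"
    and F0: "\<And>i j. i \<in> Up \<Longrightarrow> j \<in> ND \<Longrightarrow> F 0 X i j = 0"
    and i: "i \<in> Up" and j: "j \<in> ND"
  shows "base i j \<le> X $ i $ j"
proof -
  define S where "S k l = (\<Sum>m\<in>Up. A $ k $ m * X $ m $ l)" for k l
  define X' where "X' k l = (if k \<in> Up then if l \<in> Dn then X $ k $ l else 0
     else if k \<in> Dn then if k = l then 1 else 0
     else if l \<in> Dn then \<Sum>q\<in>Lv. N k q * (A $ q $ l + S q l) else 0)" for k l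
  have X'nn: "0 \<le> X' k l" for k l
    unfolding X'_def S_def using X level_inv_nonneg A_other
    by (auto intro!: sum_nonneg mult_nonneg_nonneg add_nonneg_nonneg)
  have AX: "(\<Sum>m\<in>UNIV. A $ k $ m * X' m l) = A $ k $ l + S k l + (\<Sum>q\<in>Lv. A $ k $ q * X' q l)" if l: "l \<in> Dn" for k l
  proof -
    have "(\<Sum>m\<in>Dn. A $ k $ m * X' m l) = (\<Sum>m\<in>Dn. if m = l then A $ k $ l else 0)"
      by (intro sum.cong) (auto simp: X'_def)
    also have "\<dots> = A $ k $ l" using l by simp
    finally have "(\<Sum>m\<in>Dn. A $ k $ m * X' m l) = A $ k $ l" .
    moreover have "(\<Sum>m\<in>Up. A $ k $ m * X' m l) = S k l"
      unfolding S_def using l by (intro sum.cong) (auto simp: X'_def)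
    ultimately show ?thesis unfolding split_phases by simp
  qed
  have AX0: "(\<Sum>m\<in>UNIV. A $ k $ m * X' m l) = 0" if k: "k \<in> Lv" and l: "l \<in> Dn" for k l
  proof -
    have "(\<Sum>q\<in>Lv. A $ k $ q * X' q l) = (\<Sum>q\<in>Lv. A $ k $ q * (\<Sum>p\<in>Lv. N q p * (A $ p $ l + S p l)))"
      using l by (intro sum.cong) (auto simp: X'_def)
    also have "\<dots> = (\<Sum>p\<in>Lv. (\<Sum>q\<in>Lv. A $ k $ q * N q p) * (A $ p $ l + S p l))"
      unfolding sum_distrib_left sum_distrib_right by (subst sum.swap) (simp add: mult.assoc)
    also have "\<dots> = (\<Sum>p\<in>Lv. if p = k then - (A $ k $ l + S k l) else 0)"
      by (intro sum.cong refl, subst level_inv(1)[OF k]) auto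
    also have "\<dots> = - (A $ k $ l + S k l)" using k by simp
    finally show ?thesis unfolding AX[OF l] by simp
  qed
  have ric: "(\<Sum>m\<in>UNIV. A $ k $ m * X' m l) / c $ k
        + (\<Sum>m | c $ m < 0. X' k m * ((\<Sum>q\<in>UNIV. A $ m $ q * X' q l) / - c $ m)) = 0"
    if k: "k \<in> Up" and l: "l \<in> Dn" for k l
  proof -
    have M: "mid 0 X m l + (\<Sum>q\<in>Lv. mid 0 X m q * X' q l) = (\<Sum>p\<in>UNIV. A $ m $ p * X' p l)" for m
      unfolding AX[OF l] using l by (simp add: mid_0_Lv) (simp add: mid_def scl_def S_def)
    have "0 = F 0 X k l + (\<Sum>q\<in>Lv. F 0 X k q * X' q l)" using F0[OF k] l by simp
    also have "\<dots> = dinv k * (\<Sum>p\<in>UNIV. A $ k $ p * X' p l)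
        + (\<Sum>m\<in>ND. X $ k $ m * (dinv m * (\<Sum>p\<in>UNIV. A $ m $ p * X' p l)))"
      unfolding F_combine M dz_0 by simp
    also have "(\<Sum>m\<in>ND. X $ k $ m * (dinv m * (\<Sum>p\<in>UNIV. A $ m $ p * X' p l)))
        = (\<Sum>m\<in>Dn. X' k m * ((\<Sum>q\<in>UNIV. A $ m $ q * X' q l) / - c $ m))"
    proof -
      have "(\<Sum>m\<in>Lv. X $ k $ m * (dinv m * (\<Sum>p\<in>UNIV. A $ m $ p * X' p l))) = 0"
        using AX0 l by (intro sum.neutral) auto
      moreover have "(\<Sum>m\<in>Dn. X $ k $ m * (dinv m * (\<Sum>p\<in>UNIV. A $ m $ p * X' p l)))
        = (\<Sum>m\<in>Dn. X' k m * ((\<Sum>q\<in>UNIV. A $ m $ q * X' q l) / - c $ m))"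
        using k by (intro sum.cong refl) (auto simp: X'_def dinv_def)
      ultimately show ?thesis unfolding split_ND by simp
    qed
    finally show ?thesis using k by (simp add: dinv_def)
  qed
  have YX: "Y k l \<le> X' k l" if l: "l \<in> Dn" for k l
  proof (rule return_prob_minimal[OF gen X'nn])
    show "X' m p = (if m = p then 1 else 0)" if "c $ m < 0" for m p using that by (auto simp: X'_def)
    show "(\<Sum>m\<in>UNIV. A $ k $ m * X' m p) \<le> 0" if "c $ k = 0" "c $ p < 0" for k p
      using AX0[of k p] that by simp
  qed (use ric l in auto)
  show ?thesis
  proof (cases "j \<in> Dn")
    case True
    then show ?thesis using YX[OF True, of i] i by (simp add: base_def X'_def)
  next
    case False
    then have j: "j \<in> Lv" using j by auto
    define w where "w x m = A $ i $ m / c $ i + (\<Sum>k\<in>Dn. x k * (A $ k $ m / - c $ k))" for x m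
    have F0': "w (\<lambda>k. X $ i $ k) q + (\<Sum>k\<in>Lv. X $ i $ k * dinv k * A $ k $ q) = 0" if q: "q \<in> Lv" for q
    proof -
      have "(\<Sum>k\<in>Dn. X $ i $ k * (dinv k * A $ k $ q)) = (\<Sum>k\<in>Dn. X $ i $ k * (A $ k $ q / - c $ k))"
        by (intro sum.cong) (auto simp: dinv_def)
      then show ?thesis using F0[OF i, of q] q i unfolding F_def mid_0_Lv[OF q] dz_0 split_ND w_def
        by (simp add: dinv_def mult.assoc)
    qed
    have "X $ i $ j * dinv j = (\<Sum>m\<in>Lv. w (\<lambda>k. X $ i $ k) m * N m j)"
    proof -
      have "(\<Sum>m\<in>Lv. w (\<lambda>k. X $ i $ k) m * N m j) = - (\<Sum>m\<in>Lv. (\<Sum>k\<in>Lv. X $ i $ k * dinv k * A $ k $ m) * N m j)"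
        unfolding sum_negf[symmetric] using F0' by (intro sum.cong refl) (simp add: eq_neg_iff_add_eq_0 flip: distrib_right)
      also have "(\<Sum>m\<in>Lv. (\<Sum>k\<in>Lv. X $ i $ k * dinv k * A $ k $ m) * N m j)
          = (\<Sum>k\<in>Lv. X $ i $ k * dinv k * (\<Sum>m\<in>Lv. A $ k $ m * N m j))"
        unfolding sum_distrib_left sum_distrib_right by (subst sum.swap) (simp add: mult.assoc)
      also have "\<dots> = (\<Sum>k\<in>Lv. if k = j then - (X $ i $ j * dinv j) else 0)"
        by (intro sum.cong refl, subst level_inv(1)[OF _ j]) auto
      also have "\<dots> = - (X $ i $ j * dinv j)" using j by simp
      finally show ?thesis by simp
    qed
    moreover have "(\<Sum>m\<in>Lv. w (Y i) m * N m j) \<le> (\<Sum>m\<in>Lv. w (\<lambda>k. X $ i $ k) m * N m j)"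
    proof (intro sum_mono mult_right_mono)
      fix m assume m: "m \<in> Lv"
      show "0 \<le> N m j" by (rule level_inv_nonneg[OF m j])
      have "(\<Sum>k\<in>Dn. Y i k * (A $ k $ m / - c $ k)) \<le> (\<Sum>k\<in>Dn. X $ i $ k * (A $ k $ m / - c $ k))"
      proof (intro sum_mono mult_right_mono)
        fix k assume k: "k \<in> Dn"
        show "Y i k \<le> X $ i $ k" using YX[OF k, of i] i k by (simp add: X'_def)
        show "0 \<le> A $ k $ m / - c $ k" using A_other[of k m] k m by (intro divide_nonneg_pos) auto
      qed
      then show "w (Y i) m \<le> w (\<lambda>k. X $ i $ k) m" by (simp add: w_def)
    qed
    moreover have "base i j * dinv j = (\<Sum>m\<in>Lv. w (Y i) m * N m j)"
      using j ct_neg[of j] by (simp add: base_def w_def dinv_def)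
    ultimately have "base i j * dinv j \<le> X $ i $ j * dinv j" by simp
    then show ?thesis using dinv_pos[of j] by simp
  qed
qed

text \<open>On the weight \<open>w\<close> the linearization of \<open>F\<close> is strictly negative, so \<open>base + \<delta> w\<close> is a strict
  supersolution at parameter zero for small \<open>\<delta>\<close>.  By continuity it is a supersolution for small
  parameters, and minimality of the return probabilities makes it an upper bound.\<close>

lemma scaled_return_upper:
  "\<exists>w \<delta>0. 0 < \<delta>0 \<and> (\<forall>\<delta>. 0 < \<delta> \<and> \<delta> \<le> \<delta>0 \<longrightarrow>
     eventually (\<lambda>e. \<forall>i\<in>Up. \<forall>j\<in>ND. scaled_return e $ i $ j \<le> base i j + \<delta> * w i j) (at_right 0))"
proof -
  obtain w where w: "\<And>i j. i \<in> Up \<Longrightarrow> j \<in> ND \<Longrightarrow> 0 < w i j"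
    "\<And>i j. i \<in> Up \<Longrightarrow> j \<in> ND \<Longrightarrow> (if j \<in> Dn then \<Sum>l\<in>Up. K i l * w l j else 0) + (\<Sum>k\<in>ND. w i k * Uh k j) < 0"
    using weight_exists by blast
  define X :: "real \<Rightarrow> real^'s^'s" where "X \<delta> = (\<chi> i j. base i j + \<delta> * w i j)" for \<delta>
  define Lw where "Lw i j = (if j \<in> Dn then \<Sum>l\<in>Up. K i l * w l j else 0) + (\<Sum>k\<in>ND. w i k * Uh k j)" for i j
  define R where "R i j = (\<Sum>k\<in>ND. w i k * (dinv k * (scl 0 j * (\<Sum>l\<in>Up. A $ k $ l * w l j))))" for i j
  have FX: "F 0 (X \<delta>) i j = \<delta> * (Lw i j + \<delta> * R i j)" if i: "i \<in> Up" and j: "j \<in> ND" for \<delta> i j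
  proof -
    have bX: "X \<delta> $ i $ j - baseM $ i $ j = \<delta> * w i j" if "i \<in> Up" "j \<in> ND" for i j
      using that by (simp add: X_def baseM_def)
    have m: "dz 0 k * mid 0 (X \<delta>) k j = Uh k j + \<delta> * (dinv k * (scl 0 j * (\<Sum>l\<in>Up. A $ k $ l * w l j)))" for k
    proof -
      have "mid 0 (X \<delta>) k j = mid 0 baseM k j + \<delta> * (scl 0 j * (\<Sum>l\<in>Up. A $ k $ l * w l j))"
        using j unfolding mid_def X_def baseM_def
        by (simp add: distrib_left sum.distrib sum_distrib_left mult_ac)
      then show ?thesis using ups_0[OF j, of k, where 'a = real] by (simp add: distrib_left dz_0)
    qed
    have "F 0 (X \<delta>) i j = F 0 (X \<delta>) i j - F 0 baseM i j" using F_base[OF i j, where 'a = real] by simp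
    also have "\<dots> = (\<Sum>l\<in>Up. K i l * (scl 0 j * (\<delta> * w l j)))
      + (\<Sum>k\<in>ND. (\<delta> * w i k) * (Uh k j + \<delta> * (dinv k * (scl 0 j * (\<Sum>l\<in>Up. A $ k $ l * w l j)))))"
      unfolding F_diff m using bX i j kap_0[OF i, where 'a = real] by simp
    also have "\<dots> = \<delta> * (Lw i j + \<delta> * R i j)"
      unfolding Lw_def R_def scl_0[OF j]
      by (simp add: distrib_left sum.distrib sum_distrib_left mult_ac)
    finally show ?thesis .
  qed
  have Lneg: "Lw i j < 0" if "i \<in> Up" "j \<in> ND" for i j using w(2)[OF that] by (simp add: Lw_def)
  have "eventually (\<lambda>\<delta>. \<forall>i\<in>Up. \<forall>j\<in>ND. Lw i j + \<delta> * R i j < 0) (at_right 0)"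
  proof (intro eventually_ball_finite ballI)
    fix i j assume "i \<in> Up" "j \<in> ND"
    have "((\<lambda>\<delta>. Lw i j + \<delta> * R i j) \<longlongrightarrow> Lw i j + 0 * R i j) (at_right 0)" by (intro tendsto_intros)
    then show "eventually (\<lambda>\<delta>. Lw i j + \<delta> * R i j < 0) (at_right 0)"
      using Lneg[OF \<open>i \<in> Up\<close> \<open>j \<in> ND\<close>] order_tendstoD(2) by fastforce
  qed simp_all
  then obtain b where b: "0 < b" "\<And>\<delta> i j. 0 < \<delta> \<Longrightarrow> \<delta> < b \<Longrightarrow> i \<in> Up \<Longrightarrow> j \<in> ND \<Longrightarrow> Lw i j + \<delta> * R i j < 0"
    unfolding eventually_at_right_field by blast
  show ?thesis
  proof (intro exI[of _ w] exI[of _ "b / 2"] conjI allI impI)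
    show "0 < b / 2" using b by simp
    fix \<delta> assume \<delta>: "0 < \<delta> \<and> \<delta> \<le> b / 2"
    have neg: "F 0 (X \<delta>) i j < 0" if "i \<in> Up" "j \<in> ND" for i j
      unfolding FX[OF that] using b \<delta> that by (intro mult_pos_neg) auto
    have "eventually (\<lambda>e. \<forall>i\<in>Up. \<forall>j\<in>ND. F e (X \<delta>) i j < 0) (at_right 0)"
    proof (intro eventually_ball_finite ballI)
      fix i j assume "i \<in> Up" "j \<in> ND"
      have "((\<lambda>e. F e (X \<delta>) i j) \<longlongrightarrow> F 0 (X \<delta>) i j) (at_right 0)"
        by (rule tendsto_F) (auto intro: tendsto_ident_at)
      then show "eventually (\<lambda>e. F e (X \<delta>) i j < 0) (at_right 0)"
        using neg[OF \<open>i \<in> Up\<close> \<open>j \<in> ND\<close>] order_tendstoD(2) by blast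
    qed simp_all
    then show "eventually (\<lambda>e. \<forall>i\<in>Up. \<forall>j\<in>ND. scaled_return e $ i $ j \<le> base i j + \<delta> * w i j) (at_right 0)"
      using eventually_good
    proof eventually_elim
      case (elim e)
      show ?case
      proof (intro ballI)
        fix i j assume ij: "i \<in> Up" "j \<in> ND"
        have "scaled_return e $ i $ j \<le> X \<delta> $ i $ j"
        proof (rule scaled_return_le[OF elim(2) _ _ ij])
          show "0 \<le> X \<delta> $ i $ j" if "i \<in> Up" "j \<in> ND" for i j
            using base_nonneg[OF that] w(1)[OF that] \<delta> by (simp add: X_def)
          show "F e (X \<delta>) i j \<le> 0" if "i \<in> Up" "j \<in> ND" for i j using elim(1) that by (auto intro: less_imp_le)
        qed
        then show "scaled_return e $ i $ j \<le> base i j + \<delta> * w i j" by (simp add: X_def)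
      qed
    qed
  qed
qed

text \<open>By the upper bound, a sequence of parameters along which the distance stays large has a
  convergent subsequence.  Its limit is a nonnegative zero of \<open>F\<close> at parameter zero, so at least
  \<open>base\<close> by minimality, and at most \<open>base\<close> by the upper bound with arbitrarily small \<open>\<delta>\<close>.\<close>

lemma scaled_return_tendsto:
  assumes \<eta>: "0 < \<eta>"
  shows "eventually (\<lambda>e. \<forall>i j. \<bar>scaled_return e $ i $ j - (baseM :: real^'s^'s) $ i $ j\<bar> \<le> \<eta>) (at_right 0)"
proof (rule ccontr)
  let ?Q = "\<lambda>e. \<forall>i j. \<bar>scaled_return e $ i $ j - (baseM :: real^'s^'s) $ i $ j\<bar> \<le> \<eta>"
  assume not: "\<not> eventually ?Q (at_right 0)"
  obtain w \<delta>0 where \<delta>0: "0 < \<delta>0" and up: "\<And>\<delta>. 0 < \<delta> \<Longrightarrow> \<delta> \<le> \<delta>0 \<Longrightarrow>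
     eventually (\<lambda>e. \<forall>i\<in>Up. \<forall>j\<in>ND. scaled_return e $ i $ j \<le> base i j + \<delta> * w i j) (at_right 0)"
    using scaled_return_upper by blast
  define G where "G e \<longleftrightarrow> good e \<and> (\<forall>i\<in>Up. \<forall>j\<in>ND. scaled_return e $ i $ j \<le> base i j + \<delta>0 * w i j)" for e
  have evG: "eventually G (at_right 0)"
    using eventually_good up[OF \<delta>0 order_refl] unfolding G_def by eventually_elim blast
  have "\<exists>e. 0 < e \<and> e < 1 / real (Suc n) \<and> G e \<and> \<not> ?Q e" for n
  proof -
    obtain b where b: "0 < b" "\<And>e. 0 < e \<Longrightarrow> e < b \<Longrightarrow> G e"
      using evG unfolding eventually_at_right_field by blast
    have "0 < min b (1 / real (Suc n))" using b by simp
    then obtain e where "0 < e" "e < min b (1 / real (Suc n))" "\<not> ?Q e"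
      using not unfolding eventually_at_right_field by blast
    then show ?thesis using b by (intro exI[of _ e]) auto
  qed
  then obtain en where en: "\<And>n. 0 < en n" "\<And>n. en n < 1 / real (Suc n)" "\<And>n. G (en n)" "\<And>n. \<not> ?Q (en n)"
    by metis
  have en0: "en \<longlonglongrightarrow> 0"
  proof (rule tendsto_sandwich[of "\<lambda>_. 0" _ _ "\<lambda>n. 1 / real (Suc n)"])
    show "(\<lambda>n. 1 / real (Suc n)) \<longlonglongrightarrow> 0" using LIMSEQ_inverse_real_of_nat by (simp add: inverse_eq_divide)
  qed (use en in \<open>auto intro!: always_eventually less_imp_le\<close>)
  have enr: "filterlim en (at_right 0) sequentially"
    unfolding filterlim_at
  proof (intro conjI always_eventually allI)
    show "en n \<in> {0<..}" "en n \<noteq> 0" for n using en(1)[of n] by auto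
  qed (rule en0)
  define C where "C = (\<Sum>i\<in>UNIV. \<Sum>j\<in>UNIV. \<bar>base i j + \<delta>0 * w i j\<bar>)"
  have bnd: "norm (scaled_return (en n)) \<le> real CARD('s) * (real CARD('s) * C)" for n
  proof -
    have ent: "norm (scaled_return (en n) $ i $ j) \<le> C" for i j
    proof (cases "i \<in> Up \<and> j \<in> ND")
      case True
      have "\<bar>scaled_return (en n) $ i $ j\<bar> \<le> \<bar>base i j + \<delta>0 * w i j\<bar>"
        using en(3)[of n] scaled_return_nonneg[of "en n" i j] True unfolding G_def by fastforce
      also have "\<dots> \<le> (\<Sum>j\<in>UNIV. \<bar>base i j + \<delta>0 * w i j\<bar>)" by (rule member_le_sum) auto
      also have "\<dots> \<le> C" unfolding C_def by (rule member_le_sum[of i UNIV "\<lambda>i. \<Sum>j\<in>UNIV. \<bar>base i j + \<delta>0 * w i j\<bar>"]) (auto intro: sum_nonneg)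
      finally show ?thesis by simp
    next
      case False
      then show ?thesis unfolding C_def by (auto simp: scaled_return_def intro!: sum_nonneg)
    qed
    have "norm (scaled_return (en n)) \<le> (\<Sum>i\<in>UNIV. norm (scaled_return (en n) $ i))"
      unfolding norm_vec_def by (rule L2_set_le_sum) simp
    also have "\<dots> \<le> (\<Sum>i\<in>(UNIV::'s set). \<Sum>j\<in>(UNIV::'s set). norm (scaled_return (en n) $ i $ j))"
      by (intro sum_mono) (simp add: norm_vec_def L2_set_le_sum)
    also have "\<dots> \<le> (\<Sum>i\<in>(UNIV::'s set). \<Sum>j\<in>(UNIV::'s set). C)" by (intro sum_mono ent)
    finally show ?thesis by simp
  qed
  have "bounded (range (\<lambda>n. scaled_return (en n)))"
    unfolding bounded_iff using bnd by blast
  then obtain X s where s: "strict_mono s" and X: "((\<lambda>n. scaled_return (en n)) \<circ> s) \<longlonglongrightarrow> X"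
    using bounded_imp_convergent_subsequence by blast
  have lim: "(\<lambda>n. scaled_return (en (s n)) $ i $ j) \<longlonglongrightarrow> X $ i $ j" for i j
    using X by (auto intro!: tendsto_vec_nth simp: o_def)
  have ens: "(\<lambda>n. en (s n)) \<longlonglongrightarrow> 0" using LIMSEQ_subseq_LIMSEQ[OF en0 s] by (simp add: o_def)
  have Xnn: "0 \<le> X $ i $ j" for i j
    by (rule LIMSEQ_le_const[OF lim]) (use en(3) scaled_return_nonneg in \<open>auto simp: G_def\<close>)
  have F0: "F 0 X i j = 0" if "i \<in> Up" "j \<in> ND" for i j
  proof -
    have "(\<lambda>n. F (en (s n)) (scaled_return (en (s n))) i j) \<longlonglongrightarrow> F 0 X i j"
      using tendsto_F[OF ens X[unfolded o_def]] .
    moreover have "F (en (s n)) (scaled_return (en (s n))) i j = 0" for n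
      using F_scaled_return that en(3) by (auto simp: G_def)
    ultimately show ?thesis using LIMSEQ_unique[OF _ tendsto_const] by fastforce
  qed
  have lower: "base i j \<le> X $ i $ j" if "i \<in> Up" "j \<in> ND" for i j
    by (rule base_minimal) (use Xnn F0 that in auto)
  have upper: "X $ i $ j \<le> base i j" if ij: "i \<in> Up" "j \<in> ND" for i j
  proof -
    have "X $ i $ j \<le> base i j + \<delta> * w i j" if \<delta>: "0 < \<delta>" "\<delta> < \<delta>0" for \<delta>
    proof -
      have "eventually (\<lambda>n. \<forall>i\<in>Up. \<forall>j\<in>ND. scaled_return (en (s n)) $ i $ j \<le> base i j + \<delta> * w i j) sequentially"
        using eventually_compose_filterlim[OF up[of \<delta>] filterlim_compose[OF enr filterlim_subseq[OF s]]] \<delta> by auto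
      then have "eventually (\<lambda>n. scaled_return (en (s n)) $ i $ j \<le> base i j + \<delta> * w i j) sequentially"
        by eventually_elim (use ij in blast)
      then show ?thesis by (intro tendsto_upperbound[OF lim]) auto
    qed
    then have "eventually (\<lambda>\<delta>. X $ i $ j \<le> base i j + \<delta> * w i j) (at_right 0)"
      unfolding eventually_at_right_field using \<delta>0 by blast
    moreover have "((\<lambda>\<delta>. base i j + \<delta> * w i j) \<longlongrightarrow> base i j + 0 * w i j) (at_right 0)"
      by (intro tendsto_intros)
    ultimately show ?thesis using tendsto_lowerbound[of "\<lambda>\<delta>. base i j + \<delta> * w i j" _ "at_right 0" "X $ i $ j"] by simp
  qed
  have "X $ i $ j = baseM $ i $ j" for i j
  proof (cases "i \<in> Up \<and> j \<in> ND")
    case True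
    then show ?thesis using lower[of i j] upper[of i j] by (auto simp: baseM_def intro: antisym)
  next
    case False
    have "(\<lambda>n. scaled_return (en (s n)) $ i $ j) \<longlonglongrightarrow> 0" using False by (auto simp: scaled_return_def)
    then show ?thesis using LIMSEQ_unique[OF lim[of i j]] False by (auto simp: baseM_def)
  qed
  then have "eventually (\<lambda>n. \<forall>i\<in>UNIV. \<forall>j\<in>UNIV. \<bar>scaled_return (en (s n)) $ i $ j - (baseM :: real^'s^'s) $ i $ j\<bar> < \<eta>) sequentially"
  proof (intro eventually_ball_finite ballI)
    fix i j assume "\<And>i j. X $ i $ j = baseM $ i $ j"
    then show "eventually (\<lambda>n. \<bar>scaled_return (en (s n)) $ i $ j - (baseM :: real^'s^'s) $ i $ j\<bar> < \<eta>) sequentially"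
      using tendstoD[OF lim[of i j] \<eta>] by (simp add: dist_real_def)
  qed simp_all
  then obtain n where "\<forall>i j. \<bar>scaled_return (en (s n)) $ i $ j - (baseM :: real^'s^'s) $ i $ j\<bar> < \<eta>"
    unfolding eventually_sequentially by blast
  then show False using en(4)[of "s n"] by (meson less_imp_le)
qed

section \<open>The analytic branch and its derivative\<close>

text \<open>For small \<open>\<theta>\<close>, the relaxed iteration \<open>X + \<theta> F z X\<close> is a contraction near \<open>base\<close> in the norm
  weighted by \<open>w\<close>: \<open>\<theta>\<close> is chosen such that the diagonal coefficients of identity plus \<open>\<theta>\<close> times the
  linearization are nonnegative, hence its norm is its action on \<open>w\<close>, which is less than \<open>w\<close>.  The
  function \<open>Phi\<close> is this norm for arbitrary arguments; by continuity it stays below \<open>q w\<close> nearby.\<close>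

lemma analytic_branch:
  "\<exists>\<xi> \<sigma> \<eta>. 0 < \<sigma> \<and> 0 < \<eta> \<and> (\<forall>i j. (\<lambda>z. \<xi> z $ i $ j) holomorphic_on ball 0 \<sigma>) \<and>
    (\<forall>z\<in>ball 0 \<sigma>. \<forall>i\<in>Up. \<forall>j\<in>ND. F z (\<xi> z) i j = 0) \<and>
    (\<forall>z\<in>ball 0 \<sigma>. \<forall>X. (\<forall>i j. norm (X $ i $ j - baseM $ i $ j) \<le> \<eta>) \<and> (\<forall>i j. \<not> (i \<in> Up \<and> j \<in> ND) \<longrightarrow> X $ i $ j = 0)
       \<and> (\<forall>i\<in>Up. \<forall>j\<in>ND. F z X i j = 0) \<longrightarrow> X = (\<xi> z :: complex^'s^'s))"
proof -
  obtain w0 where w0: "\<And>i j. i \<in> Up \<Longrightarrow> j \<in> ND \<Longrightarrow> 0 < w0 i j"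
    "\<And>i j. i \<in> Up \<Longrightarrow> j \<in> ND \<Longrightarrow> (if j \<in> Dn then \<Sum>l\<in>Up. K i l * w0 l j else 0) + (\<Sum>k\<in>ND. w0 i k * Uh k j) < 0"
    using weight_exists by blast
  define w where "w i j = (if i \<in> Up \<and> j \<in> ND then w0 i j else 1)" for i j
  have w: "0 < w i j" for i j using w0(1) by (simp add: w_def)
  have Lw: "(if j \<in> Dn then \<Sum>l\<in>Up. K i l * w l j else 0) + (\<Sum>k\<in>ND. w i k * Uh k j) < 0" if "i \<in> Up" "j \<in> ND" for i j
    using w0(2)[OF that] that by (cases "j \<in> Dn") (simp_all add: w_def cong: sum.cong_simp)
  define \<theta> where "\<theta> = 1 / (1 + (\<Sum>i\<in>UNIV. \<bar>K i i\<bar>) + (\<Sum>k\<in>UNIV. \<bar>Uh k k\<bar>))"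
  have den: "0 < 1 + (\<Sum>i\<in>UNIV. \<bar>K i i\<bar>) + (\<Sum>k\<in>UNIV. \<bar>Uh k k\<bar>)"
    by (intro add_pos_nonneg sum_nonneg) auto
  have \<theta>: "0 < \<theta>" using den by (simp add: \<theta>_def)
  have diag: "0 \<le> 1 + \<theta> * ((if j \<in> Dn then K i i else 0) + Uh j j)" for i j
  proof -
    have "\<bar>K i i\<bar> \<le> (\<Sum>i\<in>UNIV. \<bar>K i i\<bar>)" "\<bar>Uh j j\<bar> \<le> (\<Sum>k\<in>UNIV. \<bar>Uh k k\<bar>)"
      by (rule member_le_sum[of i UNIV "\<lambda>i. \<bar>K i i\<bar>"] member_le_sum[of j UNIV "\<lambda>i. \<bar>Uh i i\<bar>"]; simp)+
    then have "- (1 + (\<Sum>i\<in>UNIV. \<bar>K i i\<bar>) + (\<Sum>k\<in>UNIV. \<bar>Uh k k\<bar>)) \<le> (if j \<in> Dn then K i i else 0) + Uh j j"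
      by (auto simp: abs_le_iff split: if_splits)
    then have "\<theta> * - (1 + (\<Sum>i\<in>UNIV. \<bar>K i i\<bar>) + (\<Sum>k\<in>UNIV. \<bar>Uh k k\<bar>)) \<le> \<theta> * ((if j \<in> Dn then K i i else 0) + Uh j j)"
      using \<theta> by (intro mult_left_mono) auto
    moreover have "\<theta> * (1 + (\<Sum>i\<in>UNIV. \<bar>K i i\<bar>) + (\<Sum>k\<in>UNIV. \<bar>Uh k k\<bar>)) = 1"
      unfolding \<theta>_def using den by (intro nonzero_eq_divide_eq[THEN iffD1] refl) auto
    ultimately show ?thesis unfolding mult_minus_right by linarith
  qed
  define ups :: "complex \<Rightarrow> complex^'s^'s \<Rightarrow> 's \<Rightarrow> 's \<Rightarrow> complex" where "ups z X k j = dz z k * mid z X k j" for z X k j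
  define Phi where "Phi p i j = (case p of (z, X, W) \<Rightarrow>
     norm (1 + of_real \<theta> * (kap z W i i * scl z j + ups z X j j)) * w i j
     + \<theta> * ((\<Sum>l\<in>Up - {i}. norm (kap z W i l * scl z j) * w l j) + (\<Sum>k\<in>ND - {j}. norm (ups z X k j) * w i k)))"
    for p :: "complex \<times> (complex^'s^'s) \<times> (complex^'s^'s)" and i j
  let ?b = "baseM :: complex^'s^'s"
  let ?p0 = "(0, ?b, ?b)"
  have Phi0: "Phi ?p0 i j < w i j" if i: "i \<in> Up" and j: "j \<in> ND" for i j
  proof -
    let ?s = "if j \<in> Dn then 1 else 0 :: real"
    have kap: "kap 0 ?b i l * scl 0 j = of_real (?s * K i l)" for l
      unfolding kap_0[OF i] scl_0[OF j] by simp
    have ups: "ups 0 ?b k j = of_real (Uh k j)" for k unfolding ups_def by (rule ups_0[OF j])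
    have "Phi ?p0 i j = \<bar>1 + \<theta> * (?s * K i i + Uh j j)\<bar> * w i j
     + \<theta> * ((\<Sum>l\<in>Up - {i}. \<bar>?s * K i l\<bar> * w l j) + (\<Sum>k\<in>ND - {j}. \<bar>Uh k j\<bar> * w i k))"
    proof -
      have d: "1 + complex_of_real \<theta> * (of_real (?s * K i i) + of_real (Uh j j))
          = of_real (1 + \<theta> * (?s * K i i + Uh j j))" by simp
      show ?thesis unfolding Phi_def prod.case kap ups d norm_of_real ..
    qed
    also have "\<dots> = (1 + \<theta> * (?s * K i i + Uh j j)) * w i j
     + \<theta> * ((\<Sum>l\<in>Up - {i}. ?s * K i l * w l j) + (\<Sum>k\<in>ND - {j}. Uh k j * w i k))"
    proof -
      have "\<bar>1 + \<theta> * (?s * K i i + Uh j j)\<bar> = 1 + \<theta> * (?s * K i i + Uh j j)"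
        using diag[of j i] by (auto split: if_splits)
      moreover have "(\<Sum>l\<in>Up - {i}. \<bar>?s * K i l\<bar> * w l j) = (\<Sum>l\<in>Up - {i}. ?s * K i l * w l j)"
        using K_off[OF i] by (intro sum.cong) auto
      moreover have "(\<Sum>k\<in>ND - {j}. \<bar>Uh k j\<bar> * w i k) = (\<Sum>k\<in>ND - {j}. Uh k j * w i k)"
        using Uh_off[OF _ j] by (intro sum.cong) auto
      ultimately show ?thesis by simp
    qed
    also have "\<dots> = w i j + \<theta> * ((\<Sum>l\<in>Up. ?s * K i l * w l j) + (\<Sum>k\<in>ND. Uh k j * w i k))"
      using i j by (simp add: sum.remove[of Up i] sum.remove[of ND j] algebra_simps)
    also have "(\<Sum>l\<in>Up. ?s * K i l * w l j) + (\<Sum>k\<in>ND. Uh k j * w i k)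
        = (if j \<in> Dn then \<Sum>l\<in>Up. K i l * w l j else 0) + (\<Sum>k\<in>ND. w i k * Uh k j)"
      by (simp add: mult.commute)
    also have "w i j + \<theta> * \<dots> < w i j" using mult_pos_neg[OF \<theta> Lw[OF i j]] by simp
    finally show ?thesis .
  qed
  have "eventually (\<lambda>q. 0 < q \<and> q < 1 \<and> (\<forall>i\<in>Up. \<forall>j\<in>ND. Phi ?p0 i j < q * w i j)) (at_left 1)"
  proof (intro eventually_conj eventually_ball_finite ballI)
    show "eventually (\<lambda>q::real. 0 < q) (at_left 1)" by (rule eventually_at_leftI[of 0]) auto
    show "eventually (\<lambda>q::real. q < 1) (at_left 1)" by (rule eventually_at_leftI[of 0]) auto
    fix i j assume "i \<in> Up" "j \<in> ND"
    have "((\<lambda>q. q * w i j) \<longlongrightarrow> 1 * w i j) (at_left 1)" by (intro tendsto_intros)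
    then show "eventually (\<lambda>q. Phi ?p0 i j < q * w i j) (at_left 1)"
      using Phi0[OF \<open>i \<in> Up\<close> \<open>j \<in> ND\<close>] order_tendstoD(1) by fastforce
  qed simp_all
  from eventually_happens'[OF trivial_limit_at_left_real this]
  obtain q where q: "0 < q" "q < 1" "\<And>i j. i \<in> Up \<Longrightarrow> j \<in> ND \<Longrightarrow> Phi ?p0 i j < q * w i j"
    by blast
  have "eventually (\<lambda>p. \<forall>i\<in>Up. \<forall>j\<in>ND. Phi p i j < q * w i j) (nhds ?p0)"
  proof (intro eventually_ball_finite ballI)
    fix i j assume ij: "i \<in> Up" "j \<in> ND"
    have id: "((\<lambda>p. p) \<longlongrightarrow> ?p0) (nhds ?p0)" by (rule filterlim_ident)
    have z: "(fst \<longlongrightarrow> 0) (nhds ?p0)" using tendsto_fst[OF id] by simp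
    have X: "((\<lambda>p. fst (snd p)) \<longlongrightarrow> ?b) (nhds ?p0)" using tendsto_fst[OF tendsto_snd[OF id]] by simp
    have W: "((\<lambda>p. snd (snd p)) \<longlongrightarrow> ?b) (nhds ?p0)" using tendsto_snd[OF tendsto_snd[OF id]] by simp
    have "((\<lambda>p. Phi p i j) \<longlongrightarrow> Phi ?p0 i j) (nhds ?p0)"
      unfolding Phi_def case_prod_beta' fst_conv snd_conv ups_def
      by (intro tendsto_intros tendsto_kap[OF z W] tendsto_scl[OF z] tendsto_dz[OF z] tendsto_mid[OF z X])
    then show "eventually (\<lambda>p. Phi p i j < q * w i j) (nhds ?p0)"
      using q(3)[OF ij] order_tendstoD(2) by blast
  qed simp_all
  from nhds_triple_box[OF this] obtain \<rho>0 where \<rho>0: "0 < \<rho>0"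
    and box: "\<forall>z X W. norm (z - 0) \<le> \<rho>0 \<longrightarrow> (\<forall>i j. norm (X $ i $ j - ?b $ i $ j) \<le> \<rho>0) \<longrightarrow>
      (\<forall>i j. norm (W $ i $ j - ?b $ i $ j) \<le> \<rho>0) \<longrightarrow> (\<forall>i\<in>Up. \<forall>j\<in>ND. Phi (z, X, W) i j < q * w i j)"
    by (elim exE conjE) blast
  have Phi_lt: "Phi (z, X, W) i j < q * w i j"
    if "norm z \<le> \<rho>0" "\<And>i j. norm (X $ i $ j - ?b $ i $ j) \<le> \<rho>0"
      "\<And>i j. norm (W $ i $ j - ?b $ i $ j) \<le> \<rho>0" "i \<in> Up" "j \<in> ND" for z X W i j
    using box[rule_format, of z X W i j] that by simp
  define \<rho> where "\<rho> = \<rho>0 / (\<Sum>i\<in>UNIV. \<Sum>j\<in>UNIV. w i j)"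
  have wsum: "w i j \<le> (\<Sum>i\<in>UNIV. \<Sum>j\<in>UNIV. w i j)" for i j
  proof -
    have "w i j \<le> (\<Sum>j\<in>UNIV. w i j)" using w by (intro member_le_sum) (auto intro: less_imp_le)
    also have "\<dots> \<le> (\<Sum>i\<in>UNIV. \<Sum>j\<in>UNIV. w i j)"
      by (intro member_le_sum[of i UNIV "\<lambda>i. \<Sum>j\<in>UNIV. w i j"] sum_nonneg less_imp_le[OF w]) simp_all
    finally show ?thesis .
  qed
  have wpos: "0 < (\<Sum>i\<in>UNIV. \<Sum>j\<in>UNIV. w i j)" using less_le_trans[OF w wsum] .
  have \<rho>: "0 < \<rho>" "\<rho> * w i j \<le> \<rho>0" for i j
  proof -
    show "0 < \<rho>" using \<rho>0 wpos by (simp add: \<rho>_def)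
    then have "\<rho> * w i j \<le> \<rho> * (\<Sum>i\<in>UNIV. \<Sum>j\<in>UNIV. w i j)" using wsum by (intro mult_left_mono) auto
    then show "\<rho> * w i j \<le> \<rho>0" using wpos by (simp add: \<rho>_def)
  qed
  have "eventually (\<lambda>z::complex. (\<forall>k\<in>Up \<union> Dn. of_real (c $ k) + z * of_real (ct $ k) \<noteq> 0) \<and> norm z < \<rho>0 \<and>
      (\<forall>i\<in>Up. \<forall>j\<in>ND. norm (of_real \<theta> * F z ?b i j) < (1 - q) * \<rho> * w i j)) (nhds 0)"
  proof (intro eventually_conj eventually_ball_finite ballI)
    fix k assume k: "k \<in> Up \<union> Dn"
    have "((\<lambda>z::complex. of_real (c $ k) + z * of_real (ct $ k)) \<longlongrightarrow> of_real (c $ k) + 0 * of_real (ct $ k)) (nhds 0)"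
      by (intro tendsto_intros filterlim_ident)
    then show "eventually (\<lambda>z::complex. of_real (c $ k) + z * of_real (ct $ k) \<noteq> 0) (nhds 0)"
      by (rule tendsto_imp_eventually_ne) (use k in auto)
  next
    show "eventually (\<lambda>z::complex. norm z < \<rho>0) (nhds 0)"
      using \<rho>0 unfolding eventually_nhds_metric by (auto simp: dist_norm)
  next
    fix i j assume ij: "i \<in> Up" "j \<in> ND"
    have "norm (of_real \<theta> * F 0 ?b i j) < (1 - q) * \<rho> * w i j"
      using F_base[OF ij, where 'a = complex] q(2) \<rho>(1) w[of i j] by simp
    moreover have "((\<lambda>z::complex. norm (of_real \<theta> * F z ?b i j)) \<longlongrightarrow> norm (of_real \<theta> * F 0 ?b i j)) (nhds 0)"
      by (intro tendsto_intros tendsto_F filterlim_ident)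
    ultimately show "eventually (\<lambda>z::complex. norm (of_real \<theta> * F z ?b i j) < (1 - q) * \<rho> * w i j) (nhds 0)"
      by (rule order_tendstoD(2)[rotated])
  qed simp_all
  then obtain \<sigma> where \<sigma>: "0 < \<sigma>" and sm0: "\<forall>z::complex. dist z 0 < \<sigma> \<longrightarrow> (\<forall>k\<in>Up \<union> Dn. of_real (c $ k) + z * of_real (ct $ k) \<noteq> 0) \<and> norm z < \<rho>0 \<and>
      (\<forall>i\<in>Up. \<forall>j\<in>ND. norm (of_real \<theta> * F z ?b i j) < (1 - q) * \<rho> * w i j)"
    unfolding eventually_nhds_metric by (elim exE conjE)
  have sm: "(\<forall>k\<in>Up \<union> Dn. of_real (c $ k) + z * of_real (ct $ k) \<noteq> 0) \<and> norm z < \<rho>0 \<and>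
      (\<forall>i\<in>Up. \<forall>j\<in>ND. norm (of_real \<theta> * F z ?b i j) < (1 - q) * \<rho> * w i j)"
    if "norm z < \<sigma>" for z :: complex
  proof -
    have "dist z 0 < \<sigma>" using that by (simp add: dist_norm)
    with sm0 show ?thesis by blast
  qed
  define T :: "complex \<Rightarrow> complex^'s^'s \<Rightarrow> complex^'s^'s" where
    "T z X = (\<chi> i j. if i \<in> Up \<and> j \<in> ND then X $ i $ j + of_real \<theta> * F z X i j else 0)" for z X
  have Tij: "i \<in> Up \<Longrightarrow> j \<in> ND \<Longrightarrow> T z X $ i $ j = X $ i $ j + of_real \<theta> * F z X i j"
    and Tout: "\<not> (i \<in> Up \<and> j \<in> ND) \<Longrightarrow> T z X $ i $ j = 0" for i j z X by (auto simp: T_def)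
  let ?B = "{X. \<forall>i j. norm (X $ i $ j - ?b $ i $ j) \<le> \<rho> * w i j}"
  have "\<exists>\<xi>. (\<forall>i j. (\<lambda>z. \<xi> z $ i $ j) holomorphic_on ball 0 \<sigma>) \<and>
    (\<forall>z\<in>ball 0 \<sigma>. \<xi> z \<in> ?B \<and> T z (\<xi> z) = \<xi> z \<and> (\<forall>X\<in>?B. T z X = X \<longrightarrow> X = \<xi> z))"
  proof (rule holomorphic_contraction_fixed_point[where q = q])
    show "0 \<le> q" "q < 1" "0 < \<rho>" using q \<rho> by auto
    show "0 < w i j" for i j by (rule w)
    show "norm (T z ?b $ i $ j - ?b $ i $ j) \<le> (1 - q) * \<rho> * w i j" if "norm z < \<sigma>" for z i j
    proof (cases "i \<in> Up \<and> j \<in> ND")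
      case True
      then show ?thesis using sm[OF that] by (auto simp: Tij intro: less_imp_le)
    next
      case False
      then have "?b $ i $ j = 0" by (auto simp: baseM_def)
      then show ?thesis using Tout[OF False] q \<rho>(1) w[of i j] by simp
    qed
    show "(\<lambda>z. T z (X z) $ i $ j) holomorphic_on ball 0 \<sigma>"
      if X: "\<And>i j. (\<lambda>z. X z $ i $ j) holomorphic_on ball 0 \<sigma>" for X i j
    proof (cases "i \<in> Up \<and> j \<in> ND")
      case True
      have "(\<lambda>z. F z (X z) i j) holomorphic_on ball 0 \<sigma>"
      proof (rule holomorphic_F[OF _ X])
        fix k and z :: complex assume "c $ k \<noteq> 0" "z \<in> ball 0 \<sigma>"
        then show "of_real (c $ k) + z * of_real (ct $ k) \<noteq> 0" using sm[of z] by (auto simp: neq_iff)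
      qed
      then show ?thesis using True by (auto simp: Tij intro!: holomorphic_intros X)
    qed (simp add: Tout)
    fix z :: complex and X W :: "complex^'s^'s" and t :: real and i j
    assume z: "norm z < \<sigma>" and X: "X \<in> ?B" and W: "W \<in> ?B" and t: "0 \<le> t"
      and d: "\<And>i j. norm (X $ i $ j - W $ i $ j) \<le> t * w i j"
    show "norm (T z X $ i $ j - T z W $ i $ j) \<le> q * t * w i j"
    proof (cases "i \<in> Up \<and> j \<in> ND")
      case True
      then have i: "i \<in> Up" and j: "j \<in> ND" by auto
      define D where "D i j = X $ i $ j - W $ i $ j" for i j
      have "T z X $ i $ j - T z W $ i $ j = D i j + of_real \<theta> * (F z X i j - F z W i j)"
        using i j by (simp add: Tij D_def algebra_simps)
      also have "\<dots> = D i j + of_real \<theta> * ((\<Sum>l\<in>Up. kap z W i l * (scl z j * D l j)) + (\<Sum>k\<in>ND. D i k * ups z X k j))"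
        unfolding F_diff D_def ups_def ..
      also have "\<dots> = (1 + of_real \<theta> * (kap z W i i * scl z j + ups z X j j)) * D i j
        + of_real \<theta> * ((\<Sum>l\<in>Up - {i}. kap z W i l * scl z j * D l j) + (\<Sum>k\<in>ND - {j}. ups z X k j * D i k))"
        using i j by (simp add: sum.remove[of Up i] sum.remove[of ND j] algebra_simps)
      finally have eq: "T z X $ i $ j - T z W $ i $ j = \<dots>" .
      have n1: "norm (\<Sum>l\<in>Up - {i}. kap z W i l * scl z j * D l j) \<le> (\<Sum>l\<in>Up - {i}. norm (kap z W i l * scl z j) * (t * w l j))"
        by (intro sum_norm_le) (auto simp: norm_mult D_def intro!: mult_left_mono d)
      have n2: "norm (\<Sum>k\<in>ND - {j}. ups z X k j * D i k) \<le> (\<Sum>k\<in>ND - {j}. norm (ups z X k j) * (t * w i k))"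
        by (intro sum_norm_le) (auto simp: norm_mult D_def intro!: mult_left_mono d)
      have "norm (T z X $ i $ j - T z W $ i $ j) \<le>
         norm ((1 + of_real \<theta> * (kap z W i i * scl z j + ups z X j j)) * D i j)
         + norm (of_real \<theta> * ((\<Sum>l\<in>Up - {i}. kap z W i l * scl z j * D l j) + (\<Sum>k\<in>ND - {j}. ups z X k j * D i k)))"
        unfolding eq by (rule norm_triangle_ineq)
      also have "\<dots> \<le> norm (1 + of_real \<theta> * (kap z W i i * scl z j + ups z X j j)) * (t * w i j)
         + \<theta> * ((\<Sum>l\<in>Up - {i}. norm (kap z W i l * scl z j) * (t * w l j)) + (\<Sum>k\<in>ND - {j}. norm (ups z X k j) * (t * w i k)))"
      proof (rule add_mono)
        show "norm ((1 + of_real \<theta> * (kap z W i i * scl z j + ups z X j j)) * D i j)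
          \<le> norm (1 + of_real \<theta> * (kap z W i i * scl z j + ups z X j j)) * (t * w i j)"
          unfolding norm_mult D_def by (intro mult_left_mono d) simp
        have "norm ((\<Sum>l\<in>Up - {i}. kap z W i l * scl z j * D l j) + (\<Sum>k\<in>ND - {j}. ups z X k j * D i k))
          \<le> (\<Sum>l\<in>Up - {i}. norm (kap z W i l * scl z j) * (t * w l j)) + (\<Sum>k\<in>ND - {j}. norm (ups z X k j) * (t * w i k))"
          by (rule order_trans[OF norm_triangle_ineq add_mono[OF n1 n2]])
        then show "norm (of_real \<theta> * ((\<Sum>l\<in>Up - {i}. kap z W i l * scl z j * D l j) + (\<Sum>k\<in>ND - {j}. ups z X k j * D i k)))
          \<le> \<theta> * ((\<Sum>l\<in>Up - {i}. norm (kap z W i l * scl z j) * (t * w l j)) + (\<Sum>k\<in>ND - {j}. norm (ups z X k j) * (t * w i k)))"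
          using \<theta> by (simp add: norm_mult)
      qed
      also have "\<dots> = t * Phi (z, X, W) i j"
        unfolding Phi_def prod.case by (simp add: distrib_left sum_distrib_left mult_ac)
      also have "\<dots> \<le> t * (q * w i j)"
      proof -
        have "norm z \<le> \<rho>0" using sm[OF z] by simp
        moreover have "norm (X $ i $ j - ?b $ i $ j) \<le> \<rho>0" "norm (W $ i $ j - ?b $ i $ j) \<le> \<rho>0" for i j
          by (rule order_trans[OF _ \<rho>(2)[of i j]], use X W in simp)+
        ultimately have "Phi (z, X, W) i j < q * w i j" by (intro Phi_lt i j)
        then show ?thesis by (intro mult_left_mono[OF _ t]) simp
      qed
      finally show ?thesis by (simp add: mult_ac)
    next
      case False
      then show ?thesis using q t w[of i j] by (simp add: Tout)
    qed
  qed
  then obtain \<xi> where hol0: "\<forall>i j. (\<lambda>z. \<xi> z $ i $ j) holomorphic_on ball 0 \<sigma>"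
    and fp: "\<forall>z\<in>ball 0 \<sigma>. \<xi> z \<in> ?B \<and> T z (\<xi> z) = \<xi> z \<and> (\<forall>X\<in>?B. T z X = X \<longrightarrow> X = \<xi> z)"
    by (elim exE conjE)
  have hol: "(\<lambda>z. \<xi> z $ i $ j) holomorphic_on ball 0 \<sigma>" for i j
    by (rule hol0[THEN spec, THEN spec])
  have fix\<xi>: "T z (\<xi> z) = \<xi> z" if "z \<in> ball 0 \<sigma>" for z
    by (rule fp[THEN bspec, OF that, THEN conjunct2, THEN conjunct1])
  have uniq: "X = \<xi> z" if "z \<in> ball 0 \<sigma>" "X \<in> ?B" "T z X = X" for z X
    by (rule fp[THEN bspec, OF that(1), THEN conjunct2, THEN conjunct2, THEN bspec, OF that(2), THEN mp, OF that(3)])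
  define \<eta> where "\<eta> = \<rho> * Min (range (\<lambda>p. w (fst p) (snd p)))"
  have mw: "Min (range (\<lambda>p. w (fst p) (snd p))) \<le> w i j" for i j
    by (rule Min_le) (auto intro: image_eqI[of _ _ "(i, j)"])
  have \<eta>: "0 < \<eta>"
    unfolding \<eta>_def using w \<rho>(1) by (intro mult_pos_pos) (auto simp: Min_gr_iff)
  have \<eta>le: "\<eta> \<le> \<rho> * w i j" for i j unfolding \<eta>_def using \<rho>(1) mw by (intro mult_left_mono) auto
  show ?thesis
  proof (rule exI[of _ \<xi>], rule exI[of _ \<sigma>], rule exI[of _ \<eta>], intro conjI \<sigma> \<eta> allI ballI impI hol)
    fix z :: complex and i j assume z: "z \<in> ball 0 \<sigma>" and ij: "i \<in> Up" "j \<in> ND"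
    have "T z (\<xi> z) $ i $ j = \<xi> z $ i $ j" by (simp only: fix\<xi>[OF z])
    then show "F z (\<xi> z) i j = 0" using \<theta> by (simp add: Tij[OF ij])
  next
    fix z :: complex and X assume z: "z \<in> ball 0 \<sigma>"
      and X: "(\<forall>i j. norm (X $ i $ j - ?b $ i $ j) \<le> \<eta>) \<and> (\<forall>i j. \<not> (i \<in> Up \<and> j \<in> ND) \<longrightarrow> X $ i $ j = 0)
       \<and> (\<forall>i\<in>Up. \<forall>j\<in>ND. F z X i j = 0)"
    show "X = \<xi> z"
    proof (rule uniq[OF z])
      have "norm (X $ i $ j - ?b $ i $ j) \<le> \<rho> * w i j" for i j
        using X[THEN conjunct1, THEN spec, THEN spec] \<eta>le by (rule order_trans)
      then show "X \<in> ?B" by blast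
      show "T z X = X" using X by (simp add: T_def vec_eq_iff)
    qed
  qed
qed

text \<open>The rescaled return probabilities are zeros of \<open>F\<close> that come close to \<open>base\<close>, where the branch
  is the only zero.\<close>

lemma return_branch:
  "\<exists>\<xi> \<sigma>. 0 < \<sigma> \<and> (\<forall>i j. (\<lambda>z. \<xi> z $ i $ j) holomorphic_on ball 0 \<sigma>) \<and>
    (\<forall>z\<in>ball 0 \<sigma>. \<forall>i\<in>Up. \<forall>j\<in>ND. F z (\<xi> z) i j = 0) \<and> \<xi> 0 = (baseM :: complex^'s^'s) \<and>
    eventually (\<lambda>e. \<forall>i j. \<xi> (of_real e) $ i $ j = of_real (scaled_return e $ i $ j)) (at_right 0)"
proof -
  obtain \<xi> :: "complex \<Rightarrow> complex^'s^'s" and \<sigma> \<eta> where br: "0 < \<sigma>" "0 < \<eta>" "\<And>i j. (\<lambda>z. \<xi> z $ i $ j) holomorphic_on ball 0 \<sigma>"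
    "\<forall>z\<in>ball 0 \<sigma>. \<forall>i\<in>Up. \<forall>j\<in>ND. F z (\<xi> z) i j = 0"
    and un0: "\<forall>z\<in>ball 0 \<sigma>. \<forall>X. (\<forall>i j. norm (X $ i $ j - baseM $ i $ j) \<le> \<eta>) \<and> (\<forall>i j. \<not> (i \<in> Up \<and> j \<in> ND) \<longrightarrow> X $ i $ j = 0)
       \<and> (\<forall>i\<in>Up. \<forall>j\<in>ND. F z X i j = 0) \<longrightarrow> X = \<xi> z"
    using analytic_branch by (elim exE conjE) blast
  have un: "X = \<xi> z" if "z \<in> ball 0 \<sigma>" "\<And>i j. norm (X $ i $ j - baseM $ i $ j) \<le> \<eta>"
    "\<And>i j. \<not> (i \<in> Up \<and> j \<in> ND) \<Longrightarrow> X $ i $ j = 0" "\<And>i j. i \<in> Up \<Longrightarrow> j \<in> ND \<Longrightarrow> F z X i j = 0" for z X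
    using un0 that by blast
  have 0: "\<xi> 0 = baseM"
    by (rule un[symmetric]) (use br F_base in \<open>auto simp: baseM_def\<close>)
  have "eventually (\<lambda>e. e < \<sigma>) (at_right 0)"
    using br(1) by (rule eventually_at_right_real[THEN eventually_mono]) auto
  then have "eventually (\<lambda>e. \<forall>i j. \<xi> (of_real e) $ i $ j = of_real (scaled_return e $ i $ j)) (at_right 0)"
    using eventually_good scaled_return_tendsto[OF br(2)]
  proof eventually_elim
    case (elim e)
    have e: "0 < e" using elim by (simp add: good_def)
    have "(\<chi> i j. of_real (scaled_return e $ i $ j)) = \<xi> (of_real e)"
    proof (rule un)
      show "complex_of_real e \<in> ball 0 \<sigma>" using e elim by simp
      show "norm ((\<chi> i j. complex_of_real (scaled_return e $ i $ j)) $ i $ j - baseM $ i $ j) \<le> \<eta>" for i j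
      proof -
        have "(baseM :: complex^'s^'s) $ i $ j = of_real ((baseM :: real^'s^'s) $ i $ j)" by (simp add: baseM_def)
        then have "(\<chi> i j. complex_of_real (scaled_return e $ i $ j)) $ i $ j - baseM $ i $ j
            = of_real (scaled_return e $ i $ j - baseM $ i $ j)" by simp
        then show ?thesis using elim by (simp only: norm_of_real)
      qed
      show "F (of_real e) (\<chi> i j. complex_of_real (scaled_return e $ i $ j)) i j = 0" if "i \<in> Up" "j \<in> ND" for i j
        unfolding F_of_real using F_scaled_return[of e i j] elim that by simp
    qed (auto simp: scaled_return_def)
    then show ?case by (metis vec_lambda_beta)
  qed
  then show ?thesis using br 0 by blast
qed

text \<open>The identity \<open>H = 0\<close>, in which the columns of rate zero are combined with weights \<open>Y q j\<close>, is
  differentiated at zero.  Since \<open>AY\<close> vanishes in the phases of rate zero, the derivative of the zero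
  rate columns drops out; of these columns only the values \<open>base\<close> remain, through the factor \<open>z\<close>.\<close>

lemma branch_derivative:
  fixes \<xi> :: "complex \<Rightarrow> complex^'s^'s"
  assumes \<sigma>: "0 < \<sigma>" and D: "\<And>i j. ((\<lambda>z. \<xi> z $ i $ j) has_field_derivative D i j) (at 0)"
    and F0: "\<And>z i j. z \<in> ball 0 \<sigma> \<Longrightarrow> i \<in> Up \<Longrightarrow> j \<in> ND \<Longrightarrow> F z (\<xi> z) i j = 0"
    and \<xi>0: "\<xi> 0 = baseM"
    and i: "i \<in> Up" and j: "j \<in> Dn"
  shows "(\<Sum>l\<in>Up. K i l * (Re (D l j) + (\<Sum>q\<in>Lv. base l q * Y q j))) + (\<Sum>k\<in>Dn. Re (D i k) * U k j)
    + (\<Sum>k\<in>Dn. Y i k * (ct $ k / - c $ k) * U k j) + ct $ i / c $ i * (\<Sum>k\<in>Dn. Y i k * U k j) = 0"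
proof -
  \<comment> \<open>\<open>d'\<close> is the derivative of the inverse rates at parameter zero\<close>
  define M where "M z k = mid z (\<xi> z) k j + (\<Sum>q\<in>Lv. mid z (\<xi> z) k q * of_real (Y q j))" for z k
  define M' where "M' k = (\<Sum>l\<in>Up. of_real (A $ k $ l) * (D l j + (\<Sum>q\<in>Lv. of_real (base l q * Y q j))))" for k
  define d' where "d' k = (if 0 < c $ k then - ct $ k / (c $ k)\<^sup>2 else if c $ k < 0 then ct $ k / (c $ k)\<^sup>2 else 0)" for k
  have base0: "l \<in> Up \<Longrightarrow> q \<in> ND \<Longrightarrow> \<xi> 0 $ l $ q = of_real (base l q)" for l q by (simp add: \<xi>0 baseM_def)
  have dM: "((\<lambda>z. M z k) has_field_derivative M' k) (at 0)" for k
  proof -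
    have 1: "((\<lambda>z. mid z (\<xi> z) k j) has_field_derivative (\<Sum>l\<in>Up. of_real (A $ k $ l) * D l j)) (at 0)"
    proof -
      have "(\<lambda>z. mid z (\<xi> z) k j) = (\<lambda>z. of_real (A $ k $ j) + (\<Sum>l\<in>Up. of_real (A $ k $ l) * \<xi> z $ l $ j))"
        using j by (simp add: mid_def scl_def)
      moreover have "((\<lambda>z. of_real (A $ k $ j) + (\<Sum>l\<in>Up. of_real (A $ k $ l) * \<xi> z $ l $ j)) has_field_derivative
          0 + (\<Sum>l\<in>Up. of_real (A $ k $ l) * D l j)) (at 0)"
        by (intro DERIV_add DERIV_sum DERIV_cmult D DERIV_const)
      ultimately show ?thesis by simp
    qed
    have 2: "((\<lambda>z. mid z (\<xi> z) k q) has_field_derivative (\<Sum>l\<in>Up. of_real (A $ k $ l) * of_real (base l q))) (at 0)" if q: "q \<in> Lv" for q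
    proof -
      have "(\<lambda>z. mid z (\<xi> z) k q) = (\<lambda>z. of_real (A $ k $ q) + z * (\<Sum>l\<in>Up. of_real (A $ k $ l) * \<xi> z $ l $ q))"
        using q by (simp add: mid_def scl_def)
      moreover have "((\<lambda>z. of_real (A $ k $ q) + z * (\<Sum>l\<in>Up. of_real (A $ k $ l) * \<xi> z $ l $ q)) has_field_derivative
          0 + (1 * (\<Sum>l\<in>Up. of_real (A $ k $ l) * \<xi> 0 $ l $ q) + (\<Sum>l\<in>Up. of_real (A $ k $ l) * D l q) * 0)) (at 0)"
        by (intro DERIV_add DERIV_mult DERIV_sum DERIV_cmult D DERIV_const DERIV_ident)
      ultimately show ?thesis using q base0 by simp
    qed
    have "((\<lambda>z. M z k) has_field_derivative (\<Sum>l\<in>Up. of_real (A $ k $ l) * D l j)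
        + (\<Sum>q\<in>Lv. (\<Sum>l\<in>Up. of_real (A $ k $ l) * of_real (base l q)) * of_real (Y q j))) (at 0)"
      unfolding M_def by (intro DERIV_add 1 DERIV_sum DERIV_cmult_right 2)
    moreover have "(\<Sum>q\<in>Lv. (\<Sum>l\<in>Up. complex_of_real (A $ k $ l) * of_real (base l q)) * of_real (Y q j))
        = (\<Sum>l\<in>Up. of_real (A $ k $ l) * (\<Sum>q\<in>Lv. of_real (base l q * Y q j)))"
      unfolding sum_distrib_left sum_distrib_right by (subst sum.swap) (simp add: mult.assoc)
    ultimately show ?thesis by (simp add: M'_def distrib_left sum.distrib)
  qed
  have M0: "M 0 k = of_real (AY k j)" for k
    unfolding AY_split[OF j] M_def \<xi>0 using j
    by (simp add: mid_0_Lv) (simp add: mid_def scl_def baseM_def base_def)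
  have dd: "((\<lambda>z::complex. dz z k) has_field_derivative of_real (d' k)) (at 0)" for k
  proof (cases "c $ k = 0")
    case True
    then show ?thesis by (simp add: dz_def d'_def)
  next
    case False
    have d1: "((\<lambda>z. 1 / (complex_of_real (c $ k) + z * of_real (ct $ k))) has_field_derivative of_real (- ct $ k / (c $ k)\<^sup>2)) (at 0)"
      using False by (auto intro!: derivative_eq_intros simp: power2_eq_square)
    note d2 = DERIV_minus[OF d1]
    show ?thesis using False d1 d2 by (cases "0 < c $ k") (simp_all add: dz_def d'_def)
  qed
  define H where "H z = dz z i * M z i + (\<Sum>k\<in>ND. \<xi> z $ i $ k * (dz z k * M z k))" for z
  define H' where "H' = (of_real (d' i) * of_real (AY i j) + M' i * of_real (dinv i))
    + (\<Sum>k\<in>ND. D i k * (of_real (dinv k) * of_real (AY k j))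
        + (of_real (d' k) * of_real (AY k j) + M' k * of_real (dinv k)) * of_real (base i k))"
  have "(H has_field_derivative (of_real (d' i) * M 0 i + M' i * dz 0 i)
    + (\<Sum>k\<in>ND. D i k * (dz 0 k * M 0 k) + (of_real (d' k) * M 0 k + M' k * dz 0 k) * \<xi> 0 $ i $ k)) (at 0)"
    unfolding H_def by (intro DERIV_add DERIV_sum DERIV_mult D dd dM)
  moreover have "(of_real (d' i) * M 0 i + M' i * dz 0 i)
    + (\<Sum>k\<in>ND. D i k * (dz 0 k * M 0 k) + (of_real (d' k) * M 0 k + M' k * dz 0 k) * \<xi> 0 $ i $ k) = H'"
    unfolding H'_def M0 dz_0 using base0[OF i] by (simp cong: sum.cong_simp)
  ultimately have dH: "(H has_field_derivative H') (at 0)" by simp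
  have Hz: "H z = 0" if z: "z \<in> ball 0 \<sigma>" for z
  proof -
    have "H z = F z (\<xi> z) i j + (\<Sum>q\<in>Lv. F z (\<xi> z) i q * of_real (Y q j))"
      unfolding F_combine H_def M_def ..
    then show ?thesis using F0[OF z i] j by simp
  qed
  have "((\<lambda>_. 0) has_field_derivative H') (at 0)"
    by (rule has_field_derivative_transform_within_open[OF dH open_ball[of 0 \<sigma>]]) (use \<sigma> Hz in auto)
  then have "H' = 0" using DERIV_const DERIV_unique by blast
  then have "Re H' = 0" by simp
  moreover have "Re H' = (d' i * AY i j + Re (M' i) * dinv i)
    + (\<Sum>k\<in>ND. Re (D i k) * (dinv k * AY k j) + (d' k * AY k j + Re (M' k) * dinv k) * base i k)"
    unfolding H'_def by (simp flip: of_real_mult)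
  ultimately have E: "(d' i * AY i j + Re (M' i) * dinv i)
    + (\<Sum>k\<in>ND. Re (D i k) * (dinv k * AY k j) + (d' k * AY k j + Re (M' k) * dinv k) * base i k) = 0" by simp
  define v where "v l = Re (D l j) + (\<Sum>q\<in>Lv. base l q * Y q j)" for l
  have ReM: "Re (M' k) = (\<Sum>l\<in>Up. A $ k $ l * v l)" for k
    unfolding M'_def v_def by (simp flip: of_real_mult)
  have R: "row_fun i (\<lambda>k. Re (M' k)) = (\<Sum>l\<in>Up. K i l * v l)"
    unfolding ReM row_fun_sum[OF finite] K_def ..
  have U1: "(\<Sum>k\<in>ND. Re (D i k) * (dinv k * AY k j)) = (\<Sum>k\<in>Dn. Re (D i k) * U k j)"
    unfolding split_ND U_def by (simp add: AY_Lv dinv_def)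
  have U2: "(\<Sum>k\<in>ND. d' k * AY k j * base i k) = (\<Sum>k\<in>Dn. Y i k * (ct $ k / - c $ k) * U k j)"
  proof -
    have "(\<Sum>k\<in>Dn. d' k * AY k j * base i k) = (\<Sum>k\<in>Dn. Y i k * (ct $ k / - c $ k) * U k j)"
      by (intro sum.cong) (auto simp: d'_def base_def U_def power2_eq_square field_simps)
    then show ?thesis unfolding split_ND by (simp add: AY_Lv)
  qed
  have U3: "d' i * AY i j = ct $ i / c $ i * (\<Sum>k\<in>Dn. Y i k * U k j)"
  proof -
    have "AY i j / c $ i = - (\<Sum>k\<in>Dn. Y i k * U k j)" using riccati[OF i, of j] by (simp add: U_def)
    moreover have "d' i * AY i j = - (ct $ i / c $ i * (AY i j / c $ i))" using i by (simp add: d'_def power2_eq_square)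
    ultimately show ?thesis by simp
  qed
  show ?thesis
    using E R U1 U2 U3 unfolding row_fun_def v_def
    by (simp add: sum.distrib distrib_right distrib_left algebra_simps)
qed

end

section \<open>Blocks, entry by entry\<close>

lemma blk_nth: "blk I J M $ i $ j = (if i \<in> I \<and> j \<in> J then M $ i $ j else 0)"
  by (simp add: blk_def)

lemma mult_nth: "(M ** X) $ i $ j = (\<Sum>k\<in>UNIV. M $ i $ k * X $ k $ j)"
  by (simp add: matrix_matrix_mult_def)

lemma blk_mult_nth: "(blk I J M ** X) $ i $ j = (if i \<in> I then \<Sum>k\<in>J. M $ i $ k * X $ k $ j else 0)"
proof -
  have "(\<Sum>k\<in>UNIV. blk I J M $ i $ k * X $ k $ j)
      = (\<Sum>k\<in>UNIV. if k \<in> J then (if i \<in> I then M $ i $ k * X $ k $ j else 0) else 0)"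
    by (intro sum.cong) (auto simp: blk_nth)
  also have "\<dots> = (\<Sum>k\<in>J. if i \<in> I then M $ i $ k * X $ k $ j else 0)" by (simp add: sum.If_cases)
  finally show ?thesis by (simp add: mult_nth)
qed

lemma diag_mult_nth: "(blk I I (diagm d) ** X) $ i $ j = (if i \<in> I then d $ i * X $ i $ j else 0)"
  unfolding blk_mult_nth by (simp add: diagm_def if_distrib[of "\<lambda>x. x * _"] cong: if_cong)

lemma mult_diag_nth: "(X ** blk I I (diagm d)) $ i $ j = (if j \<in> I then X $ i $ j * d $ j else 0)"
proof -
  have "(X ** blk I I (diagm d)) $ i $ j = (\<Sum>k\<in>UNIV. if k = j then (if j \<in> I then X $ i $ j * d $ j else 0) else 0)"
    unfolding mult_nth by (intro sum.cong) (auto simp: blk_nth diagm_def)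
  then show ?thesis by simp
qed

lemma blk_one_mult: "blk I I X = X \<Longrightarrow> blk I I (mat 1) ** X = X"
proof -
  assume X: "blk I I X = X"
  have "(blk I I (mat 1) ** X) $ i $ j = X $ i $ j" for i j
  proof -
    have "(blk I I (mat 1) ** X) $ i $ j = (if i \<in> I then X $ i $ j else 0)"
      unfolding blk_mult_nth by (simp add: mat_def if_distrib[of "\<lambda>x. x * _"] cong: if_cong)
    also have "\<dots> = blk I I X $ i $ j" using arg_cong[OF X, of "\<lambda>X. X $ i $ j"] by (auto simp: blk_nth)
    finally show ?thesis by (simp only: X)
  qed
  then show ?thesis by (simp add: vec_eq_iff)
qed

lemma mult_blk_one: "blk I I X = X \<Longrightarrow> X ** blk I I (mat 1) = X"
proof -
  assume X: "blk I I X = X"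
  have "(X ** blk I I (mat 1)) $ i $ j = X $ i $ j" for i j
  proof -
    have "(X ** blk I I (mat 1)) $ i $ j = (\<Sum>k\<in>UNIV. if k = j then (if j \<in> I then X $ i $ j else 0) else 0)"
      unfolding mult_nth by (intro sum.cong) (auto simp: blk_nth mat_def)
    also have "\<dots> = blk I I X $ i $ j" using arg_cong[OF X, of "\<lambda>X. X $ i $ j"] by (auto simp: blk_nth)
    finally show ?thesis by (simp only: X)
  qed
  then show ?thesis by (simp add: vec_eq_iff)
qed

lemma blk_inv_eqI:
  assumes "blk I I X = X" "M ** X = blk I I (mat 1)" "X ** M = blk I I (mat 1)"
  shows "blk_inv I M = X"
  unfolding blk_inv_def
proof (rule the_equality)
  fix Z assume Z: "blk I I Z = Z \<and> M ** Z = blk I I (mat 1) \<and> Z ** M = blk I I (mat 1)"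
  have "Z = Z ** (M ** X)" using Z assms(2) mult_blk_one by metis
  also have "\<dots> = X" using Z blk_one_mult[OF assms(1)] by (simp add: matrix_mul_assoc)
  finally show "Z = X" .
qed (use assms in simp)

lemma blk_inv_diag:
  assumes "\<And>i. i \<in> I \<Longrightarrow> d $ i \<noteq> 0"
  shows "blk_inv I (blk I I (diagm d)) = blk I I (diagm (\<chi> i. 1 / d $ i))"
proof (rule blk_inv_eqI)
  show "blk I I (diagm d) ** blk I I (diagm (\<chi> i. 1 / d $ i)) = blk I I (mat 1)"
    "blk I I (diagm (\<chi> i. 1 / d $ i)) ** blk I I (diagm d) = blk I I (mat 1)"
    unfolding vec_eq_iff diag_mult_nth using assms by (auto simp: blk_nth diagm_def mat_def)
qed (simp add: vec_eq_iff blk_nth)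

lemma abs_blk_diag: "\<bar>blk I I (diagm d)\<bar> = blk I I (diagm (\<chi> i. \<bar>d $ i\<bar>))"
  by (simp add: vec_eq_iff abs_vec_def blk_nth diagm_def)

lemma diag_block_nth:
  "(blk I I (diagm d) ** (blk I J A + blk I Q A ** blk Q J X)) $ i $ j
    = (if i \<in> I \<and> j \<in> J then d $ i * (A $ i $ j + (\<Sum>l\<in>Q. A $ i $ l * X $ l $ j)) else 0)"
  unfolding diag_mult_nth by (auto simp: blk_mult_nth blk_nth intro!: sum.cong sum.neutral)

lemma block_diag_block_nth:
  "(blk I P X ** blk P P (diagm d) ** (blk P J A + blk P Q A ** blk Q J X)) $ i $ j
    = (if i \<in> I \<and> j \<in> J then \<Sum>k\<in>P. X $ i $ k * (d $ k * (A $ k $ j + (\<Sum>l\<in>Q. A $ k $ l * X $ l $ j))) else 0)"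
  unfolding matrix_mul_assoc[symmetric] blk_mult_nth[of I P X] diag_block_nth
  by (auto intro!: sum.cong sum.neutral)

text \<open>Taylor's theorem of orders zero and one on a compact ball, on which the first two derivatives are
  bounded.\<close>

lemma holomorphic_Taylor1_bounds:
  assumes f: "f holomorphic_on ball 0 \<sigma>" and \<sigma>: "0 < \<sigma>"
  obtains C r where "0 < r" "\<And>z. norm z \<le> r \<Longrightarrow> norm (f z - f 0) \<le> C * norm z"
    "\<And>z. norm z \<le> r \<Longrightarrow> norm (f z - f 0 - deriv f 0 * z) \<le> C * norm z ^ 2"
proof -
  define r where "r = \<sigma> / 2"
  have r: "0 < r" and sub: "cball 0 r \<subseteq> ball (0::complex) \<sigma>" using \<sigma> by (auto simp: r_def)
  have h1: "deriv f holomorphic_on ball 0 \<sigma>" by (rule holomorphic_deriv[OF f open_ball])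
  have h2: "deriv (deriv f) holomorphic_on ball 0 \<sigma>" by (rule holomorphic_deriv[OF h1 open_ball])
  have bd: "\<exists>B. \<forall>z\<in>cball 0 r. norm (g z) \<le> B" if "g holomorphic_on ball 0 \<sigma>" for g :: "complex \<Rightarrow> complex"
  proof -
    have "compact (g ` cball 0 r)"
      using that sub by (intro compact_continuous_image holomorphic_on_imp_continuous_on compact_cball) (auto intro: holomorphic_on_subset)
    then show ?thesis using compact_imp_bounded bounded_iff by (metis imageI)
  qed
  obtain B1 where B1: "\<And>z. z \<in> cball 0 r \<Longrightarrow> norm (deriv f z) \<le> B1" using bd[OF h1] by blast
  obtain B2 where B2: "\<And>z. z \<in> cball 0 r \<Longrightarrow> norm (deriv (deriv f) z) \<le> B2" using bd[OF h2] by blast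
  have d: "(g has_field_derivative deriv g z) (at z within cball 0 r)"
    if "g holomorphic_on ball 0 \<sigma>" "z \<in> cball 0 r" for g :: "complex \<Rightarrow> complex" and z
    using holomorphic_derivI[OF that(1) open_ball, of z] that(2) sub by (auto intro: has_field_derivative_at_within)
  let ?F = "\<lambda>i. (deriv ^^ i) f"
  have t0: "norm (f z - f 0) \<le> B1 * norm z" if "norm z \<le> r" for z
  proof -
    have "norm (?F 0 z - (\<Sum>i\<le>0. ?F i 0 * (z - 0) ^ i / fact i)) \<le> B1 * norm (z - 0) ^ Suc 0 / fact 0"
      by (rule complex_Taylor[where S = "cball 0 r"]) (use d[OF f] B1 that r in auto)
    then show ?thesis by simp
  qed
  have t1: "norm (f z - f 0 - deriv f 0 * z) \<le> B2 * norm z ^ 2" if "norm z \<le> r" for z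
  proof -
    have "norm (?F 0 z - (\<Sum>i\<le>1. ?F i 0 * (z - 0) ^ i / fact i)) \<le> B2 * norm (z - 0) ^ Suc 1 / fact 1"
    proof (rule complex_Taylor[where S = "cball 0 r"])
      fix i x assume "x \<in> cball (0::complex) r" "i \<le> (1::nat)"
      then show "(?F i has_field_derivative ?F (Suc i) x) (at x within cball 0 r)"
        using d[OF f] d[OF h1] by (cases i) auto
    qed (use B2 that r in auto)
    then show ?thesis by (simp add: diff_diff_eq power2_eq_square)
  qed
  show ?thesis
  proof (rule that[OF r, of "max B1 B2"])
    fix z :: complex assume z: "norm z \<le> r"
    show "norm (f z - f 0) \<le> max B1 B2 * norm z"
      by (rule order_trans[OF t0[OF z] mult_right_mono]) auto
    show "norm (f z - f 0 - deriv f 0 * z) \<le> max B1 B2 * norm z ^ 2"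
      by (rule order_trans[OF t1[OF z] mult_right_mono]) auto
  qed
qed

context fluid_perturbation
begin

text \<open>The entries of the matrix \<open>Q\<close>, the generator after the phases of rate zero have been eliminated.
  \<open>K\<close> and \<open>U\<close> have been introduced through the full generator; the following lemmas rewrite them in
  terms of \<open>Q\<close>.\<close>

definition Qf :: "'s \<Rightarrow> 's \<Rightarrow> real" where
  "Qf i j = A $ i $ j + (\<Sum>q\<in>Lv. (\<Sum>p\<in>Lv. A $ i $ p * N p q) * A $ q $ j)"

lemma Y_Lv: "q \<in> Lv \<Longrightarrow> j \<in> Dn \<Longrightarrow> Y q j = (\<Sum>p\<in>Lv. N q p * (A $ p $ j + (\<Sum>l\<in>Up. A $ p $ l * Y l j)))"
proof -
  assume q: "q \<in> Lv" and j: "j \<in> Dn"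
  have "A $ p $ j + (\<Sum>l\<in>Up. A $ p $ l * Y l j) = - (\<Sum>m\<in>Lv. A $ p $ m * Y m j)" if "p \<in> Lv" for p
    using AY_split[OF j, of p] AY_Lv[OF that, of j] by simp
  then have "(\<Sum>p\<in>Lv. N q p * (A $ p $ j + (\<Sum>l\<in>Up. A $ p $ l * Y l j))) = - (\<Sum>p\<in>Lv. N q p * (\<Sum>m\<in>Lv. A $ p $ m * Y m j))"
    by (simp add: sum_negf)
  also have "(\<Sum>p\<in>Lv. N q p * (\<Sum>m\<in>Lv. A $ p $ m * Y m j)) = (\<Sum>m\<in>Lv. (\<Sum>p\<in>Lv. N q p * A $ p $ m) * Y m j)"
    unfolding sum_distrib_left sum_distrib_right by (subst sum.swap) (simp add: mult.assoc)
  also have "\<dots> = (\<Sum>m\<in>Lv. if m = q then - Y q j else 0)"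
    by (intro sum.cong refl, subst level_inv(2)[OF q]) auto
  also have "\<dots> = - Y q j" using q by simp
  finally show ?thesis by simp
qed

lemma Qf_Y: "j \<in> Dn \<Longrightarrow> Qf k j + (\<Sum>l\<in>Up. Qf k l * Y l j) = AY k j"
proof -
  assume j: "j \<in> Dn"
  have "(\<Sum>l\<in>Up. (\<Sum>q\<in>Lv. (\<Sum>p\<in>Lv. A $ k $ p * N p q) * A $ q $ l) * Y l j)
      = (\<Sum>q\<in>Lv. (\<Sum>p\<in>Lv. A $ k $ p * N p q) * (\<Sum>l\<in>Up. A $ q $ l * Y l j))"
    unfolding sum_distrib_left sum_distrib_right by (subst sum.swap) (simp add: mult.assoc)
  then have "Qf k j + (\<Sum>l\<in>Up. Qf k l * Y l j) = A $ k $ j + (\<Sum>l\<in>Up. A $ k $ l * Y l j)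
      + (\<Sum>q\<in>Lv. (\<Sum>p\<in>Lv. A $ k $ p * N p q) * (A $ q $ j + (\<Sum>l\<in>Up. A $ q $ l * Y l j)))"
    by (simp add: Qf_def distrib_right distrib_left sum.distrib)
  also have "(\<Sum>q\<in>Lv. (\<Sum>p\<in>Lv. A $ k $ p * N p q) * (A $ q $ j + (\<Sum>l\<in>Up. A $ q $ l * Y l j)))
      = (\<Sum>p\<in>Lv. A $ k $ p * (\<Sum>q\<in>Lv. N p q * (A $ q $ j + (\<Sum>l\<in>Up. A $ q $ l * Y l j))))"
    unfolding sum_distrib_left[of "A $ k $ _"] sum_distrib_right by (subst sum.swap) (simp add: mult.assoc)
  also have "\<dots> = (\<Sum>p\<in>Lv. A $ k $ p * Y p j)" by (intro sum.cong refl) (simp add: Y_Lv[OF _ j])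
  finally show ?thesis by (simp add: AY_split[OF j])
qed

lemma K_Qf: "i \<in> Up \<Longrightarrow> K i l = Qf i l / c $ i + (\<Sum>k\<in>Dn. Y i k * (Qf k l / - c $ k))"
proof -
  assume i: "i \<in> Up"
  define w where "w m = A $ i $ m / c $ i + (\<Sum>k\<in>Dn. Y i k * (A $ k $ m / - c $ k))" for m
  have "(\<Sum>k\<in>Lv. base i k * (dinv k * A $ k $ l)) = (\<Sum>q\<in>Lv. (\<Sum>p\<in>Lv. w p * N p q) * A $ q $ l)"
  proof (intro sum.cong refl)
    fix k assume k: "k \<in> Lv"
    then show "base i k * (dinv k * A $ k $ l) = (\<Sum>m\<in>Lv. w m * N m k) * A $ k $ l"
      using ct_neg[of k] by (simp add: base_def dinv_def w_def)
  qed
  moreover have "(\<Sum>k\<in>Dn. base i k * (dinv k * A $ k $ l)) = (\<Sum>k\<in>Dn. Y i k * (A $ k $ l / - c $ k))"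
    by (intro sum.cong) (auto simp: base_def dinv_def)
  ultimately have "K i l = A $ i $ l / c $ i + (\<Sum>k\<in>Dn. Y i k * (A $ k $ l / - c $ k))
      + (\<Sum>q\<in>Lv. (\<Sum>p\<in>Lv. w p * N p q) * A $ q $ l)"
    using i unfolding K_def row_fun_def split_ND by (simp add: dinv_def)
  also have "(\<Sum>q\<in>Lv. (\<Sum>p\<in>Lv. w p * N p q) * A $ q $ l)
     = (\<Sum>q\<in>Lv. (\<Sum>p\<in>Lv. A $ i $ p * N p q) * A $ q $ l) / c $ i
      + (\<Sum>k\<in>Dn. Y i k * ((\<Sum>q\<in>Lv. (\<Sum>p\<in>Lv. A $ k $ p * N p q) * A $ q $ l) / - c $ k))"
  proof -
    have "(\<Sum>p\<in>Lv. w p * N p q) = (\<Sum>p\<in>Lv. A $ i $ p * N p q) / c $ i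
        + (\<Sum>k\<in>Dn. Y i k / - c $ k * (\<Sum>p\<in>Lv. A $ k $ p * N p q))" for q
    proof -
      have "(\<Sum>p\<in>Lv. (\<Sum>k\<in>Dn. Y i k * (A $ k $ p / - c $ k)) * N p q) = (\<Sum>k\<in>Dn. Y i k / - c $ k * (\<Sum>p\<in>Lv. A $ k $ p * N p q))"
        unfolding sum_distrib_left sum_distrib_right by (subst sum.swap) (simp add: mult.assoc)
      then show ?thesis by (simp add: w_def distrib_right sum.distrib sum_divide_distrib)
    qed
    then have "(\<Sum>q\<in>Lv. (\<Sum>p\<in>Lv. w p * N p q) * A $ q $ l)
      = (\<Sum>q\<in>Lv. (\<Sum>p\<in>Lv. A $ i $ p * N p q) / c $ i * A $ q $ l)
       + (\<Sum>q\<in>Lv. (\<Sum>k\<in>Dn. Y i k / - c $ k * (\<Sum>p\<in>Lv. A $ k $ p * N p q)) * A $ q $ l)"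
      by (simp only: distrib_right sum.distrib)
    also have "(\<Sum>q\<in>Lv. (\<Sum>k\<in>Dn. Y i k / - c $ k * (\<Sum>p\<in>Lv. A $ k $ p * N p q)) * A $ q $ l)
       = (\<Sum>k\<in>Dn. Y i k / - c $ k * (\<Sum>q\<in>Lv. (\<Sum>p\<in>Lv. A $ k $ p * N p q) * A $ q $ l))"
    proof -
      have "(\<Sum>q\<in>Lv. (\<Sum>k\<in>Dn. f k * g k q) * h q) = (\<Sum>k\<in>Dn. f k * (\<Sum>q\<in>Lv. g k q * h q))"
        for f h :: "'s \<Rightarrow> real" and g
        unfolding sum_distrib_left sum_distrib_right by (subst sum.swap) (simp only: mult.assoc)
      then show ?thesis .
    qed
    also have "(\<Sum>q\<in>Lv. (\<Sum>p\<in>Lv. A $ i $ p * N p q) / c $ i * A $ q $ l)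
        = (\<Sum>q\<in>Lv. (\<Sum>p\<in>Lv. A $ i $ p * N p q) * A $ q $ l) / c $ i"
      by (simp only: sum_divide_distrib[of "\<lambda>q. (\<Sum>p\<in>Lv. A $ i $ p * N p q) * A $ q $ l" Lv] times_divide_eq_left)
    finally show ?thesis by (simp only: times_divide_eq_left times_divide_eq_right)
  qed
  finally show ?thesis
    by (simp only: Qf_def add_divide_distrib distrib_left sum.distrib add_ac)
qed

text \<open>The two matrix equations of the theorem are the cases \<open>J = Lv\<close> and \<open>J = Dn\<close>.\<close>

lemma perturbed_system_nth:
  assumes e: "good e" and J: "J \<subseteq> ND" and X: "\<And>i j. X $ i $ j = scl e j * W $ i $ j"
  shows "(blk_inv Up (blk Up Up (diagm c) + e *\<^sub>R blk Up Up (diagm ct)) ** (blk Up J A + blk Up Up A ** blk Up J X)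
     + blk Up Lv X ** blk_inv Lv \<bar>e *\<^sub>R blk Lv Lv (diagm ct)\<bar> ** (blk Lv J A + blk Lv Up A ** blk Up J X)
     + blk Up Dn X ** blk_inv Dn \<bar>blk Dn Dn (diagm c) + e *\<^sub>R blk Dn Dn (diagm ct)\<bar> ** (blk Dn J A + blk Dn Up A ** blk Up J X)) $ i $ j
    = (if i \<in> Up \<and> j \<in> J then F e W i j else 0)"
proof -
  note g = good_rate[OF e]
  have e0: "0 < e" using e by (simp add: good_def)
  have 1: "blk_inv Up (blk Up Up (diagm c) + e *\<^sub>R blk Up Up (diagm ct)) = blk Up Up (diagm (\<chi> i. dz e i))"
  proof -
    have "blk Up Up (diagm c) + e *\<^sub>R blk Up Up (diagm ct) = blk Up Up (diagm (c + e *\<^sub>R ct))"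
      by (simp add: vec_eq_iff blk_nth diagm_def)
    moreover have "blk_inv Up (blk Up Up (diagm (c + e *\<^sub>R ct))) = blk Up Up (diagm (\<chi> i. 1 / (c + e *\<^sub>R ct) $ i))"
      by (rule blk_inv_diag) (use g(3) in blast)
    moreover have "blk Up Up (diagm (\<chi> i. 1 / (c + e *\<^sub>R ct) $ i)) = blk Up Up (diagm (\<chi> i. dz e i))"
      using dz_good(1)[OF e] by (auto simp: vec_eq_iff blk_nth diagm_def)
    ultimately show ?thesis by simp
  qed
  have 2: "blk_inv Lv \<bar>e *\<^sub>R blk Lv Lv (diagm ct)\<bar> = blk Lv Lv (diagm (\<chi> i. dz e i / scl e i))"
  proof -
    have "\<bar>e *\<^sub>R blk Lv Lv (diagm ct)\<bar> = blk Lv Lv (diagm (\<chi> i. - (e * ct $ i)))"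
      using e0 by (auto simp: vec_eq_iff abs_vec_def blk_nth diagm_def abs_mult abs_of_neg[OF ct_neg])
    moreover have "blk_inv Lv (blk Lv Lv (diagm (\<chi> i. - (e * ct $ i)))) = blk Lv Lv (diagm (\<chi> i. 1 / (\<chi> i. - (e * ct $ i)) $ i))"
      by (rule blk_inv_diag) (use e0 ct_neg in force)
    moreover have "blk Lv Lv (diagm (\<chi> i. 1 / (\<chi> i. - (e * ct $ i)) $ i)) = blk Lv Lv (diagm (\<chi> i. dz e i / scl e i))"
      by (auto simp: vec_eq_iff blk_nth diagm_def dz_def scl_def)
    ultimately show ?thesis by simp
  qed
  have 3: "blk_inv Dn \<bar>blk Dn Dn (diagm c) + e *\<^sub>R blk Dn Dn (diagm ct)\<bar> = blk Dn Dn (diagm (\<chi> i. dz e i / scl e i))"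
  proof -
    have "\<bar>blk Dn Dn (diagm c) + e *\<^sub>R blk Dn Dn (diagm ct)\<bar> = blk Dn Dn (diagm (- (c + e *\<^sub>R ct)))"
      using e by (auto simp: good_def vec_eq_iff abs_vec_def blk_nth diagm_def)
    moreover have "blk_inv Dn (blk Dn Dn (diagm (- (c + e *\<^sub>R ct)))) = blk Dn Dn (diagm (\<chi> i. 1 / (- (c + e *\<^sub>R ct)) $ i))"
      by (rule blk_inv_diag) (use e in \<open>force simp: good_def\<close>)
    moreover have "blk Dn Dn (diagm (\<chi> i. 1 / (- (c + e *\<^sub>R ct)) $ i)) = blk Dn Dn (diagm (\<chi> i. dz e i / scl e i))"
    proof -
      have "1 / (- (c + e *\<^sub>R ct)) $ i = dz e i / scl e i" if "i \<in> Dn" for i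
        using dz_good(2)[OF e, of i] that by (simp add: scl_def)
      then show ?thesis by (auto simp: vec_eq_iff blk_nth diagm_def)
    qed
    ultimately show ?thesis by simp
  qed
  have mid: "A $ k $ j + (\<Sum>l\<in>Up. A $ k $ l * X $ l $ j) = mid e W k j" for k
    unfolding mid_def X by (simp add: sum_distrib_left mult_ac)
  have x: "X $ i $ k * (dz e k / scl e k * m) = W $ i $ k * (dz e k * m)" for k m
    using scl_good[OF e, of k] unfolding X by simp
  show ?thesis
    unfolding 1 2 3 vector_add_component diag_block_nth block_diag_block_nth mid vec_lambda_beta x
    by (simp add: F_def split_ND)
qed

lemma level_block_inverse: "- blk_inv Lv (blk Lv Lv A) = blk Lv Lv (\<chi> i j. N i j)"
proof -
  have "blk_inv Lv (blk Lv Lv A) = blk Lv Lv (\<chi> i j. - N i j)"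
  proof (rule blk_inv_eqI)
    show "blk Lv Lv A ** blk Lv Lv (\<chi> i j. - N i j) = blk Lv Lv (mat 1)"
      unfolding vec_eq_iff blk_mult_nth using level_inv(1)
      by (auto simp: blk_nth mat_def sum_negf cong: sum.cong_simp)
    show "blk Lv Lv (\<chi> i j. - N i j) ** blk Lv Lv A = blk Lv Lv (mat 1)"
      unfolding vec_eq_iff blk_mult_nth using level_inv(2)
      by (auto simp: blk_nth mat_def sum_negf cong: sum.cong_simp)
  qed (simp add: vec_eq_iff blk_nth)
  then show ?thesis by (simp add: vec_eq_iff blk_nth)
qed

lemma inverse_rates:
  "blk_inv Up (blk Up Up (diagm c)) = blk Up Up (diagm (\<chi> i. 1 / c $ i))"
  "\<bar>blk_inv Dn (blk Dn Dn (diagm c))\<bar> = blk Dn Dn (diagm (\<chi> i. 1 / - c $ i))"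
proof -
  show "blk_inv Up (blk Up Up (diagm c)) = blk Up Up (diagm (\<chi> i. 1 / c $ i))"
    by (rule blk_inv_diag) auto
  have i: "blk_inv Dn (blk Dn Dn (diagm c)) = blk Dn Dn (diagm (\<chi> i. 1 / c $ i))"
    by (rule blk_inv_diag) auto
  show "\<bar>blk_inv Dn (blk Dn Dn (diagm c))\<bar> = blk Dn Dn (diagm (\<chi> i. 1 / - c $ i))"
    unfolding i abs_blk_diag by (auto simp: vec_eq_iff blk_nth diagm_def)
qed

context
  fixes \<Psi> Q Um Km V P0 :: "real^'s^'s"
  assumes Psi: "\<And>i j. \<Psi> $ i $ j = (if i \<in> Up \<and> j \<in> Dn then Y i j else 0)"
    and Q: "Q = blk (Up \<union> Dn) (Up \<union> Dn) A
                + blk (Up \<union> Dn) Lv A ** (- blk_inv Lv (blk Lv Lv A)) ** blk Lv (Up \<union> Dn) A"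
    and Um: "Um = \<bar>blk_inv Dn (blk Dn Dn (diagm c))\<bar> ** blk Dn Dn Q + \<bar>blk_inv Dn (blk Dn Dn (diagm c))\<bar> ** blk Dn Up Q ** \<Psi>"
    and Km: "Km = blk_inv Up (blk Up Up (diagm c)) ** blk Up Up Q + \<Psi> ** \<bar>blk_inv Dn (blk Dn Dn (diagm c))\<bar> ** blk Dn Up Q"
    and V: "V = (blk_inv Up (blk Up Up (diagm c)) ** blk Up Lv A + \<Psi> ** \<bar>blk_inv Dn (blk Dn Dn (diagm c))\<bar> ** blk Dn Lv A)
                  ** (- blk_inv Lv (blk Lv Lv A)) ** \<bar>blk Lv Lv (diagm ct)\<bar>"
    and P0: "P0 = V ** (- blk_inv Lv (blk Lv Lv A)) ** (blk Lv Dn A + blk Lv Up A ** \<Psi>)"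
begin

lemma Q_nth: "Q $ i $ j = (if i \<in> Up \<union> Dn \<and> j \<in> Up \<union> Dn then Qf i j else 0)"
proof -
  have "(blk (Up \<union> Dn) Lv A ** blk Lv Lv (\<chi> i j. N i j) ** blk Lv (Up \<union> Dn) A) $ i $ j
      = (if i \<in> Up \<union> Dn \<and> j \<in> Up \<union> Dn then \<Sum>p\<in>Lv. A $ i $ p * (\<Sum>q\<in>Lv. N p q * A $ q $ j) else 0)"
    unfolding matrix_mul_assoc[symmetric] blk_mult_nth
    by (auto simp: blk_nth intro!: sum.cong sum.neutral)
  moreover have "(\<Sum>p\<in>Lv. A $ i $ p * (\<Sum>q\<in>Lv. N p q * A $ q $ j)) = (\<Sum>q\<in>Lv. (\<Sum>p\<in>Lv. A $ i $ p * N p q) * A $ q $ j)"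
    unfolding sum_distrib_left sum_distrib_right by (subst sum.swap) (simp only: mult.assoc)
  ultimately show ?thesis
    unfolding Q level_block_inverse vector_add_component by (simp add: blk_nth Qf_def)
qed

lemma Um_nth: "Um $ k $ j = (if k \<in> Dn \<and> j \<in> Dn then U k j else 0)"
proof (cases "k \<in> Dn")
  case True
  have "Um $ k $ j = 1 / - c $ k * (blk Dn Dn Q $ k $ j + (blk Dn Up Q ** \<Psi>) $ k $ j)"
    unfolding Um inverse_rates matrix_mul_assoc[symmetric] vector_add_component diag_mult_nth using True
    by (simp add: distrib_left)
  also have "(blk Dn Up Q ** \<Psi>) $ k $ j = (if j \<in> Dn then \<Sum>l\<in>Up. Qf k l * Y l j else 0)"
    unfolding blk_mult_nth using True by (auto simp: Q_nth Psi intro!: sum.cong)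
  finally show ?thesis using True Qf_Y[of j k] by (auto simp: blk_nth Q_nth U_def)
next
  case False
  then show ?thesis
    unfolding Um inverse_rates matrix_mul_assoc[symmetric] vector_add_component diag_mult_nth by simp
qed

lemma Psi_D_nth:
  "(\<Psi> ** blk Dn Dn (diagm d) ** X) $ i $ j = (if i \<in> Up then \<Sum>k\<in>Dn. Y i k * (d $ k * X $ k $ j) else 0)"
proof -
  have "\<Psi> = blk Up Dn \<Psi>" by (simp add: vec_eq_iff blk_nth Psi)
  then have "(\<Psi> ** blk Dn Dn (diagm d) ** X) $ i $ j = (blk Up Dn \<Psi> ** (blk Dn Dn (diagm d) ** X)) $ i $ j"
    by (simp only: matrix_mul_assoc)
  also have "\<dots> = (if i \<in> Up then \<Sum>k\<in>Dn. Y i k * (d $ k * X $ k $ j) else 0)"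
    unfolding blk_mult_nth[of Up Dn] diag_mult_nth by (auto simp: Psi intro!: sum.cong)
  finally show ?thesis .
qed

lemma Km_nth: "Km $ i $ l = (if i \<in> Up \<and> l \<in> Up then K i l else 0)"
proof -
  have "Km $ i $ l = (if i \<in> Up then 1 / c $ i * blk Up Up Q $ i $ l + (\<Sum>k\<in>Dn. Y i k * (1 / - c $ k * blk Dn Up Q $ k $ l)) else 0)"
    unfolding Km inverse_rates vector_add_component diag_mult_nth Psi_D_nth by simp
  then show ?thesis using K_Qf[of i l] by (auto simp: blk_nth Q_nth intro!: sum.cong)
qed

lemma V_nth: "V $ i $ j = (if i \<in> Up \<and> j \<in> Lv then base i j else 0)"
proof -
  define W where "W = blk_inv Up (blk Up Up (diagm c)) ** blk Up Lv A + \<Psi> ** \<bar>blk_inv Dn (blk Dn Dn (diagm c))\<bar> ** blk Dn Lv A"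
  have W: "W $ i $ m = (if i \<in> Up \<and> m \<in> Lv then A $ i $ m / c $ i + (\<Sum>k\<in>Dn. Y i k * (A $ k $ m / - c $ k)) else 0)" for m
    unfolding W_def inverse_rates vector_add_component diag_mult_nth Psi_D_nth
    by (auto simp: blk_nth intro!: sum.cong)
  have "V $ i $ j = (W ** blk Lv Lv (\<chi> i j. N i j) ** blk Lv Lv (diagm (\<chi> i. \<bar>ct $ i\<bar>))) $ i $ j"
    unfolding V W_def level_block_inverse abs_blk_diag ..
  also have "\<dots> = (if j \<in> Lv then (W ** blk Lv Lv (\<chi> i j. N i j)) $ i $ j * - ct $ j else 0)"
    unfolding mult_diag_nth by (simp add: abs_of_neg[OF ct_neg])
  also have "(W ** blk Lv Lv (\<chi> i j. N i j)) $ i $ j = (\<Sum>m\<in>Lv. W $ i $ m * blk Lv Lv (\<chi> i j. N i j) $ m $ j)"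
    unfolding mult_nth by (rule sum.mono_neutral_right) (auto simp: blk_nth)
  finally show ?thesis by (auto simp: W blk_nth base_def)
qed

lemma P0_nth: "P0 $ l $ j = (if l \<in> Up \<and> j \<in> Dn then \<Sum>q\<in>Lv. base l q * Y q j else 0)"
proof -
  define R where "R = blk Lv Lv (\<chi> i j. N i j) ** (blk Lv Dn A + blk Lv Up A ** \<Psi>)"
  have R: "R $ q $ j = (if q \<in> Lv \<and> j \<in> Dn then Y q j else 0)" for q
  proof -
    have "R $ q $ j = (if q \<in> Lv then \<Sum>p\<in>Lv. N q p * (blk Lv Dn A + blk Lv Up A ** \<Psi>) $ p $ j else 0)"
      unfolding R_def blk_mult_nth by simp
    also have "\<dots> = (if q \<in> Lv \<and> j \<in> Dn then \<Sum>p\<in>Lv. N q p * (A $ p $ j + (\<Sum>l\<in>Up. A $ p $ l * Y l j)) else 0)"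
      unfolding vector_add_component blk_mult_nth by (auto simp: blk_nth Psi intro!: sum.cong sum.neutral)
    finally show ?thesis using Y_Lv[of q j] by auto
  qed
  have "P0 $ l $ j = (V ** R) $ l $ j" unfolding P0 R_def level_block_inverse matrix_mul_assoc ..
  also have "\<dots> = (\<Sum>q\<in>Lv. V $ l $ q * R $ q $ j)"
    unfolding mult_nth by (rule sum.mono_neutral_right) (auto simp: R)
  finally show ?thesis by (auto simp: V_nth R intro!: sum.cong)
qed

text \<open>The last two sums stem from the two terms on the right-hand side that contain the
  perturbation of the rates, and the inner sum over the phases of rate zero is the entry of \<open>P0\<close>.\<close>

lemma sylvester_nth:
  assumes X: "blk Up Dn X = X"
  shows "Km ** X + X ** Um = - (\<Psi> ** \<bar>blk_inv Dn (blk Dn Dn (diagm c))\<bar> ** blk Dn Dn (diagm ct) ** Um)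
                - blk_inv Up (blk Up Up (diagm c)) ** blk Up Up (diagm ct) ** \<Psi> ** Um - Km ** P0
    \<longleftrightarrow> (\<forall>i\<in>Up. \<forall>j\<in>Dn. (\<Sum>l\<in>Up. K i l * (X $ l $ j + (\<Sum>q\<in>Lv. base l q * Y q j))) + (\<Sum>k\<in>Dn. X $ i $ k * U k j)
      + (\<Sum>k\<in>Dn. Y i k * (ct $ k / - c $ k) * U k j) + ct $ i / c $ i * (\<Sum>k\<in>Dn. Y i k * U k j) = 0)"
    (is "?L = ?R \<longleftrightarrow> _")
proof -
  have X0: "X $ i $ j = 0" if "\<not> (i \<in> Up \<and> j \<in> Dn)" for i j
    using arg_cong[OF X, of "\<lambda>X. X $ i $ j"] that by (auto simp: blk_nth)
  have KX: "(Km ** Z) $ i $ j = (if i \<in> Up then \<Sum>l\<in>Up. K i l * Z $ l $ j else 0)" for Z i j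
  proof -
    have "(Km ** Z) $ i $ j = (\<Sum>l\<in>Up. Km $ i $ l * Z $ l $ j)"
      unfolding mult_nth by (rule sum.mono_neutral_right) (auto simp: Km_nth)
    then show ?thesis by (auto simp: Km_nth)
  qed
  have XU: "(Z ** Um) $ i $ j = (if j \<in> Dn then \<Sum>k\<in>Dn. Z $ i $ k * U k j else 0)" for Z i j
  proof -
    have "(Z ** Um) $ i $ j = (\<Sum>k\<in>Dn. Z $ i $ k * Um $ k $ j)"
      unfolding mult_nth by (rule sum.mono_neutral_right) (auto simp: Um_nth)
    then show ?thesis by (auto simp: Um_nth)
  qed
  have T1: "(\<Psi> ** \<bar>blk_inv Dn (blk Dn Dn (diagm c))\<bar> ** blk Dn Dn (diagm ct) ** Um) $ i $ j
      = (if i \<in> Up \<and> j \<in> Dn then \<Sum>k\<in>Dn. Y i k * (ct $ k / - c $ k) * U k j else 0)" for i j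
    unfolding XU inverse_rates mult_diag_nth by (auto simp: Psi intro!: sum.cong)
  have T2: "(blk_inv Up (blk Up Up (diagm c)) ** blk Up Up (diagm ct) ** \<Psi> ** Um) $ i $ j
      = (if i \<in> Up \<and> j \<in> Dn then ct $ i / c $ i * (\<Sum>k\<in>Dn. Y i k * U k j) else 0)" for i j
    unfolding inverse_rates matrix_mul_assoc[symmetric] diag_mult_nth XU by (auto simp: Psi)
  have D: "(?L - ?R) $ i $ j = (if i \<in> Up \<and> j \<in> Dn then
      (\<Sum>l\<in>Up. K i l * (X $ l $ j + (\<Sum>q\<in>Lv. base l q * Y q j))) + (\<Sum>k\<in>Dn. X $ i $ k * U k j)
      + (\<Sum>k\<in>Dn. Y i k * (ct $ k / - c $ k) * U k j) + ct $ i / c $ i * (\<Sum>k\<in>Dn. Y i k * U k j) else 0)" for i j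
    unfolding vector_minus_component vector_add_component vector_uminus_component T1 T2
    unfolding KX XU
    using X0 by (auto simp: P0_nth distrib_left sum.distrib)
  have "?L = ?R \<longleftrightarrow> (\<forall>i j. (?L - ?R) $ i $ j = 0)"
    by (simp add: vec_eq_iff)
  also have "\<dots> \<longleftrightarrow> (\<forall>i\<in>Up. \<forall>j\<in>Dn. (\<Sum>l\<in>Up. K i l * (X $ l $ j + (\<Sum>q\<in>Lv. base l q * Y q j))) + (\<Sum>k\<in>Dn. X $ i $ k * U k j)
      + (\<Sum>k\<in>Dn. Y i k * (ct $ k / - c $ k) * U k j) + ct $ i / c $ i * (\<Sum>k\<in>Dn. Y i k * U k j) = 0)"
    unfolding D by auto
  finally show ?thesis .
qed

end

end

section \<open>The expansion of the return probabilities\<close>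

theorem theorem3p5:
  fixes A :: "real^'s^'s" and c ct xi :: "real^'s"
    and P :: "'s \<Rightarrow> 'w measure" and \<phi> :: "real \<Rightarrow> 'w \<Rightarrow> 's"
    and Sp S0 Sm :: "'s set"
    and Cp Cm Ctp Ct0 Ctm Q \<Psi> U K \<Psi>1p0 P0 :: "real^'s^'s"
    and \<Psi>\<epsilon> :: "real \<Rightarrow> real^'s^'s"
  assumes gen: "generator A"
    and phase: "\<And>i. ctmc A i (P i) \<phi>"
    and Sp: "Sp = {i. 0 < c $ i}" and S0: "S0 = {i. c $ i = 0}" and Sm: "Sm = {i. c $ i < 0}"
    and xi_nonneg: "0 \<le> xi"
    and stationary: "\<And>x. (x v* A = 0 \<and> x \<bullet> 1 = 1) = (x = xi)"
    and drift: "(xi v* diagm c) \<bullet> 1 < 0"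
    and ct_neg: "\<And>i. i \<in> S0 \<Longrightarrow> ct $ i < 0"
    and Cp: "Cp = blk Sp Sp (diagm c)" and Cm: "Cm = blk Sm Sm (diagm c)"
    and Ctp: "Ctp = blk Sp Sp (diagm ct)" and Ct0: "Ct0 = blk S0 S0 (diagm ct)"
    and Ctm: "Ctm = blk Sm Sm (diagm ct)"
    and Psi: "\<Psi> = first_return P \<phi> c"
    and Psi_eps: "\<And>\<epsilon>. \<Psi>\<epsilon> \<epsilon> = first_return P \<phi> (c + \<epsilon> *\<^sub>R ct)"
    and Q: "Q = blk (Sp \<union> Sm) (Sp \<union> Sm) A
                + blk (Sp \<union> Sm) S0 A ** (- blk_inv S0 (blk S0 S0 A)) ** blk S0 (Sp \<union> Sm) A"
    and U: "U = \<bar>blk_inv Sm Cm\<bar> ** blk Sm Sm Q + \<bar>blk_inv Sm Cm\<bar> ** blk Sm Sp Q ** \<Psi>"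
    and K: "K = blk_inv Sp Cp ** blk Sp Sp Q + \<Psi> ** \<bar>blk_inv Sm Cm\<bar> ** blk Sm Sp Q"
    and Psi1p0: "\<Psi>1p0 = (blk_inv Sp Cp ** blk Sp S0 A + \<Psi> ** \<bar>blk_inv Sm Cm\<bar> ** blk Sm S0 A)
                  ** (- blk_inv S0 (blk S0 S0 A)) ** \<bar>Ct0\<bar>"
    and P0: "P0 = \<Psi>1p0 ** (- blk_inv S0 (blk S0 S0 A)) ** (blk S0 Sm A + blk S0 Sp A ** \<Psi>)"
  shows
    (* the matrix of first return probabilities is the minimal nonnegative solution *)
    "(\<forall>\<epsilon>>0. (\<forall>i\<in>Sp. 0 < c $ i + \<epsilon> * ct $ i) \<and> (\<forall>i\<in>Sm. c $ i + \<epsilon> * ct $ i < 0) \<longrightarrow>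
        minimal_nonneg_solution
          (\<lambda>X. blk Sp (S0 \<union> Sm) X = X \<and>
             blk_inv Sp (Cp + \<epsilon> *\<^sub>R Ctp) ** (blk Sp S0 A + blk Sp Sp A ** blk Sp S0 X)
             + blk Sp S0 X ** blk_inv S0 \<bar>\<epsilon> *\<^sub>R Ct0\<bar> ** (blk S0 S0 A + blk S0 Sp A ** blk Sp S0 X)
             + blk Sp Sm X ** blk_inv Sm \<bar>Cm + \<epsilon> *\<^sub>R Ctm\<bar>
                 ** (blk Sm S0 A + blk Sm Sp A ** blk Sp S0 X) = 0 \<and>
             blk_inv Sp (Cp + \<epsilon> *\<^sub>R Ctp) ** (blk Sp Sm A + blk Sp Sp A ** blk Sp Sm X)
             + blk Sp S0 X ** blk_inv S0 \<bar>\<epsilon> *\<^sub>R Ct0\<bar> ** (blk S0 Sm A + blk S0 Sp A ** blk Sp Sm X)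
             + blk Sp Sm X ** blk_inv Sm \<bar>Cm + \<epsilon> *\<^sub>R Ctm\<bar>
                 ** (blk Sm Sm A + blk Sm Sp A ** blk Sp Sm X) = 0)
          (\<Psi>\<epsilon> \<epsilon>)) \<and>
     (\<exists>F :: complex \<Rightarrow> complex^'s^'s.
        (\<forall>i j. (\<lambda>z. F z $ i $ j) analytic_on {0}) \<and>
        (\<forall>\<^sub>F \<epsilon> in at_right 0. \<forall>i j. F (of_real \<epsilon>) $ i $ j = of_real (\<Psi>\<epsilon> \<epsilon> $ i $ j))) \<and>
     (\<exists>\<Psi>1pm.
        (\<forall>X. (blk Sp Sm X = X \<and>
              K ** X + X ** U = - (\<Psi> ** \<bar>blk_inv Sm Cm\<bar> ** Ctm ** U)
                - blk_inv Sp Cp ** Ctp ** \<Psi> ** U - K ** P0) = (X = \<Psi>1pm)) \<and>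
        (\<forall>i j. (\<lambda>\<epsilon>. \<Psi>\<epsilon> \<epsilon> $ i $ j - (\<Psi> + \<epsilon> *\<^sub>R (\<Psi>1p0 + \<Psi>1pm)) $ i $ j)
                 \<in> O[at_right 0](\<lambda>\<epsilon>. \<epsilon>\<^sup>2)))"
proof -
  interpret fluid_perturbation A c ct xi
    by unfold_locales (use gen stationary drift ct_neg S0 in auto)
  have S: "Sp = Up" "S0 = Lv" "Sm = Dn" "S0 \<union> Sm = ND"
    unfolding Sp S0 Sm by auto
  have Psi_nth: "\<Psi> $ i $ j = (if i \<in> Up \<and> j \<in> Dn then Y i j else 0)" for i j
  proof (cases "0 < c $ i \<and> c $ j < 0")
    case True
    then show ?thesis using first_return_eq_return_prob[OF gen phase, of c i j] by (simp add: Psi)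
  next
    case False
    then have "first_return P \<phi> c $ i $ j = 0" by (simp only: first_return_def vec_lambda_beta if_False)
    then show ?thesis using False by (auto simp: Psi)
  qed
  have Psi_eps_nth: "\<Psi>\<epsilon> \<epsilon> $ i $ j = scl \<epsilon> j * scaled_return \<epsilon> $ i $ j" if e: "good \<epsilon>" for \<epsilon> i j
  proof (cases "i \<in> Up \<and> j \<in> ND")
    case True
    then show ?thesis
      using first_return_eq_return_prob[OF gen phase, of "c + \<epsilon> *\<^sub>R ct" i j] good_rate[OF e] scl_good[OF e, of j]
      by (simp add: Psi_eps scaled_return_def)
  next
    case False
    then have "\<not> (0 < (c + \<epsilon> *\<^sub>R ct) $ i \<and> (c + \<epsilon> *\<^sub>R ct) $ j < 0)" using good_rate[OF e] by blast
    then have "first_return P \<phi> (c + \<epsilon> *\<^sub>R ct) $ i $ j = 0" by (simp only: first_return_def vec_lambda_beta if_False)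
    then show ?thesis using False by (auto simp: Psi_eps scaled_return_def)
  qed
  let ?eq = "\<lambda>\<epsilon> J X. blk_inv Sp (Cp + \<epsilon> *\<^sub>R Ctp) ** (blk Sp J A + blk Sp Sp A ** blk Sp J X)
             + blk Sp S0 X ** blk_inv S0 \<bar>\<epsilon> *\<^sub>R Ct0\<bar> ** (blk S0 J A + blk S0 Sp A ** blk Sp J X)
             + blk Sp Sm X ** blk_inv Sm \<bar>Cm + \<epsilon> *\<^sub>R Ctm\<bar>
                 ** (blk Sm J A + blk Sm Sp A ** blk Sp J X)"
  have minimal: "minimal_nonneg_solution (\<lambda>X. blk Sp (S0 \<union> Sm) X = X \<and> ?eq \<epsilon> S0 X = 0 \<and> ?eq \<epsilon> Sm X = 0) (\<Psi>\<epsilon> \<epsilon>)"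
    if e: "good \<epsilon>" for \<epsilon>
  proof -
    have entries: "?eq \<epsilon> J X = 0 \<longleftrightarrow> (\<forall>i\<in>Up. \<forall>j\<in>J. F \<epsilon> W i j = 0)"
      if J: "J \<subseteq> ND" and X: "\<And>i j. X $ i $ j = scl \<epsilon> j * W $ i $ j" for J X W
    proof -
      have "?eq \<epsilon> J X = 0 \<longleftrightarrow> (\<forall>i j. ?eq \<epsilon> J X $ i $ j = 0)" by (simp add: vec_eq_iff)
      also have "\<dots> \<longleftrightarrow> (\<forall>i\<in>Up. \<forall>j\<in>J. F \<epsilon> W i j = 0)"
        unfolding S Cp Cm Ctp Ct0 Ctm perturbed_system_nth[OF e J X] by auto
      finally show ?thesis .
    qed
    have sub: "Lv \<subseteq> ND" "Dn \<subseteq> ND" by auto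
    show ?thesis
      unfolding minimal_nonneg_solution_def
    proof (intro conjI allI impI)
      show "0 \<le> \<Psi>\<epsilon> \<epsilon>"
        using scaled_return_nonneg[OF e] scl_good[OF e]
        by (simp add: less_eq_vec_def Psi_eps_nth[OF e] less_imp_le)
      show "blk Sp (S0 \<union> Sm) (\<Psi>\<epsilon> \<epsilon>) = \<Psi>\<epsilon> \<epsilon>"
        unfolding S by (auto simp: vec_eq_iff blk_nth Psi_eps_nth[OF e] scaled_return_def)
      show "?eq \<epsilon> S0 (\<Psi>\<epsilon> \<epsilon>) = 0" "?eq \<epsilon> Sm (\<Psi>\<epsilon> \<epsilon>) = 0"
        using entries[OF _ Psi_eps_nth[OF e]] F_scaled_return[OF e] sub unfolding S by auto
    next
      fix Z assume Z: "0 \<le> Z \<and> blk Sp (S0 \<union> Sm) Z = Z \<and> ?eq \<epsilon> S0 Z = 0 \<and> ?eq \<epsilon> Sm Z = 0"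
      \<comment> \<open>another solution, rescaled, is a nonnegative zero of \<open>F\<close>, hence above the rescaled return probabilities\<close>
      define W :: "real^'s^'s" where "W = (\<chi> i j. Z $ i $ j / scl \<epsilon> j)"
      have ZW: "Z $ i $ j = scl \<epsilon> j * W $ i $ j" for i j using scl_good[OF e, of j] by (simp add: W_def)
      have "F \<epsilon> W i j = 0" if "i \<in> Up" "j \<in> ND" for i j
        using entries[OF sub(1) ZW] entries[OF sub(2) ZW] Z that unfolding S by (cases "j \<in> Dn") auto
      moreover have Z0: "0 \<le> Z $ i $ j" for i j using Z by (simp add: less_eq_vec_def)
      then have "0 \<le> W $ i $ j" for i j using scl_good[OF e, of j] by (simp add: W_def)
      ultimately have le: "scaled_return \<epsilon> $ i $ j \<le> W $ i $ j" if "i \<in> Up" "j \<in> ND" for i j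
        using that by (intro scaled_return_le[OF e]) auto
      have "\<Psi>\<epsilon> \<epsilon> $ i $ j \<le> Z $ i $ j" for i j
      proof (cases "i \<in> Up \<and> j \<in> ND")
        case True
        then show ?thesis unfolding Psi_eps_nth[OF e] ZW
          using le scl_good[OF e, of j] by (intro mult_left_mono) auto
      next
        case False
        then have "scaled_return \<epsilon> $ i $ j = 0" by (auto simp: scaled_return_def)
        then show ?thesis using Z0 by (simp add: Psi_eps_nth[OF e])
      qed
      then show "\<Psi>\<epsilon> \<epsilon> \<le> Z" by (simp add: less_eq_vec_def)
    qed
  qed
  obtain \<xi> :: "complex \<Rightarrow> complex^'s^'s" and \<sigma> where \<sigma>: "0 < \<sigma>"
    and hol: "\<And>i j. (\<lambda>z. \<xi> z $ i $ j) holomorphic_on ball 0 \<sigma>"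
    and F\<xi>: "\<And>z i j. z \<in> ball 0 \<sigma> \<Longrightarrow> i \<in> Up \<Longrightarrow> j \<in> ND \<Longrightarrow> F z (\<xi> z) i j = 0"
    and \<xi>0: "\<xi> 0 = baseM"
    and \<xi>eq: "eventually (\<lambda>e. \<forall>i j. \<xi> (of_real e) $ i $ j = of_real (scaled_return e $ i $ j)) (at_right 0)"
    using return_branch by (elim exE conjE) blast
  have analytic: "\<exists>F :: complex \<Rightarrow> complex^'s^'s.
        (\<forall>i j. (\<lambda>z. F z $ i $ j) analytic_on {0}) \<and>
        (\<forall>\<^sub>F \<epsilon> in at_right 0. \<forall>i j. F (of_real \<epsilon>) $ i $ j = of_real (\<Psi>\<epsilon> \<epsilon> $ i $ j))"
  proof (intro exI[of _ "\<lambda>z. \<chi> i j. scl z j * \<xi> z $ i $ j"] conjI allI)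
    fix i j
    have "(\<lambda>z::complex. scl z j) holomorphic_on ball 0 \<sigma>" by (cases "c $ j = 0") (simp_all add: scl_def)
    then have "(\<lambda>z. scl z j * \<xi> z $ i $ j) holomorphic_on ball 0 \<sigma>" by (intro holomorphic_on_mult hol)
    then have "(\<lambda>z. scl z j * \<xi> z $ i $ j) analytic_on {0}" using \<sigma> by (auto simp: analytic_at intro!: exI[of _ "ball 0 \<sigma>"])
    then show "(\<lambda>z. (\<chi> i j. scl z j * \<xi> z $ i $ j) $ i $ j) analytic_on {0}" by simp
  next
    show "\<forall>\<^sub>F \<epsilon> in at_right 0. \<forall>i j. (\<chi> i j. scl (complex_of_real \<epsilon>) j * \<xi> (of_real \<epsilon>) $ i $ j) $ i $ j = of_real (\<Psi>\<epsilon> \<epsilon> $ i $ j)"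
      using \<xi>eq eventually_good
      by eventually_elim (simp add: Psi_eps_nth scl_of_real)
  qed
  define D where "D i j = deriv (\<lambda>z. \<xi> z $ i $ j) 0" for i j
  have D: "((\<lambda>z. \<xi> z $ i $ j) has_field_derivative D i j) (at 0)" for i j
    unfolding D_def by (rule holomorphic_derivI[OF hol open_ball]) (use \<sigma> in simp)
  \<comment> \<open>the branch is real on the real axis, so its derivative is real and \<open>Re\<close> loses nothing\<close>
  define W :: "real^'s^'s" where "W = (\<chi> i j. if i \<in> Up \<and> j \<in> Dn then Re (D i j) else 0)"
  \<comment> \<open>from here on \<open>local.K\<close> and \<open>local.U\<close> are the entries, while \<open>K\<close> and \<open>U\<close> are the matrices of the statement\<close>
  note mats = Psi_nth Q[unfolded S] U[unfolded S Cm] K[unfolded S Cp Cm] Psi1p0[unfolded S Cp Cm Ct0] P0[unfolded S]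
  have syl: "K ** X + X ** U = - (\<Psi> ** \<bar>blk_inv Sm Cm\<bar> ** Ctm ** U) - blk_inv Sp Cp ** Ctp ** \<Psi> ** U - K ** P0
    \<longleftrightarrow> (\<forall>i\<in>Up. \<forall>j\<in>Dn. (\<Sum>l\<in>Up. local.K i l * (X $ l $ j + (\<Sum>q\<in>Lv. base l q * Y q j)))
      + (\<Sum>k\<in>Dn. X $ i $ k * local.U k j)
      + (\<Sum>k\<in>Dn. Y i k * (ct $ k / - c $ k) * local.U k j)
      + ct $ i / c $ i * (\<Sum>k\<in>Dn. Y i k * local.U k j) = 0)"
    if "blk Sp Sm X = X" for X
    unfolding S Cp Cm Ctp Ctm
    by (rule sylvester_nth[OF mats]) (use that in \<open>simp add: S\<close>)
  have W_solves: "\<forall>i\<in>Up. \<forall>j\<in>Dn. (\<Sum>l\<in>Up. local.K i l * (W $ l $ j + (\<Sum>q\<in>Lv. base l q * Y q j)))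
      + (\<Sum>k\<in>Dn. W $ i $ k * local.U k j)
      + (\<Sum>k\<in>Dn. Y i k * (ct $ k / - c $ k) * local.U k j)
      + ct $ i / c $ i * (\<Sum>k\<in>Dn. Y i k * local.U k j) = 0"
  proof (intro ballI)
    fix i j assume ij: "i \<in> Up" "j \<in> Dn"
    show "(\<Sum>l\<in>Up. local.K i l * (W $ l $ j + (\<Sum>q\<in>Lv. base l q * Y q j)))
      + (\<Sum>k\<in>Dn. W $ i $ k * local.U k j)
      + (\<Sum>k\<in>Dn. Y i k * (ct $ k / - c $ k) * local.U k j)
      + ct $ i / c $ i * (\<Sum>k\<in>Dn. Y i k * local.U k j) = 0"
      using branch_derivative[OF \<sigma> D F\<xi> \<xi>0 ij] ij by (simp add: W_def cong: sum.cong_simp)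
  qed
  have W_blk: "blk Sp Sm W = W" unfolding S by (simp add: vec_eq_iff blk_nth W_def)
  have unique: "(blk Sp Sm X = X \<and>
              K ** X + X ** U = - (\<Psi> ** \<bar>blk_inv Sm Cm\<bar> ** Ctm ** U)
                - blk_inv Sp Cp ** Ctp ** \<Psi> ** U - K ** P0) = (X = W)" for X
  proof
    assume X: "blk Sp Sm X = X \<and>
              K ** X + X ** U = - (\<Psi> ** \<bar>blk_inv Sm Cm\<bar> ** Ctm ** U)
                - blk_inv Sp Cp ** Ctp ** \<Psi> ** U - K ** P0"
    note X_solves = syl[THEN iffD1, OF conjunct1[OF X] conjunct2[OF X]]
    have "X $ i $ j - W $ i $ j = 0" if ij: "i \<in> Up" "j \<in> Dn" for i j
    proof (rule sylvester_unique[OF _ ij, of "\<lambda>i j. X $ i $ j - W $ i $ j"])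
      fix i j assume ij: "i \<in> Up" "j \<in> Dn"
      show "(\<Sum>l\<in>Up. local.K i l * (X $ l $ j - W $ l $ j))
        + (\<Sum>k\<in>Dn. (X $ i $ k - W $ i $ k) * local.U k j) = 0"
        using X_solves[rule_format, OF ij] W_solves[rule_format, OF ij]
        by (simp add: distrib_left right_diff_distrib left_diff_distrib sum.distrib sum_subtractf)
    qed
    moreover have "X $ i $ j = W $ i $ j" if "\<not> (i \<in> Up \<and> j \<in> Dn)" for i j
      using arg_cong[OF conjunct1[OF X], of "\<lambda>X. X $ i $ j"] that unfolding S by (auto simp: blk_nth W_def)
    ultimately show "X = W" by (auto simp: vec_eq_iff)
  next
    assume "X = W"
    then show "blk Sp Sm X = X \<and>
              K ** X + X ** U = - (\<Psi> ** \<bar>blk_inv Sm Cm\<bar> ** Ctm ** U)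
                - blk_inv Sp Cp ** Ctp ** \<Psi> ** U - K ** P0"
      using W_blk syl[OF W_blk] W_solves by blast
  qed
  have expansion: "(\<lambda>\<epsilon>. \<Psi>\<epsilon> \<epsilon> $ i $ j - (\<Psi> + \<epsilon> *\<^sub>R (\<Psi>1p0 + W)) $ i $ j) \<in> O[at_right 0](\<lambda>\<epsilon>. \<epsilon>\<^sup>2)" for i j
  proof -
    obtain C r where r: "0 < r" and C1: "\<And>z. norm z \<le> r \<Longrightarrow> norm (\<xi> z $ i $ j - \<xi> 0 $ i $ j) \<le> C * norm z"
      and C2': "\<And>z. norm z \<le> r \<Longrightarrow> norm (\<xi> z $ i $ j - \<xi> 0 $ i $ j - deriv (\<lambda>z. \<xi> z $ i $ j) 0 * z) \<le> C * norm z ^ 2"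
      by (rule holomorphic_Taylor1_bounds[OF hol \<sigma>, of i j]) (rule that)
    note C2 = C2'[folded D_def]
    have base: "i \<in> Up \<Longrightarrow> j \<in> ND \<Longrightarrow> \<xi> 0 $ i $ j = of_real (base i j)" by (simp add: \<xi>0 baseM_def)
    have small: "eventually (\<lambda>\<epsilon>. \<epsilon> < r) (at_right 0)"
      using r by (rule eventually_at_right_real[THEN eventually_mono]) auto
    show ?thesis
    proof (rule bigoI[of _ C])
      show "\<forall>\<^sub>F \<epsilon> in at_right 0. norm (\<Psi>\<epsilon> \<epsilon> $ i $ j - (\<Psi> + \<epsilon> *\<^sub>R (\<Psi>1p0 + W)) $ i $ j) \<le> C * norm (\<epsilon>\<^sup>2)"
        using \<xi>eq eventually_good small
      proof eventually_elim
        case (elim \<epsilon>)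
        have e: "0 < \<epsilon>" using elim by (simp add: good_def)
        have nz: "norm (complex_of_real \<epsilon>) \<le> r" "norm (complex_of_real \<epsilon>) = \<epsilon>" using e elim by auto
        have lhs: "\<Psi>\<epsilon> \<epsilon> $ i $ j - (\<Psi> + \<epsilon> *\<^sub>R (\<Psi>1p0 + W)) $ i $ j
          = scl \<epsilon> j * scaled_return \<epsilon> $ i $ j - ((if i \<in> Up \<and> j \<in> Dn then Y i j else 0)
             + \<epsilon> * ((if i \<in> Up \<and> j \<in> Lv then base i j else 0) + W $ i $ j))"
          using Psi_eps_nth[of \<epsilon> i j] elim by (simp add: Psi_nth V_nth[OF mats])
        \<comment> \<open>the columns of rate zero carry a factor \<open>\<epsilon>\<close> already, so there the branch is needed only to first order\<close>
        consider "i \<in> Up" "j \<in> Dn" | "i \<in> Up" "j \<in> Lv" | "\<not> (i \<in> Up \<and> j \<in> ND)" by fastforce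
        then show ?case
        proof cases
          case 1
          have "norm (\<xi> (of_real \<epsilon>) $ i $ j - \<xi> 0 $ i $ j - D i j * of_real \<epsilon>) \<le> C * \<epsilon> ^ 2"
            using C2[OF nz(1)] nz(2) by simp
          moreover have "\<xi> (of_real \<epsilon>) $ i $ j - \<xi> 0 $ i $ j = of_real (scaled_return \<epsilon> $ i $ j - Y i j)"
            using elim base 1 by (simp add: base_def)
          moreover have "\<bar>Re (of_real (scaled_return \<epsilon> $ i $ j - Y i j) - D i j * of_real \<epsilon>)\<bar>
             \<le> norm (of_real (scaled_return \<epsilon> $ i $ j - Y i j) - D i j * of_real \<epsilon>)" by (rule abs_Re_le_cmod)
          ultimately have "\<bar>scaled_return \<epsilon> $ i $ j - Y i j - Re (D i j) * \<epsilon>\<bar> \<le> C * \<epsilon> ^ 2" by simp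
          then show ?thesis unfolding lhs using 1 by (simp add: scl_def W_def algebra_simps)
        next
          case 2
          have "norm (\<xi> (of_real \<epsilon>) $ i $ j - \<xi> 0 $ i $ j) \<le> C * \<epsilon>" using C1[OF nz(1)] nz(2) by simp
          moreover have "\<xi> (of_real \<epsilon>) $ i $ j - \<xi> 0 $ i $ j = of_real (scaled_return \<epsilon> $ i $ j - base i j)"
            using elim base 2 by simp
          ultimately have "\<bar>scaled_return \<epsilon> $ i $ j - base i j\<bar> \<le> C * \<epsilon>" by (simp only: norm_of_real)
          then have "\<epsilon> * \<bar>scaled_return \<epsilon> $ i $ j - base i j\<bar> \<le> \<epsilon> * (C * \<epsilon>)" using e by (intro mult_left_mono) auto
          moreover have "\<epsilon> * \<bar>scaled_return \<epsilon> $ i $ j - base i j\<bar> = \<bar>\<epsilon> * scaled_return \<epsilon> $ i $ j - \<epsilon> * base i j\<bar>"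
            using e by (simp add: abs_mult flip: right_diff_distrib)
          ultimately show ?thesis unfolding lhs using 2 by (simp add: scl_def W_def power2_eq_square mult_ac)
        next
          case 3
          have "0 \<le> C * \<epsilon>"  using C1[OF nz(1)] nz(2) norm_ge_zero order_trans by metis
          then have "0 \<le> C" using e by (simp add: zero_le_mult_iff)
          then show ?thesis unfolding lhs using 3 by (auto simp: scaled_return_def W_def)
        qed
      qed
    qed
  qed
  show ?thesis
  proof (intro conjI)
    show "\<forall>\<epsilon>>0. (\<forall>i\<in>Sp. 0 < c $ i + \<epsilon> * ct $ i) \<and> (\<forall>i\<in>Sm. c $ i + \<epsilon> * ct $ i < 0) \<longrightarrow>
        minimal_nonneg_solution (\<lambda>X. blk Sp (S0 \<union> Sm) X = X \<and> ?eq \<epsilon> S0 X = 0 \<and> ?eq \<epsilon> Sm X = 0) (\<Psi>\<epsilon> \<epsilon>)"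
      using minimal unfolding good_def Sp Sm by blast
    show "\<exists>F :: complex \<Rightarrow> complex^'s^'s.
        (\<forall>i j. (\<lambda>z. F z $ i $ j) analytic_on {0}) \<and>
        (\<forall>\<^sub>F \<epsilon> in at_right 0. \<forall>i j. F (of_real \<epsilon>) $ i $ j = of_real (\<Psi>\<epsilon> \<epsilon> $ i $ j))" by (rule analytic)
    show "\<exists>\<Psi>1pm.
        (\<forall>X. (blk Sp Sm X = X \<and>
              K ** X + X ** U = - (\<Psi> ** \<bar>blk_inv Sm Cm\<bar> ** Ctm ** U)
                - blk_inv Sp Cp ** Ctp ** \<Psi> ** U - K ** P0) = (X = \<Psi>1pm)) \<and>
        (\<forall>i j. (\<lambda>\<epsilon>. \<Psi>\<epsilon> \<epsilon> $ i $ j - (\<Psi> + \<epsilon> *\<^sub>R (\<Psi>1p0 + \<Psi>1pm)) $ i $ j)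
                 \<in> O[at_right 0](\<lambda>\<epsilon>. \<epsilon>\<^sup>2))"
      using unique expansion by (intro exI[of _ W] conjI allI)
  qed
qed

end
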